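(* Let $E\to M$ be a Courant algebroid. There is a spectral sequence of algebras $$E_0^{p,q}:=F^pA^{p+q}/F^{p+1}A^{p+q}\Longrightarrow H^{p+q}_{std}(E)$$ converging to the cohomology of the Courant algebroid $E$, where $A^\bullet=C^\infty(\mathcal{E})$ and $F^pA^q=I^p\cap A^q$ is the filtration by powers of the naive ideal $I$.
   Context: **Courant algebroid.** A Courant algebroid is a smooth (finite rank) vector bundle $E\to M$ with a symmetric non-degenerate fibrewise bilinear form $\langle\cdot,\cdot\rangle$ (the pseudo-metric), an $\mathbb{R}$-bilinear bracket $[\cdot,\cdot]$ on $\Gamma(E)$ (not necessarily skew-symmetric) and a bundle map $\rho:E\to TM$ (the anchor) such that for all $\phi,\psi,\psi_1,\psi_2\in\Gamma(E)$, $f\in C^\infty(M)$: $[\phi,[\psi_1,\psi_2]]=[[\phi,\psi_1],\psi_2]+[\psi_1,[\phi,\psi_2]]$; $[\phi,f\psi]=(\rho(\phi)f)\psi+f[\phi,\psi]$; $[\phi,\phi]=\frac12\rho^*\mathrm{d}\langle\phi,\phi\rangle$; $\rho(\phi)\langle\psi,\psi\rangle=2\langle[\phi,\psi],\psi\rangle$. Here $\rho^*:T^*M\to E$ is the dual of $\rho$, with $E\cong E^*$ via the pseudo-metric. **Standard cohomology.** $[k]$ denotes shifting fibre-linear coordinates to degree $k$. Sections of $\Lambda^nE\cong\Lambda^nE^*$ are the degree $n$ functions on the graded manifold $E[1]$. The minimal symplectic realization of $E[1]$ is the graded symplectic manifold $\mathcal{E}=E[1]\times_{(E\oplus E^* )[1]}T^*[2]E[1]$,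 the pullback of $T^*[2]E[1]\to(E\oplus E^* )[1]$ along $\psi\mapsto\psi\oplus\frac12\langle\psi,\cdot\rangle$; its Poisson bracket $\{\cdot,\cdot\}$ has degree $-2$; it has a projection $\pi:\mathcal{E}\to E[1]$. There is (Roytenberg) a degree 3 function $H$ on $\mathcal{E}$ with $\{H,H\}=0$, $[\phi,\psi]=\{\{H,\phi\},\psi\}$ and $\rho(\psi)=\{\{\psi,H\},\cdot\}$ on $C^\infty(M)$. Let $A^\bullet=C^\infty(\mathcal{E})$ be the graded functions and $Q=\{H,\cdot\}$, a degree 1 derivation with $Q^2=0$. Then $H^\bullet_{std}(E):=H^\bullet(A^\bullet,Q)$. **Naive ideal and filtration.** $\Gamma(\Lambda^n\ker\rho)$ denotes the smooth sections of $\Lambda^nE$ that are pointwise in the kernel of the extension of $\rho$ to an odd $C^\infty(M)$-linear derivation $\Lambda^\bullet E\to\Lambda^\bullet E\otimes TM$ (here $\ker\rho$ may have non-constant rank); such sections are viewed as functions on $\mathcal{E}$ via the pseudo-metric and $\pi$. The naive ideal is $I=\Gamma(\Lambda^{\ge1}\ker\rho)\cdot C^\infty(\mathcal{E})$. It is a differential ideal of $(A^\bullet,Q)$, giving the decreasing filtration by differential ideals $F^pA^q=I^p\cap A^q$, with $F^0A^\bullet=A^\bullet$. *)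

theory Defs
  imports "HOL-Analysis.Analysis" "HOL-Algebra.Algebra"
begin

section \<open>Graded polynomials\<close>

text \<open>The free graded commutative real algebra on odd generators \<open>\<xi>\<^sup>a\<close> of degree 1 and even generators
  \<open>p\<^sub>i\<close> of degree 2: \<open>(S, m)\<close> stands for the monomial whose odd part is the product of the \<open>\<xi>\<^sup>a\<close>,
  \<open>a \<in> S\<close>, in increasing order, and whose even part is the multiset \<open>m\<close> of the \<open>p\<^sub>i\<close>.\<close>

typedef gpoly = "{f :: nat set \<times> nat multiset \<Rightarrow> real.
    finite {u. f u \<noteq> 0} \<and> (\<forall>S m. f (S, m) \<noteq> 0 \<longrightarrow> finite S)}"
  morphisms gcoeff gpoly_of
  by (rule exI[of _ "\<lambda>_. 0"]) simp

lemma gpoly_eqI: "(\<And>S m. gcoeff f (S, m) = gcoeff g (S, m)) \<Longrightarrow> f = g"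
  by (rule gcoeff_inject[THEN iffD1], rule ext) (simp add: split_paired_all)

lemma gcoeff_gpoly_of:
  assumes "finite {u. f u \<noteq> 0}" "\<And>S m. f (S, m) \<noteq> 0 \<Longrightarrow> finite S"
  shows "gcoeff (gpoly_of f) = f"
  by (rule gpoly_of_inverse) (use assms in blast)

lemma finite_coeff: "finite {u. gcoeff f u \<noteq> 0}"
  and finite_coeff_fst: "gcoeff f (S, m) \<noteq> 0 \<Longrightarrow> finite S"
  using gcoeff[of f] by blast+

lemma gcoeff_infinite: "infinite S \<Longrightarrow> gcoeff f (S, m) = 0"
  using finite_coeff_fst by blast

definition koszul_sign :: "nat set \<Rightarrow> nat set \<Rightarrow> real" where
  "koszul_sign S T = (-1) ^ card {(i, j). i \<in> S \<and> j \<in> T \<and> j < i}"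

definition gmult_coeff :: "gpoly \<Rightarrow> gpoly \<Rightarrow> nat set \<times> nat multiset \<Rightarrow> real" where
  "gmult_coeff f g = (\<lambda>(S, m). \<Sum>T\<in>Pow S. \<Sum>k | k \<subseteq># m.
     koszul_sign T (S - T) * gcoeff f (T, k) * gcoeff g (S - T, m - k))"

lemma finite_submultisets: "finite {k. k \<subseteq># (m :: 'a multiset)}"
proof (induction m)
  case (add a m)
  have "{k. k \<subseteq># add_mset a m} \<subseteq> {k. k \<subseteq># m} \<union> add_mset a ` {k. k \<subseteq># m}"
  proof
    fix k assume "k \<in> {k. k \<subseteq># add_mset a m}"
    then have k: "k \<subseteq># add_mset a m" by simp
    show "k \<in> {k. k \<subseteq># m} \<union> add_mset a ` {k. k \<subseteq># m}"
    proof (cases "a \<in># k")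
      case True
      then obtain k' where "k = add_mset a k'" by (meson mset_add)
      with k have "k' \<subseteq># m" by simp
      with \<open>k = add_mset a k'\<close> show ?thesis by blast
    next
      case False
      with k show ?thesis
        by (metis CollectI Diff_eq_empty_iff_mset UnI1 minus_add_mset_if_not_in_lhs)
    qed
  qed
  with add show ?case by (meson finite_Un finite_imageI finite_subset)
qed simp

lemma gmult_coeff_wf:
  "finite {u. gmult_coeff f g u \<noteq> 0}"
  "gmult_coeff f g (S, m) \<noteq> 0 \<Longrightarrow> finite S"
proof -
  let ?F = "{u. gcoeff f u \<noteq> 0}" and ?G = "{u. gcoeff g u \<noteq> 0}"
  have "{u. gmult_coeff f g u \<noteq> 0} \<subseteq>
      (\<lambda>((T, k), (T', k')). (T \<union> T', k + k')) ` (?F \<times> ?G)"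
  proof
    fix u assume u: "u \<in> {u. gmult_coeff f g u \<noteq> 0}"
    obtain S m where [simp]: "u = (S, m)" by force
    have "(\<Sum>T\<in>Pow S. \<Sum>k | k \<subseteq># m.
        koszul_sign T (S - T) * gcoeff f (T, k) * gcoeff g (S - T, m - k)) \<noteq> 0"
      using u by (simp add: gmult_coeff_def)
    then obtain T where T: "T \<in> Pow S" "(\<Sum>k | k \<subseteq># m.
        koszul_sign T (S - T) * gcoeff f (T, k) * gcoeff g (S - T, m - k)) \<noteq> 0"
      by (rule sum.not_neutral_contains_not_neutral)
    from T(2) obtain k where "k \<in> {k. k \<subseteq># m}"
        "koszul_sign T (S - T) * gcoeff f (T, k) * gcoeff g (S - T, m - k) \<noteq> 0"
      by (rule sum.not_neutral_contains_not_neutral)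
    then have "k \<subseteq># m" "gcoeff f (T, k) \<noteq> 0" "gcoeff g (S - T, m - k) \<noteq> 0" by simp_all
    then show "u \<in> (\<lambda>((T, k), (T', k')). (T \<union> T', k + k')) ` (?F \<times> ?G)"
      using T(1) by (intro image_eqI[of _ _ "((T, k), (S - T, m - k))"]) auto
  qed
  then show "finite {u. gmult_coeff f g u \<noteq> 0}"
    by (rule finite_subset) (intro finite_imageI finite_cartesian_product finite_coeff)
  show "gmult_coeff f g (S, m) \<noteq> 0 \<Longrightarrow> finite S"
    by (rule ccontr) (simp add: gmult_coeff_def)
qed

instantiation gpoly :: real_algebra_1
begin

definition zero_gpoly where "0 = gpoly_of (\<lambda>_. 0)"
definition one_gpoly where "1 = gpoly_of (\<lambda>u. if u = ({}, {#}) then 1 else 0)"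
definition plus_gpoly where "f + g = gpoly_of (\<lambda>u. gcoeff f u + gcoeff g u)"
definition minus_gpoly where "f - g = gpoly_of (\<lambda>u. gcoeff f u - gcoeff g u)"
definition uminus_gpoly where "- f = gpoly_of (\<lambda>u. - gcoeff f u)"
definition scaleR_gpoly where "r *\<^sub>R f = gpoly_of (\<lambda>u. r * gcoeff f u)"
definition times_gpoly where "f * g = gpoly_of (gmult_coeff f g)"

lemma gcoeff_0: "gcoeff 0 u = 0"
  unfolding zero_gpoly_def by (subst gcoeff_gpoly_of) auto

lemma gcoeff_1: "gcoeff 1 u = (if u = ({}, {#}) then 1 else 0)"
  unfolding one_gpoly_def by (subst gcoeff_gpoly_of) (auto split: if_splits)

lemma gcoeff_plus: "gcoeff (f + g) u = gcoeff f u + gcoeff g u"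
proof -
  have "finite {u. gcoeff f u + gcoeff g u \<noteq> 0}"
    by (rule finite_subset[OF _ finite_UnI[OF finite_coeff[of f] finite_coeff[of g]]]) auto
  moreover have "finite S" if "gcoeff f (S, m) + gcoeff g (S, m) \<noteq> 0" for S m
    using that finite_coeff_fst[of f S m] finite_coeff_fst[of g S m] by linarith
  ultimately show ?thesis unfolding plus_gpoly_def by (subst gcoeff_gpoly_of) blast+
qed

lemma gcoeff_minus: "gcoeff (f - g) u = gcoeff f u - gcoeff g u"
proof -
  have "finite {u. gcoeff f u - gcoeff g u \<noteq> 0}"
    by (rule finite_subset[OF _ finite_UnI[OF finite_coeff[of f] finite_coeff[of g]]]) auto
  moreover have "finite S" if "gcoeff f (S, m) - gcoeff g (S, m) \<noteq> 0" for S m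
    using that finite_coeff_fst[of f S m] finite_coeff_fst[of g S m] by linarith
  ultimately show ?thesis unfolding minus_gpoly_def by (subst gcoeff_gpoly_of) blast+
qed

lemma gcoeff_scaleR: "gcoeff (r *\<^sub>R f) u = r * gcoeff f u"
proof -
  have "finite {u. r * gcoeff f u \<noteq> 0}"
    by (rule finite_subset[OF _ finite_coeff[of f]]) auto
  moreover have "finite S" if "r * gcoeff f (S, m) \<noteq> 0" for S m
    using that finite_coeff_fst[of f S m] by simp
  ultimately show ?thesis unfolding scaleR_gpoly_def by (subst gcoeff_gpoly_of) blast+
qed

lemma gcoeff_uminus: "gcoeff (- f) u = - gcoeff f u"
proof -
  have "finite S" if "- gcoeff f (S, m) \<noteq> 0" for S m
    using that finite_coeff_fst[of f S m] by simp
  moreover have "finite {u. - gcoeff f u \<noteq> 0}" using finite_coeff[of f] by simp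
  ultimately show ?thesis unfolding uminus_gpoly_def by (subst gcoeff_gpoly_of) blast+
qed

lemma gcoeff_times: "gcoeff (f * g) (S, m) = (\<Sum>T\<in>Pow S. \<Sum>k | k \<subseteq># m.
     koszul_sign T (S - T) * gcoeff f (T, k) * gcoeff g (S - T, m - k))"
  unfolding times_gpoly_def
  by (subst gcoeff_gpoly_of[OF gmult_coeff_wf]) (auto simp: gmult_coeff_def)

lemmas gcoeff_simps = gcoeff_0 gcoeff_1 gcoeff_plus gcoeff_minus gcoeff_uminus gcoeff_scaleR

lemma koszul_sign_empty [simp]: "koszul_sign {} S = 1" "koszul_sign S {} = 1"
  by (simp_all add: koszul_sign_def)

lemma koszul_sign_Un_left:
  assumes "finite S" "finite T" "finite U" "S \<inter> T = {}"
  shows "koszul_sign (S \<union> T) U = koszul_sign S U * koszul_sign T U"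
proof -
  have *: "{(i, j). i \<in> S \<union> T \<and> j \<in> U \<and> j < i} =
      {(i, j). i \<in> S \<and> j \<in> U \<and> j < i} \<union> {(i, j). i \<in> T \<and> j \<in> U \<and> j < i}" by auto
  have "finite {(i, j). i \<in> S \<and> j \<in> U \<and> j < i}" "finite {(i, j). i \<in> T \<and> j \<in> U \<and> j < i}"
    by (rule finite_subset[of _ "S \<times> U"] finite_subset[of _ "T \<times> U"], use assms in auto)+
  then show ?thesis unfolding koszul_sign_def * 
    by (subst card_Un_disjoint) (use assms in \<open>auto simp: power_add\<close>)
qed

lemma koszul_sign_Un_right:
  assumes "finite S" "finite T" "finite U" "S \<inter> T = {}"
  shows "koszul_sign U (S \<union> T) = koszul_sign U S * koszul_sign U T"
proof -
  have *: "{(i, j). i \<in> U \<and> j \<in> S \<union> T \<and> j < i} =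
      {(i, j). i \<in> U \<and> j \<in> S \<and> j < i} \<union> {(i, j). i \<in> U \<and> j \<in> T \<and> j < i}" by auto
  have "finite {(i, j). i \<in> U \<and> j \<in> S \<and> j < i}" "finite {(i, j). i \<in> U \<and> j \<in> T \<and> j < i}"
    by (rule finite_subset[of _ "U \<times> S"] finite_subset[of _ "U \<times> T"], use assms in auto)+
  then show ?thesis unfolding koszul_sign_def * 
    by (subst card_Un_disjoint) (use assms in \<open>auto simp: power_add\<close>)
qed

lemma gpoly_mult_assoc: "(f * g) * h = f * (g * (h :: gpoly))"
proof (rule gpoly_eqI)
  fix S m
  show "gcoeff ((f * g) * h) (S, m) = gcoeff (f * (g * h)) (S, m)"
  proof (cases "finite S")
    case False
    then show ?thesis by (simp add: gcoeff_infinite)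
  next
    case S: True
    let ?M = "\<lambda>m. {k. k \<subseteq># m}"
    let ?X = "SIGMA u : Pow S \<times> ?M m. Pow (fst u) \<times> ?M (snd u)"
    let ?Y = "SIGMA u : Pow S \<times> ?M m. Pow (S - fst u) \<times> ?M (m - snd u)"
    let ?l = "\<lambda>((T, k), (U, l)). koszul_sign T (S - T) * (koszul_sign U (T - U) *
        gcoeff f (U, l) * gcoeff g (T - U, k - l)) * gcoeff h (S - T, m - k)"
    let ?r = "\<lambda>((T, k), (U, l)). koszul_sign T (S - T) * gcoeff f (T, k) *
       (koszul_sign U (S - T - U) * gcoeff g (U, l) * gcoeff h (S - T - U, m - k - l))"
    have sum_le: "k + l \<subseteq># m" if "k \<subseteq># m" "l \<subseteq># m - k" for k l m :: "nat multiset"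
      using that by (simp add: subset_mset.le_diff_conv2 union_commute)
    have diff_le: "k - l \<subseteq># m - l" if "k \<subseteq># m" "l \<subseteq># k" for k l m :: "nat multiset"
      using that subset_eq_diff_conv by fastforce
    have le_trans: "l \<subseteq># m" if "k \<subseteq># m" "l \<subseteq># k" for k l m :: "nat multiset"
      using that by (rule subset_mset.order_trans[rotated])
    have fin: "finite T" if "T \<in> Pow S" for T using that S by (auto intro: finite_subset)
    have "gcoeff ((f * g) * h) (S, m) = (\<Sum>T\<in>Pow S. \<Sum>k\<in>?M m. \<Sum>U\<in>Pow T. \<Sum>l\<in>?M k. ?l ((T, k), (U, l)))"
      by (simp add: gcoeff_times sum_distrib_left sum_distrib_right)
    also have "\<dots> = sum ?l ?X"
      by (subst sum.Sigma[symmetric])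
         (auto simp: S finite_submultisets sum.cartesian_product' intro!: finite_cartesian_product intro: finite_subset)
    also have "\<dots> = sum ?r ?Y"
    proof (rule sum.reindex_bij_witness[of _
        "\<lambda>((T, k), (U, l)). ((T \<union> U, k + l), (T, k))" "\<lambda>((T, k), (U, l)). ((U, l), (T - U, k - l))"],
        goal_cases)
      case (1 a) then show ?case by auto
    next
      case (2 a) then show ?case by (auto simp: diff_le intro: le_trans) blast
    next
      case (3 b) then show ?case by auto
    next
      case (4 b) then show ?case by (auto simp: sum_le)
    next
      case (5 a)
      then obtain T k U l where a: "a = ((T, k), (U, l))" "T \<subseteq> S" "k \<subseteq># m" "U \<subseteq> T" "l \<subseteq># k" by auto
      have e: "S - U - (T - U) = S - T" "S - U = (T - U) \<union> (S - T)" "T = U \<union> (T - U)" using a by auto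
      have m: "m - l - (k - l) = m - k" using a by simp
      have f: "finite U" "finite (T - U)" "finite (S - T)" using a S by (auto intro: finite_subset)
      have "koszul_sign T (S - T) = koszul_sign U (S - T) * koszul_sign (T - U) (S - T)"
        by (subst e(3), rule koszul_sign_Un_left) (use f in auto)
      moreover have "koszul_sign U (S - U) = koszul_sign U (T - U) * koszul_sign U (S - T)"
        by (subst e(2), rule koszul_sign_Un_right) (use f a in auto)
      moreover have "l + (k - l) = k" using a by simp
      ultimately show ?case by (simp add: a(1) e(1) m)
    qed
    also have "\<dots> = (\<Sum>T\<in>Pow S. \<Sum>k\<in>?M m. \<Sum>U\<in>Pow (S - T). \<Sum>l\<in>?M (m - k). ?r ((T, k), (U, l)))"
      by (subst sum.Sigma[symmetric])
         (auto simp: S finite_submultisets sum.cartesian_product')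
    also have "\<dots> = gcoeff (f * (g * h)) (S, m)"
      by (simp add: gcoeff_times sum_distrib_left sum_distrib_right)
    finally show ?thesis .
  qed
qed

lemma gpoly_1_mult: "1 * f = (f :: gpoly)"
proof (rule gpoly_eqI)
  fix S m
  show "gcoeff (1 * f) (S, m) = gcoeff f (S, m)"
  proof (cases "finite S")
    case False
    then show ?thesis by (simp add: gcoeff_infinite)
  next
    case True
    have "gcoeff (1 * f) (S, m) = (\<Sum>T\<in>Pow S. \<Sum>k | k \<subseteq># m.
        if T = {} then if k = {#} then gcoeff f (S, m) else 0 else 0)"
      unfolding gcoeff_times by (intro sum.cong) (auto simp: gcoeff_1)
    also have "\<dots> = (\<Sum>T\<in>Pow S. if T = {} then \<Sum>k | k \<subseteq># m. if k = {#} then gcoeff f (S, m) else 0 else 0)"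
      by (intro sum.cong) auto
    also have "\<dots> = gcoeff f (S, m)" using True by (simp add: sum.delta finite_submultisets)
    finally show ?thesis .
  qed
qed

lemma gpoly_mult_1: "f * 1 = (f :: gpoly)"
proof (rule gpoly_eqI)
  fix S m
  show "gcoeff (f * 1) (S, m) = gcoeff f (S, m)"
  proof (cases "finite S")
    case False
    then show ?thesis by (simp add: gcoeff_infinite)
  next
    case True
    have "gcoeff (f * 1) (S, m) = (\<Sum>T\<in>Pow S. \<Sum>k | k \<subseteq># m.
        if T = S then if k = m then gcoeff f (S, m) else 0 else 0)"
      unfolding gcoeff_times
    proof (intro sum.cong refl)
      fix T k assume T: "T \<in> Pow S" and k: "k \<in> {k. k \<subseteq># m}"
      have "S - T = {} \<longleftrightarrow> T = S" "m - k = {#} \<longleftrightarrow> k = m"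
        using T k by (blast, metis Diff_eq_empty_iff_mset mem_Collect_eq subset_mset.antisym subset_mset.refl)
      then show "koszul_sign T (S - T) * gcoeff f (T, k) * gcoeff 1 (S - T, m - k) =
          (if T = S then if k = m then gcoeff f (S, m) else 0 else 0)"
        by (auto simp: gcoeff_1)
    qed
    also have "\<dots> = (\<Sum>T\<in>Pow S. if T = S then \<Sum>k | k \<subseteq># m. if k = m then gcoeff f (S, m) else 0 else 0)"
      by (intro sum.cong) auto
    also have "\<dots> = gcoeff f (S, m)" using True by (simp add: sum.delta finite_submultisets)
    finally show ?thesis .
  qed
qed

instance
proof
  fix f g h :: gpoly and a b :: real
  show "f * g * h = f * (g * h)" by (rule gpoly_mult_assoc)
  show "1 * f = f" by (rule gpoly_1_mult)
  show "f * 1 = f" by (rule gpoly_mult_1)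
  show "(f + g) * h = f * h + g * h"
    by (rule gpoly_eqI) (simp add: gcoeff_simps gcoeff_times distrib_left distrib_right sum.distrib)
  show "f * (g + h) = f * g + f * h"
    by (rule gpoly_eqI) (simp add: gcoeff_simps gcoeff_times distrib_left distrib_right sum.distrib)
  show "a *\<^sub>R f * g = a *\<^sub>R (f * g)"
    by (rule gpoly_eqI) (simp add: gcoeff_simps gcoeff_times sum_distrib_left mult_ac)
  show "f * a *\<^sub>R g = a *\<^sub>R (f * g)"
    by (rule gpoly_eqI) (simp add: gcoeff_simps gcoeff_times sum_distrib_left mult_ac)
  show "(0 :: gpoly) \<noteq> 1" 
  proof
    assume "(0 :: gpoly) = 1"
    then have "gcoeff 0 ({}, {#}) = gcoeff 1 ({}, {#})" by simp
    then show False by (simp add: gcoeff_0 gcoeff_1)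
  qed
  show "a *\<^sub>R (f + g) = a *\<^sub>R f + a *\<^sub>R g" "(a + b) *\<^sub>R f = a *\<^sub>R f + b *\<^sub>R f"
    by (rule gpoly_eqI, simp add: gcoeff_simps distrib_left distrib_right)+
qed (rule gpoly_eqI, simp add: gcoeff_simps)+

end

text \<open>The generators, and the (left and right) partial derivatives with respect to them.\<close>

definition g_xi :: "nat \<Rightarrow> gpoly" where
  "g_xi a = gpoly_of (\<lambda>u. if u = ({a}, {#}) then 1 else 0)"

definition g_p :: "nat \<Rightarrow> gpoly" where
  "g_p i = gpoly_of (\<lambda>u. if u = ({}, {#i#}) then 1 else 0)"

definition d_p :: "nat \<Rightarrow> gpoly \<Rightarrow> gpoly" where
  "d_p i f = gpoly_of (\<lambda>(S, m). real (count m i + 1) * gcoeff f (S, add_mset i m))"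

definition d_xi :: "nat \<Rightarrow> gpoly \<Rightarrow> gpoly" where
  "d_xi a f = gpoly_of (\<lambda>(S, m). if a \<in> S then 0
     else (-1) ^ card {b \<in> S. b < a} * gcoeff f (insert a S, m))"

definition d_xi_right :: "nat \<Rightarrow> gpoly \<Rightarrow> gpoly" where
  "d_xi_right a f = gpoly_of (\<lambda>(S, m). if a \<in> S then 0
     else (-1) ^ card {b \<in> S. a < b} * gcoeff f (insert a S, m))"

text \<open>Substitution of odd elements for the \<open>\<xi>\<^sup>a\<close> and of even elements for the \<open>p\<^sub>i\<close>.\<close>

definition g_subst :: "(nat \<Rightarrow> gpoly) \<Rightarrow> (nat \<Rightarrow> gpoly) \<Rightarrow> gpoly \<Rightarrow> gpoly" where
  "g_subst \<sigma> \<tau> f = (\<Sum>(S, m) | gcoeff f (S, m) \<noteq> 0.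
     gcoeff f (S, m) *\<^sub>R (prod_list (map \<sigma> (sorted_list_of_set S))
       * prod_list (map \<tau> (sorted_list_of_multiset m))))"


section \<open>Smooth manifolds and vector bundles\<close>

text \<open>\<open>\<real>\<^sup>n\<close> is \<open>Euclidean_space n\<close>, so that \<open>n = 0\<close> is allowed.  A function on an open
  subset \<open>V\<close> of it is smooth iff all its iterated partial derivatives exist and are continuous.\<close>

definition pdiff :: "nat \<Rightarrow> ((nat \<Rightarrow> real) \<Rightarrow> real) \<Rightarrow> (nat \<Rightarrow> real) \<Rightarrow> real" where
  "pdiff i f x = deriv (\<lambda>t. f (x(i := t))) (x i)"

primrec pdiffs :: "nat list \<Rightarrow> ((nat \<Rightarrow> real) \<Rightarrow> real) \<Rightarrow> (nat \<Rightarrow> real) \<Rightarrow> real" where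
  "pdiffs [] f = f"
| "pdiffs (i # is) f = pdiff i (pdiffs is f)"

definition smooth_Rn :: "nat \<Rightarrow> (nat \<Rightarrow> real) set \<Rightarrow> ((nat \<Rightarrow> real) \<Rightarrow> real) \<Rightarrow> bool" where
  "smooth_Rn n V f \<longleftrightarrow> (\<forall>is. set is \<subseteq> {..<n} \<longrightarrow>
     continuous_on V (pdiffs is f) \<and>
     (\<forall>x\<in>V. \<forall>i<n. (\<lambda>t. pdiffs is f (x(i := t))) differentiable at (x i)))"

text \<open>The points of the manifold are the elements of a Hausdorff, second countable type
  \<open>'m\<close>; a chart is a pair of its domain \<open>U\<close> and the coordinate map, of which only the values on \<open>U\<close>
  matter.\<close>

type_synonym 'm chart = "'m set \<times> ('m \<Rightarrow> nat \<Rightarrow> real)"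

definition topological_chart :: "nat \<Rightarrow> 'm::topological_space chart \<Rightarrow> bool" where
  "topological_chart n = (\<lambda>(U, \<phi>). open U \<and> openin (Euclidean_space n) (\<phi> ` U) \<and>
     homeomorphism U (\<phi> ` U) \<phi> (inv_into U \<phi>))"

definition smooth_change :: "nat \<Rightarrow> 'm chart \<Rightarrow> 'm chart \<Rightarrow> bool" where
  "smooth_change n = (\<lambda>(U, \<phi>) (U', \<phi>'). \<forall>j<n.
     smooth_Rn n (\<phi> ` (U \<inter> U')) (\<lambda>y. \<phi>' (inv_into U \<phi> y) j))"

definition smooth_manifold ::
    "nat \<Rightarrow> 'm::{t2_space,second_countable_topology} chart set \<Rightarrow> bool" where
  "smooth_manifold n \<A> \<longleftrightarrow> (\<Union>(U, \<phi>)\<in>\<A>. U) = UNIV \<and>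
     (\<forall>c\<in>\<A>. topological_chart n c) \<and> (\<forall>c\<in>\<A>. \<forall>c'\<in>\<A>. smooth_change n c c')"

text \<open>The charts of the maximal atlas containing \<open>\<A>\<close>.\<close>

definition smooth_chart :: "nat \<Rightarrow> 'm::topological_space chart set \<Rightarrow> 'm chart \<Rightarrow> bool" where
  "smooth_chart n \<A> c \<longleftrightarrow>
     topological_chart n c \<and> (\<forall>c'\<in>\<A>. smooth_change n c c' \<and> smooth_change n c' c)"

definition smooth_on :: "nat \<Rightarrow> 'm chart set \<Rightarrow> 'm set \<Rightarrow> ('m \<Rightarrow> real) \<Rightarrow> bool" where
  "smooth_on n \<A> W f \<longleftrightarrow>
     (\<forall>(U, \<phi>)\<in>\<A>. smooth_Rn n (\<phi> ` (U \<inter> W)) (\<lambda>y. f (inv_into U \<phi> y)))"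

definition chart_pd :: "'m chart \<Rightarrow> nat \<Rightarrow> ('m \<Rightarrow> real) \<Rightarrow> 'm \<Rightarrow> real" where
  "chart_pd = (\<lambda>(U, \<phi>) i f x. pdiff i (\<lambda>y. f (inv_into U \<phi> y)) (\<phi> x))"

text \<open>Tangent vectors at \<open>x\<close> are derivations at \<open>x\<close> of \<open>C\<^sup>\<infinity>(M)\<close>; their values on non-smooth
  functions are irrelevant.\<close>

definition tangent_vector :: "nat \<Rightarrow> 'm chart set \<Rightarrow> 'm \<Rightarrow> (('m \<Rightarrow> real) \<Rightarrow> real) \<Rightarrow> bool" where
  "tangent_vector n \<A> x D \<longleftrightarrow> (\<forall>f g. smooth_on n \<A> UNIV f \<longrightarrow> smooth_on n \<A> UNIV g \<longrightarrow>
     (\<forall>a b. D (\<lambda>y. a * f y + b * g y) = a * D f + b * D g) \<and>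
     D (\<lambda>y. f y * g y) = f x * D g + g x * D f)"

text \<open>The fibres of a vector bundle are given as linear subspaces of an arbitrary real vector space
  \<open>'v\<close>, which only serves as a universe; the smooth structure is given by local frames
  (equivalently, local trivialisations) with smooth transition matrices.\<close>

type_synonym ('m, 'v) frame = "'m set \<times> (nat \<Rightarrow> 'm \<Rightarrow> 'v)"

definition frame_at :: "nat \<Rightarrow> ('m \<Rightarrow> 'v::real_vector set) \<Rightarrow> (nat \<Rightarrow> 'm \<Rightarrow> 'v) \<Rightarrow> 'm \<Rightarrow> bool" where
  "frame_at r E e x \<longleftrightarrow> inj_on (\<lambda>a. e a x) {..<r} \<and> independent ((\<lambda>a. e a x) ` {..<r}) \<and>
     span ((\<lambda>a. e a x) ` {..<r}) = E x"

definition frame_coord :: "nat \<Rightarrow> (nat \<Rightarrow> 'm \<Rightarrow> 'v::real_vector) \<Rightarrow> 'm \<Rightarrow> 'v \<Rightarrow> nat \<Rightarrow> real" where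
  "frame_coord r e x v a = representation ((\<lambda>b. e b x) ` {..<r}) v (e a x)"

definition smooth_vector_bundle :: "nat \<Rightarrow> 'm::topological_space chart set \<Rightarrow> nat \<Rightarrow>
    ('m \<Rightarrow> 'v::real_vector set) \<Rightarrow> ('m, 'v) frame set \<Rightarrow> bool" where
  "smooth_vector_bundle n \<A> r E \<F> \<longleftrightarrow>
     (\<forall>x. subspace (E x)) \<and> (\<Union>(U, e)\<in>\<F>. U) = UNIV \<and>
     (\<forall>(U, e)\<in>\<F>. open U \<and> (\<forall>x\<in>U. frame_at r E e x)) \<and>
     (\<forall>(U, e)\<in>\<F>. \<forall>(U', e')\<in>\<F>. \<forall>a<r. \<forall>b<r.
        smooth_on n \<A> (U \<inter> U') (\<lambda>x. frame_coord r e' x (e b x) a))"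

definition smooth_section :: "nat \<Rightarrow> 'm chart set \<Rightarrow> nat \<Rightarrow> ('m \<Rightarrow> 'v::real_vector set) \<Rightarrow>
    ('m, 'v) frame set \<Rightarrow> 'm set \<Rightarrow> ('m \<Rightarrow> 'v) \<Rightarrow> bool" where
  "smooth_section n \<A> r E \<F> W s \<longleftrightarrow> (\<forall>x\<in>W. s x \<in> E x) \<and>
     (\<forall>(U, e)\<in>\<F>. \<forall>a<r. smooth_on n \<A> (U \<inter> W) (\<lambda>x. frame_coord r e x (s x) a))"

definition smooth_frame :: "nat \<Rightarrow> 'm::topological_space chart set \<Rightarrow> nat \<Rightarrow>
    ('m \<Rightarrow> 'v::real_vector set) \<Rightarrow> ('m, 'v) frame set \<Rightarrow> ('m, 'v) frame \<Rightarrow> bool" where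
  "smooth_frame n \<A> r E \<F> = (\<lambda>(U, e). open U \<and> (\<forall>x\<in>U. frame_at r E e x) \<and>
     (\<forall>a<r. smooth_section n \<A> r E \<F> U (e a)))"


section \<open>Courant algebroids\<close>

record ('m, 'v) courant_data =
  base_dim :: nat
  atlas :: "'m chart set"
  fibre :: "'m \<Rightarrow> 'v set"
  fibre_dim :: nat
  trivs :: "('m, 'v) frame set"
  pairing :: "'m \<Rightarrow> 'v \<Rightarrow> 'v \<Rightarrow> real"
  anchor :: "'m \<Rightarrow> 'v \<Rightarrow> ('m \<Rightarrow> real) \<Rightarrow> real"
  bracket :: "('m \<Rightarrow> 'v) \<Rightarrow> ('m \<Rightarrow> 'v) \<Rightarrow> 'm \<Rightarrow> 'v"

abbreviation smooth_functions :: "('m, 'v) courant_data \<Rightarrow> ('m \<Rightarrow> real) set" where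
  "smooth_functions C \<equiv> {f. smooth_on (base_dim C) (atlas C) UNIV f}"

definition sections :: "('m, 'v::real_vector) courant_data \<Rightarrow> ('m \<Rightarrow> 'v) set" where
  "sections C = {s. smooth_section (base_dim C) (atlas C) (fibre_dim C) (fibre C) (trivs C) UNIV s}"

text \<open>The isomorphism \<open>E\<^sub>x\<^sup>* \<cong> E\<^sub>x\<close> given by the pseudo-metric.\<close>

definition sharp :: "('m, 'v) courant_data \<Rightarrow> 'm \<Rightarrow> ('v \<Rightarrow> real) \<Rightarrow> 'v" where
  "sharp C x \<alpha> = (THE v. v \<in> fibre C x \<and> (\<forall>w\<in>fibre C x. pairing C x v w = \<alpha> w))"

text \<open>\<open>\<rho>(\<phi>)f\<close> and \<open>\<rho>\<^sup>*df\<close>.\<close>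

definition anchor_act :: "('m, 'v) courant_data \<Rightarrow> ('m \<Rightarrow> 'v) \<Rightarrow> ('m \<Rightarrow> real) \<Rightarrow> 'm \<Rightarrow> real" where
  "anchor_act C \<phi> f x = anchor C x (\<phi> x) f"

definition anchor_dual_d :: "('m, 'v) courant_data \<Rightarrow> ('m \<Rightarrow> real) \<Rightarrow> 'm \<Rightarrow> 'v" where
  "anchor_dual_d C f x = sharp C x (\<lambda>w. anchor C x w f)"

definition pair_sections :: "('m, 'v) courant_data \<Rightarrow> ('m \<Rightarrow> 'v) \<Rightarrow> ('m \<Rightarrow> 'v) \<Rightarrow> 'm \<Rightarrow> real" where
  "pair_sections C \<phi> \<psi> x = pairing C x (\<phi> x) (\<psi> x)"

locale courant_algebroid =
  fixes C :: "('m::{t2_space,second_countable_topology}, 'v::real_vector) courant_data"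
  assumes manifold: "smooth_manifold (base_dim C) (atlas C)"
    and vector_bundle: "smooth_vector_bundle (base_dim C) (atlas C) (fibre_dim C) (fibre C) (trivs C)"
    and pairing_linear: "\<lbrakk>u \<in> fibre C x; v \<in> fibre C x; w \<in> fibre C x\<rbrakk> \<Longrightarrow>
      pairing C x (a *\<^sub>R u + b *\<^sub>R v) w = a * pairing C x u w + b * pairing C x v w"
    and pairing_sym: "\<lbrakk>u \<in> fibre C x; v \<in> fibre C x\<rbrakk> \<Longrightarrow> pairing C x u v = pairing C x v u"
    and pairing_nondegenerate:
      "\<lbrakk>u \<in> fibre C x; \<And>v. v \<in> fibre C x \<Longrightarrow> pairing C x u v = 0\<rbrakk> \<Longrightarrow> u = 0"
    and pairing_smooth: "\<lbrakk>(U, e) \<in> trivs C; i < fibre_dim C; j < fibre_dim C\<rbrakk> \<Longrightarrow>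
      smooth_on (base_dim C) (atlas C) U (\<lambda>x. pairing C x (e i x) (e j x))"
    and anchor_tangent:
      "v \<in> fibre C x \<Longrightarrow> tangent_vector (base_dim C) (atlas C) x (anchor C x v)"
    and anchor_linear: "\<lbrakk>u \<in> fibre C x; v \<in> fibre C x; f \<in> smooth_functions C\<rbrakk> \<Longrightarrow>
      anchor C x (a *\<^sub>R u + b *\<^sub>R v) f = a * anchor C x u f + b * anchor C x v f"
    and anchor_smooth: "\<lbrakk>(U, e) \<in> trivs C; i < fibre_dim C; f \<in> smooth_functions C\<rbrakk> \<Longrightarrow>
      smooth_on (base_dim C) (atlas C) U (\<lambda>x. anchor C x (e i x) f)"
    and bracket_closed: "\<lbrakk>\<phi> \<in> sections C; \<psi> \<in> sections C\<rbrakk> \<Longrightarrow> bracket C \<phi> \<psi> \<in> sections C"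
    and bracket_linear_left: "\<lbrakk>\<phi> \<in> sections C; \<phi>' \<in> sections C; \<psi> \<in> sections C\<rbrakk> \<Longrightarrow>
      bracket C (\<lambda>x. a *\<^sub>R \<phi> x + b *\<^sub>R \<phi>' x) \<psi> =
        (\<lambda>x. a *\<^sub>R bracket C \<phi> \<psi> x + b *\<^sub>R bracket C \<phi>' \<psi> x)"
    and bracket_linear_right: "\<lbrakk>\<phi> \<in> sections C; \<psi> \<in> sections C; \<psi>' \<in> sections C\<rbrakk> \<Longrightarrow>
      bracket C \<phi> (\<lambda>x. a *\<^sub>R \<psi> x + b *\<^sub>R \<psi>' x) =
        (\<lambda>x. a *\<^sub>R bracket C \<phi> \<psi> x + b *\<^sub>R bracket C \<phi> \<psi>' x)"
    and bracket_jacobi: "\<lbrakk>\<phi> \<in> sections C; \<psi> \<in> sections C; \<psi>' \<in> sections C\<rbrakk> \<Longrightarrow>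
      bracket C \<phi> (bracket C \<psi> \<psi>') =
        (\<lambda>x. bracket C (bracket C \<phi> \<psi>) \<psi>' x + bracket C \<psi> (bracket C \<phi> \<psi>') x)"
    and bracket_leibniz:
      "\<lbrakk>\<phi> \<in> sections C; \<psi> \<in> sections C; f \<in> smooth_functions C\<rbrakk> \<Longrightarrow>
      bracket C \<phi> (\<lambda>x. f x *\<^sub>R \<psi> x) =
        (\<lambda>x. anchor_act C \<phi> f x *\<^sub>R \<psi> x + f x *\<^sub>R bracket C \<phi> \<psi> x)"
    and bracket_diagonal: "\<phi> \<in> sections C \<Longrightarrow>
      bracket C \<phi> \<phi> = (\<lambda>x. (1/2) *\<^sub>R anchor_dual_d C (pair_sections C \<phi> \<phi>) x)"
    and bracket_invariant: "\<lbrakk>\<phi> \<in> sections C; \<psi> \<in> sections C\<rbrakk> \<Longrightarrow>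
      anchor_act C \<phi> (pair_sections C \<psi> \<psi>) =
        (\<lambda>x. 2 * pair_sections C (bracket C \<phi> \<psi>) \<psi> x)"


section \<open>Functions on the minimal symplectic realization\<close>

text \<open>A graded chart consists of a chart \<open>(U, \<phi>)\<close> of \<open>M\<close>, with coordinates \<open>x\<^sup>i\<close>, and a local frame
  \<open>e\<^sub>a\<close> of \<open>E\<close> over \<open>U\<close>, with dual fibre coordinates \<open>\<xi>\<^sup>a\<close>, shifted to degree 1 on \<open>E[1]\<close>.  It induces
  the coordinates \<open>x\<^sup>i, \<xi>\<^sup>a, p\<^sub>i, \<theta>\<^sub>a\<close> of degrees 0, 1, 2, 1 on \<open>T\<^sup>*[2]E[1]\<close>, the momenta \<open>p\<^sub>i\<close> and \<open>\<theta>\<^sub>a\<close>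
  being the vector fields \<open>\<partial>/\<partial>x\<^sup>i\<close> and \<open>\<partial>/\<partial>\<xi>\<^sup>a\<close> on \<open>E[1]\<close> regarded as fibre-linear functions.  The
  projection to \<open>(E \<oplus> E\<^sup>*)[1]\<close> is given by \<open>x\<^sup>i, \<xi>\<^sup>a, \<theta>\<^sub>a\<close>, so the pullback along
  \<open>\<psi> \<mapsto> \<psi> \<oplus> \<langle>\<psi>,\<cdot>\<rangle>/2\<close> is cut out by \<open>\<theta>\<^sub>a = \<langle>e\<^sub>a,e\<^sub>b\<rangle>\<xi>\<^sup>b/2\<close> and has the coordinates \<open>x\<^sup>i, \<xi>\<^sup>a, p\<^sub>i\<close>.

  As usual we only use frames in which the pseudo-metric has constant coefficients.  They exist around
  every point and give Darboux coordinates for the pulled back symplectic form.\<close>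

type_synonym ('m, 'v) gchart = "'m set \<times> ('m \<Rightarrow> nat \<Rightarrow> real) \<times> (nat \<Rightarrow> 'm \<Rightarrow> 'v)"

definition darboux_chart ::
    "('m::topological_space, 'v::real_vector) courant_data \<Rightarrow> ('m, 'v) gchart \<Rightarrow> bool" where
  "darboux_chart C = (\<lambda>(U, \<phi>, e). smooth_chart (base_dim C) (atlas C) (U, \<phi>) \<and>
     smooth_frame (base_dim C) (atlas C) (fibre_dim C) (fibre C) (trivs C) (U, e) \<and>
     (\<forall>x\<in>U. \<forall>y\<in>U. \<forall>a<fibre_dim C. \<forall>b<fibre_dim C.
        pairing C x (e a x) (e b x) = pairing C y (e a y) (e b y)))"

text \<open>\<open>c\<close> is a chart around \<open>x\<close>.\<close>

definition gchart_at ::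
    "('m::topological_space, 'v::real_vector) courant_data \<Rightarrow> ('m, 'v) gchart \<Rightarrow> 'm \<Rightarrow> bool" where
  "gchart_at C c x \<longleftrightarrow> darboux_chart C c \<and> x \<in> fst c"

text \<open>The coordinate change on \<open>T\<^sup>*[2]E[1]\<close> at \<open>x\<close>, expressing unprimed in primed coordinates.  With
  \<open>\<xi>'\<^sup>a = T\<^sup>a\<^sub>b \<xi>\<^sup>b\<close> it is the transformation of vector fields on \<open>E[1]\<close>, namely \<open>\<theta>\<^sub>b = T\<^sup>a\<^sub>b \<theta>'\<^sub>a\<close> and
  \<open>p\<^sub>i = (\<partial>x'\<^sup>j/\<partial>x\<^sup>i) p'\<^sub>j + (\<partial>T\<^sup>a\<^sub>b/\<partial>x\<^sup>i) \<xi>\<^sup>b \<theta>'\<^sub>a\<close>.  The odd generator with index \<open>r + a\<close>, where \<open>r\<close> is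
  the rank of \<open>E\<close>, stands for \<open>\<theta>\<^sub>a\<close>.\<close>

definition cotangent_change :: "('m, 'v::real_vector) courant_data \<Rightarrow>
    ('m, 'v) gchart \<Rightarrow> ('m, 'v) gchart \<Rightarrow> 'm \<Rightarrow> gpoly \<Rightarrow> gpoly" where
  "cotangent_change C = (\<lambda>(U, \<phi>, e) (U', \<phi>', e') x.
     let n = base_dim C; r = fibre_dim C;
         T = (\<lambda>a b y. frame_coord r e' y (e b y) a);
         \<xi> = (\<lambda>b. \<Sum>d<r. frame_coord r e x (e' d x) b *\<^sub>R g_xi d)
     in g_subst
       (\<lambda>k. if k < r then \<xi> k else (\<Sum>a<r. T a (k - r) x *\<^sub>R g_xi (r + a)))
       (\<lambda>i. (\<Sum>j<n. chart_pd (U, \<phi>) i (\<lambda>y. \<phi>' y j) x *\<^sub>R g_p j) +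
            (\<Sum>a<r. \<Sum>b<r. chart_pd (U, \<phi>) i (T a b) x *\<^sub>R (\<xi> b * g_xi (r + a)))))"

text \<open>Pulling back to the fibre product: \<open>\<theta>\<^sub>a \<mapsto> \<langle>e\<^sub>a,e\<^sub>b\<rangle>\<xi>\<^sup>b/2\<close>.\<close>

definition realization_pullback :: "('m, 'v) courant_data \<Rightarrow>
    ('m, 'v) gchart \<Rightarrow> 'm \<Rightarrow> gpoly \<Rightarrow> gpoly" where
  "realization_pullback C = (\<lambda>(U, \<phi>, e) x. let r = fibre_dim C in g_subst
     (\<lambda>k. if k < r then g_xi k
       else (\<Sum>b<r. (pairing C x (e (k - r) x) (e b x) / 2) *\<^sub>R g_xi b)) g_p)"

text \<open>A function on the realization is the family of its coordinate expressions in all Darboux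
  charts (and \<open>0\<close> outside of their domains).  Functions have bounded degree, i.e. are finite sums of
  homogeneous ones.\<close>

type_synonym ('m, 'v) gfun = "('m, 'v) gchart \<Rightarrow> 'm \<Rightarrow> gpoly"

definition graded_functions ::
    "('m::topological_space, 'v::real_vector) courant_data \<Rightarrow> ('m, 'v) gfun set" where
  "graded_functions C = {F.
     (\<forall>c x. \<not> gchart_at C c x \<longrightarrow> F c x = 0) \<and>
     (\<exists>N. \<forall>c x S m. gcoeff (F c x) (S, m) \<noteq> 0 \<longrightarrow>
        S \<subseteq> {..<fibre_dim C} \<and> set_mset m \<subseteq> {..<base_dim C} \<and> card S + 2 * size m \<le> N) \<and>
     (\<forall>c u. darboux_chart C c \<longrightarrow>
        smooth_on (base_dim C) (atlas C) (fst c) (\<lambda>x. gcoeff (F c x) u)) \<and>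
     (\<forall>c c' x. gchart_at C c x \<longrightarrow> gchart_at C c' x \<longrightarrow>
        F c' x = realization_pullback C c' x (cotangent_change C c c' x (F c x)))}"

text \<open>The pieces are indexed by integers; those of negative degree vanish.\<close>

definition graded_piece ::
    "('m::topological_space, 'v::real_vector) courant_data \<Rightarrow> int \<Rightarrow> ('m, 'v) gfun set" where
  "graded_piece C k = {F \<in> graded_functions C.
     \<forall>c x S m. gcoeff (F c x) (S, m) \<noteq> 0 \<longrightarrow> int (card S + 2 * size m) = k}"

definition base_fun ::
    "('m::topological_space, 'v::real_vector) courant_data \<Rightarrow> ('m \<Rightarrow> real) \<Rightarrow> ('m, 'v) gfun" where
  "base_fun C f = (\<lambda>c x. if gchart_at C c x then of_real (f x) else 0)"

text \<open>The degree 1 function \<open>\<langle>\<psi>,\<cdot>\<rangle>\<close> of a section \<open>\<psi>\<close> of \<open>E\<close>.\<close>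

definition section_fun ::
    "('m::topological_space, 'v::real_vector) courant_data \<Rightarrow> ('m \<Rightarrow> 'v) \<Rightarrow> ('m, 'v) gfun" where
  "section_fun C \<psi> = (\<lambda>(U, \<phi>, e) x. if gchart_at C (U, \<phi>, e) x
     then \<Sum>a<fibre_dim C. pairing C x (\<psi> x) (e a x) *\<^sub>R g_xi a else 0)"

definition function_algebra ::
    "('m::topological_space, 'v::real_vector) courant_data \<Rightarrow> (real, ('m, 'v) gfun) module" where
  "function_algebra C = \<lparr>carrier = graded_functions C,
     monoid.mult = (\<lambda>F G c x. F c x * G c x), one = base_fun C (\<lambda>_. 1),
     ring.zero = (\<lambda>c x. 0), add = (\<lambda>F G c x. F c x + G c x),
     smult = (\<lambda>t F c x. t *\<^sub>R F c x)\<rparr>"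

text \<open>The coefficients \<open>g\<^sup>a\<^sup>b\<close> of the inverse of the pseudo-metric.\<close>

definition inverse_pairing ::
    "('m, 'v::real_vector) courant_data \<Rightarrow> (nat \<Rightarrow> 'm \<Rightarrow> 'v) \<Rightarrow> 'm \<Rightarrow> nat \<Rightarrow> nat \<Rightarrow> real" where
  "inverse_pairing C e x a b = frame_coord (fibre_dim C) e x
     (sharp C x (\<lambda>w. frame_coord (fibre_dim C) e x w a)) b"

definition gchart_pd :: "'m chart \<Rightarrow> nat \<Rightarrow> ('m \<Rightarrow> gpoly) \<Rightarrow> 'm \<Rightarrow> gpoly" where
  "gchart_pd c i f x = gpoly_of (\<lambda>u. chart_pd c i (\<lambda>y. gcoeff (f y) u) x)"

text \<open>The Poisson bracket of degree \<open>-2\<close>: the canonical bracket of \<open>T\<^sup>*[2]E[1]\<close> has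
  \<open>{p\<^sub>i, x\<^sup>j} = \<delta>\<^sub>i\<^sup>j\<close> and \<open>{\<theta>\<^sub>a, \<xi>\<^sup>b} = \<delta>\<^sub>a\<^sup>b\<close>; the pulled back symplectic form then gives
  \<open>{p\<^sub>i, x\<^sup>j} = \<delta>\<^sub>i\<^sup>j\<close>, \<open>{\<xi>\<^sup>a, \<xi>\<^sup>b} = g\<^sup>a\<^sup>b\<close> and zero for the other pairs of coordinates.\<close>

definition poisson :: "('m::topological_space, 'v::real_vector) courant_data \<Rightarrow>
    ('m, 'v) gfun \<Rightarrow> ('m, 'v) gfun \<Rightarrow> ('m, 'v) gfun" where
  "poisson C F G = (\<lambda>(U, \<phi>, e) x. if gchart_at C (U, \<phi>, e) x then
     let F' = F (U, \<phi>, e); G' = G (U, \<phi>, e) in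
       (\<Sum>i<base_dim C. d_p i (F' x) * gchart_pd (U, \<phi>) i G' x
                       - gchart_pd (U, \<phi>) i F' x * d_p i (G' x)) +
       (\<Sum>a<fibre_dim C. \<Sum>b<fibre_dim C.
          inverse_pairing C e x a b *\<^sub>R (d_xi_right a (F' x) * d_xi b (G' x)))
     else 0)"

text \<open>Roytenberg's generating function of the Courant algebroid structure.\<close>

definition courant_hamiltonian ::
    "('m::topological_space, 'v::real_vector) courant_data \<Rightarrow> ('m, 'v) gfun \<Rightarrow> bool" where
  "courant_hamiltonian C H \<longleftrightarrow> H \<in> graded_piece C 3 \<and> poisson C H H = (\<lambda>c x. 0) \<and>
     (\<forall>\<phi>\<in>sections C. \<forall>\<psi>\<in>sections C. section_fun C (bracket C \<phi> \<psi>) =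
        poisson C (poisson C H (section_fun C \<phi>)) (section_fun C \<psi>)) \<and>
     (\<forall>\<psi>\<in>sections C. \<forall>f\<in>smooth_functions C. base_fun C (anchor_act C \<psi> f) =
        poisson C (poisson C (section_fun C \<psi>) H) (base_fun C f))"


section \<open>The naive ideal\<close>

text \<open>Sections of \<open>\<Lambda>\<^sup>kE\<close> are, via the pseudo-metric, the degree \<open>k\<close> functions on \<open>E[1]\<close>, i.e. those
  not involving the momenta.\<close>

definition exterior_sections ::
    "('m::topological_space, 'v::real_vector) courant_data \<Rightarrow> nat \<Rightarrow> ('m, 'v) gfun set" where
  "exterior_sections C k = {F \<in> graded_piece C (int k).
     \<forall>c x S m. gcoeff (F c x) (S, m) \<noteq> 0 \<longrightarrow> m = {#}}"

text \<open>The odd derivation \<open>\<Lambda>E\<^sub>x \<rightarrow> \<Lambda>E\<^sub>x \<otimes> T\<^sub>xM\<close> extending \<open>\<rho>\<close>, contracted with \<open>df\<close>; the coordinate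
  \<open>\<xi>\<^sup>a\<close> corresponds to the vector \<open>sharp C x \<xi>\<^sup>a\<close> of \<open>E\<^sub>x\<close>.  An element of \<open>\<Lambda>E\<^sub>x \<otimes> T\<^sub>xM\<close> vanishes iff
  its contractions with all \<open>df\<close> do.\<close>

definition anchor_derivation :: "('m, 'v::real_vector) courant_data \<Rightarrow> ('m, 'v) gchart \<Rightarrow> 'm \<Rightarrow>
    ('m \<Rightarrow> real) \<Rightarrow> gpoly \<Rightarrow> gpoly" where
  "anchor_derivation C = (\<lambda>(U, \<phi>, e) x f P. \<Sum>a<fibre_dim C.
     anchor C x (sharp C x (\<lambda>w. frame_coord (fibre_dim C) e x w a)) f *\<^sub>R d_xi a P)"

definition kernel_sections ::
    "('m::topological_space, 'v::real_vector) courant_data \<Rightarrow> nat \<Rightarrow> ('m, 'v) gfun set" where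
  "kernel_sections C k = {F \<in> exterior_sections C k. \<forall>c x. gchart_at C c x \<longrightarrow>
     (\<forall>f\<in>smooth_functions C. anchor_derivation C c x f (F c x) = 0)}"

definition naive_ideal ::
    "('m::topological_space, 'v::real_vector) courant_data \<Rightarrow> ('m, 'v) gfun set" where
  "naive_ideal C =
     ideal_prod (function_algebra C) (\<Union>k\<in>{1..}. kernel_sections C k) (graded_functions C)"

primrec naive_ideal_power ::
    "('m::topological_space, 'v::real_vector) courant_data \<Rightarrow> nat \<Rightarrow> ('m, 'v) gfun set" where
  "naive_ideal_power C 0 = graded_functions C"
| "naive_ideal_power C (Suc p) =
     ideal_prod (function_algebra C) (naive_ideal_power C p) (naive_ideal C)"

text \<open>\<open>F\<^sup>pA\<^sup>q\<close>, extended by \<open>F\<^sup>p = F\<^sup>0\<close> for negative \<open>p\<close>.\<close>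

definition naive_filtration ::
    "('m::topological_space, 'v::real_vector) courant_data \<Rightarrow> int \<Rightarrow> int \<Rightarrow> ('m, 'v) gfun set" where
  "naive_filtration C p q = naive_ideal_power C (nat p) \<inter> graded_piece C q"


section \<open>Spectral sequences of algebras\<close>

definition real_ring :: "real ring" where
  "real_ring = \<lparr>carrier = UNIV, monoid.mult = (*), one = 1, ring.zero = 0, add = (+)\<rparr>"

definition linear_map :: "(real, 'a) module \<Rightarrow> (real, 'b) module \<Rightarrow> ('a \<Rightarrow> 'b) \<Rightarrow> bool" where
  "linear_map M N f \<longleftrightarrow> f \<in> carrier M \<rightarrow> carrier N \<and>
     (\<forall>x\<in>carrier M. \<forall>y\<in>carrier M. f (x \<oplus>\<^bsub>M\<^esub> y) = f x \<oplus>\<^bsub>N\<^esub> f y) \<and>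
     (\<forall>t. \<forall>x\<in>carrier M. f (t \<odot>\<^bsub>M\<^esub> x) = t \<odot>\<^bsub>N\<^esub> f x)"

text \<open>The fields \<open>mult\<close> and \<open>one\<close> of \<open>quotient_module\<close> are immaterial.\<close>

definition quotient_module :: "(real, 'a) module \<Rightarrow> 'a set \<Rightarrow> (real, 'a set) module" where
  "quotient_module M N = \<lparr>carrier = a_rcosets\<^bsub>M\<^esub> N, monoid.mult = (\<lambda>K L. N), one = N,
     ring.zero = N, add = (\<lambda>K L. K <+>\<^bsub>M\<^esub> L), smult = (\<lambda>t K. \<Union>x\<in>K. N +>\<^bsub>M\<^esub> (t \<odot>\<^bsub>M\<^esub> x))\<rparr>"

text \<open>\<open>E r p q\<close> is \<open>E\<^sub>r\<^sup>p\<^sup>,\<^sup>q\<close> with differential \<open>d r p q : E\<^sub>r\<^sup>p\<^sup>,\<^sup>q \<rightarrow> E\<^sub>r\<^sup>p\<^sup>+\<^sup>r\<^sup>,\<^sup>q\<^sup>-\<^sup>r\<^sup>+\<^sup>1\<close> and product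
  \<open>mul r p q p' q' : E\<^sub>r\<^sup>p\<^sup>,\<^sup>q \<times> E\<^sub>r\<^sup>p\<^sup>'\<^sup>,\<^sup>q\<^sup>' \<rightarrow> E\<^sub>r\<^sup>p\<^sup>+\<^sup>p\<^sup>'\<^sup>,\<^sup>q\<^sup>+\<^sup>q\<^sup>'\<close>.  The map \<open>h r p q\<close>, defined on the kernel of
  \<open>d r p q\<close>, induces the isomorphism of algebras from the cohomology of the page \<open>r\<close> to the page
  \<open>r + 1\<close>.\<close>

locale algebra_spectral_sequence =
  fixes E :: "nat \<Rightarrow> int \<Rightarrow> int \<Rightarrow> (real, 'b) module"
    and d :: "nat \<Rightarrow> int \<Rightarrow> int \<Rightarrow> 'b \<Rightarrow> 'b"
    and mul :: "nat \<Rightarrow> int \<Rightarrow> int \<Rightarrow> int \<Rightarrow> int \<Rightarrow> 'b \<Rightarrow> 'b \<Rightarrow> 'b"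
    and h :: "nat \<Rightarrow> int \<Rightarrow> int \<Rightarrow> 'b \<Rightarrow> 'b"
  assumes page_module: "Module.module real_ring (E r p q)"
    and d_linear: "linear_map (E r p q) (E r (p + int r) (q - int r + 1)) (d r p q)"
    and d_square: "x \<in> carrier (E r p q) \<Longrightarrow>
      d r (p + int r) (q - int r + 1) (d r p q x) =
        \<zero>\<^bsub>E r (p + 2 * int r) (q - 2 * int r + 2)\<^esub>"
    and mul_linear_left: "y \<in> carrier (E r p' q') \<Longrightarrow>
      linear_map (E r p q) (E r (p + p') (q + q')) (\<lambda>x. mul r p q p' q' x y)"
    and mul_linear_right: "x \<in> carrier (E r p q) \<Longrightarrow>
      linear_map (E r p' q') (E r (p + p') (q + q')) (mul r p q p' q' x)"
    and mul_assoc: "\<lbrakk>x \<in> carrier (E r p q); y \<in> carrier (E r p' q'); z \<in> carrier (E r p'' q'')\<rbrakk> \<Longrightarrow>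
      mul r (p + p') (q + q') p'' q'' (mul r p q p' q' x y) z =
        mul r p q (p' + p'') (q' + q'') x (mul r p' q' p'' q'' y z)"
    and mul_unit: "\<exists>u\<in>carrier (E r 0 0). \<forall>p q. \<forall>x\<in>carrier (E r p q).
      mul r 0 0 p q u x = x \<and> mul r p q 0 0 x u = x"
    and d_leibniz: "\<lbrakk>x \<in> carrier (E r p q); y \<in> carrier (E r p' q')\<rbrakk> \<Longrightarrow>
      d r (p + p') (q + q') (mul r p q p' q' x y) =
        mul r (p + int r) (q - int r + 1) p' q' (d r p q x) y
        \<oplus>\<^bsub>E r (p + p' + int r) (q + q' - int r + 1)\<^esub>
        ((if even (p + q) then 1 else - 1) \<odot>\<^bsub>E r (p + p' + int r) (q + q' - int r + 1)\<^esub>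
          mul r p q (p' + int r) (q' - int r + 1) x (d r p' q' y))"
    and next_linear: "linear_map
      (E r p q \<lparr>carrier := {x \<in> carrier (E r p q). d r p q x = \<zero>\<^bsub>E r (p + int r) (q - int r + 1)\<^esub>}\<rparr>)
      (E (Suc r) p q) (h r p q)"
    and next_surj: "carrier (E (Suc r) p q) \<subseteq>
      h r p q ` {x \<in> carrier (E r p q). d r p q x = \<zero>\<^bsub>E r (p + int r) (q - int r + 1)\<^esub>}"
    and next_kernel: "\<lbrakk>x \<in> carrier (E r p q); d r p q x = \<zero>\<^bsub>E r (p + int r) (q - int r + 1)\<^esub>\<rbrakk> \<Longrightarrow>
      h r p q x = \<zero>\<^bsub>E (Suc r) p q\<^esub> \<longleftrightarrow>
        x \<in> d r (p - int r) (q + int r - 1) ` carrier (E r (p - int r) (q + int r - 1))"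
    and next_mul: "\<lbrakk>x \<in> carrier (E r p q); d r p q x = \<zero>\<^bsub>E r (p + int r) (q - int r + 1)\<^esub>;
      y \<in> carrier (E r p' q'); d r p' q' y = \<zero>\<^bsub>E r (p' + int r) (q' - int r + 1)\<^esub>\<rbrakk> \<Longrightarrow>
      h r (p + p') (q + q') (mul r p q p' q' x y) =
        mul (Suc r) p q p' q' (h r p q x) (h r p' q' y)"

text \<open>Convergence to a graded algebra \<open>\<H>\<close> with product \<open>hmul\<close> and decreasing multiplicative
  filtration \<open>\<Phi> p n = F\<^sup>p\<H>\<^sup>n\<close>: in every degree the filtration is exhaustive and reaches zero, every
  \<open>E\<^sub>r\<^sup>p\<^sup>,\<^sup>q\<close> becomes stationary from some \<open>r0 p q\<close> on, and the maps \<open>\<alpha> r p q\<close> identify the stationary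
  value with \<open>F\<^sup>p\<H>\<^sup>p\<^sup>+\<^sup>q / F\<^sup>p\<^sup>+\<^sup>1\<H>\<^sup>p\<^sup>+\<^sup>q\<close>, multiplicatively.\<close>

definition converges_to ::
    "(nat \<Rightarrow> int \<Rightarrow> int \<Rightarrow> (real, 'b) module) \<Rightarrow> (nat \<Rightarrow> int \<Rightarrow> int \<Rightarrow> 'b \<Rightarrow> 'b) \<Rightarrow>
     (nat \<Rightarrow> int \<Rightarrow> int \<Rightarrow> int \<Rightarrow> int \<Rightarrow> 'b \<Rightarrow> 'b \<Rightarrow> 'b) \<Rightarrow> (nat \<Rightarrow> int \<Rightarrow> int \<Rightarrow> 'b \<Rightarrow> 'b) \<Rightarrow>
     (int \<Rightarrow> (real, 'c) module) \<Rightarrow> (int \<Rightarrow> int \<Rightarrow> 'c \<Rightarrow> 'c \<Rightarrow> 'c) \<Rightarrow> (int \<Rightarrow> int \<Rightarrow> 'c set) \<Rightarrow> bool" where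
  "converges_to E d mul h \<H> hmul \<Phi> \<longleftrightarrow>
     (\<forall>n. Module.module real_ring (\<H> n)) \<and>
     (\<forall>p n. submodule (\<Phi> p n) real_ring (\<H> n) \<and> \<Phi> (p + 1) n \<subseteq> \<Phi> p n) \<and>
     (\<forall>p n p' n'. \<forall>x\<in>\<Phi> p n. \<forall>y\<in>\<Phi> p' n'. hmul n n' x y \<in> \<Phi> (p + p') (n + n')) \<and>
     (\<forall>n. (\<exists>p. \<Phi> p n = carrier (\<H> n)) \<and> (\<exists>p. \<Phi> p n = {\<zero>\<^bsub>\<H> n\<^esub>})) \<and>
     (\<exists>r0 \<alpha>.
       (\<forall>p q r. r0 p q \<le> r \<longrightarrow>
          (\<forall>x\<in>carrier (E r p q). d r p q x = \<zero>\<^bsub>E r (p + int r) (q - int r + 1)\<^esub>) \<and>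
          (\<forall>x\<in>carrier (E r (p - int r) (q + int r - 1)).
             d r (p - int r) (q + int r - 1) x = \<zero>\<^bsub>E r p q\<^esub>) \<and>
          linear_map (E r p q)
            (quotient_module (\<H> (p + q) \<lparr>carrier := \<Phi> p (p + q)\<rparr>) (\<Phi> (p + 1) (p + q))) (\<alpha> r p q) \<and>
          bij_betw (\<alpha> r p q) (carrier (E r p q))
            (a_rcosets\<^bsub>\<H> (p + q) \<lparr>carrier := \<Phi> p (p + q)\<rparr>\<^esub> (\<Phi> (p + 1) (p + q))) \<and>
          (\<forall>x\<in>carrier (E r p q). \<alpha> (Suc r) p q (h r p q x) = \<alpha> r p q x)) \<and>
       (\<forall>p q p' q' r. max (r0 p q) (max (r0 p' q') (r0 (p + p') (q + q'))) \<le> r \<longrightarrow>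
          (\<forall>x\<in>carrier (E r p q). \<forall>y\<in>carrier (E r p' q').
             \<alpha> r (p + p') (q + q') (mul r p q p' q' x y) =
               (\<Union>a\<in>\<alpha> r p q x. \<Union>b\<in>\<alpha> r p' q' y.
                  \<Phi> (p + p' + 1) (p + q + p' + q') +>\<^bsub>\<H> (p + q + p' + q')\<^esub>
                    hmul (p + q) (p' + q') a b))))"


section \<open>Standard cohomology\<close>

definition standard_differential :: "('m::topological_space, 'v::real_vector) courant_data \<Rightarrow>
    ('m, 'v) gfun \<Rightarrow> ('m, 'v) gfun \<Rightarrow> ('m, 'v) gfun" where
  "standard_differential C H F = poisson C H F"

definition standard_cocycles :: "('m::topological_space, 'v::real_vector) courant_data \<Rightarrow>
    ('m, 'v) gfun \<Rightarrow> int \<Rightarrow> ('m, 'v) gfun set" where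
  "standard_cocycles C H n =
     {F \<in> graded_piece C n. standard_differential C H F = \<zero>\<^bsub>function_algebra C\<^esub>}"

definition standard_coboundaries :: "('m::topological_space, 'v::real_vector) courant_data \<Rightarrow>
    ('m, 'v) gfun \<Rightarrow> int \<Rightarrow> ('m, 'v) gfun set" where
  "standard_coboundaries C H n = standard_differential C H ` graded_piece C (n - 1)"

definition H_std :: "('m::topological_space, 'v::real_vector) courant_data \<Rightarrow>
    ('m, 'v) gfun \<Rightarrow> int \<Rightarrow> (real, ('m, 'v) gfun set) module" where
  "H_std C H n = quotient_module
     (function_algebra C \<lparr>carrier := standard_cocycles C H n\<rparr>) (standard_coboundaries C H n)"

definition H_std_mul :: "('m::topological_space, 'v::real_vector) courant_data \<Rightarrow>
    ('m, 'v) gfun \<Rightarrow> int \<Rightarrow> int \<Rightarrow> ('m, 'v) gfun set \<Rightarrow> ('m, 'v) gfun set \<Rightarrow> ('m, 'v) gfun set" where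
  "H_std_mul C H n n' K L = (\<Union>F\<in>K. \<Union>G\<in>L.
     standard_coboundaries C H (n + n') +>\<^bsub>function_algebra C\<^esub> (F \<otimes>\<^bsub>function_algebra C\<^esub> G))"

text \<open>The filtration of the cohomology by the images of the cohomologies of \<open>F\<^sup>pA\<close>.\<close>

definition H_std_filtration :: "('m::topological_space, 'v::real_vector) courant_data \<Rightarrow>
    ('m, 'v) gfun \<Rightarrow> int \<Rightarrow> int \<Rightarrow> ('m, 'v) gfun set set" where
  "H_std_filtration C H p n = (\<lambda>F. standard_coboundaries C H n +>\<^bsub>function_algebra C\<^esub> F) `
     (standard_cocycles C H n \<inter> naive_filtration C p n)"

definition associated_graded :: "('m::topological_space, 'v::real_vector) courant_data \<Rightarrow>
    int \<Rightarrow> int \<Rightarrow> (real, ('m, 'v) gfun set) module" where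
  "associated_graded C p n = quotient_module
     (function_algebra C \<lparr>carrier := naive_filtration C p n\<rparr>) (naive_filtration C (p + 1) n)"

definition graded_class :: "('m::topological_space, 'v::real_vector) courant_data \<Rightarrow>
    int \<Rightarrow> int \<Rightarrow> ('m, 'v) gfun \<Rightarrow> ('m, 'v) gfun set" where
  "graded_class C p n F = naive_filtration C (p + 1) n +>\<^bsub>function_algebra C\<^esub> F"

end

theory Submission
  imports Defs "HOL-Library.Function_Algebras"
begin

text \<open>A bounded decreasing multiplicative filtration of a differential graded algebra has a spectral
  sequence of algebras, \<open>E\<^sub>r = Z\<^sub>r / N\<^sub>r\<close> with \<open>Z\<^sub>r\<close> the elements of \<open>F\<^sup>p\<close> whose differential lies in
  \<open>F\<^sup>p\<^sup>+\<^sup>r\<close>.  The filtration by powers of the naive ideal \<open>I\<close> is bounded since \<open>I\<close> starts in degree 1.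
  That \<open>Q = {H, \<cdot>}\<close> is a square zero derivation of the algebra of functions follows from the Jacobi
  identity of the Poisson bracket in Darboux coordinates and its independence of the coordinates.

  To see that \<open>I\<close> is stable under \<open>Q\<close>, note that the fourth condition on \<open>H\<close> identifies the contraction with
  \<open>df\<close> of the odd extension of \<open>\<rho>\<close> with \<open>{Qf, \<cdot>}\<close>.  So for \<open>F\<close> in the kernel of \<open>\<rho>\<close> we have \<open>{Qf, QF} = {Q(Qf), F} - Q{Qf, F} = 0\<close>;
  moreover \<open>\<partial>(QF)/\<partial>p\<^sub>j\<close> at a point is \<open>{Qf, F}\<close> for a function \<open>f\<close> with \<open>df = dx\<^sup>j\<close> there, so that \<open>QF\<close> is
  again a section of the exterior algebra.\<close>

section \<open>The graded commutative algebra of graded polynomials\<close>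

subsection \<open>Coefficients\<close>

text \<open>The Jacobi identity is needed only with two odd entries, and it follows from a statement
  about a single odd \<open>F\<close>: the operator \<open>{F, \<cdot>}\<close> is odd and of first
  order, its square has no second order part, and what remains is half of the operator of
  \<open>{F, F}\<close>. Polarising in \<open>F\<close> gives the mixed identity. Independence of
  the coordinates is not formal, because under a change of frame a momentum acquires a term
  quadratic in the odd coordinates. Constancy of the pseudo-metric in both frames makes the
  logarithmic derivative of the transition matrix skew, and the factor 1/2 in
  \<open>\<theta>\<^sub>a = \<langle>e\<^sub>a,e\<^sub>b\<rangle>\<xi>\<^sup>b/2\<close> is the one
  for which the unwanted terms cancel: the transformed coordinates again satisfy the canonical
  bracket relations. The conditions on \<open>H\<close> concern global sections and functions,
  whereas membership in the kernel is tested at points of charts; bump functions pass from one to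
  the other. Cosets are handled as sets throughout, and induced maps as unions over representatives,
  so that nothing is chosen.\<close>

definition sgn_below :: "nat \<Rightarrow> nat set \<Rightarrow> real" where
  "sgn_below a S = (-1) ^ card {b \<in> S. b < a}"

lemma sgn_below_square [simp]: "sgn_below a S * sgn_below a S = 1"
  by (simp add: sgn_below_def flip: power_add mult_2)

lemma sgn_below_empty [simp]: "sgn_below a {} = 1"
  by (simp add: sgn_below_def)

lemma sgn_below_insert:
  assumes "finite S" "b \<notin> S"
  shows "sgn_below a (insert b S) = (if b < a then - sgn_below a S else sgn_below a S)"
proof -
  have "{c \<in> insert b S. c < a} = (if b < a then insert b {c \<in> S. c < a} else {c \<in> S. c < a})"
    by auto
  then show ?thesis using assms by (simp add: sgn_below_def)
qed

lemma sgn_below_insert_self [simp]: "sgn_below a (insert a S) = sgn_below a S"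
proof -
  have "{b \<in> insert a S. b < a} = {b \<in> S. b < a}" by auto
  then show ?thesis by (simp add: sgn_below_def)
qed

lemma sgn_below_remove_self [simp]: "sgn_below a (S - {a}) = sgn_below a S"
proof -
  have "{b \<in> S - {a}. b < a} = {b \<in> S. b < a}" by auto
  then show ?thesis by (simp add: sgn_below_def)
qed

lemma gcoeff_xi: "gcoeff (g_xi a) u = (if u = ({a}, {#}) then 1 else 0)"
  unfolding g_xi_def by (subst gcoeff_gpoly_of) (auto split: if_splits)

lemma gcoeff_p: "gcoeff (g_p i) u = (if u = ({}, {#i#}) then 1 else 0)"
  unfolding g_p_def by (subst gcoeff_gpoly_of) (auto split: if_splits)

lemma gcoeff_d_p: "gcoeff (d_p i f) (S, m) = real (count m i + 1) * gcoeff f (S, add_mset i m)"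
proof -
  have "inj_on (\<lambda>(S, m). (S, add_mset i m)) UNIV" by (auto simp: inj_on_def)
  then have "finite ((\<lambda>(S, m). (S, add_mset i m)) -` {u. gcoeff f u \<noteq> 0})"
    by (intro finite_vimageI finite_coeff)
  then have "finite {u. (\<lambda>(S, m). real (count m i + 1) * gcoeff f (S, add_mset i m)) u \<noteq> 0}"
    by (rule finite_subset[rotated]) auto
  then show ?thesis
    unfolding d_p_def by (subst gcoeff_gpoly_of) (auto dest: finite_coeff_fst)
qed

text \<open>On sets that avoid \<open>a\<close> the insertion of \<open>a\<close> is injective, so
  this support injects into that of \<open>f\<close>. It is what \<open>gpoly_of\<close> requires
  before the coefficients of \<open>d_xi\<close> and \<open>d_xi_right\<close> can be read
  off.\<close>

lemma finite_coeff_insert: "finite {(S, m). a \<notin> S \<and> gcoeff f (insert a S, m) \<noteq> 0}"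
proof (rule finite_imageD)
  let ?h = "\<lambda>(S, m). (insert a S, m)"
  show "finite (?h ` {(S, m). a \<notin> S \<and> gcoeff f (insert a S, m) \<noteq> 0})"
    by (rule finite_subset[OF _ finite_coeff[of f]]) auto
  show "inj_on ?h {(S, m). a \<notin> S \<and> gcoeff f (insert a S, m) \<noteq> 0}"
    by (auto simp: inj_on_def insert_ident)
qed

lemma gcoeff_d_xi: "gcoeff (d_xi a f) (S, m) =
    (if a \<in> S then 0 else sgn_below a S * gcoeff f (insert a S, m))"
proof -
  let ?h = "\<lambda>(S, m). if a \<in> S then 0 else (-1) ^ card {b \<in> S. b < a} * gcoeff f (insert a S, m)"
  have "{u. ?h u \<noteq> 0} \<subseteq> {(S, m). a \<notin> S \<and> gcoeff f (insert a S, m) \<noteq> 0}"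
    by (clarsimp split: if_split_asm)
  then have "finite {u. ?h u \<noteq> 0}" by (rule finite_subset[OF _ finite_coeff_insert[of a f]])
  moreover have "finite S" if "?h (S, m) \<noteq> 0" for S m
  proof -
    have "gcoeff f (insert a S, m) \<noteq> 0" using that by (cases "a \<in> S") auto
    then have "finite (insert a S)" by (rule finite_coeff_fst)
    then show ?thesis by simp
  qed
  ultimately show ?thesis
    unfolding d_xi_def sgn_below_def by (subst gcoeff_gpoly_of) (blast, blast, simp)
qed

lemma gcoeff_d_xi_right: "gcoeff (d_xi_right a f) (S, m) =
    (if a \<in> S then 0 else (-1) ^ card {b \<in> S. a < b} * gcoeff f (insert a S, m))"
proof -
  let ?h = "\<lambda>(S, m). if a \<in> S then 0 else (-1) ^ card {b \<in> S. a < b} * gcoeff f (insert a S, m)"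
  have "{u. ?h u \<noteq> 0} \<subseteq> {(S, m). a \<notin> S \<and> gcoeff f (insert a S, m) \<noteq> 0}"
    by (clarsimp split: if_split_asm)
  then have "finite {u. ?h u \<noteq> 0}" by (rule finite_subset[OF _ finite_coeff_insert[of a f]])
  moreover have "finite S" if "?h (S, m) \<noteq> 0" for S m
  proof -
    have "gcoeff f (insert a S, m) \<noteq> 0" using that by (cases "a \<in> S") auto
    then have "finite (insert a S)" by (rule finite_coeff_fst)
    then show ?thesis by simp
  qed
  ultimately show ?thesis
    unfolding d_xi_right_def by (subst gcoeff_gpoly_of) (blast, blast, simp)
qed

text \<open>Multiplication by a single generator leaves one nonzero term in the convolution that
  defines the product; this collapses the double sum in that case.\<close>

lemma sum_Pow_multiset_single:
  assumes "finite S"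
  shows "(\<Sum>T\<in>Pow S. \<Sum>k | k \<subseteq># m. if T = T0 \<and> k = k0 then c T k else (0 :: real)) =
    (if T0 \<subseteq> S \<and> k0 \<subseteq># m then c T0 k0 else 0)"
proof -
  have "(\<Sum>T\<in>Pow S. \<Sum>k | k \<subseteq># m. if T = T0 \<and> k = k0 then c T k else 0) =
      (\<Sum>T\<in>Pow S. if T = T0 then if k0 \<subseteq># m then c T0 k0 else 0 else 0)"
  proof (rule sum.cong[OF refl])
    fix T
    have "(\<Sum>k | k \<subseteq># m. if T = T0 \<and> k = k0 then c T k else 0) =
        (\<Sum>k | k \<subseteq># m. if k = k0 then if T = T0 then c T k else 0 else 0)"
      by (rule sum.cong) auto
    then show "(\<Sum>k | k \<subseteq># m. if T = T0 \<and> k = k0 then c T k else 0) =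
        (if T = T0 then if k0 \<subseteq># m then c T0 k0 else 0 else 0)"
      by (simp add: sum.delta' sum.delta finite_submultisets)
  qed
  then show ?thesis using assms by (simp add: sum.delta)
qed

text \<open>The generator has to be moved past the elements of \<open>S\<close> below
  \<open>a\<close>, whence the sign. If \<open>a\<close> is not in \<open>S\<close>, no
  factorisation of the monomial begins with it.\<close>

lemma gcoeff_xi_mult: "gcoeff (g_xi a * f) (S, m) =
    (if a \<in> S then sgn_below a S * gcoeff f (S - {a}, m) else 0)"
proof (cases "finite S")
  case False
  then show ?thesis by (simp add: gcoeff_infinite)
next
  case True
  have *: "{(i, j). i = a \<and> j \<in> S \<and> j \<noteq> a \<and> j < i} = Pair a ` {b \<in> S. b < a}" by auto
  have "koszul_sign {a} (S - {a}) = sgn_below a S"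
    by (simp add: koszul_sign_def sgn_below_def * card_image inj_on_def)
  moreover have "gcoeff (g_xi a * f) (S, m) = (\<Sum>T\<in>Pow S. \<Sum>k | k \<subseteq># m.
      if T = {a} \<and> k = {#} then koszul_sign T (S - T) * gcoeff f (S - T, m - k) else 0)"
    unfolding gcoeff_times by (intro sum.cong) (auto simp: gcoeff_xi)
  ultimately show ?thesis by (simp add: sum_Pow_multiset_single[OF True])
qed

lemma gcoeff_p_mult: "gcoeff (g_p i * f) (S, m) =
    (if i \<in># m then gcoeff f (S, m - {#i#}) else 0)"
proof (cases "finite S")
  case False
  then show ?thesis by (simp add: gcoeff_infinite)
next
  case True
  have "gcoeff (g_p i * f) (S, m) = (\<Sum>T\<in>Pow S. \<Sum>k | k \<subseteq># m.
      if T = {} \<and> k = {#i#} then koszul_sign T (S - T) * gcoeff f (S - T, m - k) else 0)"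
    unfolding gcoeff_times by (intro sum.cong) (auto simp: gcoeff_p)
  then show ?thesis by (simp add: sum_Pow_multiset_single[OF True])
qed

lemma gcoeff_sum: "gcoeff (\<Sum>x\<in>I. f x) u = (\<Sum>x\<in>I. gcoeff (f x) u)"
  by (induction I rule: infinite_finite_induct) (simp_all add: gcoeff_simps)

subsection \<open>Induction over the generators\<close>

text \<open>\<open>gpoly\<close> has countably many generators, a chart only the odd ones below the
  rank and the even ones below the dimension. The formulas in a chart sum over these, so the
  generators that may occur are tracked.\<close>

definition gvars :: "nat set \<Rightarrow> nat set \<Rightarrow> gpoly \<Rightarrow> bool" where
  "gvars A B f \<longleftrightarrow> (\<forall>S m. gcoeff f (S, m) \<noteq> 0 \<longrightarrow> S \<subseteq> A \<and> set_mset m \<subseteq> B)"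

lemma gvars_UNIV [simp]: "gvars UNIV UNIV f"
  by (simp add: gvars_def)

lemma gcoeff_prod_p:
  "gcoeff (prod_list (map g_p l)) (S, m) = (if S = {} \<and> m = mset l then 1 else 0)"
proof (induction l arbitrary: S m)
  case (Cons i l)
  have "m = add_mset i (mset l) \<longleftrightarrow> i \<in># m \<and> m - {#i#} = mset l" by (auto dest: insert_DiffM)
  then show ?case by (auto simp: gcoeff_p_mult Cons.IH)
qed (simp add: gcoeff_1)

text \<open>Each \<open>g_xi a\<close> is multiplied from the left onto a product of larger
  generators, so no sign appears: sorted products form the basis dual to the coefficients.\<close>

lemma gcoeff_monomial:
  assumes "sorted_wrt (<) l"
  shows "gcoeff (prod_list (map g_xi l) * prod_list (map g_p k)) (S, m) =
    (if S = set l \<and> m = mset k then 1 else 0)"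
  using assms
proof (induction l arbitrary: S)
  case (Cons a l)
  then have l: "\<forall>b\<in>set l. a < b" "sorted_wrt (<) l" by auto
  have "sgn_below a (insert a (set l)) = 1"
  proof -
    have "{b \<in> insert a (set l). b < a} = {}" using l(1) by auto
    then show ?thesis by (simp only: sgn_below_def card.empty power_0)
  qed
  moreover have "S = insert a (set l) \<longleftrightarrow> a \<in> S \<and> S - {a} = set l" using l(1) by auto
  moreover have "sgn_below a S = 1" if "S = insert a (set l)" using that \<open>sgn_below a _ = 1\<close> by simp
  moreover have "gcoeff (prod_list (map g_xi (a # l)) * prod_list (map g_p k)) (S, m) =
      (if a \<in> S then sgn_below a S * (if S - {a} = set l \<and> m = mset k then 1 else 0) else 0)"
    by (simp add: gcoeff_xi_mult mult.assoc Cons.IH[OF l(2)])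
  ultimately show ?case by (cases "S = insert a (set l)") (simp_all del: insert_iff)
qed (auto simp: gcoeff_prod_p)

definition gsubst_monomial ::
    "(nat \<Rightarrow> gpoly) \<Rightarrow> (nat \<Rightarrow> gpoly) \<Rightarrow> nat set \<times> nat multiset \<Rightarrow> gpoly" where
  "gsubst_monomial \<sigma> \<tau> = (\<lambda>(S, m). prod_list (map \<sigma> (sorted_list_of_set S)) *
     prod_list (map \<tau> (sorted_list_of_multiset m)))"

text \<open>The definition sums over the support of \<open>f\<close>; two polynomials in one
  equation need a common finite index set.\<close>

lemma g_subst_eq_sum:
  assumes "finite M" "{u. gcoeff f u \<noteq> 0} \<subseteq> M"
  shows "g_subst \<sigma> \<tau> f = (\<Sum>u\<in>M. gcoeff f u *\<^sub>R gsubst_monomial \<sigma> \<tau> u)"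
proof -
  have "g_subst \<sigma> \<tau> f = (\<Sum>u | gcoeff f u \<noteq> 0. gcoeff f u *\<^sub>R gsubst_monomial \<sigma> \<tau> u)"
    unfolding g_subst_def gsubst_monomial_def by (rule sum.cong) auto
  also have "\<dots> = (\<Sum>u\<in>M. gcoeff f u *\<^sub>R gsubst_monomial \<sigma> \<tau> u)"
    by (rule sum.mono_neutral_left) (use assms in auto)
  finally show ?thesis .
qed

text \<open>This is the expansion of \<open>f\<close> in monomials, written as the substitution of
  the generators for themselves; the induction principle below rests on it.\<close>

lemma g_subst_generators: "g_subst g_xi g_p f = f"
proof (rule gpoly_eqI)
  fix S m
  have *: "gcoeff (gsubst_monomial g_xi g_p (T, k)) (S, m) = (if (S, m) = (T, k) then 1 else 0)"
    if "finite T" for T k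
    using that by (auto simp: gsubst_monomial_def gcoeff_monomial)
  have "gcoeff (g_subst g_xi g_p f) (S, m) =
      (\<Sum>u | gcoeff f u \<noteq> 0. gcoeff f u * gcoeff (gsubst_monomial g_xi g_p u) (S, m))"
    by (subst g_subst_eq_sum[OF finite_coeff order.refl]) (simp add: gcoeff_sum gcoeff_simps)
  also have "\<dots> = (\<Sum>u | gcoeff f u \<noteq> 0. if u = (S, m) then gcoeff f u else 0)"
  proof (rule sum.cong[OF refl])
    fix u assume u: "u \<in> {u. gcoeff f u \<noteq> 0}"
    obtain T k where [simp]: "u = (T, k)" by force
    have "finite T" using u by (auto dest: finite_coeff_fst)
    then show "gcoeff f u * gcoeff (gsubst_monomial g_xi g_p u) (S, m) =
        (if u = (S, m) then gcoeff f u else 0)"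
      by (auto simp: *)
  qed
  also have "\<dots> = gcoeff f (S, m)"
    by (simp add: sum.delta[OF finite_coeff])
  finally show "gcoeff (g_subst g_xi g_p f) (S, m) = gcoeff f (S, m)" .
qed

text \<open>A property preserved by linear combinations is reduced to left multiplication by one
  generator at a time. The hypothesis \<open>gvars A B f\<close> keeps the generators inside
  prescribed sets, as is needed in a chart.\<close>

lemma gpoly_induct [consumes 1, case_names one add scale xi p]:
  assumes "gvars A B f" and one: "P 1"
    and add: "\<And>f g. P f \<Longrightarrow> P g \<Longrightarrow> P (f + g)"
    and scale: "\<And>c f. P f \<Longrightarrow> P (c *\<^sub>R f)"
    and xi: "\<And>a f. a \<in> A \<Longrightarrow> P f \<Longrightarrow> P (g_xi a * f)"
    and p: "\<And>i f. i \<in> B \<Longrightarrow> P f \<Longrightarrow> P (g_p i * f)"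
  shows "P f"
proof -
  have P0: "P 0" using scale[OF one, of 0] by simp
  have Psum: "P (\<Sum>x\<in>I. h x)" if "\<And>x. x \<in> I \<Longrightarrow> P (h x)" for I and h :: "_ \<Rightarrow> gpoly"
    using that by (induction I rule: infinite_finite_induct) (auto intro: add P0)
  have pp: "P (prod_list (map g_p l))" if "set l \<subseteq> B" for l
    using that by (induction l) (auto intro: one p)
  have mon: "P (prod_list (map g_xi k) * prod_list (map g_p l))" if "set l \<subseteq> B" "set k \<subseteq> A" for k l
    using that(2) by (induction k) (auto simp: mult.assoc intro: xi pp[OF that(1)])
  have "P (gcoeff f u *\<^sub>R gsubst_monomial g_xi g_p u)" if "gcoeff f u \<noteq> 0" for u
  proof (cases u)
    case (Pair S m)
    then have "finite S" "S \<subseteq> A" "set_mset m \<subseteq> B"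
      using that assms(1) unfolding gvars_def by (auto dest: finite_coeff_fst)
    then show ?thesis
      unfolding Pair gsubst_monomial_def prod.case by (intro scale mon) auto
  qed
  then have "P (g_subst g_xi g_p f)"
    by (subst g_subst_eq_sum[OF finite_coeff order.refl]) (auto intro: Psum)
  then show ?thesis by (simp add: g_subst_generators)
qed

subsection \<open>Parity and graded commutativity\<close>

text \<open>The involution that is -1 on odd elements. The even generators have degree 2, so only
  \<open>card S\<close> counts. With it the sign rules can be stated for all polynomials, not only
  for homogeneous ones.\<close>

definition gpar :: "gpoly \<Rightarrow> gpoly" where
  "gpar f = gpoly_of (\<lambda>(S, m). (-1) ^ card S * gcoeff f (S, m))"

lemma gcoeff_gpar: "gcoeff (gpar f) (S, m) = (-1) ^ card S * gcoeff f (S, m)"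
proof -
  have "{u. (case u of (S, m) \<Rightarrow> (-1) ^ card S * gcoeff f (S, m)) \<noteq> 0} = {u. gcoeff f u \<noteq> 0}"
    by auto
  then have "finite {u. (case u of (S, m) \<Rightarrow> (-1) ^ card S * gcoeff f (S, m)) \<noteq> 0}"
    by (simp add: finite_coeff)
  then show ?thesis
    unfolding gpar_def by (subst gcoeff_gpoly_of) (auto dest: finite_coeff_fst)
qed

lemma gpar_linear [simp]: "gpar (f + g) = gpar f + gpar g" "gpar (c *\<^sub>R f) = c *\<^sub>R gpar f"
  "gpar (f - g) = gpar f - gpar g" "gpar (- f) = - gpar f" "gpar 0 = 0"
  by (rule gpoly_eqI; simp add: gcoeff_gpar gcoeff_simps algebra_simps)+

lemma gpar_1 [simp]: "gpar 1 = 1"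
  by (rule gpoly_eqI) (auto simp: gcoeff_gpar gcoeff_simps)

lemma gpar_gpar [simp]: "gpar (gpar f) = f"
proof (rule gpoly_eqI)
  fix S m show "gcoeff (gpar (gpar f)) (S, m) = gcoeff f (S, m)"
    by (cases "even (card S)") (simp_all add: gcoeff_gpar)
qed

lemma gpar_xi_mult: "gpar (g_xi a * f) = - (g_xi a * gpar f)"
proof (rule gpoly_eqI)
  fix S m show "gcoeff (gpar (g_xi a * f)) (S, m) = gcoeff (- (g_xi a * gpar f)) (S, m)"
  proof (cases "finite S \<and> a \<in> S")
    case True
    then have "card S = Suc (card (S - {a}))" by (metis card.remove)
    then have "(-1 :: real) ^ card S = - ((-1) ^ card (S - {a}))" by simp
    with True show ?thesis
      by (simp add: gcoeff_gpar gcoeff_simps gcoeff_xi_mult del: card_Diff_insert card_Diff_singleton)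
  next
    case False
    then show ?thesis by (auto simp: gcoeff_gpar gcoeff_simps gcoeff_xi_mult gcoeff_infinite)
  qed
qed

lemma gpar_p_mult: "gpar (g_p i * f) = g_p i * gpar f"
  by (rule gpoly_eqI) (simp add: gcoeff_gpar gcoeff_p_mult)

lemma gpar_mult [simp]: "gpar (f * g) = gpar f * gpar g"
  using gvars_UNIV
  by (induction f rule: gpoly_induct)
     (simp_all add: distrib_right mult.assoc gpar_xi_mult gpar_p_mult)

lemma gpar_xi [simp]: "gpar (g_xi a) = - g_xi a"
  using gpar_xi_mult[of a 1] by simp

lemma gpar_p [simp]: "gpar (g_p i) = g_p i"
  using gpar_p_mult[of i 1] by simp

lemma gpar_sum: "gpar (\<Sum>x\<in>I. f x) = (\<Sum>x\<in>I. gpar (f x))"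
  by (induction I rule: infinite_finite_induct) simp_all

lemma xi_mult_xi_mult: "g_xi a * (g_xi b * f) = - (g_xi b * (g_xi a * f))"
proof (rule gpoly_eqI)
  fix S m show "gcoeff (g_xi a * (g_xi b * f)) (S, m) = gcoeff (- (g_xi b * (g_xi a * f))) (S, m)"
  proof (cases "finite S \<and> a \<in> S \<and> b \<in> S \<and> a \<noteq> b")
    case True
    define S' where "S' = S - {a, b}"
    have S': "S = insert a (insert b S')" "finite S'" "a \<notin> S'" "b \<notin> S'"
      using True by (auto simp: S'_def)
    have "S - {a} = insert b S'" "S - {b} = insert a S'" using S' True by auto
    moreover have "insert b S' - {b} = S'" "insert a S' - {a} = S'" using S' by auto
    moreover have "sgn_below a S = (if b < a then - sgn_below a S' else sgn_below a S')"
      unfolding S'(1) using S' by (simp add: sgn_below_insert)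
    moreover have "sgn_below b S = (if a < b then - sgn_below b S' else sgn_below b S')"
      unfolding S'(1) insert_commute[of a b] using S' by (simp add: sgn_below_insert)
    ultimately show ?thesis using True by (simp add: gcoeff_xi_mult gcoeff_simps)
  next
    case False
    then show ?thesis by (auto simp: gcoeff_xi_mult gcoeff_simps gcoeff_infinite)
  qed
qed

lemma p_mult_p_mult: "g_p i * (g_p j * f) = g_p j * (g_p i * f)"
proof (rule gpoly_eqI)
  fix S m show "gcoeff (g_p i * (g_p j * f)) (S, m) = gcoeff (g_p j * (g_p i * f)) (S, m)"
  proof (cases "i = j")
    case False
    then have "j \<in># m - {#i#} \<longleftrightarrow> j \<in># m" "i \<in># m - {#j#} \<longleftrightarrow> i \<in># m"
      by (auto simp: in_diff_count)
    moreover have "m - {#i#} - {#j#} = m - {#j#} - {#i#}" by (rule diff_right_commute)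
    ultimately show ?thesis by (simp add: gcoeff_p_mult)
  qed simp
qed

lemma xi_mult_p_mult: "g_xi a * (g_p i * f) = g_p i * (g_xi a * f)"
  by (rule gpoly_eqI) (simp add: gcoeff_p_mult gcoeff_xi_mult)

lemma mult_p: "f * g_p i = g_p i * f"
  using gvars_UNIV
proof (induction f rule: gpoly_induct)
  case (xi a f)
  then show ?case by (simp add: mult.assoc xi_mult_p_mult)
next
  case (p j f)
  then show ?case by (simp add: mult.assoc p_mult_p_mult[of j i])
qed (simp_all add: distrib_left distrib_right)

lemma mult_xi: "f * g_xi a = g_xi a * gpar f"
  using gvars_UNIV
proof (induction f rule: gpoly_induct)
  case (xi b f)
  then show ?case by (simp add: mult.assoc xi_mult_xi_mult[of b a])
next
  case (p j f)
  then show ?case by (simp add: mult.assoc xi_mult_p_mult)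
qed (simp_all add: distrib_left distrib_right)

text \<open>In terms of the even part \<open>(f + gpar f) / 2\<close> and the odd part
  \<open>(f - gpar f) / 2\<close>: the even part of \<open>f\<close> commutes with \<open>g\<close>,
  the odd part does so up to replacing \<open>g\<close> by \<open>gpar g\<close>. In this form the
  identity is linear in \<open>f\<close> and passes through the induction over generators.\<close>

lemma mult_commute_graded:
  "2 *\<^sub>R (g * f) = (f + gpar f) * g + (f - gpar f) * gpar g"
  using gvars_UNIV
proof (induction f arbitrary: g rule: gpoly_induct)
  case (add f f')
  have "2 *\<^sub>R (g * (f + f')) = 2 *\<^sub>R (g * f) + 2 *\<^sub>R (g * f')" by (simp add: algebra_simps)
  then show ?case unfolding add by (simp add: algebra_simps)
next
  case (scale c f)
  have "2 *\<^sub>R (g * (c *\<^sub>R f)) = c *\<^sub>R (2 *\<^sub>R (g * f))" by simp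
  then show ?case unfolding scale by (simp add: algebra_simps)
next
  case (xi a f)
  have "2 *\<^sub>R (g * (g_xi a * f)) = g_xi a * (2 *\<^sub>R (gpar g * f))"
    by (simp add: mult_xi flip: mult.assoc)
  then show ?case unfolding xi by (simp add: algebra_simps)
next
  case (p i f)
  have "2 *\<^sub>R (g * (g_p i * f)) = g_p i * (2 *\<^sub>R (g * f))"
    by (simp add: mult_p flip: mult.assoc)
  then show ?case unfolding p by (simp add: algebra_simps)
qed (simp_all add: distrib_right flip: scaleR_2)

definition geven :: "gpoly \<Rightarrow> bool" where "geven f \<longleftrightarrow> gpar f = f"
definition godd :: "gpoly \<Rightarrow> bool" where "godd f \<longleftrightarrow> gpar f = - f"

lemma geven_mult_commute: "geven f \<Longrightarrow> g * f = f * g"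
  using mult_commute_graded[of g f] by (simp add: geven_def scaleR_2[symmetric])

lemma godd_mult_commute: "godd f \<Longrightarrow> g * f = f * gpar g"
  using mult_commute_graded[of g f] by (simp add: godd_def scaleR_2[symmetric])

lemma godd_anticommute: "godd f \<Longrightarrow> godd g \<Longrightarrow> g * f = - (f * g)"
  using godd_mult_commute[of f g] by (simp add: godd_def)

lemma godd_square:
  assumes "godd f"
  shows "f * f = 0"
proof -
  have "f * f + f * f = 0"
    using godd_anticommute[OF assms assms] by (metis add.right_inverse)
  then have "2 *\<^sub>R (f * f) = 0" by (simp only: scaleR_2)
  then show ?thesis by simp
qed

lemma geven_intros [intro]:
  "geven 0" "geven 1" "geven f \<Longrightarrow> geven g \<Longrightarrow> geven (f + g)" "geven f \<Longrightarrow> geven (c *\<^sub>R f)"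
  "geven f \<Longrightarrow> geven g \<Longrightarrow> geven (f * g)" "godd f \<Longrightarrow> godd g \<Longrightarrow> geven (f * g)"
  "geven (g_p i)"
  by (simp_all add: geven_def godd_def)

lemma godd_intros [intro]:
  "godd 0" "godd f \<Longrightarrow> godd g \<Longrightarrow> godd (f + g)" "godd f \<Longrightarrow> godd (c *\<^sub>R f)"
  "geven f \<Longrightarrow> godd g \<Longrightarrow> godd (f * g)" "godd f \<Longrightarrow> geven g \<Longrightarrow> godd (f * g)"
  "godd (g_xi i)"
  by (simp_all add: geven_def godd_def)

lemma geven_sum [intro]: "(\<And>x. x \<in> I \<Longrightarrow> geven (f x)) \<Longrightarrow> geven (\<Sum>x\<in>I. f x)"
  by (simp add: geven_def gpar_sum)

lemma godd_sum [intro]: "(\<And>x. x \<in> I \<Longrightarrow> godd (f x)) \<Longrightarrow> godd (\<Sum>x\<in>I. f x)"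
  by (simp add: godd_def gpar_sum sum_negf)

subsection \<open>Derivations\<close>

lemma d_xi_linear [simp]: "d_xi a (f + g) = d_xi a f + d_xi a g" "d_xi a (c *\<^sub>R f) = c *\<^sub>R d_xi a f"
  "d_xi a (f - g) = d_xi a f - d_xi a g" "d_xi a (- f) = - d_xi a f" "d_xi a 0 = 0"
  by (rule gpoly_eqI; simp add: gcoeff_d_xi gcoeff_simps algebra_simps)+

lemma d_p_linear [simp]: "d_p i (f + g) = d_p i f + d_p i g" "d_p i (c *\<^sub>R f) = c *\<^sub>R d_p i f"
  "d_p i (f - g) = d_p i f - d_p i g" "d_p i (- f) = - d_p i f" "d_p i 0 = 0"
  by (rule gpoly_eqI; simp add: gcoeff_d_p gcoeff_simps algebra_simps)+

lemma d_xi_sum: "d_xi a (\<Sum>x\<in>I. f x) = (\<Sum>x\<in>I. d_xi a (f x))"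
  by (induction I rule: infinite_finite_induct) simp_all

lemma d_p_sum: "d_p a (\<Sum>x\<in>I. f x) = (\<Sum>x\<in>I. d_p a (f x))"
  by (induction I rule: infinite_finite_induct) simp_all

lemma d_xi_1 [simp]: "d_xi a 1 = 0" and d_p_1 [simp]: "d_p i 1 = 0"
  by (rule gpoly_eqI; simp add: gcoeff_d_xi gcoeff_d_p gcoeff_simps)+

lemma d_xi_xi_mult: "d_xi a (g_xi b * f) = (if a = b then f else 0) - g_xi b * d_xi a f"
proof (rule gpoly_eqI)
  fix S m
  show "gcoeff (d_xi a (g_xi b * f)) (S, m) =
      gcoeff ((if a = b then f else 0) - g_xi b * d_xi a f) (S, m)"
  proof (cases "finite S")
    case False
    then show ?thesis by (simp add: gcoeff_infinite)
  next
    case fin: True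
    show ?thesis
    proof (cases "a = b")
      case True
      then show ?thesis
        by (auto simp: gcoeff_d_xi gcoeff_simps gcoeff_xi_mult insert_absorb simp flip: mult.assoc)
    next
      case ab: False
      show ?thesis
      proof (cases "b \<in> S \<and> a \<notin> S")
        case True
        then obtain S' where S': "S = insert b S'" "b \<notin> S'" by (metis Set.set_insert)
        then have "insert a S - {b} = insert a S'" "S - {b} = S'" "finite S'" "a \<notin> S'"
          using ab True fin by auto
        then show ?thesis using S' ab True
          by (auto simp: gcoeff_d_xi gcoeff_simps gcoeff_xi_mult sgn_below_insert insert_commute)
      next
        case False
        then show ?thesis using ab by (auto simp: gcoeff_d_xi gcoeff_simps gcoeff_xi_mult)
      qed
    qed
  qed
qed

lemma d_xi_p_mult: "d_xi a (g_p i * f) = g_p i * d_xi a f"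
  by (rule gpoly_eqI) (simp add: gcoeff_d_xi gcoeff_p_mult)

lemma d_p_xi_mult: "d_p i (g_xi a * f) = g_xi a * d_p i f"
  by (rule gpoly_eqI) (simp add: gcoeff_d_p gcoeff_xi_mult)

lemma d_p_p_mult: "d_p i (g_p j * f) = (if i = j then f else 0) + g_p j * d_p i f"
proof (rule gpoly_eqI)
  fix S m
  show "gcoeff (d_p i (g_p j * f)) (S, m) =
      gcoeff ((if i = j then f else 0) + g_p j * d_p i f) (S, m)"
  proof (cases "j \<in># m")
    case True
    then obtain m' where "m = add_mset j m'" by (meson mset_add)
    then show ?thesis
      by (auto simp: gcoeff_d_p gcoeff_p_mult gcoeff_simps add_mset_commute algebra_simps)
  next
    case False
    then show ?thesis
      by (auto simp: gcoeff_d_p gcoeff_p_mult gcoeff_simps count_eq_zero_iff)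
  qed
qed

lemma d_xi_mult: "d_xi a (f * g) = d_xi a f * g + gpar f * d_xi a g"
  using gvars_UNIV
  by (induction f rule: gpoly_induct)
     (simp_all add: distrib_right distrib_left mult.assoc d_xi_xi_mult d_xi_p_mult
        left_diff_distrib scaleR_add_right)

lemma d_p_mult: "d_p i (f * g) = d_p i f * g + f * d_p i g"
  using gvars_UNIV
  by (induction f rule: gpoly_induct)
     (simp_all add: distrib_right distrib_left mult.assoc d_p_xi_mult d_p_p_mult scaleR_add_right)

lemma d_xi_xi: "d_xi a (g_xi b) = (if a = b then 1 else 0)"
  using d_xi_xi_mult[of a b 1] by simp

lemma d_p_xi [simp]: "d_p i (g_xi a) = 0"
  using d_p_xi_mult[of i a 1] by simp

lemma d_p_p: "d_p i (g_p j) = (if i = j then 1 else 0)"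
  using d_p_p_mult[of i j 1] by simp

lemma d_xi_p [simp]: "d_xi a (g_p j) = 0"
  using d_xi_p_mult[of a j 1] by simp

lemma gpar_d_xi: "gpar (d_xi a f) = - d_xi a (gpar f)"
  using gvars_UNIV
  by (induction f rule: gpoly_induct)
     (simp_all add: d_xi_xi_mult d_xi_p_mult)

lemma gpar_d_p: "gpar (d_p i f) = d_p i (gpar f)"
  by (rule gpoly_eqI) (simp add: gcoeff_gpar gcoeff_d_p)

text \<open>Taking \<open>g_xi a\<close> out on the right instead of the left replaces the
  generators below \<open>a\<close> by those above it. The two signs differ by
  \<open>(-1) ^ card S\<close>, that is by \<open>gpar\<close> applied after the derivative.\<close>

lemma d_xi_right_eq: "d_xi_right a f = gpar (d_xi a f)"
proof (rule gpoly_eqI)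
  fix S m show "gcoeff (d_xi_right a f) (S, m) = gcoeff (gpar (d_xi a f)) (S, m)"
  proof (cases "finite S \<and> a \<notin> S")
    case True
    have "S = {b \<in> S. b < a} \<union> {b \<in> S. a < b}" using True by auto (metis linorder_cases)
    then have "card S = card ({b \<in> S. b < a} \<union> {b \<in> S. a < b})" by (rule arg_cong)
    also have "\<dots> = card {b \<in> S. b < a} + card {b \<in> S. a < b}"
    proof (rule card_Un_disjoint)
      show "finite {b \<in> S. b < a}" "finite {b \<in> S. a < b}" using True by simp_all
      show "{b \<in> S. b < a} \<inter> {b \<in> S. a < b} = {}" by force
    qed
    finally have c: "card S = card {b \<in> S. b < a} + card {b \<in> S. a < b}" .
    have "(-1) ^ card S * sgn_below a S = (-1) ^ card {b \<in> S. a < b}"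
      unfolding c sgn_below_def
      by (cases "even (card {b \<in> S. b < a})") (simp_all add: power_add)
    then show ?thesis using True by (simp add: gcoeff_gpar gcoeff_d_xi gcoeff_d_xi_right flip: mult.assoc)
  next
    case False
    then show ?thesis by (auto simp: gcoeff_gpar gcoeff_d_xi gcoeff_d_xi_right gcoeff_infinite)
  qed
qed

lemma d_p_commute: "d_p i (d_p j f) = d_p j (d_p i f)"
  using gvars_UNIV
  by (induction f rule: gpoly_induct) (simp_all add: d_p_xi_mult d_p_p_mult)

lemma d_p_d_xi: "d_p i (d_xi a f) = d_xi a (d_p i f)"
  using gvars_UNIV
  by (induction f rule: gpoly_induct)
     (simp_all add: d_p_xi_mult d_p_p_mult d_xi_xi_mult d_xi_p_mult)

lemma d_xi_anticommute: "d_xi a (d_xi b f) = - d_xi b (d_xi a f)"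
  using gvars_UNIV
  by (induction f rule: gpoly_induct) (simp_all add: d_xi_xi_mult d_xi_p_mult)

lemma geven_derivs: "geven f \<Longrightarrow> geven (d_p i f)" "godd f \<Longrightarrow> geven (d_xi a f)"
  and godd_derivs: "godd f \<Longrightarrow> godd (d_p i f)" "geven f \<Longrightarrow> godd (d_xi a f)"
  by (simp_all add: geven_def godd_def gpar_d_p gpar_d_xi)

subsection \<open>Substitution\<close>

lemma g_subst_linear [simp]:
  "g_subst \<sigma> \<tau> (f + g) = g_subst \<sigma> \<tau> f + g_subst \<sigma> \<tau> g"
  "g_subst \<sigma> \<tau> (c *\<^sub>R f) = c *\<^sub>R g_subst \<sigma> \<tau> f"
  "g_subst \<sigma> \<tau> 0 = 0"
proof -
  let ?M = "{u. gcoeff f u \<noteq> 0} \<union> {u. gcoeff g u \<noteq> 0}"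
  have M: "finite ?M" by (simp add: finite_coeff)
  have "g_subst \<sigma> \<tau> (f + g) = (\<Sum>u\<in>?M. gcoeff (f + g) u *\<^sub>R gsubst_monomial \<sigma> \<tau> u)"
    by (rule g_subst_eq_sum[OF M]) (auto simp: gcoeff_simps)
  also have "\<dots> = g_subst \<sigma> \<tau> f + g_subst \<sigma> \<tau> g"
    by (subst (1 2) g_subst_eq_sum[OF M]) (auto simp: gcoeff_simps scaleR_add_left sum.distrib)
  finally show "g_subst \<sigma> \<tau> (f + g) = g_subst \<sigma> \<tau> f + g_subst \<sigma> \<tau> g" .
  have "g_subst \<sigma> \<tau> (c *\<^sub>R f) = (\<Sum>u | gcoeff f u \<noteq> 0. gcoeff (c *\<^sub>R f) u *\<^sub>R gsubst_monomial \<sigma> \<tau> u)"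
    by (rule g_subst_eq_sum[OF finite_coeff]) (auto simp: gcoeff_simps)
  also have "\<dots> = c *\<^sub>R g_subst \<sigma> \<tau> f"
    by (subst g_subst_eq_sum[OF finite_coeff order.refl]) (auto simp: gcoeff_simps scaleR_sum_right)
  finally show "g_subst \<sigma> \<tau> (c *\<^sub>R f) = c *\<^sub>R g_subst \<sigma> \<tau> f" .
  show "g_subst \<sigma> \<tau> 0 = 0" by (simp add: g_subst_def gcoeff_simps)
qed

lemma g_subst_sum: "g_subst \<sigma> \<tau> (\<Sum>x\<in>I. f x) = (\<Sum>x\<in>I. g_subst \<sigma> \<tau> (f x))"
  by (induction I rule: infinite_finite_induct) simp_all

lemma g_subst_1 [simp]: "g_subst \<sigma> \<tau> 1 = 1"
  by (subst g_subst_eq_sum[of "{({}, {#})}"]) (auto simp: gcoeff_simps gsubst_monomial_def)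

text \<open>Odd elements anticommute and square to zero, so sorting one into a product costs the
  same sign as for the generators \<open>g_xi\<close>. This exterior algebra relation is what makes
  substitution multiplicative.\<close>

lemma prod_list_insort_odd:
  assumes "\<And>k. godd (\<sigma> k)" "sorted_wrt (<) l"
  shows "\<sigma> a * prod_list (map \<sigma> l) =
    (if a \<in> set l then 0 else sgn_below a (set l) *\<^sub>R prod_list (map \<sigma> (insort a l)))"
  using assms(2)
proof (induction l)
  case (Cons b l)
  then have l: "\<forall>c\<in>set l. b < c" "sorted_wrt (<) l" by auto
  consider "a < b" | "a = b" | "b < a" by linarith
  then show ?case
  proof cases
    case 1
    then have "{c \<in> set (b # l). c < a} = {}" "a \<notin> set (b # l)"
      using l(1) by auto
    then have "sgn_below a (set (b # l)) = 1" "a \<notin> set (b # l)"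
      by (simp_all only: sgn_below_def card.empty power_0 not_False_eq_True)
    then show ?thesis using 1 by simp
  next
    case 2
    have "\<sigma> a * (\<sigma> b * prod_list (map \<sigma> l)) = 0"
      by (simp add: 2 godd_square[OF assms(1)] flip: mult.assoc)
    then show ?thesis using 2 by simp
  next
    case 3
    have "\<sigma> a * (\<sigma> b * prod_list (map \<sigma> l)) = - (\<sigma> b * (\<sigma> a * prod_list (map \<sigma> l)))"
      by (metis godd_anticommute[OF assms(1) assms(1)] mult.assoc mult_minus_left)
    moreover have "b \<notin> set l" using l by auto
    ultimately show ?thesis using 3 Cons.IH[OF l(2)] by (auto simp: sgn_below_insert)
  qed
qed simp

lemma g_subst_xi_mult:
  assumes "\<And>k. godd (\<sigma> k)"
  shows "g_subst \<sigma> \<tau> (g_xi a * f) = \<sigma> a * g_subst \<sigma> \<tau> f"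
proof -
  let ?M = "{u. gcoeff f u \<noteq> 0}"
  \<comment> \<open>Monomials of \<open>f\<close> that contain \<open>a\<close> contribute to
    neither side: \<open>g_xi a\<close> annihilates them, and \<open>\<sigma> a\<close> annihilates
    their images.\<close>
  let ?N = "{u \<in> ?M. a \<notin> fst u}"
  let ?h = "\<lambda>(S, m). (insert a S, m)"
  have N: "finite ?N" by (simp add: finite_coeff)
  have inj: "inj_on ?h ?N" by (auto simp: inj_on_def insert_ident)
  have mon: "\<sigma> a * gsubst_monomial \<sigma> \<tau> (S, m) =
      (if a \<in> S then 0 else sgn_below a S *\<^sub>R gsubst_monomial \<sigma> \<tau> (insert a S, m))" if "finite S" for S m
    using that prod_list_insort_odd[of \<sigma> "sorted_list_of_set S" a, OF assms]
    by (auto simp: gsubst_monomial_def sorted_list_of_set_insert simp flip: mult.assoc)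
  have "g_subst \<sigma> \<tau> (g_xi a * f) =
      (\<Sum>u\<in>?h ` ?N. gcoeff (g_xi a * f) u *\<^sub>R gsubst_monomial \<sigma> \<tau> u)"
  proof (rule g_subst_eq_sum)
    show "{u. gcoeff (g_xi a * f) u \<noteq> 0} \<subseteq> ?h ` ?N"
    proof safe
      fix S m assume "gcoeff (g_xi a * f) (S, m) \<noteq> 0"
      then have "a \<in> S" "gcoeff f (S - {a}, m) \<noteq> 0" by (auto simp: gcoeff_xi_mult split: if_splits)
      then show "(S, m) \<in> ?h ` ?N" by (intro image_eqI[of _ _ "(S - {a}, m)"]) auto
    qed
  qed (use N in auto)
  also have "\<dots> = (\<Sum>u\<in>?N. gcoeff f u *\<^sub>R (\<sigma> a * gsubst_monomial \<sigma> \<tau> u))"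
    unfolding sum.reindex[OF inj]
    by (rule sum.cong) (auto simp: gcoeff_xi_mult mon finite_coeff_fst)
  also have "\<dots> = (\<Sum>u\<in>?M. gcoeff f u *\<^sub>R (\<sigma> a * gsubst_monomial \<sigma> \<tau> u))"
    by (rule sum.mono_neutral_left) (auto simp: finite_coeff mon finite_coeff_fst)
  also have "\<dots> = \<sigma> a * g_subst \<sigma> \<tau> f"
    by (subst g_subst_eq_sum[OF finite_coeff order.refl]) (simp add: sum_distrib_left)
  finally show ?thesis .
qed

lemma prod_list_insort_even:
  assumes "\<And>i. geven (\<tau> i)"
  shows "prod_list (map \<tau> (insort i l)) = \<tau> i * prod_list (map \<tau> l)"
proof (induction l)
  case (Cons j l)
  have "\<tau> j * (\<tau> i * prod_list (map \<tau> l)) = \<tau> i * (\<tau> j * prod_list (map \<tau> l))"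
    by (metis geven_mult_commute[OF assms] mult.assoc)
  then show ?case by (simp add: Cons.IH)
qed simp

lemma g_subst_p_mult:
  assumes "\<And>i. geven (\<tau> i)"
  shows "g_subst \<sigma> \<tau> (g_p i * f) = \<tau> i * g_subst \<sigma> \<tau> f"
proof -
  let ?M = "{u. gcoeff f u \<noteq> 0}"
  let ?h = "\<lambda>(S, m). (S, add_mset i m)"
  have inj: "inj_on ?h ?M" by (auto simp: inj_on_def)
  have mon: "\<tau> i * gsubst_monomial \<sigma> \<tau> (S, m) = gsubst_monomial \<sigma> \<tau> (S, add_mset i m)" for S m
    by (simp add: gsubst_monomial_def prod_list_insort_even[OF assms])
       (metis geven_mult_commute[OF assms] mult.assoc)
  have "g_subst \<sigma> \<tau> (g_p i * f) =
      (\<Sum>u\<in>?h ` ?M. gcoeff (g_p i * f) u *\<^sub>R gsubst_monomial \<sigma> \<tau> u)"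
  proof (rule g_subst_eq_sum)
    show "{u. gcoeff (g_p i * f) u \<noteq> 0} \<subseteq> ?h ` ?M"
    proof safe
      fix S m assume "gcoeff (g_p i * f) (S, m) \<noteq> 0"
      then have "i \<in># m" "gcoeff f (S, m - {#i#}) \<noteq> 0" by (auto simp: gcoeff_p_mult split: if_splits)
      then show "(S, m) \<in> ?h ` ?M" by (intro image_eqI[of _ _ "(S, m - {#i#})"]) auto
    qed
  qed (simp add: finite_coeff)
  also have "\<dots> = (\<Sum>u\<in>?M. gcoeff f u *\<^sub>R (\<tau> i * gsubst_monomial \<sigma> \<tau> u))"
    unfolding sum.reindex[OF inj] by (rule sum.cong) (auto simp: gcoeff_p_mult mon)
  also have "\<dots> = \<tau> i * g_subst \<sigma> \<tau> f"
    by (subst g_subst_eq_sum[OF finite_coeff order.refl]) (simp add: sum_distrib_left)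
  finally show ?thesis .
qed

text \<open>The universal property of the free graded commutative algebra: odd values for the odd
  generators and even values for the even ones extend to a homomorphism.\<close>

lemma g_subst_mult:
  assumes "\<And>k. godd (\<sigma> k)" "\<And>i. geven (\<tau> i)"
  shows "g_subst \<sigma> \<tau> (f * g) = g_subst \<sigma> \<tau> f * g_subst \<sigma> \<tau> g"
  using gvars_UNIV
  by (induction f rule: gpoly_induct)
     (simp_all add: distrib_right mult.assoc g_subst_xi_mult[OF assms(1)] g_subst_p_mult[OF assms(2)])

lemma g_subst_xi: "(\<And>k. godd (\<sigma> k)) \<Longrightarrow> g_subst \<sigma> \<tau> (g_xi a) = \<sigma> a"
  using g_subst_xi_mult[of \<sigma> \<tau> a 1] by simp

lemma g_subst_p: "(\<And>i. geven (\<tau> i)) \<Longrightarrow> g_subst \<sigma> \<tau> (g_p i) = \<tau> i"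
  using g_subst_p_mult[of \<tau> \<sigma> i 1] by simp

lemma gpar_g_subst:
  assumes "\<And>k. godd (\<sigma> k)" "\<And>i. geven (\<tau> i)"
  shows "gpar (g_subst \<sigma> \<tau> f) = g_subst \<sigma> \<tau> (gpar f)"
  using gvars_UNIV
proof (induction f rule: gpoly_induct)
  case (xi a f)
  have "g_subst \<sigma> \<tau> (- f) = - g_subst \<sigma> \<tau> f" for f
    using g_subst_linear(2)[of \<sigma> \<tau> "-1" f] by simp
  then show ?case using xi assms(1)[of a]
    by (simp add: g_subst_xi_mult[OF assms(1)] gpar_xi_mult godd_def)
next
  case (p i f)
  then show ?case using assms(2)[of i]
    by (simp add: g_subst_p_mult[OF assms(2)] gpar_p_mult geven_def)
qed simp_all

subsection \<open>Degrees\<close>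

text \<open>A condition on the monomials that occur, so that 0 has every degree.\<close>

definition gdeg :: "nat \<Rightarrow> gpoly \<Rightarrow> bool" where
  "gdeg k f \<longleftrightarrow> (\<forall>S m. gcoeff f (S, m) \<noteq> 0 \<longrightarrow> card S + 2 * size m = k)"

text \<open>Some term of the convolution is nonzero. In its two factors cardinalities and sizes add,
  which is all that the estimates of degree and support of a product use.\<close>

lemma gcoeff_times_nonzero:
  assumes "gcoeff (f * g) (S, m) \<noteq> 0"
  obtains T k where "T \<subseteq> S" "k \<subseteq># m" "gcoeff f (T, k) \<noteq> 0" "gcoeff g (S - T, m - k) \<noteq> 0"
    "card S = card T + card (S - T)" "size m = size k + size (m - k)"
proof -
  have fin: "finite S" using assms gcoeff_infinite by blast
  obtain T where T: "T \<in> Pow S" "(\<Sum>k | k \<subseteq># m.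
      koszul_sign T (S - T) * gcoeff f (T, k) * gcoeff g (S - T, m - k)) \<noteq> 0"
    using assms unfolding gcoeff_times by (rule sum.not_neutral_contains_not_neutral)
  from T(2) obtain k where "k \<in> {k. k \<subseteq># m}"
      "koszul_sign T (S - T) * gcoeff f (T, k) * gcoeff g (S - T, m - k) \<noteq> 0"
    by (rule sum.not_neutral_contains_not_neutral)
  then show thesis
    using T fin that[of T k] by (auto simp: card_Diff_subset finite_subset card_mono size_Diff_submset size_mset_mono)
qed

lemma gdeg_mult [intro]:
  assumes "gdeg k f" "gdeg l g"
  shows "gdeg (k + l) (f * g)"
  unfolding gdeg_def
proof (intro allI impI)
  fix S m assume "gcoeff (f * g) (S, m) \<noteq> 0"
  then obtain T n where *: "gcoeff f (T, n) \<noteq> 0" "gcoeff g (S - T, m - n) \<noteq> 0"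
    "card S = card T + card (S - T)" "size m = size n + size (m - n)"
    by (rule gcoeff_times_nonzero)
  have "card T + 2 * size n = k" "card (S - T) + 2 * size (m - n) = l"
    using * assms unfolding gdeg_def by blast+
  then show "card S + 2 * size m = k + l" using * by simp
qed

lemma gdeg_add [intro]: "gdeg k f \<Longrightarrow> gdeg k g \<Longrightarrow> gdeg k (f + g)"
  unfolding gdeg_def by (metis add.right_neutral gcoeff_plus)

lemma gdeg_simps [simp, intro]: "gdeg k 0" "gdeg 0 1" "gdeg 1 (g_xi a)" "gdeg 2 (g_p i)"
  by (auto simp: gdeg_def gcoeff_simps gcoeff_xi gcoeff_p split: if_splits)

lemma gdeg_scaleR [intro]: "gdeg k f \<Longrightarrow> gdeg k (c *\<^sub>R f)"
  by (auto simp: gdeg_def gcoeff_simps)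

lemma gdeg_sum [intro]: "(\<And>x. x \<in> I \<Longrightarrow> gdeg k (f x)) \<Longrightarrow> gdeg k (\<Sum>x\<in>I. f x)"
  by (induction I rule: infinite_finite_induct) auto

lemma gvars_intros [intro]:
  "gvars A B 0" "gvars A B 1" "a \<in> A \<Longrightarrow> gvars A B (g_xi a)" "i \<in> B \<Longrightarrow> gvars A B (g_p i)"
  "gvars A B f \<Longrightarrow> gvars A B (c *\<^sub>R f)" "gvars A B f \<Longrightarrow> gvars A B g \<Longrightarrow> gvars A B (f + g)"
  "gvars A B f \<Longrightarrow> gvars A B g \<Longrightarrow> gvars A B (f - g)"
  "gvars A B f \<Longrightarrow> gvars A B (- f)" "gvars A B f \<Longrightarrow> gvars A B (gpar f)"
proof -
  have "gcoeff f u \<noteq> 0 \<or> gcoeff g u \<noteq> 0" if "gcoeff (f + g) u \<noteq> 0 \<or> gcoeff (f - g) u \<noteq> 0" for u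
    using that by (auto simp: gcoeff_simps)
  then show "gvars A B f \<Longrightarrow> gvars A B g \<Longrightarrow> gvars A B (f + g)"
    "gvars A B f \<Longrightarrow> gvars A B g \<Longrightarrow> gvars A B (f - g)"
    unfolding gvars_def by blast+
qed (auto simp: gvars_def gcoeff_simps gcoeff_xi gcoeff_p gcoeff_gpar)

lemma gvars_mult [intro]: 
  assumes "gvars A B f" "gvars A B g"
  shows "gvars A B (f * g)"
  unfolding gvars_def
proof (intro allI impI)
  fix S m assume "gcoeff (f * g) (S, m) \<noteq> 0"
  then obtain T k where *: "T \<subseteq> S" "k \<subseteq># m" "gcoeff f (T, k) \<noteq> 0" "gcoeff g (S - T, m - k) \<noteq> 0"
    by (rule gcoeff_times_nonzero)
  have "m = k + (m - k)" using *(2) by simp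
  then have "set_mset m = set_mset k \<union> set_mset (m - k)" by (metis set_mset_union)
  then show "S \<subseteq> A \<and> set_mset m \<subseteq> B" using * assms unfolding gvars_def by blast
qed

lemma gvars_sum [intro]: "(\<And>x. x \<in> I \<Longrightarrow> gvars A B (f x)) \<Longrightarrow> gvars A B (\<Sum>x\<in>I. f x)"
  by (induction I rule: infinite_finite_induct) auto

lemma gvars_d_p [intro]: "gvars A B f \<Longrightarrow> gvars A B (d_p i f)"
  by (fastforce simp: gvars_def gcoeff_d_p)

lemma gvars_d_xi [intro]: "gvars A B f \<Longrightarrow> gvars A B (d_xi i f)"
  by (fastforce simp: gvars_def gcoeff_d_xi split: if_splits)

lemma gdeg_d_p: "gdeg (k + 2) f \<Longrightarrow> gdeg k (d_p i f)"
  by (force simp: gdeg_def gcoeff_d_p)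

lemma gdeg_d_xi: "gdeg (k + 1) f \<Longrightarrow> gdeg k (d_xi a f)"
  by (auto simp: gdeg_def gcoeff_d_xi split: if_splits)
     (metis add_Suc card_insert_disjoint finite_coeff_fst finite_insert old.nat.inject)

text \<open>The even generators contribute 2 each, so the parity of the degree is that of
  \<open>card S\<close>.\<close>

lemma gdeg_parity: "gdeg k f \<Longrightarrow> gpar f = (-1) ^ k *\<^sub>R f"
proof (rule gpoly_eqI)
  fix S m assume "gdeg k f"
  then have "gcoeff f (S, m) \<noteq> 0 \<Longrightarrow> k = card S + 2 * size m" by (auto simp: gdeg_def)
  then show "gcoeff (gpar f) (S, m) = gcoeff ((-1) ^ k *\<^sub>R f) (S, m)"
    by (cases "gcoeff f (S, m) = 0") (auto simp: gcoeff_gpar gcoeff_simps power_add)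
qed

section \<open>The spectral sequence of a filtered differential graded algebra\<close>

text \<open>A function on the realization is a map into \<open>gpoly\<close>, by way of charts and
  points. With pointwise scalar multiplication such maps form a real algebra, and
  \<open>subspace\<close> with its lemmas applies to sets of them.\<close>

instantiation "fun" :: (type, real_vector) real_vector
begin

definition "scaleR c f = (\<lambda>x. c *\<^sub>R f x)"

instance by standard (simp_all add: fun_eq_iff scaleR_fun_def scaleR_add_left scaleR_add_right)

end

lemma scaleR_fun_apply [simp]: "(c *\<^sub>R f) x = c *\<^sub>R f x"
  by (simp add: scaleR_fun_def)

instance "fun" :: (type, real_algebra) real_algebra
  by standard (simp_all add: fun_eq_iff)

subsection \<open>Quotient spaces\<close>

text \<open>Cosets in type class form; \<open>coset_M\<close> identifies them with the cosets
  \<open>+>\<close> in which the theorem is stated.\<close>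

definition trans_set :: "'a::real_vector set \<Rightarrow> 'a \<Rightarrow> 'a set" where
  "trans_set N x = (\<lambda>n. n + x) ` N"

lemma mem_trans_set: "y \<in> trans_set N x \<longleftrightarrow> y - x \<in> N"
  unfolding trans_set_def by (auto intro: image_eqI[of _ _ "y - x"])

lemma trans_set_eq_iff:
  assumes "subspace N"
  shows "trans_set N x = trans_set N y \<longleftrightarrow> x - y \<in> N"
proof
  assume "trans_set N x = trans_set N y"
  moreover have "x \<in> trans_set N x" by (simp add: mem_trans_set subspace_0[OF assms])
  ultimately show "x - y \<in> N" by (simp add: mem_trans_set)
next
  assume xy: "x - y \<in> N"
  show "trans_set N x = trans_set N y"
  proof (rule Set.set_eqI)
    fix z
    have "z - x \<in> N \<Longrightarrow> z - y \<in> N" using subspace_add[OF assms _ xy, of "z - x"] by simp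
    moreover have "z - y \<in> N \<Longrightarrow> z - x \<in> N" using subspace_diff[OF assms _ xy, of "z - y"] by simp
    ultimately show "z \<in> trans_set N x \<longleftrightarrow> z \<in> trans_set N y" by (auto simp: mem_trans_set)
  qed
qed

lemma trans_set_0 [simp]: "trans_set N 0 = N"
  by (simp add: trans_set_def)

lemma self_mem_trans_set: "subspace N \<Longrightarrow> x \<in> trans_set N x"
  by (simp add: mem_trans_set subspace_0)

lemma trans_set_plus:
  assumes "subspace N"
  shows "{a + b |a b. a \<in> trans_set N x \<and> b \<in> trans_set N y} = trans_set N (x + y)"
proof (rule Set.set_eqI)
  fix z
  have "\<exists>a b. z = a + b \<and> a - x \<in> N \<and> b - y \<in> N" if "z - (x + y) \<in> N"
    using that subspace_0[OF assms] by (intro exI[of _ "z - y"] exI[of _ y]) (auto simp: algebra_simps)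
  moreover have "z - (x + y) \<in> N" if "z = a + b" "a - x \<in> N" "b - y \<in> N" for a b
    using subspace_add[OF assms that(2,3)] that(1) by (simp add: algebra_simps)
  ultimately show "z \<in> {a + b |a b. a \<in> trans_set N x \<and> b \<in> trans_set N y} \<longleftrightarrow> z \<in> trans_set N (x + y)"
    unfolding mem_trans_set by blast
qed

text \<open>The map that \<open>f\<close> induces on cosets, as a union over all representatives.
  The scalar multiplication of \<open>quotient_module\<close> has the same shape, so it is an
  instance.\<close>

definition quot_lift :: "'b::real_vector set \<Rightarrow> ('a \<Rightarrow> 'b) \<Rightarrow> 'a set \<Rightarrow> 'b set" where
  "quot_lift N f K = (\<Union>x\<in>K. trans_set N (f x))"

lemma quot_lift_trans_set:
  assumes "subspace N" "subspace N'" "\<And>y. y - x \<in> N \<Longrightarrow> f y - f x \<in> N'"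
  shows "quot_lift N' f (trans_set N x) = trans_set N' (f x)"
proof -
  have "trans_set N' (f y) = trans_set N' (f x)" if "y \<in> trans_set N x" for y
    using that assms(3) by (simp add: mem_trans_set trans_set_eq_iff[OF assms(2)])
  moreover have "trans_set N x \<noteq> {}" using self_mem_trans_set[OF assms(1), of x] by blast
  ultimately show ?thesis unfolding quot_lift_def by (rule SUP_eq_const[rotated])
qed

definition quot_lift2 ::
    "'b::real_vector set \<Rightarrow> ('a \<Rightarrow> 'c \<Rightarrow> 'b) \<Rightarrow> 'a set \<Rightarrow> 'c set \<Rightarrow> 'b set" where
  "quot_lift2 N f K L = (\<Union>x\<in>K. \<Union>y\<in>L. trans_set N (f x y))"

lemma quot_lift2_trans_set:
  assumes "subspace N" "subspace N1" "subspace N2"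
    "\<And>x' y'. x' - x \<in> N1 \<Longrightarrow> y' - y \<in> N2 \<Longrightarrow> f x' y' - f x y \<in> N"
  shows "quot_lift2 N f (trans_set N1 x) (trans_set N2 y) = trans_set N (f x y)"
proof -
  have "trans_set N (f x' y') = trans_set N (f x y)" if "x' \<in> trans_set N1 x" "y' \<in> trans_set N2 y" for x' y'
    using that assms(4) by (simp add: mem_trans_set trans_set_eq_iff[OF assms(1)])
  moreover have "trans_set N1 x \<noteq> {}" "trans_set N2 y \<noteq> {}"
    using self_mem_trans_set[OF assms(2), of x] self_mem_trans_set[OF assms(3), of y] by blast+
  ultimately show ?thesis unfolding quot_lift2_def by (intro SUP_eq_const)
qed

text \<open>Addition, zero and scalar multiplication of \<open>M\<close> are fixed while the carrier
  stays open, because every page and every cohomology space is formed with its own carrier inside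
  the same type.\<close>

locale pointwise_module =
  fixes M :: "(real, 'a::real_algebra) module"
  assumes add_M: "add M = (+)" and zero_M: "ring.zero M = 0" and smult_M: "smult M = scaleR"
begin

lemma coset_M: "N +>\<^bsub>M\<lparr>carrier := Z\<rparr>\<^esub> x = trans_set N x" "N +>\<^bsub>M\<^esub> x = trans_set N x"
  by (auto simp: a_r_coset_def' trans_set_def add_M)

lemma carrier_quot: "carrier (quotient_module (M\<lparr>carrier := Z\<rparr>) N) = trans_set N ` Z"
  by (auto simp: quotient_module_def A_RCOSETS_def' coset_M)

lemma zero_quot: "\<zero>\<^bsub>quotient_module (M\<lparr>carrier := Z\<rparr>) N\<^esub> = N"
  by (simp add: quotient_module_def)

lemma add_quot_set: "K \<oplus>\<^bsub>quotient_module (M\<lparr>carrier := Z\<rparr>) N\<^esub> L = {a + b |a b. a \<in> K \<and> b \<in> L}"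
  by (auto simp: quotient_module_def set_add_def' add_M)

lemma add_quot:
  assumes "subspace N"
  shows "trans_set N x \<oplus>\<^bsub>quotient_module (M\<lparr>carrier := Z\<rparr>) N\<^esub> trans_set N y = trans_set N (x + y)"
  by (simp add: add_quot_set trans_set_plus[OF assms])

lemma smult_quot:
  assumes "subspace N"
  shows "t \<odot>\<^bsub>quotient_module (M\<lparr>carrier := Z\<rparr>) N\<^esub> trans_set N x = trans_set N (t *\<^sub>R x)"
proof -
  have "quot_lift N (scaleR t) (trans_set N x) = trans_set N (t *\<^sub>R x)"
    by (rule quot_lift_trans_set[OF assms assms])
       (simp add: subspace_scale[OF assms] flip: scaleR_diff_right)
  then show ?thesis by (simp add: quotient_module_def coset_M smult_M quot_lift_def)
qed

lemma real_ring_simps [simp]: "carrier real_ring = UNIV" "x \<oplus>\<^bsub>real_ring\<^esub> y = x + y"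
  "x \<otimes>\<^bsub>real_ring\<^esub> y = x * y" "\<zero>\<^bsub>real_ring\<^esub> = 0" "\<one>\<^bsub>real_ring\<^esub> = 1"
  by (simp_all add: real_ring_def)

lemma cring_real_ring: "cring real_ring"
proof (rule cringI)
  show "abelian_group real_ring"
    by (rule abelian_groupI) (auto intro: exI[of _ "- _"] add.left_inverse)
  show "comm_monoid real_ring" by (rule comm_monoidI) auto
qed (simp add: algebra_simps)

lemma module_quot:
  assumes N: "subspace N" and Z: "subspace Z"
  shows "Module.module real_ring (quotient_module (M\<lparr>carrier := Z\<rparr>) N)" (is "Module.module _ ?Q")
proof (rule moduleI)
  note s = carrier_quot zero_quot add_quot[OF N] smult_quot[OF N]
  have N0: "N = trans_set N 0" by simp
  show "abelian_group ?Q"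
  proof (rule abelian_groupI, unfold s)
    fix K L assume "K \<in> trans_set N ` Z" "L \<in> trans_set N ` Z"
    then show "K \<oplus>\<^bsub>?Q\<^esub> L \<in> trans_set N ` Z" by (auto simp: s intro: subspace_add[OF Z])
  next
    show "N \<in> trans_set N ` Z" using N0 subspace_0[OF Z] by blast
  next
    fix K L J assume "K \<in> trans_set N ` Z" "L \<in> trans_set N ` Z" "J \<in> trans_set N ` Z"
    then show "(K \<oplus>\<^bsub>?Q\<^esub> L) \<oplus>\<^bsub>?Q\<^esub> J = K \<oplus>\<^bsub>?Q\<^esub> (L \<oplus>\<^bsub>?Q\<^esub> J)"
      by (auto simp: s add.assoc)
  next
    fix K L assume "K \<in> trans_set N ` Z" "L \<in> trans_set N ` Z"
    then show "K \<oplus>\<^bsub>?Q\<^esub> L = L \<oplus>\<^bsub>?Q\<^esub> K" by (auto simp: s add.commute)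
  next
    fix K assume "K \<in> trans_set N ` Z"
    then obtain x where x: "x \<in> Z" "K = trans_set N x" by blast
    show "N \<oplus>\<^bsub>?Q\<^esub> K = K" using add_quot[OF N, of Z 0 x] by (simp add: x)
    show "\<exists>L\<in>trans_set N ` Z. L \<oplus>\<^bsub>?Q\<^esub> K = N"
      using add_quot[OF N, of Z "- x" x] subspace_neg[OF Z x(1)] by (auto simp: x)
  qed
qed (auto simp: cring_real_ring carrier_quot add_quot[OF N] smult_quot[OF N]
    subspace_scale[OF Z] scaleR_add_left scaleR_add_right)

text \<open>The map \<open>h\<close> has to agree with the one induced by \<open>f\<close> on cosets
  of elements of \<open>Z\<close> only; elsewhere it may be anything.\<close>

lemma linear_map_quot_lift:
  assumes N: "subspace N" and N': "subspace N'" and Z: "subspace Z" "N \<subseteq> Z"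
    and f: "\<And>x. x \<in> Z \<Longrightarrow> f x \<in> Z'" "\<And>x y. x \<in> Z \<Longrightarrow> y \<in> Z \<Longrightarrow> f (x + y) = f x + f y"
      "\<And>t x. x \<in> Z \<Longrightarrow> f (t *\<^sub>R x) = t *\<^sub>R f x" "\<And>x. x \<in> N \<Longrightarrow> f x \<in> N'"
    and h: "\<And>x. x \<in> Z \<Longrightarrow> h (trans_set N x) = trans_set N' (f x)"
  shows "linear_map (quotient_module (M\<lparr>carrier := Z\<rparr>) N) (quotient_module (M\<lparr>carrier := Z'\<rparr>) N') h"
  unfolding linear_map_def carrier_quot
  using f by (auto simp: add_quot[OF N] add_quot[OF N'] smult_quot[OF N] smult_quot[OF N'] h
      subspace_add[OF Z(1)] subspace_scale[OF Z(1)])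

end

subsection \<open>Pages\<close>

text \<open>\<open>F p n\<close> is the part of filtration \<open>p\<close> in total degree
  \<open>n\<close>. The laws for \<open>Q\<close> and the unit are demanded on these pieces only:
  the Poisson bracket is linear where the derivatives exist, and the unit function vanishes outside
  the domains of charts. Boundedness is expressed by \<open>F_nonpos\<close> and
  \<open>F_large\<close>.\<close>

locale filtered_dga = pointwise_module M for M :: "(real, 'a::real_algebra) module" +
  fixes F :: "int \<Rightarrow> int \<Rightarrow> 'a set" and Q :: "'a \<Rightarrow> 'a" and e :: 'a
  assumes F_subspace: "subspace (F p n)"
    and F_Suc: "F (p + 1) n \<subseteq> F p n"
    and F_nonpos: "p \<le> 0 \<Longrightarrow> F p n = F 0 n"
    and F_large: "p > max 0 n \<Longrightarrow> F p n = {0}"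
    and Q_add: "x \<in> F 0 n \<Longrightarrow> y \<in> F 0 n \<Longrightarrow> Q (x + y) = Q x + Q y"
    and Q_scale: "x \<in> F 0 n \<Longrightarrow> Q (t *\<^sub>R x) = t *\<^sub>R Q x"
    and Q_F: "x \<in> F p n \<Longrightarrow> Q x \<in> F p (n + 1)"
    and Q_Q: "x \<in> F 0 n \<Longrightarrow> Q (Q x) = 0"
    and Q_mult: "x \<in> F 0 n \<Longrightarrow> y \<in> F 0 m \<Longrightarrow>
      Q (x * y) = Q x * y + (if even n then 1 else - 1) *\<^sub>R (x * Q y)"
    and F_mult: "x \<in> F p n \<Longrightarrow> y \<in> F p' n' \<Longrightarrow> x * y \<in> F (p + p') (n + n')"
    and unit_F: "e \<in> F 0 0" and Q_unit: "Q e = 0"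
    and unit_mult: "x \<in> F 0 n \<Longrightarrow> e * x = x" "x \<in> F 0 n \<Longrightarrow> x * e = x"
begin

lemma F_antimono: "p \<le> p' \<Longrightarrow> F p' n \<subseteq> F p n"
proof (induction p' rule: int_ge_induct)
  case (step p')
  then show ?case using F_Suc by blast
qed simp

lemma F_le_0: "x \<in> F p n \<Longrightarrow> x \<in> F 0 n"
  using F_antimono[of 0 p n] F_nonpos[of p n] by (cases "p \<le> 0") auto

lemmas F_0 = subspace_0[OF F_subspace] and F_add = subspace_add[OF F_subspace]
  and F_scale = subspace_scale[OF F_subspace] and F_diff = subspace_diff[OF F_subspace]

lemma Q_0 [simp]: "Q 0 = 0"
  using Q_scale[OF F_0, of 0] by simp

lemma Q_diff: "x \<in> F 0 n \<Longrightarrow> y \<in> F 0 n \<Longrightarrow> Q (x - y) = Q x - Q y"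
  using Q_add[of x n "(-1) *\<^sub>R y"] Q_scale[of y n "-1"] F_scale[of y 0 n "-1"] by simp

definition Z :: "nat \<Rightarrow> int \<Rightarrow> int \<Rightarrow> 'a set" where
  "Z r p n = {x \<in> F p n. Q x \<in> F (p + int r) (n + 1)}"

text \<open>In the usual notation the sum of \<open>Q Z\<^sub>r\<^sub>-\<^sub>1\<close> and
  \<open>Z\<^sub>r\<^sub>-\<^sub>1\<close> in the filtrations \<open>p - r + 1\<close> and
  \<open>p + 1\<close>: that \<open>Q y\<close> lies in \<open>F p n\<close> follows, since
  \<open>x\<close> and \<open>w\<close> do. Written without the index \<open>r - 1\<close> it also
  covers \<open>r = 0\<close>, where it is \<open>F (p + 1) n\<close>.\<close>

definition N :: "nat \<Rightarrow> int \<Rightarrow> int \<Rightarrow> 'a set" where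
  "N r p n = {x \<in> F p n. \<exists>y\<in>F (p - int r + 1) (n - 1). \<exists>w\<in>F (p + 1) n.
     Q w \<in> F (p + int r) (n + 1) \<and> x = Q y + w}"

lemma N_I: "y \<in> F (p - int r + 1) (n - 1) \<Longrightarrow> w \<in> F (p + 1) n \<Longrightarrow>
    Q w \<in> F (p + int r) (n + 1) \<Longrightarrow> Q y \<in> F p n \<Longrightarrow> Q y + w \<in> N r p n"
  unfolding N_def using F_Suc F_add by blast

text \<open>Besides the defining data this records \<open>Q x = Q w\<close>, because
  \<open>Q\<close> kills the boundary part.\<close>

lemma N_E:
  assumes "x \<in> N r p n"
  obtains y w where "y \<in> F (p - int r + 1) (n - 1)" "w \<in> F (p + 1) n" 
    "Q w \<in> F (p + int r) (n + 1)" "Q y \<in> F p n" "x = Q y + w" "Q x = Q w"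
proof -
  obtain y w where yw: "y \<in> F (p - int r + 1) (n - 1)" "w \<in> F (p + 1) n" "x \<in> F p n"
    "Q w \<in> F (p + int r) (n + 1)" "x = Q y + w"
    using assms unfolding N_def by blast
  have w: "w \<in> F p n" using yw(2) F_Suc by blast
  have "Q y = x - w" using yw(5) by simp
  then have Qy: "Q y \<in> F p n" using F_diff[OF yw(3) w] by simp
  have "Q x = Q (Q y) + Q w" unfolding yw(5) by (rule Q_add[of _ n]) (use F_le_0 Qy w in auto)
  also have "Q (Q y) = 0" by (rule Q_Q[OF F_le_0[OF yw(1)]])
  finally show thesis using that yw Qy by simp
qed

lemma Z_subspace: "subspace (Z r p n)"
proof (rule subspaceI)
  show "0 \<in> Z r p n" by (simp add: Z_def F_0)
  show "x + y \<in> Z r p n" if "x \<in> Z r p n" "y \<in> Z r p n" for x y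
    using that Q_add[OF F_le_0 F_le_0] by (auto simp: Z_def intro: F_add)
  show "t *\<^sub>R x \<in> Z r p n" if "x \<in> Z r p n" for x t
    using that Q_scale[OF F_le_0] by (auto simp: Z_def intro: F_scale)
qed

lemma N_subspace: "subspace (N r p n)"
proof (rule subspaceI)
  show "0 \<in> N r p n" using N_I[of 0 p r n 0] by (simp add: F_0)
next
  fix x x' assume "x \<in> N r p n" "x' \<in> N r p n"
  then obtain y w y' w' where a: "y \<in> F (p - int r + 1) (n - 1)" "w \<in> F (p + 1) n" 
    "Q w \<in> F (p + int r) (n + 1)" "Q y \<in> F p n" "x = Q y + w"
    and b: "y' \<in> F (p - int r + 1) (n - 1)" "w' \<in> F (p + 1) n" 
    "Q w' \<in> F (p + int r) (n + 1)" "Q y' \<in> F p n" "x' = Q y' + w'"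
    by (meson N_E)
  have "Q (y + y') = Q y + Q y'" "Q (w + w') = Q w + Q w'"
    using Q_add[OF F_le_0[OF a(1)] F_le_0[OF b(1)]] Q_add[OF F_le_0[OF a(2)] F_le_0[OF b(2)]] by auto
  then have "Q (y + y') + (w + w') \<in> N r p n"
    by (intro N_I) (use a b F_add in auto)
  then show "x + x' \<in> N r p n" using \<open>Q (y + y') = _\<close> by (simp add: a b algebra_simps)
next
  fix x and t :: real assume "x \<in> N r p n"
  then obtain y w where a: "y \<in> F (p - int r + 1) (n - 1)" "w \<in> F (p + 1) n" 
    "Q w \<in> F (p + int r) (n + 1)" "Q y \<in> F p n" "x = Q y + w"
    by (meson N_E)
  have q: "Q (t *\<^sub>R y) = t *\<^sub>R Q y" "Q (t *\<^sub>R w) = t *\<^sub>R Q w"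
    using Q_scale[OF F_le_0[OF a(1)]] Q_scale[OF F_le_0[OF a(2)]] by auto
  then have "Q (t *\<^sub>R y) + t *\<^sub>R w \<in> N r p n"
    by (intro N_I) (use a F_scale in auto)
  then show "t *\<^sub>R x \<in> N r p n" using q by (simp add: a algebra_simps)
qed

lemma N_le_Z: "N r p n \<subseteq> Z r p n"
proof
  fix x assume x: "x \<in> N r p n"
  then show "x \<in> Z r p n" by (rule N_E) (use x in \<open>auto simp: Z_def N_def\<close>)
qed

lemma Z_0: "Z 0 p n = F p n"
  by (auto simp: Z_def Q_F)

lemma N_0: "N 0 p n = F (p + 1) n"
proof
  show "N 0 p n \<subseteq> F (p + 1) n"
    using Q_F[of _ "p + 1" "n - 1"] F_add by (fastforce elim!: N_E)
  show "F (p + 1) n \<subseteq> N 0 p n"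
    using N_I[of 0 p 0 n] F_Suc Q_F[of _ p n] by (force simp: F_0)
qed

lemma Q_Z: "x \<in> Z r p n \<Longrightarrow> Q x \<in> Z r (p + int r) (n + 1)"
  using Q_Q[OF F_le_0] by (auto simp: Z_def F_0)

text \<open>Since \<open>Q x = Q w\<close> and \<open>w\<close> has filtration
  \<open>p + 1 = (p + r) - r + 1\<close>, the element \<open>w\<close> itself is the witness for the
  boundary part, and the other part is 0.\<close>

lemma Q_N: "x \<in> N r p n \<Longrightarrow> Q x \<in> N r (p + int r) (n + 1)"
proof (elim N_E)
  fix y w assume w: "w \<in> F (p + 1) n" "Q w \<in> F (p + int r) (n + 1)" "Q x = Q w"
  then show "Q x \<in> N r (p + int r) (n + 1)"
    using N_I[of w "p + int r" r "n + 1" 0] by (simp add: F_0)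
qed

lemma Z_mult:
  assumes "x \<in> Z r p n" "y \<in> Z r p' n'"
  shows "x * y \<in> Z r (p + p') (n + n')"
proof -
  have *: "x \<in> F p n" "y \<in> F p' n'" "Q x \<in> F (p + int r) (n + 1)" "Q y \<in> F (p' + int r) (n' + 1)"
    using assms by (auto simp: Z_def)
  have "Q x * y \<in> F (p + p' + int r) (n + n' + 1)" "x * Q y \<in> F (p + p' + int r) (n + n' + 1)"
    using F_mult[OF *(3,2)] F_mult[OF *(1,4)] by (simp_all add: add_ac)
  then have "Q (x * y) \<in> F (p + p' + int r) (n + n' + 1)"
    unfolding Q_mult[OF F_le_0[OF *(1)] F_le_0[OF *(2)]] by (intro F_add F_scale)
  then show ?thesis using F_mult[OF *(1,2)] by (simp add: Z_def)
qed

text \<open>For \<open>x = Q y + w\<close> the Leibniz rule gives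
  \<open>x * z = Q (y * z) + w * z - s (y * Q z)\<close> with a sign \<open>s\<close>. In the last
  term \<open>y\<close> has filtration \<open>p - r + 1\<close> and \<open>Q z\<close> has
  \<open>p' + r\<close>, so the product has filtration \<open>p + p' + 1\<close> and can be absorbed
  into the new \<open>w\<close>.\<close>

lemma N_mult_right:
  assumes "x \<in> N r p n" "z \<in> Z r p' n'"
  shows "x * z \<in> N r (p + p') (n + n')"
proof -
  obtain y w where a: "y \<in> F (p - int r + 1) (n - 1)" "w \<in> F (p + 1) n" 
    "Q w \<in> F (p + int r) (n + 1)" "Q y \<in> F p n" "x = Q y + w"
    using assms(1) by (meson N_E)
  have z: "z \<in> F p' n'" "Q z \<in> F (p' + int r) (n' + 1)" using assms(2) by (auto simp: Z_def)
  let ?s = "(if even (n - 1) then 1 else - 1) :: real"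
  have yz: "y * z \<in> F (p + p' - int r + 1) (n + n' - 1)" and Qyz: "Q y * z \<in> F (p + p') (n + n')"
    and yQz: "y * Q z \<in> F (p + p' + 1) (n + n')"
    and QyQz: "Q y * Q z \<in> F (p + p' + int r) (n + n' + 1)"
    and wz: "w * z \<in> F (p + p' + 1) (n + n')" and Qwz: "Q w * z \<in> F (p + p' + int r) (n + n' + 1)"
    and wQz: "w * Q z \<in> F (p + p' + int r) (n + n' + 1)"
    using F_mult[OF a(1) z(1)] F_mult[OF a(4) z(1)] F_mult[OF a(1) z(2)] F_mult[OF a(4) z(2)]
      F_mult[OF a(2) z(1)] F_mult[OF a(3) z(1)] F_mult[OF a(2) z(2)]
      F_antimono[of "p + p' + int r" "p + p' + int r + 1" "n + n' + 1"]
    by (auto simp: algebra_simps)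
  have l: "Q (y * z) = Q y * z + ?s *\<^sub>R (y * Q z)"
    by (rule Q_mult[OF F_le_0[OF a(1)] F_le_0[OF z(1)]])
  have "Q (y * Q z) = Q y * Q z + ?s *\<^sub>R (y * Q (Q z))"
    by (rule Q_mult[OF F_le_0[OF a(1)] F_le_0[OF z(2)]])
  then have QyQz': "Q (y * Q z) = Q y * Q z" by (simp add: Q_Q[OF F_le_0[OF z(1)]])
  have wz': "Q (w * z) = Q w * z + (if even n then 1 else - 1) *\<^sub>R (w * Q z)"
    by (rule Q_mult[OF F_le_0[OF a(2)] F_le_0[OF z(1)]])
  let ?w = "w * z - ?s *\<^sub>R (y * Q z)"
  have "Q ?w = Q (w * z) - ?s *\<^sub>R Q (y * Q z)"
    using Q_diff[OF F_le_0[OF wz] F_le_0[OF F_scale[OF yQz, of ?s]]] Q_scale[OF F_le_0[OF yQz]] by simp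
  then have Qw: "Q ?w \<in> F (p + p' + int r) (n + n' + 1)"
    unfolding QyQz' wz' by (simp only:) (intro F_diff F_add F_scale Qwz wQz QyQz)
  have "Q (y * z) \<in> F (p + p') (n + n')"
    unfolding l using F_Suc yQz by (intro F_add F_scale Qyz) blast
  then have "Q (y * z) + ?w \<in> N r (p + p') (n + n')"
    by (intro N_I Qw) (use yz in simp, intro F_diff F_scale wz yQz)
  then show ?thesis by (simp add: a l distrib_right)
qed

text \<open>The same computation with the boundary \<open>Q (s (z * y))\<close>: the sign
  \<open>s\<close> comes from the degree of \<open>z\<close> and can be put in front of
  \<open>z * y\<close>, because \<open>s * s = 1\<close>.\<close>

lemma N_mult_left:
  assumes "z \<in> Z r p' n'" "x \<in> N r p n"
  shows "z * x \<in> N r (p' + p) (n' + n)"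
proof -
  obtain y w where a: "y \<in> F (p - int r + 1) (n - 1)" "w \<in> F (p + 1) n" 
    "Q w \<in> F (p + int r) (n + 1)" "Q y \<in> F p n" "x = Q y + w"
    using assms(2) by (meson N_E)
  have z: "z \<in> F p' n'" "Q z \<in> F (p' + int r) (n' + 1)" using assms(1) by (auto simp: Z_def)
  let ?s = "(if even n' then 1 else - 1) :: real"
  have s: "?s * ?s = 1" by simp
  have yz: "z * y \<in> F (p' + p - int r + 1) (n' + n - 1)" and Qyz: "z * Q y \<in> F (p' + p) (n' + n)"
    and yQz: "Q z * y \<in> F (p' + p + 1) (n' + n)"
    and QyQz: "Q z * Q y \<in> F (p' + p + int r) (n' + n + 1)"
    and wz: "z * w \<in> F (p' + p + 1) (n' + n)" and Qwz: "z * Q w \<in> F (p' + p + int r) (n' + n + 1)"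
    and wQz: "Q z * w \<in> F (p' + p + int r) (n' + n + 1)"
    using F_mult[OF z(1) a(1)] F_mult[OF z(1) a(4)] F_mult[OF z(2) a(1)] F_mult[OF z(2) a(4)]
      F_mult[OF z(1) a(2)] F_mult[OF z(1) a(3)] F_mult[OF z(2) a(2)]
      F_antimono[of "p' + p + int r" "p' + p + int r + 1" "n' + n + 1"]
    by (auto simp: algebra_simps)
  have l: "Q (z * y) = Q z * y + ?s *\<^sub>R (z * Q y)"
    by (rule Q_mult[OF F_le_0[OF z(1)] F_le_0[OF a(1)]])
  have "Q (Q z * y) = Q (Q z) * y + (if even (n' + 1) then 1 else - 1) *\<^sub>R (Q z * Q y)"
    by (rule Q_mult[OF F_le_0[OF z(2)] F_le_0[OF a(1)]])
  then have QyQz': "Q (Q z * y) = - ?s *\<^sub>R (Q z * Q y)" by (simp add: Q_Q[OF F_le_0[OF z(1)]])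
  have wz': "Q (z * w) = Q z * w + ?s *\<^sub>R (z * Q w)"
    by (rule Q_mult[OF F_le_0[OF z(1)] F_le_0[OF a(2)]])
  let ?w = "z * w - ?s *\<^sub>R (Q z * y)"
  have "Q ?w = Q (z * w) - ?s *\<^sub>R Q (Q z * y)"
    using Q_diff[OF F_le_0[OF wz] F_le_0[OF F_scale[OF yQz, of ?s]]] Q_scale[OF F_le_0[OF yQz]] by simp
  then have Qw: "Q ?w \<in> F (p' + p + int r) (n' + n + 1)"
    unfolding QyQz' wz' by (simp only:) (intro F_diff F_add F_scale Qwz wQz QyQz)
  have Ql: "Q (?s *\<^sub>R (z * y)) = ?s *\<^sub>R Q (z * y)"
    by (rule Q_scale[OF F_le_0[OF yz]])
  have "Q (?s *\<^sub>R (z * y)) \<in> F (p' + p) (n' + n)"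
    unfolding Ql l using F_Suc yQz by (intro F_scale F_add Qyz) blast
  then have "Q (?s *\<^sub>R (z * y)) + ?w \<in> N r (p' + p) (n' + n)"
    by (intro N_I Qw) (use yz in \<open>intro F_scale, simp\<close>, intro F_diff F_scale wz yQz)
  moreover have "Q (?s *\<^sub>R (z * y)) + ?w = z * x"
    unfolding Ql l by (simp add: a distrib_left scaleR_add_right)
  ultimately show ?thesis by simp
qed

lemma N_mult_cong:
  assumes "x \<in> Z r p n" "y \<in> Z r p' n'" "x' - x \<in> N r p n" "y' - y \<in> N r p' n'"
  shows "x' * y' - x * y \<in> N r (p + p') (n + n')"
proof -
  have "x' - x + x \<in> Z r p n" by (rule subspace_add[OF Z_subspace _ assms(1)]) (use assms(3) N_le_Z in blast)
  then have x': "x' \<in> Z r p n" by simp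
  have "x' * (y' - y) + (x' - x) * y \<in> N r (p + p') (n + n')"
    by (intro subspace_add[OF N_subspace] N_mult_left[OF x'] N_mult_right[OF _ assms(2)] assms)
  then show ?thesis by (simp add: algebra_simps)
qed

definition page :: "nat \<Rightarrow> int \<Rightarrow> int \<Rightarrow> (real, 'a set) module" where
  "page r p q = quotient_module (M\<lparr>carrier := Z r p (p + q)\<rparr>) (N r p (p + q))"

definition page_d :: "nat \<Rightarrow> int \<Rightarrow> int \<Rightarrow> 'a set \<Rightarrow> 'a set" where
  "page_d r p q = quot_lift (N r (p + int r) (p + q + 1)) Q"

definition page_mul :: "nat \<Rightarrow> int \<Rightarrow> int \<Rightarrow> int \<Rightarrow> int \<Rightarrow> 'a set \<Rightarrow> 'a set \<Rightarrow> 'a set" where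
  "page_mul r p q p' q' = quot_lift2 (N r (p + p') (p + q + p' + q')) (*)"

text \<open>A class is restricted to its representatives in \<open>Z (Suc r)\<close> before cosets
  of \<open>N (Suc r)\<close> are taken. For a class killed by \<open>page_d\<close> such
  representatives exist by \<open>Z_Suc_N\<close>, and any two agree modulo \<open>N (Suc r)\<close>
  by \<open>N_inter_Z_Suc\<close>.\<close>

definition page_next :: "nat \<Rightarrow> int \<Rightarrow> int \<Rightarrow> 'a set \<Rightarrow> 'a set" where
  "page_next r p q K = quot_lift (N (Suc r) p (p + q)) (\<lambda>x. x) (K \<inter> Z (Suc r) p (p + q))"

lemma carrier_page: "carrier (page r p q) = trans_set (N r p (p + q)) ` Z r p (p + q)"
  by (simp add: page_def carrier_quot)

lemma zero_page: "\<zero>\<^bsub>page r p q\<^esub> = N r p (p + q)"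
  by (simp add: page_def zero_quot)

lemma page_eq_zero_iff: "trans_set (N r p n) x = N r p n \<longleftrightarrow> x \<in> N r p n"
  using trans_set_eq_iff[OF N_subspace, of r p n x 0] by simp

lemma page_d_eq:
  assumes "x \<in> Z r p (p + q)"
  shows "page_d r p q (trans_set (N r p (p + q)) x) = trans_set (N r (p + int r) (p + q + 1)) (Q x)"
  unfolding page_d_def
proof (rule quot_lift_trans_set[OF N_subspace N_subspace])
  fix y assume y: "y - x \<in> N r p (p + q)"
  then have "y - x \<in> F p (p + q)" "x \<in> F p (p + q)" using assms by (auto simp: N_def Z_def)
  then have "y \<in> F p (p + q)" using F_add[of "y - x" p "p + q" x] by simp
  then have "Q y - Q x = Q (y - x)"
    using Q_diff[OF F_le_0 F_le_0] \<open>x \<in> F p (p + q)\<close> by metis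
  then show "Q y - Q x \<in> N r (p + int r) (p + q + 1)" using Q_N[OF y] by simp
qed

lemma page_mul_eq:
  assumes "x \<in> Z r p (p + q)" "y \<in> Z r p' (p' + q')"
  shows "page_mul r p q p' q' (trans_set (N r p (p + q)) x) (trans_set (N r p' (p' + q')) y) =
    trans_set (N r (p + p') (p + q + p' + q')) (x * y)"
  unfolding page_mul_def
  by (rule quot_lift2_trans_set[OF N_subspace N_subspace N_subspace])
     (use N_mult_cong[OF assms] in \<open>simp add: add.assoc\<close>)

text \<open>If \<open>Q x = Q y + w\<close> with \<open>y\<close> of filtration \<open>p + 1\<close>
  and \<open>w\<close> of filtration \<open>p + r + 1\<close>, then \<open>x - y\<close> has the
  differential \<open>w\<close> and survives to the next page, while \<open>y\<close> itself lies in
  \<open>N r p n\<close>.\<close>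

lemma Z_Suc_N:
  assumes "x \<in> Z r p n" "Q x \<in> N r (p + int r) (n + 1)"
  obtains z where "z \<in> Z (Suc r) p n" "z - x \<in> N r p n"
proof -
  obtain y w where yw: "y \<in> F (p + 1) n" "w \<in> F (p + int r + 1) (n + 1)" "Q x = Q y + w"
    "Q y \<in> F (p + int r) (n + 1)"
    using assms(2) by (rule N_E) (auto simp: algebra_simps)
  have x: "x \<in> F p n" using assms by (simp add: Z_def)
  have y: "y \<in> F p n" using yw F_Suc by blast
  have "Q (x - y) = w" using Q_diff[OF F_le_0[OF x] F_le_0[OF y]] yw by simp
  then have "x - y \<in> Z (Suc r) p n" using yw F_diff[OF x y] by (simp add: Z_def add_ac)
  moreover have "y \<in> N r p n" using N_I[of 0 p r n y] yw by (simp add: F_0)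
  then have "(x - y) - x \<in> N r p n" using subspace_neg[OF N_subspace] by fastforce
  ultimately show thesis by (rule that)
qed

text \<open>Since \<open>Q x = Q w\<close>, membership of \<open>x\<close> in
  \<open>Z (Suc r)\<close> gives the stronger condition on \<open>w\<close>; for the boundary part
  the requirement on the filtration becomes weaker from \<open>r\<close> to
  \<open>Suc r\<close>.\<close>

lemma N_inter_Z_Suc: "x \<in> N r p n \<Longrightarrow> x \<in> Z (Suc r) p n \<Longrightarrow> x \<in> N (Suc r) p n"
proof (elim N_E)
  fix y w assume a: "x \<in> Z (Suc r) p n" "y \<in> F (p - int r + 1) (n - 1)" "w \<in> F (p + 1) n"
    "Q y \<in> F p n" "x = Q y + w" "Q x = Q w"
  have "y \<in> F (p - int (Suc r) + 1) (n - 1)"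
    using a(2) F_antimono[of "p - int (Suc r) + 1" "p - int r + 1"] by auto
  then show "x \<in> N (Suc r) p n" using a N_I[of y p "Suc r" n w] by (simp add: Z_def)
qed

lemma Z_Suc: "Z (Suc r) p n \<subseteq> Z r p n"
  using F_antimono[of "p + int r" "p + int (Suc r)" "n + 1"] by (auto simp: Z_def)

lemma page_next_eq:
  assumes "z \<in> Z (Suc r) p (p + q)"
  shows "page_next r p q (trans_set (N r p (p + q)) z) = trans_set (N (Suc r) p (p + q)) z"
proof -
  have "trans_set (N (Suc r) p (p + q)) x = trans_set (N (Suc r) p (p + q)) z"
    if "x \<in> trans_set (N r p (p + q)) z \<inter> Z (Suc r) p (p + q)" for x
    using that assms subspace_diff[OF Z_subspace, of x "Suc r" p "p + q" z]
    by (auto simp: trans_set_eq_iff[OF N_subspace] mem_trans_set intro: N_inter_Z_Suc)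
  then show ?thesis
    unfolding page_next_def quot_lift_def using assms self_mem_trans_set[OF N_subspace] by blast
qed

lemma degree_shift: "p + int r + (q - int r + 1) = p + q + 1" "p + p' + (q + q') = p + q + p' + q'"
  "p - int r + (q + int r - 1) = p + q - 1" "p + int r + (q - int r + 1) + p' + q' = p + q + p' + q' + 1"
  "p + q + (p' + int r) + (q' - int r + 1) = p + q + p' + q' + 1"
  for p q p' q' :: int
  by simp_all

text \<open>One inclusion is \<open>Z_Suc_N\<close>. For the other, the differential of an element
  of \<open>Z (Suc r)\<close> is a cocycle one filtration step deeper than its target, hence of the
  kind \<open>w\<close> in \<open>N\<close>.\<close>

lemma kernel_page_d:
  "{x \<in> carrier (page r p q). page_d r p q x = \<zero>\<^bsub>page r (p + int r) (q - int r + 1)\<^esub>} =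
     trans_set (N r p (p + q)) ` Z (Suc r) p (p + q)" (is "?l = ?r")
proof (intro equalityI subsetI)
  fix K assume "K \<in> ?l"
  then obtain x where x: "x \<in> Z r p (p + q)" "K = trans_set (N r p (p + q)) x"
    "page_d r p q K = N r (p + int r) (p + q + 1)"
    unfolding carrier_page zero_page degree_shift(1) by blast
  then have "Q x \<in> N r (p + int r) (p + q + 1)" by (simp add: page_d_eq page_eq_zero_iff)
  then obtain z where "z \<in> Z (Suc r) p (p + q)" "z - x \<in> N r p (p + q)"
    using Z_Suc_N[OF x(1)] by blast
  then show "K \<in> ?r" unfolding x(2) using trans_set_eq_iff[OF N_subspace] by blast
next
  fix K assume "K \<in> ?r"
  then obtain z where z: "z \<in> Z (Suc r) p (p + q)" "K = trans_set (N r p (p + q)) z" by blast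
  have "Q z \<in> F (p + int r + 1) (p + q + 1)" "Q (Q z) = 0"
    using z(1) Q_Q[OF F_le_0] by (auto simp: Z_def algebra_simps)
  then have "Q z \<in> N r (p + int r) (p + q + 1)"
    using N_I[of 0 "p + int r" r "p + q + 1" "Q z"] by (simp add: F_0)
  moreover have z': "z \<in> Z r p (p + q)" using z(1) Z_Suc by blast
  ultimately have "page_d r p q K = N r (p + int r) (p + q + 1)"
    unfolding z(2) page_d_eq[OF z'] page_eq_zero_iff by blast
  then show "K \<in> ?l" unfolding carrier_page zero_page degree_shift(1) using z(2) z' by blast
qed

lemma linear_map_page:
  assumes "\<And>x. x \<in> Z r p (p + q) \<Longrightarrow> f x \<in> Z r' p' (p' + q')"
    and "\<And>x y. x \<in> Z r p (p + q) \<Longrightarrow> y \<in> Z r p (p + q) \<Longrightarrow> f (x + y) = f x + f y"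
    and "\<And>t x. x \<in> Z r p (p + q) \<Longrightarrow> f (t *\<^sub>R x) = t *\<^sub>R f x"
    and "\<And>x. x \<in> N r p (p + q) \<Longrightarrow> f x \<in> N r' p' (p' + q')"
    and "\<And>x. x \<in> Z r p (p + q) \<Longrightarrow> h (trans_set (N r p (p + q)) x) = trans_set (N r' p' (p' + q')) (f x)"
  shows "linear_map (page r p q) (page r' p' q') h"
  unfolding page_def
  by (rule linear_map_quot_lift[OF N_subspace N_subspace Z_subspace N_le_Z]) (use assms in auto)

theorem algebra_spectral_sequence_page: "algebra_spectral_sequence page page_d page_mul page_next"
proof (rule algebra_spectral_sequence.intro, goal_cases)
  case (1 r p q)
  show ?case unfolding page_def by (rule module_quot[OF N_subspace Z_subspace])
next
  case (2 r p q)
  show ?case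
  proof (rule linear_map_page[where f = Q], unfold degree_shift)
    fix x y t assume "x \<in> Z r p (p + q)" "y \<in> Z r p (p + q)"
    then have "x \<in> F p (p + q)" "y \<in> F p (p + q)" by (auto simp: Z_def)
    then show "Q (x + y) = Q x + Q y" "Q (t *\<^sub>R x) = t *\<^sub>R Q x"
      using Q_add[OF F_le_0 F_le_0] Q_scale[OF F_le_0] by auto
  qed (auto simp: page_d_eq Q_N intro: Q_Z)
next
  case (3 x r p q)
  then obtain a where a: "a \<in> Z r p (p + q)" "x = trans_set (N r p (p + q)) a"
    by (auto simp: carrier_page)
  have "Q (Q a) = 0" using a Q_Q[OF F_le_0] by (auto simp: Z_def)
  moreover have "page_d r (p + int r) (q - int r + 1) (trans_set (N r (p + int r) (p + q + 1)) (Q a)) =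
      trans_set (N r (p + int r + int r) (p + q + 1 + 1)) (Q (Q a))"
    using page_d_eq[of "Q a" r "p + int r" "q - int r + 1"] Q_Z[OF a(1)] unfolding degree_shift by simp
  ultimately show ?case using a by (simp add: page_d_eq zero_page algebra_simps)
next
  case (4 y r p' q' p q)
  then obtain b where b: "b \<in> Z r p' (p' + q')" "y = trans_set (N r p' (p' + q')) b"
    by (auto simp: carrier_page)
  have "a * b \<in> Z r (p + p') (p + q + p' + q')" if "a \<in> Z r p (p + q)" for a
    using Z_mult[OF that b(1)] unfolding add.assoc .
  moreover have "a * b \<in> N r (p + p') (p + q + p' + q')" if "a \<in> N r p (p + q)" for a
    using N_mult_right[OF that b(1)] unfolding add.assoc .
  ultimately show ?case
    by (intro linear_map_page[where f = "\<lambda>a. a * b"], unfold degree_shift)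
       (auto simp: b page_mul_eq distrib_right)
next
  case (5 x r p q p' q')
  then obtain a where a: "a \<in> Z r p (p + q)" "x = trans_set (N r p (p + q)) a"
    by (auto simp: carrier_page)
  have "a * b \<in> Z r (p + p') (p + q + p' + q')" if "b \<in> Z r p' (p' + q')" for b
    using Z_mult[OF a(1) that] unfolding add.assoc .
  moreover have "a * b \<in> N r (p + p') (p + q + p' + q')" if "b \<in> N r p' (p' + q')" for b
    using N_mult_left[OF a(1) that] unfolding add.assoc .
  ultimately show ?case
    by (intro linear_map_page[where f = "\<lambda>b. a * b"], unfold degree_shift)
       (auto simp: a page_mul_eq distrib_left)
next
  case (6 x r p q y p' q' z p'' q'')
  then obtain a b c where a: "a \<in> Z r p (p + q)" "x = trans_set (N r p (p + q)) a"
    and b: "b \<in> Z r p' (p' + q')" "y = trans_set (N r p' (p' + q')) b"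
    and c: "c \<in> Z r p'' (p'' + q'')" "z = trans_set (N r p'' (p'' + q'')) c"
    by (auto simp: carrier_page)
  have ab: "a * b \<in> Z r (p + p') (p + p' + (q + q'))" and bc: "b * c \<in> Z r (p' + p'') (p' + p'' + (q' + q''))"
    using Z_mult[OF a(1) b(1)] Z_mult[OF b(1) c(1)] by (simp_all add: add_ac)
  show ?case
    using page_mul_eq[OF ab c(1)] page_mul_eq[OF a(1) bc]
    by (simp add: a b c page_mul_eq degree_shift add_ac mult.assoc)
next
  case (7 r)
  \<comment> \<open>A cocycle of filtration 0 and degree 0 lies in \<open>Z r 0 0\<close> for every
    \<open>r\<close>, so one element gives the units of all pages.\<close>
  have e: "e \<in> Z r 0 (0 + 0)" by (simp add: Z_def unit_F Q_unit F_0)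
  show ?case
  proof (intro bexI[of _ "trans_set (N r 0 (0 + 0)) e"] allI ballI)
    fix p q x assume "x \<in> carrier (page r p q)"
    then obtain a where a: "a \<in> Z r p (p + q)" "x = trans_set (N r p (p + q)) a"
      by (auto simp: carrier_page)
    then have "a \<in> F 0 (p + q)" using F_le_0 by (auto simp: Z_def)
    then show "page_mul r 0 0 p q (trans_set (N r 0 (0 + 0)) e) x = x \<and>
        page_mul r p q 0 0 x (trans_set (N r 0 (0 + 0)) e) = x"
      using page_mul_eq[OF e a(1)] page_mul_eq[OF a(1) e] by (simp add: a unit_mult)
  qed (use e in \<open>simp add: carrier_page\<close>)
next
  case (8 x r p q y p' q')
  then obtain a b where a: "a \<in> Z r p (p + q)" "x = trans_set (N r p (p + q)) a"
    and b: "b \<in> Z r p' (p' + q')" "y = trans_set (N r p' (p' + q')) b"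
    by (auto simp: carrier_page)
  let ?N = "N r (p + p' + int r) (p + q + p' + q' + 1)"
  let ?s = "(if even (p + q) then 1 else - 1) :: real"
  have ab: "a * b \<in> Z r (p + p') (p + p' + (q + q'))"
    using Z_mult[OF a(1) b(1)] by (simp add: add_ac)
  have Qa: "Q a \<in> Z r (p + int r) (p + int r + (q - int r + 1))"
    and Qb: "Q b \<in> Z r (p' + int r) (p' + int r + (q' - int r + 1))"
    using Q_Z[OF a(1)] Q_Z[OF b(1)] unfolding degree_shift by auto
  have 1: "page_d r (p + p') (q + q') (page_mul r p q p' q' x y) = trans_set ?N (Q (a * b))"
    using page_d_eq[OF ab] by (simp add: a b page_mul_eq degree_shift)
  have 2: "page_mul r (p + int r) (q - int r + 1) p' q' (page_d r p q x) y = trans_set ?N (Q a * b)"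
    using page_mul_eq[OF Qa b(1)] a b unfolding degree_shift by (simp add: page_d_eq add_ac)
  have 3: "page_mul r p q (p' + int r) (q' - int r + 1) x (page_d r p' q' y) = trans_set ?N (a * Q b)"
    using page_mul_eq[OF a(1) Qb] a b unfolding degree_shift by (simp add: page_d_eq add_ac)
  have "Q (a * b) = Q a * b + ?s *\<^sub>R (a * Q b)"
    by (rule Q_mult) (use a b F_le_0 in \<open>auto simp: Z_def\<close>)
  then show ?case
    unfolding 1 2 3 page_def
    by (simp add: degree_shift(2) add.assoc[symmetric])
       (simp add: add_quot[OF N_subspace] smult_quot[OF N_subspace] add_ac)
next
  case (9 r p q)
  let ?N = "N r p (p + q)"
  \<comment> \<open>The operations of a quotient are defined without reference to its carrier, so
    the page restricted to the kernel is the quotient formed from the smaller carrier.\<close>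
  have eq: "page r p q\<lparr>carrier := trans_set ?N ` Z (Suc r) p (p + q)\<rparr> =
      quotient_module (M\<lparr>carrier := Z (Suc r) p (p + q)\<rparr>) ?N"
    unfolding page_def by (rule module.equality)
      (simp_all add: carrier_quot, simp_all add: quotient_module_def coset_M set_add_def' fun_eq_iff)
  show ?case
    unfolding kernel_page_d eq unfolding linear_map_def carrier_quot carrier_page
    using subspace_add[OF Z_subspace] subspace_scale[OF Z_subspace]
    by (auto simp: page_next_eq add_quot[OF N_subspace] smult_quot[OF N_subspace] page_def)
next
  case (10 r p q)
  show ?case unfolding kernel_page_d unfolding carrier_page
  proof
    fix K assume "K \<in> trans_set (N (Suc r) p (p + q)) ` Z (Suc r) p (p + q)"
    then obtain z where "z \<in> Z (Suc r) p (p + q)" "K = trans_set (N (Suc r) p (p + q)) z" by blast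
    then show "K \<in> page_next r p q ` trans_set (N r p (p + q)) ` Z (Suc r) p (p + q)"
      by (intro image_eqI[of _ _ "trans_set (N r p (p + q)) z"]) (simp_all add: page_next_eq)
  qed
next
  case (11 x r p q)
  then have "x \<in> trans_set (N r p (p + q)) ` Z (Suc r) p (p + q)"
    using kernel_page_d[of r p q] by blast
  then obtain z where z: "z \<in> Z (Suc r) p (p + q)" "x = trans_set (N r p (p + q)) z" by blast
  have c: "carrier (page r (p - int r) (q + int r - 1)) =
      trans_set (N r (p - int r) (p + q - 1)) ` Z r (p - int r) (p + q - 1)"
    unfolding carrier_page degree_shift ..
  have d: "page_d r (p - int r) (q + int r - 1) (trans_set (N r (p - int r) (p + q - 1)) y) =
      trans_set (N r p (p + q)) (Q y)" if "y \<in> Z r (p - int r) (p + q - 1)" for y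
    using page_d_eq[of y r "p - int r" "q + int r - 1"] that unfolding degree_shift by simp
  \<comment> \<open>The elements \<open>y\<close> in the definition of \<open>N (Suc r)\<close> have
    filtration \<open>p - r\<close>, the source of the incoming differential. After subtracting
    \<open>Q y\<close> a term \<open>w\<close> is left, which belongs to \<open>N r\<close>.\<close>
  have "z \<in> N (Suc r) p (p + q) \<longleftrightarrow> (\<exists>y\<in>Z r (p - int r) (p + q - 1). z - Q y \<in> N r p (p + q))"
  proof
    assume "z \<in> N (Suc r) p (p + q)"
    then show "\<exists>y\<in>Z r (p - int r) (p + q - 1). z - Q y \<in> N r p (p + q)"
    proof (rule N_E)
      fix y w assume a: "y \<in> F (p - int (Suc r) + 1) (p + q - 1)" "w \<in> F (p + 1) (p + q)"
        "Q w \<in> F (p + int (Suc r)) (p + q + 1)" "Q y \<in> F p (p + q)" "z = Q y + w"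
      have "y \<in> Z r (p - int r) (p + q - 1)" using a by (simp add: Z_def)
      moreover have "Q w \<in> F (p + int r) (p + q + 1)"
        using a(3) F_antimono[of "p + int r" "p + int (Suc r)"] by auto
      then have "z - Q y \<in> N r p (p + q)" using N_I[of 0 p r "p + q" w] a by (simp add: F_0)
      ultimately show ?thesis by blast
    qed
  next
    assume "\<exists>y\<in>Z r (p - int r) (p + q - 1). z - Q y \<in> N r p (p + q)"
    then obtain y where y: "y \<in> Z r (p - int r) (p + q - 1)" "z - Q y \<in> N r p (p + q)" by blast
    have "Q y \<in> F p (p + q)" "Q (Q y) = 0" using y(1) Q_Q[OF F_le_0] by (auto simp: Z_def)
    then have Qy: "Q y \<in> Z (Suc r) p (p + q)" by (simp add: Z_def F_0)
    have "Q y + 0 \<in> N (Suc r) p (p + q)"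
      by (rule N_I) (use y(1) \<open>Q y \<in> F p (p + q)\<close> in \<open>auto simp: Z_def F_0\<close>)
    moreover have "z - Q y \<in> N (Suc r) p (p + q)"
      by (rule N_inter_Z_Suc[OF y(2) subspace_diff[OF Z_subspace z(1) Qy]])
    ultimately show "z \<in> N (Suc r) p (p + q)"
      using subspace_add[OF N_subspace, of "z - Q y" "Suc r" p "p + q" "Q y"] by simp
  qed
  then show ?case
    unfolding c z(2) zero_page page_next_eq[OF z(1)] page_eq_zero_iff
    by (auto simp: d trans_set_eq_iff[OF N_subspace] image_iff)
next
  case (12 x r p q y p' q')
  then have "x \<in> trans_set (N r p (p + q)) ` Z (Suc r) p (p + q)"
    "y \<in> trans_set (N r p' (p' + q')) ` Z (Suc r) p' (p' + q')"
    using kernel_page_d[of r p q] kernel_page_d[of r p' q'] by blast+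
  then obtain a b where a: "a \<in> Z (Suc r) p (p + q)" "x = trans_set (N r p (p + q)) a"
    and b: "b \<in> Z (Suc r) p' (p' + q')" "y = trans_set (N r p' (p' + q')) b" by blast
  have ab: "a * b \<in> Z (Suc r) (p + p') (p + p' + (q + q'))"
    using Z_mult[OF a(1) b(1)] by (simp add: add_ac)
  have "a \<in> Z r p (p + q)" "b \<in> Z r p' (p' + q')" using a b Z_Suc by auto
  then show ?case
    using page_next_eq[OF ab] a b by (simp add: page_next_eq page_mul_eq degree_shift)
qed

subsection \<open>Convergence\<close>

definition cocyc :: "int \<Rightarrow> 'a set" where "cocyc n = {x \<in> F 0 n. Q x = 0}"

definition cob :: "int \<Rightarrow> 'a set" where "cob n = Q ` F 0 (n - 1)"

definition coh :: "int \<Rightarrow> (real, 'a set) module" where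
  "coh n = quotient_module (M\<lparr>carrier := cocyc n\<rparr>) (cob n)"

definition coh_mul :: "int \<Rightarrow> int \<Rightarrow> 'a set \<Rightarrow> 'a set \<Rightarrow> 'a set" where
  "coh_mul n n' = quot_lift2 (cob (n + n')) (*)"

definition coh_fil :: "int \<Rightarrow> int \<Rightarrow> 'a set set" where
  "coh_fil p n = trans_set (cob n) ` (cocyc n \<inter> F p n)"

lemma cocyc_subspace: "subspace (cocyc n)"
  by (rule subspaceI) (auto simp: cocyc_def F_0 F_add F_scale Q_add Q_scale)

lemma cob_subspace: "subspace (cob n)"
proof (rule subspaceI)
  show "0 \<in> cob n" unfolding cob_def by (rule image_eqI[of _ _ 0]) (simp_all add: F_0)
  show "x + y \<in> cob n" if xy: "x \<in> cob n" "y \<in> cob n" for x y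
  proof -
    obtain a b where "a \<in> F 0 (n - 1)" "b \<in> F 0 (n - 1)" "x = Q a" "y = Q b"
      using xy unfolding cob_def by blast
    then show ?thesis unfolding cob_def by (intro image_eqI[of _ _ "a + b"]) (simp_all add: Q_add F_add)
  qed
  show "t *\<^sub>R x \<in> cob n" if x: "x \<in> cob n" for x t
  proof -
    obtain a where "a \<in> F 0 (n - 1)" "x = Q a" using x unfolding cob_def by blast
    then show ?thesis unfolding cob_def
      by (intro image_eqI[of _ _ "t *\<^sub>R a"]) (simp_all add: Q_scale F_scale)
  qed
qed

lemma cob_le_cocyc: "cob n \<subseteq> cocyc n"
  using Q_F[of _ 0 "n - 1"] by (auto simp: cob_def cocyc_def Q_Q)

lemma cocyc_mult:
  assumes "x \<in> cocyc n" "y \<in> cocyc m"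
  shows "x * y \<in> cocyc (n + m)"
  using assms F_mult[of x 0 n y 0 m] Q_mult[of x n y m] by (simp add: cocyc_def)

lemma cob_mult_right:
  assumes "x \<in> cob n" "z \<in> cocyc m"
  shows "x * z \<in> cob (n + m)"
proof -
  obtain a where a: "a \<in> F 0 (n - 1)" "x = Q a" using assms unfolding cob_def by blast
  have z: "z \<in> F 0 m" "Q z = 0" using assms by (auto simp: cocyc_def)
  have "Q (a * z) = x * z" using Q_mult[OF a(1) z(1)] a z by simp
  moreover have "a * z \<in> F 0 (n + m - 1)" using F_mult[OF a(1) z(1)] by (simp add: algebra_simps)
  ultimately show ?thesis unfolding cob_def by (metis image_eqI)
qed

lemma cob_mult_left:
  assumes "z \<in> cocyc m" "x \<in> cob n"
  shows "z * x \<in> cob (m + n)"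
proof -
  obtain a where a: "a \<in> F 0 (n - 1)" "x = Q a" using assms unfolding cob_def by blast
  have z: "z \<in> F 0 m" "Q z = 0" using assms by (auto simp: cocyc_def)
  let ?s = "(if even m then 1 else - 1) :: real"
  have za: "z * a \<in> F 0 (m + n - 1)" using F_mult[OF z(1) a(1)] by (simp add: algebra_simps)
  have "Q (?s *\<^sub>R (z * a)) = z * x"
    using Q_mult[OF z(1) a(1)] Q_scale[OF za, of ?s] a z by simp
  moreover have "?s *\<^sub>R (z * a) \<in> F 0 (m + n - 1)" by (rule F_scale[OF za])
  ultimately show ?thesis unfolding cob_def by (metis image_eqI)
qed

lemma coh_mul_eq:
  assumes "x \<in> cocyc n" "y \<in> cocyc m"
  shows "coh_mul n m (trans_set (cob n) x) (trans_set (cob m) y) = trans_set (cob (n + m)) (x * y)"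
  unfolding coh_mul_def
proof (rule quot_lift2_trans_set[OF cob_subspace cob_subspace cob_subspace])
  fix x' y' assume a: "x' - x \<in> cob n" "y' - y \<in> cob m"
  have "x' - x + x \<in> cocyc n"
    by (rule subspace_add[OF cocyc_subspace _ assms(1)]) (use a cob_le_cocyc in blast)
  then have x': "x' \<in> cocyc n" by simp
  have "x' * (y' - y) + (x' - x) * y \<in> cob (n + m)"
    by (intro subspace_add[OF cob_subspace] cob_mult_left[OF x'] cob_mult_right[OF _ assms(2)] a)
  then show "x' * y' - x * y \<in> cob (n + m)" by (simp add: algebra_simps)
qed

text \<open>In degree \<open>n + 1\<close> the filtration is zero from \<open>p + r\<close> on, so
  the condition on the differential says that it vanishes.\<close>

lemma Z_stable:
  assumes "p + int r > max 0 (n + 1)"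
  shows "Z r p n = cocyc n \<inter> F p n"
  using F_large[OF assms] F_le_0 by (auto simp: Z_def cocyc_def)

text \<open>Once \<open>p - r + 1 \<le> 0\<close> the boundary part runs through all coboundaries in
  \<open>F p n\<close>, and \<open>w\<close> has become a cocycle.\<close>

lemma N_stable:
  assumes "p + int r > max 0 (n + 1)" "p - int r + 1 \<le> 0"
  shows "x \<in> N r p n \<longleftrightarrow> (\<exists>b\<in>cob n. \<exists>w\<in>cocyc n \<inter> F (p + 1) n. b \<in> F p n \<and> x = b + w)"
proof
  assume "x \<in> N r p n"
  then show "\<exists>b\<in>cob n. \<exists>w\<in>cocyc n \<inter> F (p + 1) n. b \<in> F p n \<and> x = b + w"
    by (rule N_E) (use assms F_large F_nonpos[OF assms(2)] F_le_0 in \<open>auto simp: cob_def cocyc_def\<close>)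
next
  assume "\<exists>b\<in>cob n. \<exists>w\<in>cocyc n \<inter> F (p + 1) n. b \<in> F p n \<and> x = b + w"
  then obtain y w where "y \<in> F 0 (n - 1)" "w \<in> F (p + 1) n" "Q w = 0" "Q y \<in> F p n" "x = Q y + w"
    by (auto simp: cob_def cocyc_def)
  then show "x \<in> N r p n" using N_I[of y p r n w] F_nonpos[OF assms(2)] by (simp add: F_0)
qed

text \<open>An element of the associated graded of the cohomology is a set of cohomology classes,
  which is why images of sets are compared. Modulo \<open>N r p n\<close> elements differ by a
  coboundary, invisible in cohomology, and a cocycle of filtration \<open>p + 1\<close>. The second
  representative \<open>y\<close> lets later arguments change \<open>z\<close>.\<close>

lemma limit_class:
  assumes "p + int r > max 0 (n + 1)" "p - int r + 1 \<le> 0" "y - z \<in> N r p n"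
  shows "trans_set (cob n) ` trans_set (N r p n) z =
    trans_set (cob n) ` trans_set (cocyc n \<inter> F (p + 1) n) y"
proof -
  let ?W = "cocyc n \<inter> F (p + 1) n"
  have W: "subspace ?W" by (rule subspace_inter[OF cocyc_subspace F_subspace])
  have WN: "?W \<subseteq> N r p n"
    using N_stable[OF assms(1,2)] subspace_0[OF cob_subspace] F_0 by fastforce
  have "trans_set (N r p n) z = trans_set (N r p n) y"
    using assms(3) trans_set_eq_iff[OF N_subspace] by metis
  moreover have "trans_set (cob n) ` trans_set (N r p n) y = trans_set (cob n) ` trans_set ?W y"
  proof
    show "trans_set (cob n) ` trans_set (N r p n) y \<subseteq> trans_set (cob n) ` trans_set ?W y"
    proof safe
      fix x assume "x \<in> trans_set (N r p n) y"
      then obtain b w where bw: "b \<in> cob n" "w \<in> ?W" "x - y = b + w"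
        unfolding mem_trans_set N_stable[OF assms(1,2)] by blast
      then have "x - (y + w) = b" by (simp add: algebra_simps)
      then have "trans_set (cob n) x = trans_set (cob n) (y + w)"
        using bw(1) by (simp add: trans_set_eq_iff[OF cob_subspace])
      moreover have "y + w \<in> trans_set ?W y" using bw(2) by (simp add: mem_trans_set)
      ultimately show "trans_set (cob n) x \<in> trans_set (cob n) ` trans_set ?W y" by blast
    qed
    show "trans_set (cob n) ` trans_set ?W y \<subseteq> trans_set (cob n) ` trans_set (N r p n) y"
      using WN by (intro image_mono) (auto simp: mem_trans_set)
  qed
  ultimately show ?thesis by simp
qed

lemma coh_fil_subset_carrier: "coh_fil p n \<subseteq> carrier (coh n)"
  by (auto simp: coh_fil_def coh_def carrier_quot)

lemma coh_add: "trans_set (cob n) x \<oplus>\<^bsub>coh n\<^esub> trans_set (cob n) y = trans_set (cob n) (x + y)"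
  and coh_smult: "t \<odot>\<^bsub>coh n\<^esub> trans_set (cob n) x = trans_set (cob n) (t *\<^sub>R x)"
  by (simp_all add: coh_def add_quot[OF cob_subspace] smult_quot[OF cob_subspace])

lemma module_coh: "Module.module real_ring (coh n)"
  unfolding coh_def by (rule module_quot[OF cob_subspace cocyc_subspace])

lemma submodule_coh_fil: "submodule (coh_fil p n) real_ring (coh n)"
proof -
  interpret Module.module real_ring "coh n" by (rule module_coh)
  have W: "subspace (cocyc n \<inter> F p n)" by (rule subspace_inter[OF cocyc_subspace F_subspace])
  have z: "\<zero>\<^bsub>coh n\<^esub> = trans_set (cob n) 0" by (simp add: coh_def zero_quot)
  show ?thesis
  proof (rule submoduleI[OF coh_fil_subset_carrier])
    show "\<zero>\<^bsub>coh n\<^esub> \<in> coh_fil p n"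
      unfolding z coh_fil_def using subspace_0[OF W] by blast
    show add: "K \<oplus>\<^bsub>coh n\<^esub> L \<in> coh_fil p n" if "K \<in> coh_fil p n" "L \<in> coh_fil p n" for K L
      using that subspace_add[OF W] unfolding coh_fil_def by (auto simp: coh_add)
    show sm: "t \<odot>\<^bsub>coh n\<^esub> K \<in> coh_fil p n" if "K \<in> coh_fil p n" for t K
      using that subspace_scale[OF W] unfolding coh_fil_def by (auto simp: coh_smult)
    show "\<ominus>\<^bsub>coh n\<^esub> K \<in> coh_fil p n" if K: "K \<in> coh_fil p n" for K
    proof -
      obtain x where x: "x \<in> cocyc n \<inter> F p n" "K = trans_set (cob n) x"
        using K unfolding coh_fil_def by blast
      have m: "trans_set (cob n) (- x) \<in> coh_fil p n"
        using subspace_neg[OF W x(1)] unfolding coh_fil_def by blast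
      have "trans_set (cob n) (- x) \<oplus>\<^bsub>coh n\<^esub> K = \<zero>\<^bsub>coh n\<^esub>"
        unfolding x(2) coh_add z by simp
      then have "\<ominus>\<^bsub>coh n\<^esub> K = trans_set (cob n) (- x)"
        by (rule M.minus_equality) (use m K coh_fil_subset_carrier in blast)+
      with m show ?thesis by simp
    qed
  qed
qed

text \<open>By \<open>limit_class\<close> the cohomology classes of all representatives of a stable
  class already form one coset of the associated graded.\<close>

definition limit_map :: "nat \<Rightarrow> int \<Rightarrow> int \<Rightarrow> 'a set \<Rightarrow> 'a set set" where
  "limit_map r p q K = trans_set (cob (p + q)) ` K"

text \<open>The bound \<open>q + 2\<close> puts \<open>p + r\<close> above the degree
  \<open>p + q + 1\<close> in which outgoing differentials land. The bound
  \<open>\<bar>p\<bar> + 1\<close> gives \<open>p + r > 0\<close> and also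
  \<open>p - r + 1 \<le> 0\<close>, which concerns the incoming ones.\<close>

definition stable_page :: "int \<Rightarrow> int \<Rightarrow> nat" where
  "stable_page p q = nat (max (q + 2) (\<bar>p\<bar> + 1))"

lemma stable_pageD:
  assumes "stable_page p q \<le> r"
  shows "p + int r > max 0 (p + q + 1)" "p - int r + 1 \<le> 0"
  using assms unfolding stable_page_def by linarith+

lemma coset_coh_fil:
  assumes "z \<in> cocyc n"
  shows "coh_fil p' n +>\<^bsub>coh n\<lparr>carrier := S\<rparr>\<^esub> trans_set (cob n) z =
    trans_set (cob n) ` trans_set (cocyc n \<inter> F p' n) z"
proof -
  have "coh_fil p' n +>\<^bsub>coh n\<lparr>carrier := S\<rparr>\<^esub> trans_set (cob n) z =
      (\<lambda>w. trans_set (cob n) (w + z)) ` (cocyc n \<inter> F p' n)"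
    unfolding a_r_coset_def' coh_fil_def by (auto simp: coh_add)
  also have "\<dots> = trans_set (cob n) ` trans_set (cocyc n \<inter> F p' n) z"
    unfolding trans_set_def[of "cocyc n \<inter> F p' n"] image_image ..
  finally show ?thesis .
qed

lemma limit_map_eq:
  assumes "stable_page p q \<le> r" "y - z \<in> N r p (p + q)" "y \<in> cocyc (p + q)"
  shows "limit_map r p q (trans_set (N r p (p + q)) z) =
    coh_fil (p + 1) (p + q) +>\<^bsub>coh (p + q)\<lparr>carrier := S\<rparr>\<^esub> trans_set (cob (p + q)) y"
  unfolding limit_map_def limit_class[OF stable_pageD[OF assms(1)] assms(2)] coset_coh_fil[OF assms(3)] ..

lemma linear_limit_map:
  assumes r: "stable_page p q \<le> r"
  shows "linear_map (page r p q)
    (quotient_module (coh (p + q)\<lparr>carrier := coh_fil p (p + q)\<rparr>) (coh_fil (p + 1) (p + q)))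
    (limit_map r p q)" (is "linear_map _ ?L _")
  unfolding linear_map_def
proof (intro conjI allI ballI)
  let ?n = "p + q" and ?N = "N r p (p + q)"
  have car: "carrier (page r p q) = trans_set ?N ` (cocyc ?n \<inter> F p ?n)"
    unfolding carrier_page Z_stable[OF stable_pageD(1)[OF r]] ..
  have zero: "z - z \<in> ?N" for z using subspace_0[OF N_subspace] by simp
  show "limit_map r p q \<in> carrier (page r p q) \<rightarrow> carrier ?L"
  proof
    fix K assume "K \<in> carrier (page r p q)"
    then obtain z where z: "z \<in> cocyc ?n \<inter> F p ?n" "K = trans_set ?N z" unfolding car by blast
    have "trans_set (cob ?n) z \<in> coh_fil p ?n" using z unfolding coh_fil_def by blast
    then show "limit_map r p q K \<in> carrier ?L"
      using z limit_map_eq[OF r zero] by (auto simp: quotient_module_def A_RCOSETS_def')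
  qed
  fix K assume "K \<in> carrier (page r p q)"
  then obtain z where z: "z \<in> cocyc ?n \<inter> F p ?n" "K = trans_set ?N z" unfolding car by blast
  show "limit_map r p q (K \<oplus>\<^bsub>page r p q\<^esub> L) = limit_map r p q K \<oplus>\<^bsub>?L\<^esub> limit_map r p q L" for L
    unfolding limit_map_def page_def add_quot_set
    by (auto simp: quotient_module_def[of "coh _\<lparr>carrier := _\<rparr>"] set_add_def' coh_add image_iff)
  fix t
  have sp: "t *\<^sub>R z \<in> cocyc ?n" using z subspace_scale[OF cocyc_subspace] by blast
  have "limit_map r p q (t \<odot>\<^bsub>page r p q\<^esub> K) = coh_fil (p + 1) ?n
      +>\<^bsub>coh ?n\<lparr>carrier := coh_fil p ?n\<rparr>\<^esub> trans_set (cob ?n) (t *\<^sub>R z)"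
    unfolding z(2) page_def smult_quot[OF N_subspace] by (rule limit_map_eq[OF r zero sp])
  moreover have "t \<odot>\<^bsub>?L\<^esub> limit_map r p q K = (\<Union>k\<in>K. coh_fil (p + 1) ?n
      +>\<^bsub>coh ?n\<lparr>carrier := coh_fil p ?n\<rparr>\<^esub> trans_set (cob ?n) (t *\<^sub>R k))"
    by (simp add: quotient_module_def limit_map_def coh_smult)
  \<comment> \<open>All members of \<open>K\<close> are cocycles that differ from \<open>z\<close>
    by elements of \<open>N\<close>, so the union over them is constant.\<close>
  moreover have "(\<Union>k\<in>K. coh_fil (p + 1) ?n
      +>\<^bsub>coh ?n\<lparr>carrier := coh_fil p ?n\<rparr>\<^esub> trans_set (cob ?n) (t *\<^sub>R k)) = coh_fil (p + 1) ?n
      +>\<^bsub>coh ?n\<lparr>carrier := coh_fil p ?n\<rparr>\<^esub> trans_set (cob ?n) (t *\<^sub>R z)"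
  proof (rule SUP_eq_const)
    show "K \<noteq> {}" using z self_mem_trans_set[OF N_subspace] by blast
    fix k assume "k \<in> K"
    then have kz: "k - z \<in> ?N" using z by (simp add: mem_trans_set)
    have "k - z \<in> Z r p ?n" using kz N_le_Z by blast
    moreover have "z \<in> Z r p ?n" using z(1) unfolding Z_stable[OF stable_pageD(1)[OF r]] .
    ultimately have "k - z + z \<in> Z r p ?n" by (rule subspace_add[OF Z_subspace])
    then have k: "k \<in> cocyc ?n" using Z_stable[OF stable_pageD(1)[OF r]] by auto
    have tk: "t *\<^sub>R k \<in> cocyc ?n" by (rule subspace_scale[OF cocyc_subspace k])
    have "t *\<^sub>R k - t *\<^sub>R z \<in> ?N"
      using subspace_scale[OF N_subspace kz, of t] by (simp add: scaleR_diff_right)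
    then show "coh_fil (p + 1) ?n
      +>\<^bsub>coh ?n\<lparr>carrier := coh_fil p ?n\<rparr>\<^esub> trans_set (cob ?n) (t *\<^sub>R k) = coh_fil (p + 1) ?n
      +>\<^bsub>coh ?n\<lparr>carrier := coh_fil p ?n\<rparr>\<^esub> trans_set (cob ?n) (t *\<^sub>R z)"
      using limit_map_eq[OF r _ tk] limit_map_eq[OF r zero sp] by metis
  qed
  ultimately show "limit_map r p q (t \<odot>\<^bsub>page r p q\<^esub> K) = t \<odot>\<^bsub>?L\<^esub> limit_map r p q K" by simp
qed

lemma bij_limit_map:
  assumes r: "stable_page p q \<le> r"
  shows "bij_betw (limit_map r p q) (carrier (page r p q))
    (a_rcosets\<^bsub>coh (p + q)\<lparr>carrier := coh_fil p (p + q)\<rparr>\<^esub> (coh_fil (p + 1) (p + q)))"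
proof -
  let ?n = "p + q" and ?N = "N r p (p + q)"
  have car: "carrier (page r p q) = trans_set ?N ` (cocyc ?n \<inter> F p ?n)"
    unfolding carrier_page Z_stable[OF stable_pageD(1)[OF r]] ..
  have zero: "z - z \<in> ?N" for z using subspace_0[OF N_subspace] by simp
  have eq: "limit_map r p q (trans_set ?N z) = coh_fil (p + 1) ?n
      +>\<^bsub>coh ?n\<lparr>carrier := coh_fil p ?n\<rparr>\<^esub> trans_set (cob ?n) z" if "z \<in> cocyc ?n" for z
    by (rule limit_map_eq[OF r zero that])
  \<comment> \<open>If the images agree, \<open>z\<close> is cohomologous to some \<open>k\<close>
    in the class of \<open>z'\<close>. The difference \<open>z - k\<close> is then a coboundary of
    filtration \<open>p\<close>, which on a stable page lies in \<open>N\<close>.\<close>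
  have "inj_on (limit_map r p q) (carrier (page r p q))"
  proof (rule inj_onI)
    fix K L assume a: "K \<in> carrier (page r p q)" "L \<in> carrier (page r p q)"
      "limit_map r p q K = limit_map r p q L"
    obtain z z' where z: "z \<in> cocyc ?n \<inter> F p ?n" "K = trans_set ?N z"
      and z': "z' \<in> cocyc ?n \<inter> F p ?n" "L = trans_set ?N z'"
      using a(1,2) unfolding car by blast
    have "trans_set (cob ?n) z \<in> limit_map r p q K"
      unfolding limit_map_def z(2) using self_mem_trans_set[OF N_subspace] by blast
    then have "trans_set (cob ?n) z \<in> limit_map r p q L" using a(3) by simp
    then obtain k where k: "k \<in> L" "trans_set (cob ?n) z = trans_set (cob ?n) k"
      unfolding limit_map_def by blast
    have kz: "k - z' \<in> ?N" using k(1) z'(2) by (simp add: mem_trans_set)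
    then have "k - z' + z' \<in> F p ?n" using z'(1) by (intro F_add) (auto simp: N_def)
    then have "z - k \<in> F p ?n" using z(1) by (intro F_diff) auto
    moreover have "z - k \<in> cob ?n" using k(2) trans_set_eq_iff[OF cob_subspace] by blast
    moreover have "0 \<in> cocyc ?n \<inter> F (p + 1) ?n" by (simp add: cocyc_def F_0)
    ultimately have "z - k \<in> ?N"
      unfolding N_stable[OF stable_pageD[OF r]] by (metis add.right_neutral)
    then have "z - z' \<in> ?N" using subspace_add[OF N_subspace _ kz, of "z - k"] by simp
    then show "K = L" unfolding z(2) z'(2) trans_set_eq_iff[OF N_subspace] .
  qed
  moreover have "limit_map r p q ` carrier (page r p q) =
      a_rcosets\<^bsub>coh ?n\<lparr>carrier := coh_fil p ?n\<rparr>\<^esub> (coh_fil (p + 1) ?n)"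
    unfolding car A_RCOSETS_def' using eq by (auto simp: coh_fil_def[of p] image_iff)
  ultimately show ?thesis by (simp add: bij_betw_def)
qed

theorem converges_to_coh: "converges_to page page_d page_mul page_next coh coh_mul coh_fil"
  unfolding converges_to_def
proof (intro conjI allI)
  show "Module.module real_ring (coh n)" for n by (rule module_coh)
  show "submodule (coh_fil p n) real_ring (coh n)" for p n by (rule submodule_coh_fil)
  show "coh_fil (p + 1) n \<subseteq> coh_fil p n" for p n
    using F_Suc by (auto simp: coh_fil_def)
  show "\<forall>x\<in>coh_fil p n. \<forall>y\<in>coh_fil p' n'. coh_mul n n' x y \<in> coh_fil (p + p') (n + n')" for p n p' n'
    unfolding coh_fil_def using F_mult cocyc_mult by (auto simp: coh_mul_eq)
  show "\<exists>p. coh_fil p n = carrier (coh n)" for n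
    by (rule exI[of _ 0]) (auto simp: coh_fil_def coh_def carrier_quot cocyc_def)
  \<comment> \<open>By \<open>F_large\<close> the filtration in degree \<open>n\<close> is zero
    beyond \<open>max 0 n\<close>; the maximum covers negative degrees.\<close>
  have "coh_fil (max 0 n + 1) n = {\<zero>\<^bsub>coh n\<^esub>}" for n
    using F_large[of n "max 0 n + 1"] by (auto simp: coh_fil_def coh_def zero_quot cocyc_def F_0)
  then show "\<exists>p. coh_fil p n = {\<zero>\<^bsub>coh n\<^esub>}" for n by blast
  show "\<exists>r0 \<alpha>.
       (\<forall>p q r. r0 p q \<le> r \<longrightarrow>
          (\<forall>x\<in>carrier (page r p q). page_d r p q x = \<zero>\<^bsub>page r (p + int r) (q - int r + 1)\<^esub>) \<and>
          (\<forall>x\<in>carrier (page r (p - int r) (q + int r - 1)).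
             page_d r (p - int r) (q + int r - 1) x = \<zero>\<^bsub>page r p q\<^esub>) \<and>
          linear_map (page r p q)
            (quotient_module (coh (p + q) \<lparr>carrier := coh_fil p (p + q)\<rparr>) (coh_fil (p + 1) (p + q))) (\<alpha> r p q) \<and>
          bij_betw (\<alpha> r p q) (carrier (page r p q))
            (a_rcosets\<^bsub>coh (p + q) \<lparr>carrier := coh_fil p (p + q)\<rparr>\<^esub> (coh_fil (p + 1) (p + q))) \<and>
          (\<forall>x\<in>carrier (page r p q). \<alpha> (Suc r) p q (page_next r p q x) = \<alpha> r p q x)) \<and>
       (\<forall>p q p' q' r. max (r0 p q) (max (r0 p' q') (r0 (p + p') (q + q'))) \<le> r \<longrightarrow>
          (\<forall>x\<in>carrier (page r p q). \<forall>y\<in>carrier (page r p' q').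
             \<alpha> r (p + p') (q + q') (page_mul r p q p' q' x y) =
               (\<Union>a\<in>\<alpha> r p q x. \<Union>b\<in>\<alpha> r p' q' y.
                  coh_fil (p + p' + 1) (p + q + p' + q') +>\<^bsub>coh (p + q + p' + q')\<^esub>
                    coh_mul (p + q) (p' + q') a b)))"
  proof (intro exI[of _ stable_page] exI[of _ limit_map] conjI allI impI ballI)
    fix p q r assume r: "stable_page p q \<le> r"
    let ?n = "p + q" and ?N = "N r p (p + q)"
    note st = stable_pageD[OF r]
    have car: "carrier (page r p q) = trans_set ?N ` (cocyc ?n \<inter> F p ?n)"
      unfolding carrier_page Z_stable[OF st(1)] ..
    show "page_d r p q x = \<zero>\<^bsub>page r (p + int r) (q - int r + 1)\<^esub>" if x: "x \<in> carrier (page r p q)" for x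
    proof -
      obtain z where z: "z \<in> cocyc ?n \<inter> F p ?n" "x = trans_set ?N z" using x unfolding car by blast
      then have "z \<in> Z r p ?n" "Q z = 0" using Z_stable[OF st(1)] by (auto simp: cocyc_def)
      then show ?thesis unfolding z(2) zero_page degree_shift by (simp add: page_d_eq)
    qed
    show "page_d r (p - int r) (q + int r - 1) x = \<zero>\<^bsub>page r p q\<^esub>"
      if "x \<in> carrier (page r (p - int r) (q + int r - 1))" for x
    proof -
      obtain z where z: "z \<in> Z r (p - int r) (p - int r + (q + int r - 1))"
        "x = trans_set (N r (p - int r) (p - int r + (q + int r - 1))) z"
        using \<open>x \<in> _\<close> unfolding carrier_page by blast
      have "page_d r (p - int r) (q + int r - 1) x = trans_set ?N (Q z)"
        unfolding z(2) page_d_eq[OF z(1)] by simp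
      moreover have "Q z \<in> ?N"
      proof -
        have "z \<in> Z r (p - int r) (?n - 1)" using z(1) unfolding degree_shift .
        then have "z \<in> F (p - int r) (?n - 1)" "Q z \<in> F p ?n" by (auto simp: Z_def)
        then show ?thesis
          using N_I[of z p r ?n 0] F_nonpos[OF st(2)] F_le_0 by (simp add: F_0)
      qed
      ultimately show ?thesis by (simp add: zero_page page_eq_zero_iff)
    qed
    show "linear_map (page r p q)
        (quotient_module (coh ?n \<lparr>carrier := coh_fil p ?n\<rparr>) (coh_fil (p + 1) ?n)) (limit_map r p q)"
      by (rule linear_limit_map[OF r])
    show "bij_betw (limit_map r p q) (carrier (page r p q))
        (a_rcosets\<^bsub>coh ?n \<lparr>carrier := coh_fil p ?n\<rparr>\<^esub> (coh_fil (p + 1) ?n))"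
      by (rule bij_limit_map[OF r])
    show "limit_map (Suc r) p q (page_next r p q x) = limit_map r p q x"
      if x: "x \<in> carrier (page r p q)" for x
    proof -
      obtain z where z: "z \<in> cocyc ?n \<inter> F p ?n" "x = trans_set ?N z" using x unfolding car by blast
      have r': "stable_page p q \<le> Suc r" using r by simp
      have "z \<in> Z (Suc r) p ?n" using z Z_stable[OF stable_pageD(1)[OF r']] by auto
      moreover have zero: "z - z \<in> N r' p ?n" for r' using subspace_0[OF N_subspace] by simp
      moreover have zc: "z \<in> cocyc ?n" using z(1) by blast
      ultimately show ?thesis
        unfolding z(2) using limit_map_eq[OF r zero zc] limit_map_eq[OF r' zero zc]
        by (simp only: page_next_eq)
    qed
  next
    fix p q p' q' r x y
    assume r: "max (stable_page p q) (max (stable_page p' q') (stable_page (p + p') (q + q'))) \<le> r"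
      and x: "x \<in> carrier (page r p q)" and y: "y \<in> carrier (page r p' q')"
    have r1: "stable_page p q \<le> r" and r2: "stable_page p' q' \<le> r"
      and r3: "stable_page (p + p') (q + q') \<le> r" using r by auto
    obtain a b where a: "a \<in> Z r p (p + q)" "x = trans_set (N r p (p + q)) a"
      and b: "b \<in> Z r p' (p' + q')" "y = trans_set (N r p' (p' + q')) b"
      using x y unfolding carrier_page by blast
    let ?n = "p + q + p' + q'" and ?p = "p + p' + 1"
    have n: "p + p' + (q + q') = ?n" by simp
    have "page_mul r p q p' q' x y = trans_set (N r (p + p') ?n) (a * b)"
      unfolding a(2) b(2) by (rule page_mul_eq[OF a(1) b(1)])
    have st3: "p + p' + int r > max 0 (?n + 1)" "p + p' - int r + 1 \<le> 0"
      using stable_pageD[OF r3] unfolding n by auto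
    \<comment> \<open>Any two classes taken from the images have cocycle representatives
      \<open>k\<close> and \<open>l\<close> whose product is congruent to \<open>a * b\<close>
      modulo \<open>N\<close>; hence every member of the double union is the same coset.\<close>
    have key: "coh_fil ?p ?n +>\<^bsub>coh ?n\<^esub> coh_mul (p + q) (p' + q') K L =
        trans_set (cob ?n) ` trans_set (N r (p + p') ?n) (a * b)"
      if "K \<in> limit_map r p q x" "L \<in> limit_map r p' q' y" for K L
    proof -
      from that(1) obtain k where k: "k - a \<in> N r p (p + q)" "K = trans_set (cob (p + q)) k"
        unfolding limit_map_def a(2) mem_trans_set[symmetric] by blast
      from \<open>L \<in> _\<close> obtain l where l: "l - b \<in> N r p' (p' + q')" "L = trans_set (cob (p' + q')) l"
        unfolding limit_map_def b(2) mem_trans_set[symmetric] by blast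
      have "k - a + a \<in> Z r p (p + q)" "l - b + b \<in> Z r p' (p' + q')"
        using k l a b N_le_Z by (intro subspace_add[OF Z_subspace]; blast)+
      then have kl: "k \<in> cocyc (p + q)" "l \<in> cocyc (p' + q')"
        using Z_stable[OF stable_pageD(1)[OF r1]] Z_stable[OF stable_pageD(1)[OF r2]] by auto
      have kl': "k * l \<in> cocyc ?n" using cocyc_mult[OF kl] by (simp add: add.assoc)
      have "k * l - a * b \<in> N r (p + p') ?n"
        using N_mult_cong[OF a(1) b(1) k(1) l(1)] by (simp add: add.assoc)
      then have "trans_set (cob ?n) ` trans_set (N r (p + p') ?n) (a * b) =
          trans_set (cob ?n) ` trans_set (cocyc ?n \<inter> F ?p ?n) (k * l)"
        by (rule limit_class[OF st3])
      also have "\<dots> = coh_fil ?p ?n +>\<^bsub>coh ?n\<lparr>carrier := carrier (coh ?n)\<rparr>\<^esub> trans_set (cob ?n) (k * l)"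
        by (rule coset_coh_fil[OF kl', symmetric])
      also have "trans_set (cob ?n) (k * l) = coh_mul (p + q) (p' + q') K L"
        using coh_mul_eq[OF kl] by (simp add: k(2) l(2) add.assoc)
      finally show ?thesis by simp
    qed
    have "limit_map r p q x \<noteq> {}" "limit_map r p' q' y \<noteq> {}"
      unfolding limit_map_def a(2) b(2) using self_mem_trans_set[OF N_subspace] by blast+
    then have "(\<Union>K\<in>limit_map r p q x. \<Union>L\<in>limit_map r p' q' y.
        coh_fil ?p ?n +>\<^bsub>coh ?n\<^esub> coh_mul (p + q) (p' + q') K L) =
        trans_set (cob ?n) ` trans_set (N r (p + p') ?n) (a * b)"
      by (intro SUP_eq_const key)
    then show "limit_map r (p + p') (q + q') (page_mul r p q p' q' x y) =
        (\<Union>K\<in>limit_map r p q x. \<Union>L\<in>limit_map r p' q' y.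
          coh_fil ?p ?n +>\<^bsub>coh ?n\<^esub> coh_mul (p + q) (p' + q') K L)"
      unfolding limit_map_def[of r "p + p'"] n \<open>page_mul r p q p' q' x y = _\<close> by simp
  qed
qed

end

section \<open>Smooth functions\<close>

subsection \<open>Open subsets of coordinate space\<close>

text \<open>A basic open set of the product topology restricts finitely many coordinates, and the
  smallest of the finitely many radii serves for all of them. The 1 in the minimum covers the case
  that no coordinate is restricted.\<close>

lemma open_fun_box:
  fixes x :: "nat \<Rightarrow> real"
  assumes "open T" "x \<in> T"
  obtains I \<epsilon> where "finite I" "\<epsilon> > 0" "\<And>y. (\<And>i. i \<in> I \<Longrightarrow> \<bar>y i - x i\<bar> < \<epsilon>) \<Longrightarrow> y \<in> T"
proof -
  have "openin (product_topology (\<lambda>i. euclidean) UNIV) T"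
    using assms(1) unfolding euclidean_product_topology by simp
  from product_topology_open_contains_basis[OF this assms(2)]
  obtain B where B: "x \<in> (\<Pi>\<^sub>E i\<in>UNIV. B i)" "\<And>i. open (B i)" "finite {i. B i \<noteq> UNIV}"
    "(\<Pi>\<^sub>E i\<in>UNIV. B i) \<subseteq> T" by auto
  let ?I = "{i. B i \<noteq> UNIV}"
  have "\<exists>e>0. \<forall>t. \<bar>t - x i\<bar> < e \<longrightarrow> t \<in> B i" for i
  proof -
    have "x i \<in> B i" using B(1) by (auto simp: PiE_iff)
    then show ?thesis using B(2)[of i] unfolding open_dist dist_real_def by blast
  qed
  then obtain e where e: "\<And>i. e i > 0" "\<And>i t. \<bar>t - x i\<bar> < e i \<Longrightarrow> t \<in> B i" by metis
  define \<epsilon> where "\<epsilon> = Min (insert 1 (e ` ?I))"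
  have \<epsilon>: "\<epsilon> > 0" "\<And>i. i \<in> ?I \<Longrightarrow> \<epsilon> \<le> e i"
    using B(3) e(1) by (auto simp: \<epsilon>_def)
  show thesis
  proof (rule that[OF B(3) \<epsilon>(1)])
    fix y assume y: "\<And>i. i \<in> ?I \<Longrightarrow> \<bar>y i - x i\<bar> < \<epsilon>"
    have "y i \<in> B i" for i
    proof (cases "i \<in> ?I")
      case True
      then have "\<bar>y i - x i\<bar> < e i" using y[OF True] \<epsilon>(2)[OF True] by linarith
      then show ?thesis by (rule e(2))
    qed auto
    then show "y \<in> T" using B(4) by (auto simp: PiE_iff)
  qed
qed

lemma tendsto_fun_componentwise:
  fixes l :: "nat \<Rightarrow> real"
  assumes "\<And>i. ((\<lambda>t. f t i) \<longlongrightarrow> l i) \<F>"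
  shows "(f \<longlongrightarrow> l) \<F>"
proof (rule topological_tendstoI)
  fix T assume "open T" "l \<in> T"
  then obtain I \<epsilon> where I: "finite I" "\<epsilon> > 0" "\<And>y. (\<And>i. i \<in> I \<Longrightarrow> \<bar>y i - l i\<bar> < \<epsilon>) \<Longrightarrow> y \<in> T"
    by (rule open_fun_box) blast
  have "\<forall>\<^sub>F t in \<F>. \<forall>i\<in>I. \<bar>f t i - l i\<bar> < \<epsilon>"
    using assms I(1,2) by (auto simp: eventually_ball_finite_distrib tendsto_iff dist_real_def)
  then show "\<forall>\<^sub>F t in \<F>. f t \<in> T" by eventually_elim (rule I(3), simp)
qed

lemma openin_Euclidean_space_iff:
  "openin (Euclidean_space n) V \<longleftrightarrow> (\<exists>T. open T \<and> V = T \<inter> {x. \<forall>i\<ge>n. x i = 0})"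
  unfolding Euclidean_space_def euclidean_product_topology by (auto simp: openin_subtopology)

lemma Euclidean_open_box:
  assumes "openin (Euclidean_space n) V" "x \<in> V"
  obtains \<epsilon> where "\<epsilon> > 0"
    "\<And>y. (\<And>i. i < n \<Longrightarrow> \<bar>y i - x i\<bar> < \<epsilon>) \<Longrightarrow> (\<And>i. i \<ge> n \<Longrightarrow> y i = 0) \<Longrightarrow> y \<in> V"
proof -
  obtain T where T: "open T" "V = T \<inter> {x. \<forall>i\<ge>n. x i = 0}"
    using assms(1) unfolding openin_Euclidean_space_iff by blast
  have x: "x \<in> T" "\<And>i. i \<ge> n \<Longrightarrow> x i = 0" using assms(2) T by auto
  obtain I \<epsilon> where I: "finite I" "\<epsilon> > 0" "\<And>y. (\<And>i. i \<in> I \<Longrightarrow> \<bar>y i - x i\<bar> < \<epsilon>) \<Longrightarrow> y \<in> T"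
    using open_fun_box[OF T(1) x(1)] by metis
  show thesis
  proof (rule that[OF I(2)])
    fix y assume y: "\<And>i. i < n \<Longrightarrow> \<bar>y i - x i\<bar> < \<epsilon>" "\<And>i. i \<ge> n \<Longrightarrow> y i = 0"
    have "\<bar>y i - x i\<bar> < \<epsilon>" for i using y x(2) I(2) by (cases "i < n") auto
    then show "y \<in> V" unfolding T using I(3) y(2) by blast
  qed
qed

lemma Euclidean_zero: "openin (Euclidean_space n) V \<Longrightarrow> x \<in> V \<Longrightarrow> i \<ge> n \<Longrightarrow> x i = 0"
  unfolding openin_Euclidean_space_iff by auto

lemma eventually_upd_mem:
  assumes V: "openin (Euclidean_space n) V" "x \<in> V" and i: "i < n"
  shows "\<forall>\<^sub>F t in nhds (x i). x(i := t) \<in> V"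
proof -
  obtain \<epsilon> where \<epsilon>: "\<epsilon> > 0"
    "\<And>y. (\<And>i. i < n \<Longrightarrow> \<bar>y i - x i\<bar> < \<epsilon>) \<Longrightarrow> (\<And>i. i \<ge> n \<Longrightarrow> y i = 0) \<Longrightarrow> y \<in> V"
    by (rule Euclidean_open_box[OF V]) blast
  show ?thesis
    unfolding eventually_nhds_metric dist_real_def
    using \<epsilon> i Euclidean_zero[OF V] by (intro exI[of _ \<epsilon>]) auto
qed

subsection \<open>The algebra of smooth functions on an open set\<close>

text \<open>The relational form of \<open>pdiff\<close>: it carries the existence of the derivative,
  which a value of \<open>deriv\<close> alone does not.\<close>

definition has_pd :: "((nat \<Rightarrow> real) \<Rightarrow> real) \<Rightarrow> nat \<Rightarrow> (nat \<Rightarrow> real) \<Rightarrow> real \<Rightarrow> bool" where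
  "has_pd f i x D \<longleftrightarrow> ((\<lambda>t. f (x(i := t))) has_real_derivative D) (at (x i))"

lemma has_pd_imp_pdiff: "has_pd f i x D \<Longrightarrow> pdiff i f x = D"
  unfolding has_pd_def pdiff_def by (rule DERIV_imp_deriv)

lemma pdiffs_append: "pdiffs (is @ js) f = pdiffs is (pdiffs js f)"
  by (induction "is") simp_all

lemma smooth_RnD:
  assumes "smooth_Rn n V f"
  shows "continuous_on V f"
    and "x \<in> V \<Longrightarrow> i < n \<Longrightarrow> has_pd f i x (pdiff i f x)"
    and "i < n \<Longrightarrow> smooth_Rn n V (pdiff i f)"
proof -
  show "continuous_on V f" using assms unfolding smooth_Rn_def by (metis empty_subsetI list.set(1) pdiffs.simps(1))
  show "has_pd f i x (pdiff i f x)" if "x \<in> V" "i < n"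
  proof -
    have "(\<lambda>t. pdiffs [] f (x(i := t))) differentiable at (x i)"
      using assms that unfolding smooth_Rn_def by (metis empty_subsetI list.set(1))
    then show ?thesis unfolding has_pd_def pdiff_def by (simp add: DERIV_deriv_iff_real_differentiable)
  qed
  show "smooth_Rn n V (pdiff i f)" if "i < n"
    unfolding smooth_Rn_def
  proof (intro allI impI)
    fix "is" assume "set is \<subseteq> {..<n}"
    then have "set (is @ [i]) \<subseteq> {..<n}" using that by auto
    then show "continuous_on V (pdiffs is (pdiff i f)) \<and>
        (\<forall>x\<in>V. \<forall>j<n. (\<lambda>t. pdiffs is (pdiff i f) (x(j := t))) differentiable at (x j))"
      using assms unfolding smooth_Rn_def by (metis pdiffs_append pdiffs.simps)
  qed
qed

lemma has_pd_cong:
  assumes V: "openin (Euclidean_space n) V" "x \<in> V" "i < n" and eq: "\<And>y. y \<in> V \<Longrightarrow> f y = g y"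
  shows "has_pd f i x D \<longleftrightarrow> has_pd g i x D"
proof -
  have "\<forall>\<^sub>F t in nhds (x i). f (x(i := t)) = g (x(i := t))"
    using eventually_upd_mem[OF V] by eventually_elim (rule eq)
  then show ?thesis unfolding has_pd_def by (rule DERIV_cong_ev[OF refl _ refl])
qed

text \<open>A property that yields continuity and passes to partial derivatives implies smoothness.
  Derivatives need to agree with members of the class on \<open>V\<close> only, since values
  elsewhere are arbitrary.\<close>

lemma smooth_Rn_coinduct:
  assumes V: "openin (Euclidean_space n) V" and f: "S f"
    and step: "\<And>g. S g \<Longrightarrow> continuous_on V g \<and>
      (\<forall>i<n. \<exists>g'. S g' \<and> (\<forall>x\<in>V. has_pd g i x (g' x)))"
  shows "smooth_Rn n V f"
  unfolding smooth_Rn_def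
proof (intro allI impI)
  fix "is" assume "set is \<subseteq> {..<n}"
  then have "\<exists>g. S g \<and> (\<forall>x\<in>V. pdiffs is f x = g x)"
  proof (induction "is")
    case (Cons i "is")
    then obtain g where g: "S g" "\<forall>x\<in>V. pdiffs is f x = g x" and i: "i < n" by auto
    obtain g' where g': "S g'" "\<forall>x\<in>V. has_pd g i x (g' x)" using step[OF g(1)] i by blast
    have "has_pd (pdiffs is f) i x (g' x)" if "x \<in> V" for x
      using g' that has_pd_cong[OF V that i, of "pdiffs is f" g] g(2) by blast
    then have "\<forall>x\<in>V. pdiffs (i # is) f x = g' x" using has_pd_imp_pdiff by simp
    with g' show ?case by blast
  qed (use f in auto)
  then obtain g where g: "S g" "\<forall>x\<in>V. pdiffs is f x = g x" by blast
  note s = step[OF g(1)]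
  have "continuous_on V (pdiffs is f)" using s g(2) continuous_on_cong by metis
  moreover have "(\<lambda>t. pdiffs is f (x(i := t))) differentiable at (x i)" if x: "x \<in> V" "i < n" for x i
  proof -
    obtain g' where "\<forall>x\<in>V. has_pd g i x (g' x)" using s x by blast
    then have "has_pd (pdiffs is f) i x (g' x)"
      using x has_pd_cong[OF V x, of "pdiffs is f" g] g(2) by blast
    then show ?thesis unfolding has_pd_def by (auto simp: real_differentiable_def)
  qed
  ultimately show "continuous_on V (pdiffs is f) \<and>
      (\<forall>x\<in>V. \<forall>i<n. (\<lambda>t. pdiffs is f (x(i := t))) differentiable at (x i))" by blast
qed

lemma smooth_Rn_cong:
  assumes V: "openin (Euclidean_space n) V" and f: "smooth_Rn n V f" and eq: "\<And>x. x \<in> V \<Longrightarrow> g x = f x"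
  shows "smooth_Rn n V g"
proof (rule smooth_Rn_coinduct[OF V, of "\<lambda>g. \<exists>f. smooth_Rn n V f \<and> (\<forall>x\<in>V. g x = f x)"])
  fix g assume "\<exists>f. smooth_Rn n V f \<and> (\<forall>x\<in>V. g x = f x)"
  then obtain f where f: "smooth_Rn n V f" "\<forall>x\<in>V. g x = f x" by blast
  have "continuous_on V g" using smooth_RnD(1)[OF f(1)] f(2) continuous_on_cong by metis
  moreover have "has_pd g i x (pdiff i f x)" if "x \<in> V" "i < n" for x i
    using smooth_RnD(2)[OF f(1) that] has_pd_cong[OF V that, of g f] f(2) by blast
  ultimately show "continuous_on V g \<and> (\<forall>i<n. \<exists>g'. (\<exists>f. smooth_Rn n V f \<and> (\<forall>x\<in>V. g' x = f x)) \<and>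
      (\<forall>x\<in>V. has_pd g i x (g' x)))"
    using smooth_RnD(3)[OF f(1)] by blast
qed (use f eq in blast)

lemma smooth_Rn_subset: "smooth_Rn n V f \<Longrightarrow> V' \<subseteq> V \<Longrightarrow> smooth_Rn n V' f"
  unfolding smooth_Rn_def by (meson continuous_on_subset subsetD)

text \<open>The unital algebra generated by \<open>B\<close>. If the generators have their partial
  derivatives in this algebra then so have all elements, by the sum and product rules; this makes it
  a suitable class for \<open>smooth_Rn_coinduct\<close>.\<close>

inductive gen_alg :: "((nat \<Rightarrow> real) \<Rightarrow> real) set \<Rightarrow> ((nat \<Rightarrow> real) \<Rightarrow> real) \<Rightarrow> bool" for B where
  base: "f \<in> B \<Longrightarrow> gen_alg B f"
| const: "gen_alg B (\<lambda>x. c)"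
| add: "gen_alg B f \<Longrightarrow> gen_alg B g \<Longrightarrow> gen_alg B (\<lambda>x. f x + g x)"
| mult: "gen_alg B f \<Longrightarrow> gen_alg B g \<Longrightarrow> gen_alg B (\<lambda>x. f x * g x)"

lemma gen_alg_sum: "finite I \<Longrightarrow> (\<And>i. i \<in> I \<Longrightarrow> gen_alg B (f i)) \<Longrightarrow> gen_alg B (\<lambda>x. \<Sum>i\<in>I. f i x)"
  by (induction I rule: finite_induct) (auto intro: gen_alg.intros)

lemma gen_alg_prod: "finite I \<Longrightarrow> (\<And>i. i \<in> I \<Longrightarrow> gen_alg B (f i)) \<Longrightarrow> gen_alg B (\<lambda>x. \<Prod>i\<in>I. f i x)"
  by (induction I rule: finite_induct) (auto intro: gen_alg.intros)

lemma gen_alg_smooth: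
  assumes V: "openin (Euclidean_space n) V"
    and B: "\<And>f. f \<in> B \<Longrightarrow> continuous_on V f"
      "\<And>f i. f \<in> B \<Longrightarrow> i < n \<Longrightarrow> \<exists>f'. gen_alg B f' \<and> (\<forall>x\<in>V. has_pd f i x (f' x))"
    and f: "gen_alg B f"
  shows "smooth_Rn n V f"
proof (rule smooth_Rn_coinduct[OF V, of "gen_alg B", OF f])
  fix g assume "gen_alg B g"
  then show "continuous_on V g \<and> (\<forall>i<n. \<exists>g'. gen_alg B g' \<and> (\<forall>x\<in>V. has_pd g i x (g' x)))"
  proof induction
    case (base f)
    then show ?case using B by blast
  next
    case (const c)
    have "has_pd (\<lambda>x. c) i x 0" for i x unfolding has_pd_def by simp
    then show ?case using gen_alg.const[of B 0] by (auto intro!: exI[of _ "\<lambda>_. 0"])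
  next
    case (add f g)
    have "\<exists>g'. gen_alg B g' \<and> (\<forall>x\<in>V. has_pd (\<lambda>x. f x + g x) i x (g' x))" if i: "i < n" for i
    proof -
      obtain f' g' where "gen_alg B f'" "\<forall>x\<in>V. has_pd f i x (f' x)" "gen_alg B g'" "\<forall>x\<in>V. has_pd g i x (g' x)"
        using add.IH i by blast
      then show ?thesis
        by (intro exI[of _ "\<lambda>x. f' x + g' x"]) (auto simp: has_pd_def intro: gen_alg.add DERIV_add)
    qed
    then show ?case using add.IH by (auto intro: continuous_on_add)
  next
    case (mult f g)
    have "\<exists>g'. gen_alg B g' \<and> (\<forall>x\<in>V. has_pd (\<lambda>x. f x * g x) i x (g' x))" if i: "i < n" for i
    proof -
      obtain f' g' where fg: "gen_alg B f'" "\<forall>x\<in>V. has_pd f i x (f' x)" "gen_alg B g'" "\<forall>x\<in>V. has_pd g i x (g' x)"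
        using mult.IH i by blast
      have "gen_alg B (\<lambda>x. f' x * g x + g' x * f x)"
        using fg mult.hyps by (intro gen_alg.add gen_alg.mult)
      moreover have "has_pd (\<lambda>x. f x * g x) i x (f' x * g x + g' x * f x)" if "x \<in> V" for x
      proof -
        have "has_pd f i x (f' x)" "has_pd g i x (g' x)" using fg that by auto
        from DERIV_mult[OF this[unfolded has_pd_def]] show ?thesis unfolding has_pd_def by simp
      qed
      ultimately show ?thesis by blast
    qed
    then show ?case using mult.IH by (auto intro: continuous_on_mult)
  qed
qed

lemma smooth_Rn_gen_alg:
  assumes V: "openin (Euclidean_space n) V" and f: "gen_alg (Collect (smooth_Rn n V)) f"
  shows "smooth_Rn n V f"
proof (rule gen_alg_smooth[OF V _ _ f])
  fix f i assume f: "f \<in> Collect (smooth_Rn n V)"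
  then show "continuous_on V f" using smooth_RnD(1) by blast
  assume i: "i < n"
  show "\<exists>f'. gen_alg (Collect (smooth_Rn n V)) f' \<and> (\<forall>x\<in>V. has_pd f i x (f' x))"
    using f i smooth_RnD(2,3)[of n V f] by (intro exI[of _ "pdiff i f"]) (auto intro: gen_alg.base)
qed

lemma smooth_Rn_local:
  assumes V: "openin (Euclidean_space n) V"
    and loc: "\<And>x. x \<in> V \<Longrightarrow> \<exists>V'. openin (Euclidean_space n) V' \<and> x \<in> V' \<and> V' \<subseteq> V \<and> smooth_Rn n V' f"
  shows "smooth_Rn n V f"
  unfolding smooth_Rn_def
proof (intro allI impI conjI ballI)
  fix "is" assume sub: "set is \<subseteq> {..<n}"
  have "continuous (at x within V) (pdiffs is f)" if x: "x \<in> V" for x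
  proof -
    obtain V' where V': "openin (Euclidean_space n) V'" "x \<in> V'" "V' \<subseteq> V" "smooth_Rn n V' f"
      using loc[OF x] by blast
    obtain T where T: "open T" "V' = T \<inter> {x. \<forall>i\<ge>n. x i = 0}"
      using V'(1) unfolding openin_Euclidean_space_iff by blast
    have "V' = T \<inter> V" using T V' V Euclidean_zero by blast
    then have "at x within V = at x within V'"
      using T(1) V' by (intro at_within_nhd[of x T]) auto
    moreover have "continuous (at x within V') (pdiffs is f)"
      using V'(2,4) sub unfolding smooth_Rn_def continuous_on_eq_continuous_within by blast
    ultimately show ?thesis by simp
  qed
  then show "continuous_on V (pdiffs is f)" by (simp add: continuous_on_eq_continuous_within)
  fix x i assume "x \<in> V" "i < n"
  then show "(\<lambda>t. pdiffs is f (x(i := t))) differentiable at (x i)"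
    using loc[of x] sub unfolding smooth_Rn_def by blast
qed

lemma smooth_Rn_coord:
  assumes V: "openin (Euclidean_space n) V"
  shows "smooth_Rn n V (\<lambda>y. y j)"
proof (rule gen_alg_smooth[OF V, of "{\<lambda>y. y j}"])
  fix f :: "(nat \<Rightarrow> real) \<Rightarrow> real" and i assume f: "f \<in> {\<lambda>y. y j}"
  then show "continuous_on V f" by (auto intro: continuous_on_product_then_coordinatewise continuous_on_id)
  have "has_pd f i x (if i = j then 1 else 0)" for x using f by (auto simp: has_pd_def)
  then show "\<exists>f'. gen_alg {\<lambda>y. y j} f' \<and> (\<forall>x\<in>V. has_pd f i x (f' x))"
    using gen_alg.const[of "{\<lambda>y. y j}" "if i = j then 1 else 0"] by blast
qed (auto intro: gen_alg.base)

subsection \<open>The chain rule\<close>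

text \<open>The partial derivatives of \<open>f\<close> are continuous and the curve is
  differentiable in each coordinate. The increment of \<open>f\<close> along the curve is split into
  increments in one coordinate at a time, each of which is treated by the mean value
  theorem.\<close>

lemma chain_rule_curve:
  assumes W: "openin (Euclidean_space m) W" and f: "smooth_Rn m W f"
    and c0: "c t0 \<in> W" and cW: "\<forall>\<^sub>F t in nhds t0. c t \<in> W"
    and c': "\<And>j. j < m \<Longrightarrow> ((\<lambda>t. c t j) has_real_derivative c' j) (at t0)"
  shows "((\<lambda>t. f (c t)) has_real_derivative (\<Sum>j<m. pdiff j f (c t0) * c' j)) (at t0)"
proof -
  \<comment> \<open>The first \<open>k\<close> coordinates of \<open>mix k t\<close> move along the
    curve, the others stay at time \<open>t0\<close>; the induction on \<open>k\<close> releases one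
    coordinate at a time.\<close>
  define mix where "mix k t = (\<lambda>j. if j < k then c t j else c t0 j)" for k t
  obtain \<epsilon> where \<epsilon>: "\<epsilon> > 0"
    "\<And>y. (\<And>i. i < m \<Longrightarrow> \<bar>y i - c t0 i\<bar> < \<epsilon>) \<Longrightarrow> (\<And>i. i \<ge> m \<Longrightarrow> y i = 0) \<Longrightarrow> y \<in> W"
    by (rule Euclidean_open_box[OF W c0]) blast
  have lim: "((\<lambda>t. c t j) \<longlongrightarrow> c t0 j) (at t0)" if "j < m" for j
    using DERIV_isCont[OF c'[OF that]] by (simp add: isCont_def)
  have near: "\<forall>\<^sub>F t in at t0. \<forall>j<m. \<bar>c t j - c t0 j\<bar> < \<epsilon>"
  proof -
    have "\<forall>\<^sub>F t in at t0. \<bar>c t j - c t0 j\<bar> < \<epsilon>" if "j < m" for j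
      using lim[OF that] \<epsilon>(1) by (auto simp: tendsto_iff dist_real_def)
    then have "\<forall>\<^sub>F t in at t0. \<forall>j\<in>{..<m}. \<bar>c t j - c t0 j\<bar> < \<epsilon>"
      by (intro eventually_ball_finite) auto
    then show ?thesis by (rule eventually_mono) auto
  qed
  have zero: "c t0 j = 0" if "j \<ge> m" for j using Euclidean_zero[OF W c0 that] .
  have "((\<lambda>t. f (mix k t)) has_real_derivative (\<Sum>j<k. pdiff j f (c t0) * c' j)) (at t0)" if "k \<le> m" for k
    using that
  proof (induction k)
    case 0
    then show ?case by (simp add: mix_def)
  next
    case (Suc k)
    then have k: "k < m" by simp
    let ?g = "\<lambda>t. f (mix (Suc k) t) - f (mix k t)"
    have mk: "mix (Suc k) t = (mix k t)(k := c t k)" for t by (auto simp: mix_def fun_eq_iff)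
    have mk0: "mix k t = (mix k t)(k := c t0 k)" for t by (auto simp: mix_def fun_eq_iff)
    have "\<forall>\<^sub>F t in at t0. \<exists>z. z \<in> W \<and> ?g t = pdiff k f z * (c t k - c t0 k) \<and>
        (\<forall>j. \<bar>z j - c t0 j\<bar> \<le> (if j < m then \<bar>c t j - c t0 j\<bar> else 0))"
      using near
    proof eventually_elim
      case (elim t)
      have inW: "(mix k t)(k := s) \<in> W" if "\<bar>s - c t0 k\<bar> \<le> \<bar>c t k - c t0 k\<bar>" for s
      proof (rule \<epsilon>(2))
        have "\<bar>s - c t0 k\<bar> < \<epsilon>" using elim k that by fastforce
        then show "\<bar>((mix k t)(k := s)) i - c t0 i\<bar> < \<epsilon>" if "i < m" for i
          using that elim \<epsilon>(1) by (auto simp: mix_def)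
        show "((mix k t)(k := s)) i = 0" if "i \<ge> m" for i
          using that k zero by (auto simp: mix_def)
      qed
      define \<phi> where "\<phi> s = f ((mix k t)(k := s))" for s
      have d: "(\<phi> has_real_derivative pdiff k f ((mix k t)(k := s))) (at s)"
        if "\<bar>s - c t0 k\<bar> \<le> \<bar>c t k - c t0 k\<bar>" for s
        using smooth_RnD(2)[OF f inW[OF that] k] by (simp add: has_pd_def \<phi>_def[abs_def])
      have "\<exists>s. \<bar>s - c t0 k\<bar> \<le> \<bar>c t k - c t0 k\<bar> \<and>
          \<phi> (c t k) - \<phi> (c t0 k) = (c t k - c t0 k) * pdiff k f ((mix k t)(k := s))"
      proof -
        consider "c t k = c t0 k" | "c t0 k < c t k" | "c t k < c t0 k" by linarith
        then show ?thesis
        proof cases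
          case 1
          then show ?thesis by (intro exI[of _ "c t0 k"]) auto
        next
          case 2
          obtain s where "s > c t0 k" "s < c t k"
            "\<phi> (c t k) - \<phi> (c t0 k) = (c t k - c t0 k) * pdiff k f ((mix k t)(k := s))"
            using MVT2[OF 2, of \<phi> "\<lambda>s. pdiff k f ((mix k t)(k := s))"] d by auto
          then show ?thesis by (intro exI[of _ s]) auto
        next
          case 3
          obtain s where "s > c t k" "s < c t0 k"
            "\<phi> (c t0 k) - \<phi> (c t k) = (c t0 k - c t k) * pdiff k f ((mix k t)(k := s))"
            using MVT2[OF 3, of \<phi> "\<lambda>s. pdiff k f ((mix k t)(k := s))"] d by auto
          then show ?thesis by (intro exI[of _ s]) (auto simp: algebra_simps)
        qed
      qed
      then obtain s where s: "\<bar>s - c t0 k\<bar> \<le> \<bar>c t k - c t0 k\<bar>"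
        "\<phi> (c t k) - \<phi> (c t0 k) = (c t k - c t0 k) * pdiff k f ((mix k t)(k := s))" by blast
      have "?g t = \<phi> (c t k) - \<phi> (c t0 k)"
        unfolding \<phi>_def mk[symmetric] mk0[symmetric] ..
      then show ?case
        using inW[OF s(1)] s k by (intro exI[of _ "(mix k t)(k := s)"]) (auto simp: mix_def)
    qed
    \<comment> \<open>The intermediate points of the mean value theorem are chosen as a function of
      \<open>t\<close>. Coordinatewise they are no farther from \<open>c t0\<close> than the curve
      is, so they converge to \<open>c t0\<close>.\<close>
    then have "\<exists>\<zeta>. \<forall>\<^sub>F t in at t0. \<zeta> t \<in> W \<and> ?g t = pdiff k f (\<zeta> t) * (c t k - c t0 k) \<and>
        (\<forall>j. \<bar>\<zeta> t j - c t0 j\<bar> \<le> (if j < m then \<bar>c t j - c t0 j\<bar> else 0))"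
      by (subst (asm) eventually_ex) 
    then obtain \<zeta> where \<zeta>: "\<forall>\<^sub>F t in at t0. \<zeta> t \<in> W \<and> ?g t = pdiff k f (\<zeta> t) * (c t k - c t0 k) \<and>
        (\<forall>j. \<bar>\<zeta> t j - c t0 j\<bar> \<le> (if j < m then \<bar>c t j - c t0 j\<bar> else 0))" by blast
    have \<zeta>_lim: "(\<zeta> \<longlongrightarrow> c t0) (at t0)"
    proof (rule tendsto_fun_componentwise)
      fix j
      have b: "((\<lambda>t. if j < m then \<bar>c t j - c t0 j\<bar> else 0) \<longlongrightarrow> 0) (at t0)"
      proof (cases "j < m")
        case True
        then show ?thesis using tendsto_rabs[OF tendsto_diff[OF lim[OF True] tendsto_const[of "c t0 j"]]] by simp
      qed simp
      have "((\<lambda>t. \<zeta> t j - c t0 j) \<longlongrightarrow> 0) (at t0)"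
        by (rule Lim_null_comparison[OF _ b]) (use \<zeta> in eventually_elim, auto)
      then show "((\<lambda>t. \<zeta> t j) \<longlongrightarrow> c t0 j) (at t0)" by (simp add: LIM_zero_iff)
    qed
    have pl: "((\<lambda>t. pdiff k f (\<zeta> t)) \<longlongrightarrow> pdiff k f (c t0)) (at t0)"
      by (rule continuous_on_tendsto_compose[OF smooth_RnD(1)[OF smooth_RnD(3)[OF f k]] \<zeta>_lim c0])
         (use \<zeta> in eventually_elim, auto)
    have q: "((\<lambda>t. (c t k - c t0 k) / (t - t0)) \<longlongrightarrow> c' k) (at t0)"
      using c'[OF k] by (simp add: has_field_derivative_iff)
    have "((\<lambda>t. (?g t - ?g t0) / (t - t0)) \<longlongrightarrow> pdiff k f (c t0) * c' k) (at t0)"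
    proof (rule Lim_transform_eventually[OF tendsto_mult[OF pl q]])
      have "?g t0 = 0" by (simp add: mix_def)
      then show "\<forall>\<^sub>F t in at t0. pdiff k f (\<zeta> t) * ((c t k - c t0 k) / (t - t0)) = (?g t - ?g t0) / (t - t0)"
        using \<zeta> by (auto elim!: eventually_mono)
    qed
    then have "(?g has_real_derivative pdiff k f (c t0) * c' k) (at t0)"
      by (simp add: has_field_derivative_iff)
    from DERIV_add[OF this Suc.IH[OF less_imp_le[OF k]]] show ?case by (simp add: add.commute)
  qed
  from this[of m] have "((\<lambda>t. f (mix m t)) has_real_derivative (\<Sum>j<m. pdiff j f (c t0) * c' j)) (at t0)"
    by simp
  moreover have "\<forall>\<^sub>F t in nhds t0. f (mix m t) = f (c t)"
    using cW
  proof eventually_elim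
    case (elim t)
    have "mix m t = c t"
      using zero Euclidean_zero[OF W elim] by (auto simp: mix_def fun_eq_iff not_less)
    then show ?case by simp
  qed
  ultimately show ?thesis by (subst (asm) DERIV_cong_ev[OF refl _ refl])
qed

lemma chain_rule_pd:
  assumes W: "openin (Euclidean_space m) W" "smooth_Rn m W f"
    and V: "openin (Euclidean_space n) V" "x \<in> V" "i < n"
    and h: "\<And>y. y \<in> V \<Longrightarrow> h y \<in> W" "\<And>j. j < m \<Longrightarrow> smooth_Rn n V (\<lambda>y. h y j)"
  shows "has_pd (\<lambda>y. f (h y)) i x (\<Sum>j<m. pdiff j f (h x) * pdiff i (\<lambda>y. h y j) x)"
proof -
  have "((\<lambda>t. f (h (x(i := t)))) has_real_derivative
      (\<Sum>j<m. pdiff j f (h (x(i := x i))) * pdiff i (\<lambda>y. h y j) x)) (at (x i))"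
  proof (rule chain_rule_curve[OF W])
    show "h (x(i := x i)) \<in> W" using h(1)[OF V(2)] by simp
    show "\<forall>\<^sub>F t in nhds (x i). h (x(i := t)) \<in> W"
      using eventually_upd_mem[OF V] by eventually_elim (rule h(1))
    show "((\<lambda>t. h (x(i := t)) j) has_real_derivative pdiff i (\<lambda>y. h y j) x) (at (x i))" if "j < m" for j
      using smooth_RnD(2)[OF h(2)[OF that] V(2,3)] by (simp add: has_pd_def)
  qed
  then show ?thesis by (simp add: has_pd_def)
qed

text \<open>The algebra generated by the smooth functions on \<open>V\<close> and by all composites
  with \<open>h\<close> is closed under partial derivatives, by the chain rule. Taking all outer
  functions at once replaces an induction over the order of differentiation.\<close>

lemma smooth_Rn_compose:
  assumes W: "openin (Euclidean_space m) W" "smooth_Rn m W f"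
    and V: "openin (Euclidean_space n) V"
    and h: "\<And>y. y \<in> V \<Longrightarrow> h y \<in> W" "\<And>j. j < m \<Longrightarrow> smooth_Rn n V (\<lambda>y. h y j)"
  shows "smooth_Rn n V (\<lambda>y. f (h y))"
proof -
  let ?B = "Collect (smooth_Rn n V) \<union> {(\<lambda>y. f (h y)) | f. smooth_Rn m W f}"
  have hc: "continuous_on V h"
  proof (rule continuous_on_coordinatewise_then_product)
    fix j
    show "continuous_on V (\<lambda>y. h y j)"
    proof (cases "j < m")
      case True
      then show ?thesis by (rule smooth_RnD(1)[OF h(2)])
    next
      case False
      then have "h y j = 0" if "y \<in> V" for y using Euclidean_zero[OF W(1) h(1)[OF that]] by simp
      then show ?thesis by (simp cong: continuous_on_cong)
    qed
  qed
  show ?thesis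
  proof (rule gen_alg_smooth[OF V, of ?B])
    fix g assume g: "g \<in> ?B"
    show "continuous_on V g"
      using g
    proof
      assume "g \<in> {(\<lambda>y. f (h y)) | f. smooth_Rn m W f}"
      then obtain f where f: "g = (\<lambda>y. f (h y))" "smooth_Rn m W f" by blast
      show ?thesis unfolding f(1)
        by (rule continuous_on_compose2[OF smooth_RnD(1)[OF f(2)] hc]) (use h(1) in blast)
    qed (use smooth_RnD(1) in blast)
    fix i assume i: "i < n"
    show "\<exists>f'. gen_alg ?B f' \<and> (\<forall>x\<in>V. has_pd g i x (f' x))"
      using g
    proof
      assume "g \<in> Collect (smooth_Rn n V)"
      then show ?thesis
        using smooth_RnD(2,3)[of n V g] i by (intro exI[of _ "pdiff i g"]) (auto intro: gen_alg.base)
    next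
      assume "g \<in> {(\<lambda>y. f (h y)) | f. smooth_Rn m W f}"
      then obtain f where f: "g = (\<lambda>y. f (h y))" "smooth_Rn m W f" by blast
      have "gen_alg ?B (\<lambda>x. \<Sum>j<m. pdiff j f (h x) * pdiff i (\<lambda>y. h y j) x)"
      proof (intro gen_alg_sum gen_alg.mult gen_alg.base finite_lessThan)
        fix j assume "j \<in> {..<m}"
        then have j: "j < m" by simp
        show "(\<lambda>x. pdiff j f (h x)) \<in> ?B" using smooth_RnD(3)[OF f(2) j] by blast
        show "pdiff i (\<lambda>y. h y j) \<in> ?B" using smooth_RnD(3)[OF h(2)[OF j] i] by blast
      qed
      moreover have "has_pd g i x (\<Sum>j<m. pdiff j f (h x) * pdiff i (\<lambda>y. h y j) x)" if "x \<in> V" for x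
        unfolding f(1) by (rule chain_rule_pd[OF W(1) f(2) V that i h])
      ultimately show ?thesis by blast
    qed
  qed (use W(2) in \<open>auto intro: gen_alg.base\<close>)
qed

subsection \<open>Symmetry of second derivatives\<close>

text \<open>The mean value theorem in direction \<open>i\<close>, applied to a difference in
  direction \<open>j\<close>, and then once more in direction \<open>j\<close>, turns the second
  difference over a square of side \<delta> into a mixed derivative at a point of that
  square.\<close>

lemma mixed_difference:
  assumes f: "smooth_Rn n V f" and ij: "i < n" "j < n" "i \<noteq> j" and \<delta>: "\<delta> > 0"
    and box: "\<And>s t. x i \<le> s \<Longrightarrow> s \<le> x i + \<delta> \<Longrightarrow> x j \<le> t \<Longrightarrow> t \<le> x j + \<delta> \<Longrightarrow> x(i := s, j := t) \<in> V"
  obtains s t where "x i \<le> s" "s \<le> x i + \<delta>" "x j \<le> t" "t \<le> x j + \<delta>"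
    "f (x(i := x i + \<delta>, j := x j + \<delta>)) - f (x(i := x i + \<delta>)) - f (x(j := x j + \<delta>)) + f x =
      \<delta> * (\<delta> * pdiff j (pdiff i f) (x(i := s, j := t)))"
proof -
  define g where "g s t = f (x(i := s, j := t))" for s t
  have upd: "(x(i := s, j := t))(i := u) = x(i := u, j := t)" "(x(i := s, j := t))(j := u) = x(i := s, j := u)"
    for s t u using ij by (auto simp: fun_eq_iff)
  have gi: "((\<lambda>s. g s t) has_real_derivative pdiff i f (x(i := s, j := t))) (at s)"
    if "x i \<le> s" "s \<le> x i + \<delta>" "x j \<le> t" "t \<le> x j + \<delta>" for s t
    using smooth_RnD(2)[OF f box[OF that] ij(1)] ij by (simp add: has_pd_def g_def upd)
  have gj: "((\<lambda>t. pdiff i f (x(i := s, j := t))) has_real_derivative pdiff j (pdiff i f) (x(i := s, j := t))) (at t)"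
    if "x i \<le> s" "s \<le> x i + \<delta>" "x j \<le> t" "t \<le> x j + \<delta>" for s t
    using smooth_RnD(2)[OF smooth_RnD(3)[OF f ij(1)] box[OF that] ij(2)] ij by (simp add: has_pd_def upd)
  have "x i < x i + \<delta>" "x j < x j + \<delta>" using \<delta> by auto
  have "((\<lambda>s. g s (x j + \<delta>) - g s (x j)) has_real_derivative
      pdiff i f (x(i := s, j := x j + \<delta>)) - pdiff i f (x(i := s, j := x j))) (at s)"
    if "x i \<le> s" "s \<le> x i + \<delta>" for s
    by (rule DERIV_diff) (use gi that \<delta> in auto)
  then obtain s where s: "s > x i" "s < x i + \<delta>"
    "(g (x i + \<delta>) (x j + \<delta>) - g (x i + \<delta>) (x j)) - (g (x i) (x j + \<delta>) - g (x i) (x j)) =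
      (x i + \<delta> - x i) * (pdiff i f (x(i := s, j := x j + \<delta>)) - pdiff i f (x(i := s, j := x j)))"
    using MVT2[OF \<open>x i < x i + \<delta>\<close>, of "\<lambda>s. g s (x j + \<delta>) - g s (x j)"
      "\<lambda>s. pdiff i f (x(i := s, j := x j + \<delta>)) - pdiff i f (x(i := s, j := x j))"]
      by blast
  obtain t where t: "t > x j" "t < x j + \<delta>"
    "pdiff i f (x(i := s, j := x j + \<delta>)) - pdiff i f (x(i := s, j := x j)) =
      (x j + \<delta> - x j) * pdiff j (pdiff i f) (x(i := s, j := t))"
    using MVT2[OF \<open>x j < x j + \<delta>\<close>, of "\<lambda>t. pdiff i f (x(i := s, j := t))"
      "\<lambda>t. pdiff j (pdiff i f) (x(i := s, j := t))"] gj s by auto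
  have e: "x(i := u, j := x j) = x(i := u)" "x(i := x i, j := v) = x(j := v)" for u v
    using ij by (auto simp: fun_eq_iff)
  show thesis
    using that[of s t] s t by (simp add: g_def e algebra_simps)
qed

text \<open>The second difference is symmetric in the two directions. So in every small square one
  mixed derivative at some point equals the other one at some other point, and continuity gives
  equality at the corner \<open>x\<close>.\<close>

lemma pdiff_commute:
  assumes V: "openin (Euclidean_space n) V" "x \<in> V" and f: "smooth_Rn n V f" and ij: "i < n" "j < n"
  shows "pdiff i (pdiff j f) x = pdiff j (pdiff i f) x"
proof (cases "i = j")
  case False
  obtain \<epsilon> where \<epsilon>: "\<epsilon> > 0"
    "\<And>y. (\<And>i. i < n \<Longrightarrow> \<bar>y i - x i\<bar> < \<epsilon>) \<Longrightarrow> (\<And>i. i \<ge> n \<Longrightarrow> y i = 0) \<Longrightarrow> y \<in> V"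
    by (rule Euclidean_open_box[OF V]) blast
  \<comment> \<open>The shift by 2 makes \<open>\<delta> k < \<epsilon>\<close> already for
    \<open>k = 0\<close>, so that all the squares stay inside \<open>V\<close>.\<close>
  define \<delta> where "\<delta> k = \<epsilon> / real (k + 2)" for k
  have \<delta>: "\<delta> k > 0" "\<delta> k < \<epsilon>" for k using \<epsilon>(1) by (auto simp: \<delta>_def field_simps add_pos_nonneg)
  have \<delta>_lim: "\<delta> \<longlonglongrightarrow> 0"
    unfolding \<delta>_def using LIMSEQ_ignore_initial_segment[OF lim_const_over_n[of \<epsilon>], of 2] by simp
  have box: "x(i := s, j := t) \<in> V"
    if "x i \<le> s" "s \<le> x i + \<delta> k" "x j \<le> t" "t \<le> x j + \<delta> k" for s t k
    by (rule \<epsilon>(2)) (use that \<delta>[of k] ij Euclidean_zero[OF V] in auto)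
  have ex: "\<exists>s t s' t'. x i \<le> s \<and> s \<le> x i + \<delta> k \<and> x j \<le> t \<and> t \<le> x j + \<delta> k \<and>
      x i \<le> s' \<and> s' \<le> x i + \<delta> k \<and> x j \<le> t' \<and> t' \<le> x j + \<delta> k \<and>
      pdiff j (pdiff i f) (x(i := s, j := t)) = pdiff i (pdiff j f) (x(i := s', j := t'))" for k
  proof -
    obtain s t where 1: "x i \<le> s" "s \<le> x i + \<delta> k" "x j \<le> t" "t \<le> x j + \<delta> k"
      "f (x(i := x i + \<delta> k, j := x j + \<delta> k)) - f (x(i := x i + \<delta> k)) - f (x(j := x j + \<delta> k)) + f x =
        \<delta> k * (\<delta> k * pdiff j (pdiff i f) (x(i := s, j := t)))"
      by (rule mixed_difference[OF f ij False \<delta>(1)[of k] box[of _ k]])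
    have box': "x(j := t, i := s) \<in> V"
      if "x j \<le> t" "t \<le> x j + \<delta> k" "x i \<le> s" "s \<le> x i + \<delta> k" for s t
      using box[OF that(3,4,1,2)] False by (simp add: fun_upd_twist)
    obtain s' t' where 2: "x j \<le> t'" "t' \<le> x j + \<delta> k" "x i \<le> s'" "s' \<le> x i + \<delta> k"
      "f (x(j := x j + \<delta> k, i := x i + \<delta> k)) - f (x(j := x j + \<delta> k)) - f (x(i := x i + \<delta> k)) + f x =
        \<delta> k * (\<delta> k * pdiff i (pdiff j f) (x(j := t', i := s')))"
      by (rule mixed_difference[OF f ij(2,1) False[symmetric] \<delta>(1)[of k] box'])
    have "\<delta> k * (\<delta> k * pdiff j (pdiff i f) (x(i := s, j := t))) =
        \<delta> k * (\<delta> k * pdiff i (pdiff j f) (x(i := s', j := t')))"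
      using 1(5) 2(5) unfolding fun_upd_twist[OF False[symmetric], of x] by linarith
    then have "pdiff j (pdiff i f) (x(i := s, j := t)) = pdiff i (pdiff j f) (x(i := s', j := t'))"
      using \<delta>(1)[of k] by simp
    with 1 2 show ?thesis by blast
  qed
  obtain s t s' t' where st: "\<And>k. x i \<le> s k" "\<And>k. s k \<le> x i + \<delta> k" "\<And>k. x j \<le> t k" "\<And>k. t k \<le> x j + \<delta> k"
      "\<And>k. x i \<le> s' k" "\<And>k. s' k \<le> x i + \<delta> k" "\<And>k. x j \<le> t' k" "\<And>k. t' k \<le> x j + \<delta> k"
      "\<And>k. pdiff j (pdiff i f) (x(i := s k, j := t k)) = pdiff i (pdiff j f) (x(i := s' k, j := t' k))"
    using ex by metis
  have sq: "u \<longlonglongrightarrow> a" if "\<And>k. a \<le> u k" "\<And>k. u k \<le> a + \<delta> k" for u and a :: real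
  proof (rule tendsto_sandwich[OF _ _ tendsto_const[of a]])
    show "(\<lambda>k. a + \<delta> k) \<longlonglongrightarrow> a" using tendsto_add[OF tendsto_const[of a] \<delta>_lim] by simp
  qed (use that in auto)
  have pt: "(\<lambda>k. x(i := u k, j := v k)) \<longlonglongrightarrow> x" if "u \<longlonglongrightarrow> x i" "v \<longlonglongrightarrow> x j" for u v
  proof (rule tendsto_fun_componentwise)
    show "(\<lambda>k. (x(i := u k, j := v k)) l) \<longlonglongrightarrow> x l" for l
      using that by (cases "l = j"; cases "l = i") auto
  qed
  have inV: "x(i := s k, j := t k) \<in> V" "x(i := s' k, j := t' k) \<in> V" for k
    by (rule box[OF st(1-4)], rule box[OF st(5-8)])
  have "(\<lambda>k. pdiff j (pdiff i f) (x(i := s k, j := t k))) \<longlonglongrightarrow> pdiff j (pdiff i f) x"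
    by (rule continuous_on_tendsto_compose[OF smooth_RnD(1)[OF smooth_RnD(3)[OF smooth_RnD(3)[OF f ij(1)] ij(2)]]
          pt[OF sq sq] V(2)]) (auto simp: st inV)
  moreover have "(\<lambda>k. pdiff i (pdiff j f) (x(i := s' k, j := t' k))) \<longlonglongrightarrow> pdiff i (pdiff j f) x"
    by (rule continuous_on_tendsto_compose[OF smooth_RnD(1)[OF smooth_RnD(3)[OF smooth_RnD(3)[OF f ij(2)] ij(1)]]
          pt[OF sq sq] V(2)]) (auto simp: st inV)
  ultimately show ?thesis unfolding st(9) by (rule LIMSEQ_unique[symmetric])
qed simp

subsection \<open>Bump functions\<close>

text \<open>For \<open>k = 0\<close> this is the standard smooth function that is flat at 0. The
  whole family is used because derivatives of its members are linear combinations of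
  members.\<close>

definition flat :: "nat \<Rightarrow> real \<Rightarrow> real" where
  "flat k t = (if t > 0 then (1 / t) ^ k * exp (- (1 / t)) else 0)"

lemma flat_DERIV: "(flat k has_real_derivative - real k * flat (Suc k) t + flat (k + 2) t) (at t)"
proof -
  consider "t < 0" | "t = 0" | "t > 0" by linarith
  then show ?thesis
  proof cases
    case 1
    then have "\<forall>\<^sub>F s in nhds t. flat k s = 0"
      using eventually_nhds_in_open[of "{..<0}" t] by (auto elim!: eventually_mono simp: flat_def)
    moreover have "((\<lambda>_. 0) has_real_derivative 0) (at t)" by simp
    ultimately show ?thesis using 1 by (subst DERIV_cong_ev[OF refl _ refl]) (auto simp: flat_def)
  next
    case 3
    then have "\<forall>\<^sub>F s in nhds t. flat k s = (1 / s) ^ k * exp (- (1 / s))"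
      using eventually_nhds_in_open[of "{0<..}" t] by (auto elim!: eventually_mono simp: flat_def)
    moreover have "((\<lambda>s. (1 / s) ^ k * exp (- (1 / s))) has_real_derivative
        - real k * flat (Suc k) t + flat (k + 2) t) (at t)"
      by (rule derivative_eq_intros refl | use 3 in \<open>simp; fail\<close>)+
         (use 3 in \<open>cases k; simp add: flat_def field_simps power2_eq_square\<close>)
    ultimately show ?thesis by (subst DERIV_cong_ev[OF refl _ refl])
  next
    case 2
    \<comment> \<open>In terms of \<open>y = 1 / s\<close> the difference quotient at 0 from the
      right is \<open>y ^ (k + 1) / exp y\<close>.\<close>
    have lim: "((\<lambda>y::real. y ^ (k + 1) / exp y) \<longlongrightarrow> 0) at_top" by (rule tendsto_power_div_exp_0)
    have "((\<lambda>s::real. inverse s ^ (k + 1) / exp (inverse s)) \<longlongrightarrow> 0) (at_right 0)"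
      by (rule filterlim_compose[OF lim filterlim_inverse_at_top_right])
    then have r: "((\<lambda>s. flat k s / s) \<longlongrightarrow> 0) (at_right 0)"
      by (rule Lim_transform_eventually)
         (auto simp: eventually_at_right_field flat_def exp_minus field_simps intro!: exI[of _ 1])
    have l: "((\<lambda>s. flat k s / s) \<longlongrightarrow> 0) (at_left 0)"
      by (rule Lim_transform_eventually[OF tendsto_const])
         (auto simp: eventually_at_left_field flat_def intro!: exI[of _ "-1"])
    have "((\<lambda>s. flat k s / s) \<longlongrightarrow> 0) (at 0)" using filterlim_split_at[OF l r] .
    then show ?thesis using 2 by (simp add: has_field_derivative_iff flat_def)
  qed
qed

lemma smooth_flat_prod:
  fixes x :: "nat \<Rightarrow> real"
  assumes V: "openin (Euclidean_space n) V" and "finite I"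
  shows "smooth_Rn n V (\<lambda>y. \<Prod>i\<in>I. flat 0 (\<epsilon> + (y i - x i)) * flat 0 (\<epsilon> - (y i - x i)))"
proof -
  \<comment> \<open>The generators are flat functions of affine functions of one coordinate; the
    index \<open>k\<close> and the coefficients vary, so their derivatives stay in the generated
    algebra.\<close>
  define B where "B = {(\<lambda>y::nat \<Rightarrow> real. flat k (a + b * y i)) | k a b i. True}"
  show ?thesis
  proof (rule gen_alg_smooth[OF V, of B])
    fix g assume "g \<in> B"
    then obtain k a b j where g: "g = (\<lambda>y. flat k (a + b * y j))" unfolding B_def by blast
    have "continuous_on UNIV (flat k)"
      by (intro continuous_at_imp_continuous_on ballI DERIV_isCont[OF flat_DERIV])
    moreover have "continuous_on V (\<lambda>y. a + b * y j)"
      by (intro continuous_intros continuous_on_product_then_coordinatewise[OF continuous_on_id])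
    ultimately show "continuous_on V g" unfolding g
      using continuous_on_compose2[of UNIV "flat k" V "\<lambda>y. a + b * y j"] by simp
    fix i
    have "has_pd g i x (if i = j then b * (- real k * flat (Suc k) (a + b * x j) + flat (k + 2) (a + b * x j)) else 0)" for x
    proof (cases "i = j")
      case True
      have "((\<lambda>t. a + b * t) has_real_derivative b) (at (x j))" by (auto intro!: derivative_eq_intros)
      from DERIV_chain2[OF flat_DERIV this] show ?thesis
        using True by (simp add: has_pd_def g mult.commute)
    qed (simp add: has_pd_def g)
    moreover have "gen_alg B (\<lambda>x. if i = j then b * (- real k * flat (Suc k) (a + b * x j) + flat (k + 2) (a + b * x j)) else 0)"
    proof (cases "i = j")
      case True
      have "(\<lambda>x. flat l (a + b * x j)) \<in> B" for l unfolding B_def by blast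
      then have "gen_alg B (\<lambda>x. b * (- real k * flat (Suc k) (a + b * x j) + flat (k + 2) (a + b * x j)))"
        by (intro gen_alg.mult gen_alg.add gen_alg.const gen_alg.base)
      then show ?thesis using True by simp
    qed (simp add: gen_alg.const)
    ultimately show "\<exists>f'. gen_alg B f' \<and> (\<forall>x\<in>V. has_pd g i x (f' x))" by blast
  next
    have "(\<lambda>y. flat 0 (\<epsilon> + (y i - x i))) \<in> B" "(\<lambda>y. flat 0 (\<epsilon> - (y i - x i))) \<in> B" for i
      unfolding B_def
      by (rule CollectI, rule exI[of _ 0], rule exI[of _ "\<epsilon> - x i"], rule exI[of _ 1], force simp: algebra_simps)
         (rule CollectI, rule exI[of _ 0], rule exI[of _ "\<epsilon> + x i"], rule exI[of _ "-1"], force simp: algebra_simps)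
    then show "gen_alg B (\<lambda>y. \<Prod>i\<in>I. flat 0 (\<epsilon> + (y i - x i)) * flat 0 (\<epsilon> - (y i - x i)))"
      using assms(2) by (intro gen_alg_prod gen_alg.mult gen_alg.base) auto
  qed
qed


lemma smooth_Rn_intros:
  assumes "openin (Euclidean_space n) V"
  shows "smooth_Rn n V (\<lambda>x. c)"
    and "smooth_Rn n V f \<Longrightarrow> smooth_Rn n V g \<Longrightarrow> smooth_Rn n V (\<lambda>x. f x + g x)"
    and "smooth_Rn n V f \<Longrightarrow> smooth_Rn n V g \<Longrightarrow> smooth_Rn n V (\<lambda>x. f x * g x)"
  by (rule smooth_Rn_gen_alg[OF assms], auto intro: gen_alg.intros)+

subsection \<open>Charts\<close>

lemma chartD:
  assumes "topological_chart n (U, \<phi>)"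
  shows "open U" "x \<in> U \<Longrightarrow> inv_into U \<phi> (\<phi> x) = x" "continuous_on (\<phi> ` U) (inv_into U \<phi>)"
  using assms by (auto simp: topological_chart_def homeomorphism_def)

lemma chart_image_open:
  assumes c: "topological_chart n (U, \<phi>)" and W: "open W" "W \<subseteq> U"
  shows "openin (Euclidean_space n) (\<phi> ` W)"
proof -
  let ?E = "{x :: nat \<Rightarrow> real. \<forall>i\<ge>n. x i = 0}"
  have E: "Euclidean_space n = top_of_set ?E"
    by (simp add: Euclidean_space_def euclidean_product_topology)
  have "openin (top_of_set U) W" using W by (simp add: openin_open_eq chartD(1)[OF c])
  then have "openin (top_of_set (\<phi> ` U)) (\<phi> ` W)"
    using c by (auto simp: topological_chart_def intro: homeomorphism_imp_open_map)
  moreover have "openin (top_of_set ?E) (\<phi> ` U)" using c by (simp add: topological_chart_def E)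
  ultimately show ?thesis unfolding E by (rule openin_trans)
qed

lemma chart_pd_cong:
  assumes c: "topological_chart n (U, \<phi>)" and W: "open W" "W \<subseteq> U" "x \<in> W" and i: "i < n"
    and eq: "\<And>y. y \<in> W \<Longrightarrow> f y = g y"
  shows "chart_pd (U, \<phi>) i f x = chart_pd (U, \<phi>) i g x"
  unfolding chart_pd_def prod.case pdiff_def
proof (rule deriv_cong_ev[OF _ refl])
  show "\<forall>\<^sub>F t in nhds (\<phi> x i). f (inv_into U \<phi> ((\<phi> x)(i := t))) = g (inv_into U \<phi> ((\<phi> x)(i := t)))"
    using eventually_upd_mem[OF chart_image_open[OF c W(1,2)] imageI[OF W(3)] i]
  proof eventually_elim
    case (elim t)
    then obtain z where "z \<in> W" "(\<phi> x)(i := t) = \<phi> z" by blast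
    then show ?case using chartD(2)[OF c] W(2) eq by auto
  qed
qed

locale smooth_atlas =
  fixes n :: nat and \<A> :: "'m::{t2_space,second_countable_topology} chart set"
  assumes manifold: "smooth_manifold n \<A>"
begin

abbreviation "sm \<equiv> smooth_on n \<A>"

lemma atlas_chart: "c \<in> \<A> \<Longrightarrow> topological_chart n c"
  using manifold by (simp add: smooth_manifold_def)

lemma atlas_cover: obtains U \<phi> where "(U, \<phi>) \<in> \<A>" "x \<in> U"
proof -
  have "x \<in> (\<Union>(U, \<phi>)\<in>\<A>. U)" using manifold by (simp add: smooth_manifold_def)
  then show thesis using that by blast
qed

lemma atlas_image_open: "open W \<Longrightarrow> (U, \<phi>) \<in> \<A> \<Longrightarrow> openin (Euclidean_space n) (\<phi> ` (U \<inter> W))"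
  using chart_image_open[OF atlas_chart, of U \<phi> "U \<inter> W"] chartD(1)[OF atlas_chart] by auto

lemma smI: "(\<And>U \<phi>. (U, \<phi>) \<in> \<A> \<Longrightarrow> smooth_Rn n (\<phi> ` (U \<inter> W)) (\<lambda>y. f (inv_into U \<phi> y))) \<Longrightarrow> sm W f"
  by (auto simp: smooth_on_def)

lemma smD: "sm W f \<Longrightarrow> (U, \<phi>) \<in> \<A> \<Longrightarrow> smooth_Rn n (\<phi> ` (U \<inter> W)) (\<lambda>y. f (inv_into U \<phi> y))"
  by (auto simp: smooth_on_def)

lemma sm_const: "open W \<Longrightarrow> sm W (\<lambda>x. c)"
  by (intro smI smooth_Rn_intros(1) atlas_image_open)

lemma sm_add: "open W \<Longrightarrow> sm W f \<Longrightarrow> sm W g \<Longrightarrow> sm W (\<lambda>x. f x + g x)"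
  by (rule smI, rule smooth_Rn_intros(2)[OF atlas_image_open]) (simp_all add: smD)

lemma sm_mult: "open W \<Longrightarrow> sm W f \<Longrightarrow> sm W g \<Longrightarrow> sm W (\<lambda>x. f x * g x)"
  by (rule smI, rule smooth_Rn_intros(3)[OF atlas_image_open]) (simp_all add: smD)

lemma sm_minus: "open W \<Longrightarrow> sm W f \<Longrightarrow> sm W (\<lambda>x. - f x)"
  using sm_mult[OF _ sm_const[of W "-1"], of f] by simp

lemma sm_diff: "open W \<Longrightarrow> sm W f \<Longrightarrow> sm W g \<Longrightarrow> sm W (\<lambda>x. f x - g x)"
  using sm_add[OF _ _ sm_minus] by force

lemma sm_sum: "open W \<Longrightarrow> (\<And>i. i \<in> I \<Longrightarrow> sm W (f i)) \<Longrightarrow> sm W (\<lambda>x. \<Sum>i\<in>I. f i x)"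
  by (induction I rule: infinite_finite_induct) (simp_all add: sm_const sm_add)

lemma sm_subset:
  assumes "sm W f" "W' \<subseteq> W"
  shows "sm W' f"
proof (rule smI)
  fix U \<phi> assume "(U, \<phi>) \<in> \<A>"
  then show "smooth_Rn n (\<phi> ` (U \<inter> W')) (\<lambda>y. f (inv_into U \<phi> y))"
    by (rule smooth_Rn_subset[OF smD[OF assms(1)]]) (use assms(2) in blast)
qed

lemma sm_cong:
  assumes W: "open W" and f: "sm W f" and eq: "\<And>x. x \<in> W \<Longrightarrow> g x = f x"
  shows "sm W g"
proof (rule smI, rule smooth_Rn_cong[OF atlas_image_open[OF W] smD[OF f]])
  fix U \<phi> y assume c: "(U, \<phi>) \<in> \<A>" and "y \<in> \<phi> ` (U \<inter> W)"
  then obtain z where "z \<in> U \<inter> W" "y = \<phi> z" by blast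
  then show "g (inv_into U \<phi> y) = f (inv_into U \<phi> y)"
    using chartD(2)[OF atlas_chart[OF c]] eq by simp
qed

lemma sm_local:
  assumes W: "open W" and loc: "\<And>x. x \<in> W \<Longrightarrow> \<exists>W'. open W' \<and> x \<in> W' \<and> sm W' f"
  shows "sm W f"
proof (rule smI, rule smooth_Rn_local[OF atlas_image_open[OF W]])
  fix U \<phi> y assume c: "(U, \<phi>) \<in> \<A>" and "y \<in> \<phi> ` (U \<inter> W)"
  then obtain z where z: "z \<in> U \<inter> W" "y = \<phi> z" by blast
  then obtain W' where W': "open W'" "z \<in> W'" "sm W' f" using loc by blast
  have "smooth_Rn n (\<phi> ` (U \<inter> (W \<inter> W'))) (\<lambda>y. f (inv_into U \<phi> y))"
    by (rule smooth_Rn_subset[OF smD[OF W'(3) c]]) blast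
  then show "\<exists>V'. openin (Euclidean_space n) V' \<and> y \<in> V' \<and> V' \<subseteq> \<phi> ` (U \<inter> W) \<and>
      smooth_Rn n V' (\<lambda>y. f (inv_into U \<phi> y))"
    using atlas_image_open[OF open_Int[OF W W'(1)] c] z W'
    by (intro exI[of _ "\<phi> ` (U \<inter> (W \<inter> W'))"]) auto
qed

lemma smooth_chartD:
  assumes "smooth_chart n \<A> (U, \<phi>)"
  shows "topological_chart n (U, \<phi>)"
    and "(U', \<phi>') \<in> \<A> \<Longrightarrow> j < n \<Longrightarrow> smooth_Rn n (\<phi> ` (U \<inter> U')) (\<lambda>y. \<phi>' (inv_into U \<phi> y) j)"
    and "(U', \<phi>') \<in> \<A> \<Longrightarrow> j < n \<Longrightarrow> smooth_Rn n (\<phi>' ` (U' \<inter> U)) (\<lambda>y. \<phi> (inv_into U' \<phi>' y) j)"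
  using assms by (auto simp: smooth_chart_def smooth_change_def)

text \<open>Smoothness is defined through the charts of the atlas; the two directions of
  \<open>smooth_change\<close> allow it to be tested in any compatible chart whose domain contains
  \<open>W\<close>. The forward direction is local, because no single chart of the atlas need cover
  \<open>W\<close>.\<close>

lemma sm_chart_iff:
  assumes c: "smooth_chart n \<A> (U, \<phi>)" and W: "open W" "W \<subseteq> U"
  shows "sm W f \<longleftrightarrow> smooth_Rn n (\<phi> ` W) (\<lambda>y. f (inv_into U \<phi> y))"
proof
  note tc = smooth_chartD(1)[OF c]
  assume f: "sm W f"
  show "smooth_Rn n (\<phi> ` W) (\<lambda>y. f (inv_into U \<phi> y))"
  proof (rule smooth_Rn_local[OF chart_image_open[OF tc W]])
    fix y assume "y \<in> \<phi> ` W"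
    then obtain x where x: "x \<in> W" "y = \<phi> x" by blast
    obtain U0 \<phi>0 where c0: "(U0, \<phi>0) \<in> \<A>" "x \<in> U0" by (rule atlas_cover)
    note tc0 = atlas_chart[OF c0(1)]
    have op: "openin (Euclidean_space n) (\<phi> ` (W \<inter> U0))"
      by (rule chart_image_open[OF tc]) (use W chartD(1)[OF tc0] in auto)
    have inv: "inv_into U \<phi> z \<in> W \<inter> U0" if "z \<in> \<phi> ` (W \<inter> U0)" for z
      using that chartD(2)[OF tc] W(2) by auto
    have "smooth_Rn n (\<phi> ` (W \<inter> U0)) (\<lambda>z. f (inv_into U0 \<phi>0 (\<phi>0 (inv_into U \<phi> z))))"
    proof (rule smooth_Rn_compose[OF atlas_image_open[OF W(1) c0(1)] smD[OF f c0(1)] op])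
      show "\<phi>0 (inv_into U \<phi> z) \<in> \<phi>0 ` (U0 \<inter> W)" if "z \<in> \<phi> ` (W \<inter> U0)" for z
        using inv[OF that] by blast
      show "smooth_Rn n (\<phi> ` (W \<inter> U0)) (\<lambda>z. \<phi>0 (inv_into U \<phi> z) j)" if "j < n" for j
        by (rule smooth_Rn_subset[OF smooth_chartD(2)[OF c c0(1) that]]) (use W(2) in auto)
    qed
    then have "smooth_Rn n (\<phi> ` (W \<inter> U0)) (\<lambda>z. f (inv_into U \<phi> z))"
      by (rule smooth_Rn_cong[OF op]) (use inv chartD(2)[OF tc0] in auto)
    then show "\<exists>V'. openin (Euclidean_space n) V' \<and> y \<in> V' \<and> V' \<subseteq> \<phi> ` W \<and>
        smooth_Rn n V' (\<lambda>y. f (inv_into U \<phi> y))"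
      using op x c0 by (intro exI[of _ "\<phi> ` (W \<inter> U0)"]) auto
  qed
next
  note tc = smooth_chartD(1)[OF c]
  assume f: "smooth_Rn n (\<phi> ` W) (\<lambda>y. f (inv_into U \<phi> y))"
  show "sm W f"
  proof (rule smI)
    fix U0 \<phi>0 assume c0: "(U0, \<phi>0) \<in> \<A>"
    note tc0 = atlas_chart[OF c0]
    note op = atlas_image_open[OF W(1) c0]
    have inv: "inv_into U0 \<phi>0 z \<in> W" if "z \<in> \<phi>0 ` (U0 \<inter> W)" for z
      using that chartD(2)[OF tc0] by auto
    have "smooth_Rn n (\<phi>0 ` (U0 \<inter> W)) (\<lambda>z. f (inv_into U \<phi> (\<phi> (inv_into U0 \<phi>0 z))))"
    proof (rule smooth_Rn_compose[OF chart_image_open[OF tc W] f op])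
      show "\<phi> (inv_into U0 \<phi>0 z) \<in> \<phi> ` W" if "z \<in> \<phi>0 ` (U0 \<inter> W)" for z
        using inv[OF that] by blast
      show "smooth_Rn n (\<phi>0 ` (U0 \<inter> W)) (\<lambda>z. \<phi> (inv_into U0 \<phi>0 z) j)" if "j < n" for j
        by (rule smooth_Rn_subset[OF smooth_chartD(3)[OF c c0 that]]) (use W(2) in auto)
    qed
    then show "smooth_Rn n (\<phi>0 ` (U0 \<inter> W)) (\<lambda>z. f (inv_into U0 \<phi>0 z))"
      by (rule smooth_Rn_cong[OF op]) (use inv chartD(2)[OF tc] W(2) in \<open>simp add: subset_iff\<close>)
  qed
qed

lemma chart_pd_eqI: "has_pd (\<lambda>y. f (inv_into U \<phi> y)) i (\<phi> x) D \<Longrightarrow> chart_pd (U, \<phi>) i f x = D"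
  unfolding chart_pd_def by (simp add: has_pd_imp_pdiff)

lemma chart_pd_const: "chart_pd (U, \<phi>) i (\<lambda>x. k) x = 0"
  by (rule chart_pd_eqI) (simp add: has_pd_def)

context
  fixes U \<phi> W
  assumes c: "smooth_chart n \<A> (U, \<phi>)" and W: "open W" "W \<subseteq> U"
begin

private lemma tc: "topological_chart n (U, \<phi>)"
  by (rule smooth_chartD(1)[OF c])

private lemma op: "openin (Euclidean_space n) (\<phi> ` W)"
  by (rule chart_image_open[OF tc W])

lemma chart_has_pd:
  assumes "sm W f" "x \<in> W" "i < n"
  shows "has_pd (\<lambda>y. f (inv_into U \<phi> y)) i (\<phi> x) (chart_pd (U, \<phi>) i f x)"
  using smooth_RnD(2)[of n "\<phi> ` W" _ "\<phi> x" i] assms sm_chart_iff[OF c W]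
  by (simp add: chart_pd_def)

lemma chart_pd_add:
  assumes "sm W f" "sm W g" "x \<in> W" "i < n"
  shows "chart_pd (U, \<phi>) i (\<lambda>x. f x + g x) x = chart_pd (U, \<phi>) i f x + chart_pd (U, \<phi>) i g x"
  using chart_has_pd[OF assms(1,3,4)] chart_has_pd[OF assms(2,3,4)] DERIV_add
  by (intro chart_pd_eqI) (simp add: has_pd_def)

lemma chart_pd_mult:
  assumes "sm W f" "sm W g" "x \<in> W" "i < n"
  shows "chart_pd (U, \<phi>) i (\<lambda>x. f x * g x) x =
    chart_pd (U, \<phi>) i f x * g x + f x * chart_pd (U, \<phi>) i g x"
proof (rule chart_pd_eqI)
  have "inv_into U \<phi> (\<phi> x) = x" using chartD(2)[OF tc] assms(3) W(2) by auto
  then show "has_pd (\<lambda>y. f (inv_into U \<phi> y) * g (inv_into U \<phi> y)) i (\<phi> x)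
      (chart_pd (U, \<phi>) i f x * g x + f x * chart_pd (U, \<phi>) i g x)"
    using DERIV_mult[OF chart_has_pd[OF assms(1,3,4), unfolded has_pd_def]
        chart_has_pd[OF assms(2,3,4), unfolded has_pd_def]]
    by (simp add: has_pd_def algebra_simps)
qed

lemma chart_pd_cmult:
  assumes "sm W f" "x \<in> W" "i < n"
  shows "chart_pd (U, \<phi>) i (\<lambda>x. k * f x) x = k * chart_pd (U, \<phi>) i f x"
  using chart_pd_mult[OF sm_const[OF W(1)] assms] by (simp add: chart_pd_const)

lemma chart_pd_sum:
  assumes "\<And>a. a \<in> I \<Longrightarrow> sm W (f a)" "x \<in> W" "i < n"
  shows "chart_pd (U, \<phi>) i (\<lambda>x. \<Sum>a\<in>I. f a x) x = (\<Sum>a\<in>I. chart_pd (U, \<phi>) i (f a) x)"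
  using assms(1)
proof (induction I rule: infinite_finite_induct)
  case (insert a I)
  then show ?case using W(1) assms(2,3) by (simp add: chart_pd_add sm_sum)
qed (simp_all add: chart_pd_const)

lemma sm_chart_pd:
  assumes "sm W f" "i < n"
  shows "sm W (chart_pd (U, \<phi>) i f)"
proof -
  have "smooth_Rn n (\<phi> ` W) (pdiff i (\<lambda>y. f (inv_into U \<phi> y)))"
    using assms sm_chart_iff[OF c W] smooth_RnD(3) by blast
  then have "smooth_Rn n (\<phi> ` W) (\<lambda>y. chart_pd (U, \<phi>) i f (inv_into U \<phi> y))"
    by (rule smooth_Rn_cong[OF op]) (use chartD(2)[OF tc] W(2) in \<open>auto simp: chart_pd_def subset_iff\<close>)
  then show ?thesis using sm_chart_iff[OF c W] by blast
qed

lemma chart_pd_commute: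
  assumes f: "sm W f" and x: "x \<in> W" and ij: "i < n" "j < n"
  shows "chart_pd (U, \<phi>) i (chart_pd (U, \<phi>) j f) x = chart_pd (U, \<phi>) j (chart_pd (U, \<phi>) i f) x"
proof -
  let ?f = "\<lambda>y. f (inv_into U \<phi> y)"
  have sf: "smooth_Rn n (\<phi> ` W) ?f" using f sm_chart_iff[OF c W] by blast
  have *: "chart_pd (U, \<phi>) i (chart_pd (U, \<phi>) j f) x = pdiff i (pdiff j ?f) (\<phi> x)" if ij: "i < n" "j < n" for i j
  proof (rule chart_pd_eqI)
    have "has_pd (pdiff j ?f) i (\<phi> x) (pdiff i (pdiff j ?f) (\<phi> x))"
      by (rule smooth_RnD(2)[OF smooth_RnD(3)[OF sf ij(2)] imageI[OF x] ij(1)])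
    moreover have "chart_pd (U, \<phi>) j f (inv_into U \<phi> y) = pdiff j ?f y" if "y \<in> \<phi> ` W" for y
      using that chartD(2)[OF tc] W(2) by (auto simp: chart_pd_def subset_iff)
    ultimately show "has_pd (\<lambda>y. chart_pd (U, \<phi>) j f (inv_into U \<phi> y)) i (\<phi> x) (pdiff i (pdiff j ?f) (\<phi> x))"
      using has_pd_cong[OF op imageI[OF x] ij(1),
          of "\<lambda>y. chart_pd (U, \<phi>) j f (inv_into U \<phi> y)" "pdiff j ?f"] by simp
  qed
  show ?thesis using *[OF ij] *[OF ij(2,1)] pdiff_commute[OF op imageI[OF x] sf ij] by simp
qed

end

lemma sm_coord:
  assumes c: "smooth_chart n \<A> (U, \<phi>)"
  shows "sm U (\<lambda>x. \<phi> x j)"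
proof -
  note tc = smooth_chartD(1)[OF c]
  have op: "openin (Euclidean_space n) (\<phi> ` U)" using chart_image_open[OF tc chartD(1)[OF tc]] by simp
  have "smooth_Rn n (\<phi> ` U) (\<lambda>y. \<phi> (inv_into U \<phi> y) j)"
    by (rule smooth_Rn_cong[OF op smooth_Rn_coord[OF op, of j]]) (simp add: f_inv_into_f)
  then show ?thesis using sm_chart_iff[OF c chartD(1)[OF tc] order.refl] by simp
qed

lemma chart_pd_coord:
  assumes c: "smooth_chart n \<A> (U, \<phi>)" and x: "x \<in> U" "i < n"
  shows "chart_pd (U, \<phi>) i (\<lambda>x. \<phi> x j) x = (if i = j then 1 else 0)"
proof (rule chart_pd_eqI)
  note tc = smooth_chartD(1)[OF c]
  have op: "openin (Euclidean_space n) (\<phi> ` U)" using chart_image_open[OF tc chartD(1)[OF tc]] by simp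
  have "has_pd (\<lambda>y. y j) i (\<phi> x) (if i = j then 1 else 0)" by (auto simp: has_pd_def)
  then show "has_pd (\<lambda>y. \<phi> (inv_into U \<phi> y) j) i (\<phi> x) (if i = j then 1 else 0)"
    using has_pd_cong[OF op imageI[OF x(1)] x(2), of "\<lambda>y. \<phi> (inv_into U \<phi> y) j" "\<lambda>y. y j"]
    by (simp add: f_inv_into_f)
qed

lemma chart_pd_chain:
  assumes c: "smooth_chart n \<A> (U, \<phi>)" and c': "smooth_chart n \<A> (U', \<phi>')"
    and W: "open W" "W \<subseteq> U" "W \<subseteq> U'" and x: "x \<in> W" and f: "sm W f" and i: "i < n"
  shows "chart_pd (U, \<phi>) i f x =
    (\<Sum>j<n. chart_pd (U, \<phi>) i (\<lambda>y. \<phi>' y j) x * chart_pd (U', \<phi>') j f x)"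
proof -
  note tc = smooth_chartD(1)[OF c] and tc' = smooth_chartD(1)[OF c']
  note op = chart_image_open[OF tc W(1,2)] and op' = chart_image_open[OF tc' W(1,3)]
  have inv: "inv_into U \<phi> z \<in> W" if "z \<in> \<phi> ` W" for z
    using that chartD(2)[OF tc] W(2) by auto
  have "has_pd (\<lambda>y. f (inv_into U' \<phi>' (\<phi>' (inv_into U \<phi> y)))) i (\<phi> x)
      (\<Sum>j<n. pdiff j (\<lambda>y. f (inv_into U' \<phi>' y)) (\<phi>' (inv_into U \<phi> (\<phi> x))) *
        pdiff i (\<lambda>y. \<phi>' (inv_into U \<phi> y) j) (\<phi> x))"
  proof (rule chain_rule_pd[OF op' _ op imageI[OF x] i])
    show "smooth_Rn n (\<phi>' ` W) (\<lambda>y. f (inv_into U' \<phi>' y))"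
      using f sm_chart_iff[OF c' W(1,3)] by blast
    show "\<phi>' (inv_into U \<phi> y) \<in> \<phi>' ` W" if "y \<in> \<phi> ` W" for y using inv[OF that] by blast
    show "smooth_Rn n (\<phi> ` W) (\<lambda>y. \<phi>' (inv_into U \<phi> y) j)" if "j < n" for j
      by (rule iffD1[OF sm_chart_iff[OF c W(1,2)] sm_subset[OF sm_coord[OF c'] W(3)]])
  qed
  moreover have "f (inv_into U' \<phi>' (\<phi>' (inv_into U \<phi> y))) = f (inv_into U \<phi> y)" if "y \<in> \<phi> ` W" for y
    using inv[OF that] chartD(2)[OF tc'] W(3) by (simp add: subset_iff)
  ultimately have "has_pd (\<lambda>y. f (inv_into U \<phi> y)) i (\<phi> x)
      (\<Sum>j<n. pdiff j (\<lambda>y. f (inv_into U' \<phi>' y)) (\<phi>' (inv_into U \<phi> (\<phi> x))) *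
        pdiff i (\<lambda>y. \<phi>' (inv_into U \<phi> y) j) (\<phi> x))"
    using has_pd_cong[OF op imageI[OF x] i, of "\<lambda>y. f (inv_into U' \<phi>' (\<phi>' (inv_into U \<phi> y)))"
        "\<lambda>y. f (inv_into U \<phi> y)"] by simp
  moreover have "inv_into U \<phi> (\<phi> x) = x" using chartD(2)[OF tc] x W(2) by auto
  ultimately show ?thesis by (simp add: chart_pd_def has_pd_imp_pdiff mult.commute)
qed

text \<open>A product of flat functions of the coordinates lives on a closed box inside the image of
  the chart. The preimage of the box is compact, hence closed in the Hausdorff space of points, and
  this makes the extension by 0 smooth.\<close>

lemma bump_function:
  assumes c: "smooth_chart n \<A> (U, \<phi>)" and x: "x \<in> U"
  obtains b K where "sm UNIV b" "b x = 1" "closed K" "K \<subseteq> U" "\<And>y. y \<notin> K \<Longrightarrow> b y = 0"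
proof -
  note tc = smooth_chartD(1)[OF c]
  note U = chartD(1)[OF tc]
  have op: "openin (Euclidean_space n) (\<phi> ` U)" using chart_image_open[OF tc U] by simp
  obtain \<epsilon> where \<epsilon>: "\<epsilon> > 0"
    "\<And>y. (\<And>i. i < n \<Longrightarrow> \<bar>y i - \<phi> x i\<bar> < \<epsilon>) \<Longrightarrow> (\<And>i. i \<ge> n \<Longrightarrow> y i = 0) \<Longrightarrow> y \<in> \<phi> ` U"
    by (rule Euclidean_open_box[OF op imageI[OF x]]) blast
  define \<delta> where "\<delta> = \<epsilon> / 2"
  have \<delta>: "\<delta> > 0" "\<delta> < \<epsilon>" using \<epsilon>(1) by (auto simp: \<delta>_def)
  define \<beta> where "\<beta> y = (\<Prod>i<n. flat 0 (\<delta> + (y i - \<phi> x i)) * flat 0 (\<delta> - (y i - \<phi> x i)))" for y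
  have \<beta>0: "\<beta> (\<phi> x) > 0" using \<delta> by (auto simp: \<beta>_def flat_def intro!: prod_pos)
  \<comment> \<open>The coordinates from \<open>n\<close> on are pinned to 0, as in
    \<open>Euclidean_space n\<close>; the box is then a product of compact sets.\<close>
  define B where "B = PiE UNIV (\<lambda>i. if i < n then {\<phi> x i - \<delta>..\<phi> x i + \<delta>} else {0})"
  have B_sub: "B \<subseteq> \<phi> ` U"
  proof
    fix y assume y: "y \<in> B"
    show "y \<in> \<phi> ` U"
    proof (rule \<epsilon>(2))
      fix i
      have "y i \<in> (if i < n then {\<phi> x i - \<delta>..\<phi> x i + \<delta>} else {0})"
        using y unfolding B_def PiE_iff by blast
      then show "i < n \<Longrightarrow> \<bar>y i - \<phi> x i\<bar> < \<epsilon>" "i \<ge> n \<Longrightarrow> y i = 0" using \<delta> by auto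
    qed
  qed
  have "compactin (product_topology (\<lambda>i. euclidean) UNIV) B"
    unfolding B_def compactin_PiE by auto
  then have "compact B" unfolding euclidean_product_topology by simp
  then have "compact (inv_into U \<phi> ` B)"
    by (rule compact_continuous_image[OF continuous_on_subset[OF chartD(3)[OF tc] B_sub]])
  then have K: "closed (inv_into U \<phi> ` B)" by (rule compact_imp_closed)
  have KU: "inv_into U \<phi> ` B \<subseteq> U"   proof
    fix z assume "z \<in> inv_into U \<phi> ` B"
    then obtain y where "y \<in> B" "z = inv_into U \<phi> y" by blast
    then show "z \<in> U" using B_sub by (auto intro: inv_into_into)
  qed
  define b where "b z = (if z \<in> U then \<beta> (\<phi> z) / \<beta> (\<phi> x) else 0)" for z
  have b0: "b z = 0" if "z \<notin> inv_into U \<phi> ` B" for z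
  proof (rule ccontr)
    assume nz: "b z \<noteq> 0"
    then have z: "z \<in> U" "\<beta> (\<phi> z) \<noteq> 0" by (auto simp: b_def split: if_splits)
    have "\<phi> z i \<in> (if i < n then {\<phi> x i - \<delta>..\<phi> x i + \<delta>} else {0})" for i
    proof (cases "i < n")
      case True
      then have "flat 0 (\<delta> + (\<phi> z i - \<phi> x i)) \<noteq> 0" "flat 0 (\<delta> - (\<phi> z i - \<phi> x i)) \<noteq> 0"
        using z(2) by (auto simp: \<beta>_def)
      then show ?thesis using True by (auto simp: flat_def split: if_splits)
    next
      case False
      then show ?thesis using Euclidean_zero[OF op imageI[OF z(1)], of i] by simp
    qed
    then have "\<phi> z \<in> B" by (auto simp: B_def PiE_iff)
    then have "inv_into U \<phi> (\<phi> z) \<in> inv_into U \<phi> ` B" by blast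
    then show False using that chartD(2)[OF tc z(1)] by simp
  qed
  have "sm U b"
  proof -
    have "smooth_Rn n (\<phi> ` U) (\<lambda>y. \<beta> y * (1 / \<beta> (\<phi> x)))"
      unfolding \<beta>_def by (intro smooth_Rn_intros[OF op] smooth_flat_prod[OF op]) auto
    then have "smooth_Rn n (\<phi> ` U) (\<lambda>y. b (inv_into U \<phi> y))"
      by (rule smooth_Rn_cong[OF op]) (auto simp: b_def f_inv_into_f inv_into_into)
    then show ?thesis using sm_chart_iff[OF c U order.refl] by blast
  qed
  moreover have "sm (- inv_into U \<phi> ` B) b"
    using K by (intro sm_cong[OF _ sm_const[of _ 0]]) (auto intro: b0)
  ultimately have "sm UNIV b"
    using U K KU by (intro sm_local) (auto simp: open_Compl)
  moreover have "b x = 1" using x \<beta>0 by (simp add: b_def)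
  ultimately show thesis using that K KU b0 by blast
qed

end

section \<open>The algebra of functions in a Darboux chart\<close>

subsection \<open>Frames and the pseudo-metric\<close>

lemma frame_coord_linear:
  assumes "frame_at r E e x" "u \<in> E x" "v \<in> E x"
  shows "frame_coord r e x (s *\<^sub>R u + t *\<^sub>R v) a = s * frame_coord r e x u a + t * frame_coord r e x v a"
proof -
  let ?B = "(\<lambda>b. e b x) ` {..<r}"
  have B: "independent ?B" "span ?B = E x" using assms(1) by (auto simp: frame_at_def)
  have uv: "u \<in> span ?B" "v \<in> span ?B" using assms(2,3) B(2) by auto
  show ?thesis
    unfolding frame_coord_def
    using representation_add[OF B(1) span_scale[OF uv(2), of t] span_scale[OF uv(1), of s]]
      representation_scale[OF B(1) uv(1), of s] representation_scale[OF B(1) uv(2), of t] by simp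
qed

lemma frame_coord_basis:
  assumes "frame_at r E e x" "a < r" "b < r"
  shows "frame_coord r e x (e b x) a = (if a = b then 1 else 0)"
  using assms by (auto simp: frame_coord_def frame_at_def representation_basis inj_on_def)

lemma frame_expansion:
  assumes "frame_at r E e x" "v \<in> E x"
  shows "v = (\<Sum>a<r. frame_coord r e x v a *\<^sub>R e a x)"
proof -
  let ?B = "(\<lambda>b. e b x) ` {..<r}"
  have B: "independent ?B" "span ?B = E x" "inj_on (\<lambda>a. e a x) {..<r}"
    using assms(1) by (auto simp: frame_at_def)
  have "v = (\<Sum>b\<in>?B. representation ?B v b *\<^sub>R b)"
    by (rule sum_representation_eq[symmetric]) (use assms(2) B in auto)
  also have "\<dots> = (\<Sum>a<r. frame_coord r e x v a *\<^sub>R e a x)"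
    unfolding frame_coord_def by (simp add: sum.reindex[OF B(3)])
  finally show ?thesis .
qed

lemma frame_mem: "frame_at r E e x \<Longrightarrow> a < r \<Longrightarrow> e a x \<in> E x"
  unfolding frame_at_def by (metis imageI lessThan_iff span_base)

lemma sum_delta_real [simp]:
  "(\<Sum>a<(r::nat). (if a = b then 1 else 0) * f a) = (if b < r then f b else (0::real))"
  "(\<Sum>a<(r::nat). (if b = a then 1 else 0) * f a) = (if b < r then f b else (0::real))"
  "(\<Sum>a<(r::nat). f a * (if a = b then 1 else 0)) = (if b < r then f b else (0::real))"
  "(\<Sum>a<(r::nat). f a * (if b = a then 1 else 0)) = (if b < r then f b else (0::real))"
  by (simp_all add: if_distrib[of "\<lambda>z. z * _"] if_distrib[of "\<lambda>z. _ * z"] cong: if_cong)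

sublocale courant_algebroid \<subseteq> atl?: smooth_atlas "base_dim C" "atlas C"
  by unfold_locales (rule courant_algebroid.manifold, rule courant_algebroid_axioms)

context courant_algebroid
begin

abbreviation "n \<equiv> base_dim C"
abbreviation "r \<equiv> fibre_dim C"

lemma fibre_subspace: "subspace (fibre C x)"
  using vector_bundle by (simp add: smooth_vector_bundle_def)

lemma pairing_sum_left:
  assumes "\<And>a. a \<in> I \<Longrightarrow> v a \<in> fibre C x" "w \<in> fibre C x"
  shows "pairing C x (\<Sum>a\<in>I. k a *\<^sub>R v a) w = (\<Sum>a\<in>I. k a * pairing C x (v a) w)"
  using assms(1)
proof (induction I rule: infinite_finite_induct)
  case (insert a I)
  have "(\<Sum>a\<in>I. k a *\<^sub>R v a) \<in> fibre C x"
    using insert.prems by (intro subspace_sum[OF fibre_subspace] subspace_scale[OF fibre_subspace]) auto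
  then show ?case
    using insert pairing_linear[of "v a" x "\<Sum>a\<in>I. k a *\<^sub>R v a" w "k a" 1] assms(2) by simp
qed (use pairing_linear[of w x w w 0 0] assms(2) in auto)

lemma pairing_sum_right:
  assumes "\<And>a. a \<in> I \<Longrightarrow> v a \<in> fibre C x" "w \<in> fibre C x"
  shows "pairing C x w (\<Sum>a\<in>I. k a *\<^sub>R v a) = (\<Sum>a\<in>I. k a * pairing C x w (v a))"
proof -
  have s: "(\<Sum>a\<in>I. k a *\<^sub>R v a) \<in> fibre C x"
    using assms(1) by (intro subspace_sum[OF fibre_subspace] subspace_scale[OF fibre_subspace]) auto
  have "pairing C x w (v a) = pairing C x (v a) w" if "a \<in> I" for a
    by (rule pairing_sym[OF assms(2) assms(1)[OF that]])
  then show ?thesis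
    using pairing_sum_left[of I v x w k, OF assms] pairing_sym[OF s assms(2)] by simp
qed

text \<open>The endomorphism \<open>v \<mapsto> \<Sum>\<^sub>b \<langle>v, e\<^sub>b\<rangle>
  e\<^sub>b\<close> of the fibre is injective by nondegeneracy, hence surjective for reasons of
  dimension. A preimage of \<open>e b x\<close> pairs with the frame as required.\<close>

lemma dual_frame_ex:
  assumes fr: "frame_at r (fibre C) e x" and b: "b < r"
  shows "\<exists>v\<in>fibre C x. \<forall>a<r. pairing C x v (e a x) = (if a = b then 1 else 0)"
proof -
  let ?B = "(\<lambda>b. e b x) ` {..<r}"
  have B: "independent ?B" "span ?B = fibre C x" "inj_on (\<lambda>a. e a x) {..<r}"
    using fr by (auto simp: frame_at_def)
  note em = frame_mem[OF fr]
  \<comment> \<open>The pairing is linear on the fibre, and so is \<open>g0\<close>. The map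
    \<open>g\<close> extends its values on the frame linearly to the whole type, so that the lemmas
    on linear maps apply.\<close>
  define g0 where "g0 v = (\<Sum>b<r. pairing C x v (e b x) *\<^sub>R e b x)" for v
  obtain g where g: "linear g" "\<forall>v\<in>?B. g v = g0 v"
    using linear_independent_extend[OF B(1)] by blast
  have gv: "g v = g0 v" if v: "v \<in> fibre C x" for v
  proof -
    note vx = frame_expansion[OF fr v]
    have "g v = (\<Sum>a<r. frame_coord r e x v a *\<^sub>R g (e a x))"
      by (subst vx) (simp add: linear_sum[OF g(1)] linear_scale[OF g(1)])
    also have "\<dots> = (\<Sum>a<r. \<Sum>b<r. (frame_coord r e x v a * pairing C x (e a x) (e b x)) *\<^sub>R e b x)"
      using g(2) by (simp add: g0_def scaleR_sum_right)
    also have "\<dots> = (\<Sum>b<r. (\<Sum>a<r. frame_coord r e x v a * pairing C x (e a x) (e b x)) *\<^sub>R e b x)"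
      by (subst sum.swap) (simp add: scaleR_sum_left)
    also have "\<dots> = g0 v"
      unfolding g0_def
      by (rule sum.cong[OF refl], subst vx, subst pairing_sum_left) (use em in auto)
    finally show ?thesis .
  qed
  have z: "v = 0" if v: "v \<in> fibre C x" and "g v = 0" for v
  proof -
    have "(\<Sum>b<r. pairing C x v (e b x) *\<^sub>R e b x) = 0" using that gv by (simp add: g0_def)
    then have "(\<Sum>w\<in>?B. pairing C x v w *\<^sub>R w) = 0" by (simp add: sum.reindex[OF B(3)])
    then have p: "\<forall>w\<in>?B. pairing C x v w = 0"
      using B(1) independentD[OF B(1), of ?B] by blast
    show "v = 0"
    proof (rule pairing_nondegenerate[OF v])
      fix w assume w: "w \<in> fibre C x"
      show "pairing C x v w = 0"
        by (subst frame_expansion[OF fr w], subst pairing_sum_right) (use em v p in auto)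
    qed
  qed
  have inj: "inj_on g (span ?B)"
    unfolding B(2)
  proof (rule inj_onI)
    fix u v assume "u \<in> fibre C x" "v \<in> fibre C x" "g u = g v"
    then have "u - v \<in> fibre C x" "g (u - v) = 0"
      by (simp_all add: linear_diff[OF g(1)] subspace_diff[OF fibre_subspace])
    then have "u - v = 0" by (rule z)
    then show "u = v" by simp
  qed
  have ind: "independent (g ` ?B)"
    by (rule linear_independent_injective_image[OF g(1) B(1) inj])
  have gB: "g ` ?B \<subseteq> span ?B"
  proof (rule image_subsetI)
    fix w assume "w \<in> ?B"
    then have gw: "g w = g0 w" using g(2) by blast
    show "g w \<in> span ?B"
      unfolding gw g0_def by (rule span_sum, rule span_scale, rule span_base) simp
  qed
  have fin: "finite ?B" by simp
  have "inj_on g ?B" using inj by (rule inj_on_subset) (rule span_superset)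
  then have card: "card (g ` ?B) = r" by (simp add: card_image B(3))
  \<comment> \<open>If \<open>e b x\<close> were missing from the span of the images, adding it to
    them would give \<open>r + 1\<close> independent vectors in a space of dimension
    \<open>r\<close>.\<close>
  have "e b x \<in> span (g ` ?B)"
  proof (rule ccontr)
    assume no: "e b x \<notin> span (g ` ?B)"
    from independent_insertI[OF this ind] have "independent (insert (e b x) (g ` ?B))" .
    moreover have "insert (e b x) (g ` ?B) \<subseteq> span ?B"
    proof (rule insert_subsetI[OF _ gB])
      show "e b x \<in> span ?B" by (rule span_base) (use b in blast)
    qed
    ultimately have "card (insert (e b x) (g ` ?B)) \<le> card ?B"
      by (rule conjunct2[OF independent_span_bound[OF fin]])
    moreover have "e b x \<notin> g ` ?B" using no span_base[of "e b x" "g ` ?B"] by argo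
    ultimately show False using card by (simp add: card_image B(3))
  qed
  then have "e b x \<in> g ` span ?B" using linear_span_image[OF g(1)] by blast
  then obtain v where v: "v \<in> fibre C x" "g v = e b x" unfolding B(2) by auto
  have "pairing C x v (e a x) = (if a = b then 1 else 0)" if a: "a < r" for a
  proof -
    have "(\<Sum>c<r. (pairing C x v (e c x) - (if c = b then 1 else 0)) *\<^sub>R e c x) = 0"
      using v gv b by (simp add: g0_def scaleR_diff_left sum_subtractf if_distrib[of "\<lambda>z. z *\<^sub>R _"] cong: if_cong)
    moreover have eb: "e c x = e b x \<longleftrightarrow> c = b" if "c < r" for c
      using inj_on_eq_iff[OF B(3), of c b] that b by simp
    have "(\<Sum>w\<in>?B. (pairing C x v w - (if w = e b x then 1 else 0)) *\<^sub>R w) =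
        (\<Sum>c<r. (pairing C x v (e c x) - (if c = b then 1 else 0)) *\<^sub>R e c x)"
      unfolding sum.reindex[OF B(3)] by (rule sum.cong) (auto simp: eb)
    ultimately have "(\<Sum>w\<in>?B. (pairing C x v w - (if w = e b x then 1 else 0)) *\<^sub>R w) = 0"
      by simp
    from independentD[OF B(1) fin order.refl this, of "e a x"] show ?thesis
      using a eb[OF a] by simp
  qed
  then show ?thesis using v by blast
qed

text \<open>The dual frame with respect to the pseudo-metric; its coordinates in the frame
  \<open>e\<close> are the inverse matrix \<open>g\<^sup>a\<^sup>b\<close>, see
  \<open>inverse_pairing_eq\<close>.\<close>

definition dual_vec :: "(nat \<Rightarrow> 'm \<Rightarrow> 'v) \<Rightarrow> 'm \<Rightarrow> nat \<Rightarrow> 'v" where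
  "dual_vec e x a = sharp C x (\<lambda>w. frame_coord r e x w a)"

text \<open>\<open>sharp\<close> is a definite description: existence comes from
  \<open>dual_frame_ex\<close>, uniqueness from nondegeneracy.\<close>

lemma dual_vec:
  assumes fr: "frame_at r (fibre C) e x" and a: "a < r"
  shows "dual_vec e x a \<in> fibre C x"
    and "w \<in> fibre C x \<Longrightarrow> pairing C x (dual_vec e x a) w = frame_coord r e x w a"
proof -
  let ?P = "\<lambda>v. v \<in> fibre C x \<and> (\<forall>w\<in>fibre C x. pairing C x v w = frame_coord r e x w a)"
  obtain v where v: "v \<in> fibre C x" "\<forall>b<r. pairing C x v (e b x) = (if b = a then 1 else 0)"
    using dual_frame_ex[OF fr a] by blast
  have "?P v"
  proof (intro conjI ballI v(1))
    fix w assume w: "w \<in> fibre C x"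
    have "pairing C x v w = (\<Sum>b<r. frame_coord r e x w b * pairing C x v (e b x))"
      by (subst frame_expansion[OF fr w], subst pairing_sum_right) (use frame_mem[OF fr] v in auto)
    also have "\<dots> = (\<Sum>b<r. frame_coord r e x w b * (if b = a then 1 else 0))"
      using v(2) by (intro sum.cong) auto
    also have "\<dots> = frame_coord r e x w a" using a by simp
    finally show "pairing C x v w = frame_coord r e x w a" .
  qed
  moreover have "u = v" if "?P u" for u
  proof -
    have "u - v = 0"
    proof (rule pairing_nondegenerate)
      show "u - v \<in> fibre C x" using that v(1) subspace_diff[OF fibre_subspace] by blast
      show "pairing C x (u - v) w = 0" if "w \<in> fibre C x" for w
        using pairing_linear[of u x v w 1 "-1"] \<open>?P u\<close> \<open>?P v\<close> that by simp
    qed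
    then show ?thesis by simp
  qed
  ultimately have "?P (dual_vec e x a)"
    unfolding dual_vec_def sharp_def by (rule theI)
  then show "dual_vec e x a \<in> fibre C x"
    "w \<in> fibre C x \<Longrightarrow> pairing C x (dual_vec e x a) w = frame_coord r e x w a" by blast+
qed

lemma inverse_pairing_eq: "inverse_pairing C e x a b = frame_coord r e x (dual_vec e x a) b"
  by (simp add: inverse_pairing_def dual_vec_def)

lemma inverse_pairing_sym:
  assumes fr: "frame_at r (fibre C) e x" and "a < r" "b < r"
  shows "inverse_pairing C e x a b = inverse_pairing C e x b a"
  unfolding inverse_pairing_eq
  using dual_vec(2)[OF fr assms(2) dual_vec(1)[OF fr assms(3)]]
    dual_vec(2)[OF fr assms(3) dual_vec(1)[OF fr assms(2)]]
    pairing_sym[OF dual_vec(1)[OF fr assms(2)] dual_vec(1)[OF fr assms(3)]] by simp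

lemma inverse_pairing:
  assumes fr: "frame_at r (fibre C) e x" and ac: "a < r" "c < r"
  shows "(\<Sum>b<r. inverse_pairing C e x a b * pairing C x (e b x) (e c x)) = (if a = c then 1 else 0)"
proof -
  have "(\<Sum>b<r. inverse_pairing C e x a b * pairing C x (e b x) (e c x)) =
      pairing C x (\<Sum>b<r. frame_coord r e x (dual_vec e x a) b *\<^sub>R e b x) (e c x)"
    unfolding inverse_pairing_eq by (subst pairing_sum_left) (use frame_mem[OF fr] ac in auto)
  also have "\<dots> = pairing C x (dual_vec e x a) (e c x)"
    using frame_expansion[OF fr dual_vec(1)[OF fr ac(1)]] by simp
  also have "\<dots> = (if a = c then 1 else 0)"
    using dual_vec(2)[OF fr ac(1) frame_mem[OF fr ac(2)]] frame_coord_basis[OF fr ac] by simp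
  finally show ?thesis .
qed

lemma frame_coord_eq_pairing:
  assumes fr: "frame_at r (fibre C) e x" and a: "a < r" and v: "v \<in> fibre C x"
  shows "frame_coord r e x v a = (\<Sum>b<r. inverse_pairing C e x a b * pairing C x (e b x) v)"
proof -
  have "frame_coord r e x v a = pairing C x (dual_vec e x a) v" using dual_vec(2)[OF fr a v] by simp
  also have "\<dots> = pairing C x (\<Sum>b<r. frame_coord r e x (dual_vec e x a) b *\<^sub>R e b x) v"
    using frame_expansion[OF fr dual_vec(1)[OF fr a]] by simp
  also have "\<dots> = (\<Sum>b<r. inverse_pairing C e x a b * pairing C x (e b x) v)"
    unfolding inverse_pairing_eq by (subst pairing_sum_left) (use frame_mem[OF fr] v in auto)
  finally show ?thesis .
qed

lemma darbouxD:
  assumes "darboux_chart C (U, \<phi>, e)"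
  shows "smooth_chart n (atlas C) (U, \<phi>)" "open U" "x \<in> U \<Longrightarrow> frame_at r (fibre C) e x"
    "x \<in> U \<Longrightarrow> y \<in> U \<Longrightarrow> a < r \<Longrightarrow> b < r \<Longrightarrow> pairing C x (e a x) (e b x) = pairing C y (e a y) (e b y)"
    "a < r \<Longrightarrow> smooth_section n (atlas C) r (fibre C) (trivs C) U (e a)"
proof -
  have *: "smooth_chart n (atlas C) (U, \<phi>)" "open U" "\<forall>x\<in>U. frame_at r (fibre C) e x"
    "\<forall>x\<in>U. \<forall>y\<in>U. \<forall>a<r. \<forall>b<r. pairing C x (e a x) (e b x) = pairing C y (e a y) (e b y)"
    "\<forall>a<r. smooth_section n (atlas C) r (fibre C) (trivs C) U (e a)"
    using assms unfolding darboux_chart_def smooth_frame_def prod.case by blast+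
  show "smooth_chart n (atlas C) (U, \<phi>)" "open U" by fact+
  show "x \<in> U \<Longrightarrow> frame_at r (fibre C) e x" using *(3) by blast
  show "x \<in> U \<Longrightarrow> y \<in> U \<Longrightarrow> a < r \<Longrightarrow> b < r \<Longrightarrow>
      pairing C x (e a x) (e b x) = pairing C y (e a y) (e b y)" using *(4) by blast
  show "a < r \<Longrightarrow> smooth_section n (atlas C) r (fibre C) (trivs C) U (e a)" using *(5) by blast
qed

text \<open>In a Darboux frame the pairings have the same matrix at \<open>x\<close> and at
  \<open>y\<close>. A left inverse of it, taken at \<open>x\<close>, and a right inverse, taken at
  \<open>y\<close>, coincide.\<close>

lemma inverse_pairing_const:
  assumes d: "darboux_chart C (U, \<phi>, e)" and x: "x \<in> U" "y \<in> U" and ab: "a < r" "b < r"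
  shows "inverse_pairing C e x a b = inverse_pairing C e y a b"
proof -
  note fx = darbouxD(3)[OF d x(1)] and fy = darbouxD(3)[OF d x(2)]
  let ?g = "\<lambda>c d. pairing C x (e c x) (e d x)"
  have gy: "pairing C y (e c y) (e d y) = ?g c d" if "c < r" "d < r" for c d
    by (rule darbouxD(4)[OF d x(2,1) that])
  have right: "(\<Sum>d<r. ?g c d * inverse_pairing C e y d b) = (if c = b then 1 else 0)" if c: "c < r" for c
  proof -
    have "(\<Sum>d<r. ?g c d * inverse_pairing C e y d b) =
        (\<Sum>d<r. inverse_pairing C e y b d * pairing C y (e d y) (e c y))"
    proof (rule sum.cong[OF refl])
      fix d assume "d \<in> {..<r}"
      then have d: "d < r" by simp
      show "?g c d * inverse_pairing C e y d b = inverse_pairing C e y b d * pairing C y (e d y) (e c y)"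
        using pairing_sym[OF frame_mem[OF fy d] frame_mem[OF fy c]] gy[OF c d]
          inverse_pairing_sym[OF fy d ab(2)] by simp
    qed
    then show ?thesis using inverse_pairing[OF fy ab(2) c] by auto
  qed
  have "inverse_pairing C e x a b =
      (\<Sum>c<r. inverse_pairing C e x a c * (\<Sum>d<r. ?g c d * inverse_pairing C e y d b))"
  proof -
    have "(\<Sum>c<r. inverse_pairing C e x a c * (\<Sum>d<r. ?g c d * inverse_pairing C e y d b)) =
        (\<Sum>c<r. inverse_pairing C e x a c * (if c = b then 1 else 0))"
      by (rule sum.cong[OF refl]) (simp add: right)
    then show ?thesis using ab(2) by simp
  qed
  also have "\<dots> = (\<Sum>d<r. (\<Sum>c<r. inverse_pairing C e x a c * ?g c d) * inverse_pairing C e y d b)"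
    unfolding sum_distrib_left sum_distrib_right by (subst sum.swap) (simp add: mult.assoc)
  also have "\<dots> = (\<Sum>d<r. (if a = d then 1 else 0) * inverse_pairing C e y d b)"
    using inverse_pairing[OF fx ab(1)] by (intro sum.cong) auto
  also have "\<dots> = inverse_pairing C e y a b" using ab(1) by simp
  finally show ?thesis .
qed

subsection \<open>Families of graded polynomials\<close>

text \<open>The monomials of all members come from one finite set. This uniformity makes
  coefficientwise operations, above all differentiation along the base, produce polynomials
  again.\<close>

definition fam :: "'m set \<Rightarrow> ('m \<Rightarrow> gpoly) set" where
  "fam W = {F. (\<exists>M. finite M \<and> (\<forall>x\<in>W. \<forall>u. gcoeff (F x) u \<noteq> 0 \<longrightarrow> u \<in> M)) \<and>
     (\<forall>u. sm W (\<lambda>x. gcoeff (F x) u)) \<and> (\<forall>x\<in>W. gvars {..<r} {..<n} (F x))}"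

lemma famD:
  assumes "F \<in> fam W"
  obtains M where "finite M" "\<And>x u. x \<in> W \<Longrightarrow> gcoeff (F x) u \<noteq> 0 \<Longrightarrow> u \<in> M"
  using assms unfolding fam_def by blast

lemma fam_sm: "F \<in> fam W \<Longrightarrow> sm W (\<lambda>x. gcoeff (F x) u)"
  and fam_gvars: "F \<in> fam W \<Longrightarrow> x \<in> W \<Longrightarrow> gvars {..<r} {..<n} (F x)"
  unfolding fam_def by blast+

lemma famI:
  assumes "finite M" "\<And>x u. x \<in> W \<Longrightarrow> gcoeff (F x) u \<noteq> 0 \<Longrightarrow> u \<in> M"
    "\<And>S m. sm W (\<lambda>x. gcoeff (F x) (S, m))" "\<And>x. x \<in> W \<Longrightarrow> gvars {..<r} {..<n} (F x)"
  shows "F \<in> fam W"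
  using assms unfolding fam_def by (auto simp: split_paired_all)

lemma fam_const: "open W \<Longrightarrow> gvars {..<r} {..<n} P \<Longrightarrow> (\<lambda>x. P) \<in> fam W"
  by (rule famI[OF finite_coeff[of P]]) (auto intro: sm_const)

lemma fam_add:
  assumes W: "open W" and F: "F \<in> fam W" "G \<in> fam W"
  shows "(\<lambda>x. F x + G x) \<in> fam W"
proof -
  obtain M N where M: "finite M" "\<And>x u. x \<in> W \<Longrightarrow> gcoeff (F x) u \<noteq> 0 \<Longrightarrow> u \<in> M"
    and N: "finite N" "\<And>x u. x \<in> W \<Longrightarrow> gcoeff (G x) u \<noteq> 0 \<Longrightarrow> u \<in> N"
    using famD[OF F(1)] famD[OF F(2)] by metis
  show ?thesis
  proof (rule famI[of "M \<union> N"])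
    show "u \<in> M \<union> N" if "x \<in> W" "gcoeff (F x + G x) u \<noteq> 0" for x u
      using that M(2)[of x u] N(2)[of x u] by (cases "gcoeff (F x) u = 0") (auto simp: gcoeff_plus)
    show "sm W (\<lambda>x. gcoeff (F x + G x) (S, m))" for S m
      unfolding gcoeff_plus by (intro sm_add W fam_sm F)
  qed (use M N F in \<open>auto intro: fam_gvars\<close>)
qed

lemma fam_scaleR:
  assumes W: "open W" and f: "sm W f" and F: "F \<in> fam W"
  shows "(\<lambda>x. f x *\<^sub>R F x) \<in> fam W"
proof -
  obtain M where M: "finite M" "\<And>x u. x \<in> W \<Longrightarrow> gcoeff (F x) u \<noteq> 0 \<Longrightarrow> u \<in> M"
    using famD[OF F] by metis
  show ?thesis
    by (rule famI[OF M(1)])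
       (use M(2) in \<open>auto simp: gcoeff_scaleR intro!: sm_mult W f fam_sm F gvars_intros fam_gvars[OF F]\<close>)
qed

lemma fam_mult:
  assumes W: "open W" and F: "F \<in> fam W" "G \<in> fam W"
  shows "(\<lambda>x. F x * G x) \<in> fam W"
proof -
  obtain M N where M: "finite M" "\<And>x u. x \<in> W \<Longrightarrow> gcoeff (F x) u \<noteq> 0 \<Longrightarrow> u \<in> M"
    and N: "finite N" "\<And>x u. x \<in> W \<Longrightarrow> gcoeff (G x) u \<noteq> 0 \<Longrightarrow> u \<in> N"
    using famD[OF F(1)] famD[OF F(2)] by metis
  show ?thesis
  proof (rule famI[of "(\<lambda>((T, k), (T', k')). (T \<union> T', k + k')) ` (M \<times> N)"])
    fix x u assume x: "x \<in> W" "gcoeff (F x * G x) u \<noteq> 0"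
    obtain S m where u: "u = (S, m)" by force
    obtain T k where T: "T \<subseteq> S" "k \<subseteq># m" "gcoeff (F x) (T, k) \<noteq> 0" "gcoeff (G x) (S - T, m - k) \<noteq> 0"
      using x(2) unfolding u by (rule gcoeff_times_nonzero)
    then have "((T, k), (S - T, m - k)) \<in> M \<times> N" using M(2) N(2) x(1) by blast
    moreover have "u = (T \<union> (S - T), k + (m - k))" using T(1,2) u by auto
    ultimately show "u \<in> (\<lambda>((T, k), (T', k')). (T \<union> T', k + k')) ` (M \<times> N)" by force
  next
    show "sm W (\<lambda>x. gcoeff (F x * G x) (S, m))" for S m
      unfolding gcoeff_times by (intro sm_sum sm_mult sm_const W fam_sm F)
  qed (use M N F in \<open>auto intro: fam_gvars\<close>)
qed

lemma fam_cong:
  assumes W: "open W" and F: "F \<in> fam W" and eq: "\<And>x. x \<in> W \<Longrightarrow> G x = F x"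
  shows "G \<in> fam W"
proof -
  obtain M where M: "finite M" "\<And>x u. x \<in> W \<Longrightarrow> gcoeff (F x) u \<noteq> 0 \<Longrightarrow> u \<in> M"
    using famD[OF F] by metis
  show ?thesis
    by (rule famI[OF M(1)]) (use M(2) eq fam_gvars[OF F] in \<open>auto intro: sm_cong[OF W fam_sm[OF F]]\<close>)
qed

lemma fam_subset: "F \<in> fam W \<Longrightarrow> W' \<subseteq> W \<Longrightarrow> F \<in> fam W'"
  unfolding fam_def by (fast intro: sm_subset)

lemma fam_0: "open W \<Longrightarrow> (\<lambda>x. 0) \<in> fam W"
  by (rule fam_const) auto

lemma fam_sum: "open W \<Longrightarrow> (\<And>i. i \<in> I \<Longrightarrow> F i \<in> fam W) \<Longrightarrow> (\<lambda>x. \<Sum>i\<in>I. F i x) \<in> fam W"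
  by (induction I rule: infinite_finite_induct) (simp_all add: fam_0 fam_add)

lemma fam_minus: "open W \<Longrightarrow> F \<in> fam W \<Longrightarrow> (\<lambda>x. - F x) \<in> fam W"
  using fam_scaleR[OF _ sm_const[of W "-1"]] by simp

lemma fam_diff: "open W \<Longrightarrow> F \<in> fam W \<Longrightarrow> G \<in> fam W \<Longrightarrow> (\<lambda>x. F x - G x) \<in> fam W"
  using fam_add[OF _ _ fam_minus] by force

lemma fam_d_p:
  assumes W: "open W" and F: "F \<in> fam W"
  shows "(\<lambda>x. d_p i (F x)) \<in> fam W"
proof -
  obtain M where M: "finite M" "\<And>x u. x \<in> W \<Longrightarrow> gcoeff (F x) u \<noteq> 0 \<Longrightarrow> u \<in> M"
    using famD[OF F] by metis
  show ?thesis
  proof (rule famI[of "(\<lambda>(S, m). (S, m - {#i#})) ` M"])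
    fix x u assume x: "x \<in> W" "gcoeff (d_p i (F x)) u \<noteq> 0"
    obtain S m where u: "u = (S, m)" by force
    have "(S, add_mset i m) \<in> M" using M(2)[OF x(1)] x(2) by (auto simp: u gcoeff_d_p)
    then show "u \<in> (\<lambda>(S, m). (S, m - {#i#})) ` M" by (force simp: u)
  qed (use M in \<open>auto simp: gcoeff_d_p intro!: sm_mult sm_const W fam_sm F gvars_d_p fam_gvars[OF F]\<close>)
qed

lemma fam_d_xi:
  assumes W: "open W" and F: "F \<in> fam W"
  shows "(\<lambda>x. d_xi a (F x)) \<in> fam W"
proof -
  obtain M where M: "finite M" "\<And>x u. x \<in> W \<Longrightarrow> gcoeff (F x) u \<noteq> 0 \<Longrightarrow> u \<in> M"
    using famD[OF F] by metis
  show ?thesis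
  proof (rule famI[of "(\<lambda>(S, m). (S - {a}, m)) ` M"])
    fix x u assume x: "x \<in> W" "gcoeff (d_xi a (F x)) u \<noteq> 0"
    obtain S m where u: "u = (S, m)" by force
    have "(insert a S, m) \<in> M" "a \<notin> S" using M(2)[OF x(1)] x(2) by (auto simp: u gcoeff_d_xi split: if_splits)
    then show "u \<in> (\<lambda>(S, m). (S - {a}, m)) ` M" by (force simp: u)
  next
    show "sm W (\<lambda>x. gcoeff (d_xi a (F x)) (S, m))" for S m
      by (cases "a \<in> S") (auto simp: gcoeff_d_xi intro!: sm_mult sm_const W fam_sm F)
  qed (use M in \<open>auto intro!: gvars_d_xi fam_gvars[OF F]\<close>)
qed

lemma fam_gpar:
  assumes W: "open W" and F: "F \<in> fam W"
  shows "(\<lambda>x. gpar (F x)) \<in> fam W"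
proof -
  obtain M where M: "finite M" "\<And>x u. x \<in> W \<Longrightarrow> gcoeff (F x) u \<noteq> 0 \<Longrightarrow> u \<in> M"
    using famD[OF F] by metis
  show ?thesis
    by (rule famI[OF M(1)])
       (use M F in \<open>auto simp: gcoeff_gpar intro!: sm_mult sm_const W fam_sm fam_gvars gvars_intros\<close>)
qed

context
  fixes U \<phi> W
  assumes c: "smooth_chart n (atlas C) (U, \<phi>)" and W: "open W" "W \<subseteq> U"
begin

private abbreviation "pd \<equiv> gchart_pd (U, \<phi>)"
private abbreviation "cpd \<equiv> chart_pd (U, \<phi>)"

lemma chart_pd_zero:
  assumes "x \<in> W" "i < n" "\<And>y. y \<in> W \<Longrightarrow> f y = 0"
  shows "cpd i f x = 0"
  using chart_pd_cong[OF smooth_chartD(1)[OF c] W assms(1,2), of f "\<lambda>_. 0"] assms(3)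
  by (simp add: chart_pd_const)

text \<open>\<open>gchart_pd\<close> is built with \<open>gpoly_of\<close>, whose coefficients are
  the given ones when these have finite support; the common finite set of monomials of a family
  provides that.\<close>

lemma gcoeff_gchart_pd:
  assumes F: "F \<in> fam W" and x: "x \<in> W" "i < n"
  shows "gcoeff (pd i F x) u = cpd i (\<lambda>y. gcoeff (F y) u) x"
proof -
  obtain M where M: "finite M" "\<And>x u. x \<in> W \<Longrightarrow> gcoeff (F x) u \<noteq> 0 \<Longrightarrow> u \<in> M"
    using famD[OF F] by metis
  have "cpd i (\<lambda>y. gcoeff (F y) u) x = 0" if "u \<notin> M" for u
    by (rule chart_pd_zero[OF x]) (use M(2) that in blast)
  then have "finite {u. cpd i (\<lambda>y. gcoeff (F y) u) x \<noteq> 0}"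
    by (intro finite_subset[OF _ M(1)]) auto
  moreover have "finite S" if "cpd i (\<lambda>y. gcoeff (F y) (S, m)) x \<noteq> 0" for S m
    using that chart_pd_const[of U \<phi> i 0 x] by (cases "finite S") (auto simp: gcoeff_infinite)
  ultimately show ?thesis
    unfolding gchart_pd_def by (subst gcoeff_gpoly_of) blast+
qed

lemma gchart_pd_cong:
  assumes "x \<in> W" "i < n" "\<And>y. y \<in> W \<Longrightarrow> F y = G y"
  shows "pd i F x = pd i G x"
proof -
  have "cpd i (\<lambda>y. gcoeff (F y) u) x = cpd i (\<lambda>y. gcoeff (G y) u) x" for u
    by (rule chart_pd_cong[OF smooth_chartD(1)[OF c] W assms(1,2)]) (simp add: assms(3))
  then show ?thesis by (simp add: gchart_pd_def)
qed

lemma fam_gchart_pd: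
  assumes F: "F \<in> fam W" and i: "i < n"
  shows "pd i F \<in> fam W"
proof -
  obtain M where M: "finite M" "\<And>x u. x \<in> W \<Longrightarrow> gcoeff (F x) u \<noteq> 0 \<Longrightarrow> u \<in> M"
    using famD[OF F] by metis
  show ?thesis
  proof (rule famI[OF M(1)])
    show "u \<in> M" if "x \<in> W" "gcoeff (pd i F x) u \<noteq> 0" for x u
    proof (rule ccontr)
      assume "u \<notin> M"
      then have "cpd i (\<lambda>y. gcoeff (F y) u) x = 0"
        using M(2) by (intro chart_pd_zero[OF that(1) i]) blast
      then show False using that gcoeff_gchart_pd[OF F that(1) i] by simp
    qed
    show "sm W (\<lambda>x. gcoeff (pd i F x) (S, m))" for S m
      by (rule sm_cong[OF W(1) sm_chart_pd[OF c W fam_sm[OF F, of "(S, m)"] i]])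
         (simp add: gcoeff_gchart_pd[OF F _ i])
    show "gvars {..<r} {..<n} (pd i F x)" if x: "x \<in> W" for x
      unfolding gvars_def
    proof (intro allI impI)
      fix S m assume nz: "gcoeff (pd i F x) (S, m) \<noteq> 0"
      show "S \<subseteq> {..<r} \<and> set_mset m \<subseteq> {..<n}"
      proof (rule ccontr)
        assume "\<not> (S \<subseteq> {..<r} \<and> set_mset m \<subseteq> {..<n})"
        then have "gcoeff (F y) (S, m) = 0" if "y \<in> W" for y
          using fam_gvars[OF F that] unfolding gvars_def by blast
        then have "cpd i (\<lambda>y. gcoeff (F y) (S, m)) x = 0" by (rule chart_pd_zero[OF x i])
        then show False using nz gcoeff_gchart_pd[OF F x i] by simp
      qed
    qed
  qed
qed

lemma gchart_pd_const: "pd i (\<lambda>y. P) x = 0"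
  by (rule gpoly_eqI) (simp add: gchart_pd_def chart_pd_const zero_gpoly_def)

context
  fixes x i
  assumes x: "x \<in> W" and i: "i < n"
begin

lemma gchart_pd_add:
  assumes "F \<in> fam W" "G \<in> fam W"
  shows "pd i (\<lambda>y. F y + G y) x = pd i F x + pd i G x"
  by (rule gpoly_eqI)
     (simp add: gcoeff_gchart_pd[OF fam_add[OF W(1) assms] x i] gcoeff_plus gcoeff_gchart_pd[OF _ x i] assms
       chart_pd_add[OF c W fam_sm[OF assms(1)] fam_sm[OF assms(2)] x i])

lemma gchart_pd_scaleR:
  assumes "sm W f" "F \<in> fam W"
  shows "pd i (\<lambda>y. f y *\<^sub>R F y) x = cpd i f x *\<^sub>R F x + f x *\<^sub>R pd i F x"
  by (rule gpoly_eqI)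
     (simp add: gcoeff_gchart_pd[OF fam_scaleR[OF W(1) assms] x i] gcoeff_plus gcoeff_scaleR
       gcoeff_gchart_pd[OF _ x i] assms chart_pd_mult[OF c W assms(1) fam_sm[OF assms(2)] x i])

lemma gchart_pd_cscaleR: "F \<in> fam W \<Longrightarrow> pd i (\<lambda>y. k *\<^sub>R F y) x = k *\<^sub>R pd i F x"
  using gchart_pd_scaleR[OF sm_const[OF W(1)], of F k] by (simp add: chart_pd_const)

lemma gchart_pd_diff:
  assumes "F \<in> fam W" "G \<in> fam W"
  shows "pd i (\<lambda>y. F y - G y) x = pd i F x - pd i G x"
  using gchart_pd_add[OF assms(1) fam_scaleR[OF W(1) sm_const[OF W(1), of "-1"] assms(2)]]
    gchart_pd_cscaleR[OF assms(2), of "-1"] by simp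

lemma gchart_pd_sum:
  assumes "\<And>a. a \<in> I \<Longrightarrow> F a \<in> fam W"
  shows "pd i (\<lambda>y. \<Sum>a\<in>I. F a y) x = (\<Sum>a\<in>I. pd i (F a) x)"
  using assms
  by (induction I rule: infinite_finite_induct)
     (simp_all add: gchart_pd_const gchart_pd_add fam_sum[OF W(1)])

lemma gchart_pd_mult:
  assumes F: "F \<in> fam W" and G: "G \<in> fam W"
  shows "pd i (\<lambda>y. F y * G y) x = pd i F x * G x + F x * pd i G x"
proof (rule gpoly_eqI)
  fix S m
  let ?s = "\<lambda>T. koszul_sign T (S - T)"
  have sF: "sm W (\<lambda>y. k * gcoeff (F y) u)" for k u
    by (intro sm_mult sm_const W fam_sm F)
  have s: "sm W (\<lambda>y. k * gcoeff (F y) u * gcoeff (G y) v)" for k u v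
    by (intro sm_mult sF W fam_sm G)
  have t: "cpd i (\<lambda>y. k * gcoeff (F y) u * gcoeff (G y) v) x =
      k * gcoeff (pd i F x) u * gcoeff (G x) v + k * gcoeff (F x) u * gcoeff (pd i G x) v" for k u v
    unfolding chart_pd_mult[OF c W sF fam_sm[OF G] x i] chart_pd_cmult[OF c W fam_sm[OF F] x i]
      gcoeff_gchart_pd[OF F x i] gcoeff_gchart_pd[OF G x i] ..
  have "gcoeff (pd i (\<lambda>y. F y * G y) x) (S, m) = cpd i (\<lambda>y. \<Sum>T\<in>Pow S. \<Sum>k | k \<subseteq># m.
      ?s T * gcoeff (F y) (T, k) * gcoeff (G y) (S - T, m - k)) x"
    unfolding gcoeff_gchart_pd[OF fam_mult[OF W(1) F G] x i] gcoeff_times ..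
  also have "\<dots> = (\<Sum>T\<in>Pow S. cpd i (\<lambda>y. \<Sum>k | k \<subseteq># m.
      ?s T * gcoeff (F y) (T, k) * gcoeff (G y) (S - T, m - k)) x)"
    by (rule chart_pd_sum[OF c W _ x i]) (intro sm_sum W s)
  also have "\<dots> = (\<Sum>T\<in>Pow S. \<Sum>k | k \<subseteq># m. cpd i (\<lambda>y.
      ?s T * gcoeff (F y) (T, k) * gcoeff (G y) (S - T, m - k)) x)"
    by (rule sum.cong[OF refl], rule chart_pd_sum[OF c W _ x i], rule s)
  also have "\<dots> = gcoeff (pd i F x * G x + F x * pd i G x) (S, m)"
    by (simp add: t gcoeff_plus gcoeff_times sum.distrib)
  finally show "gcoeff (pd i (\<lambda>y. F y * G y) x) (S, m) = gcoeff (pd i F x * G x + F x * pd i G x) (S, m)" .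
qed

lemma gchart_pd_d_p: "F \<in> fam W \<Longrightarrow> pd i (\<lambda>y. d_p j (F y)) x = d_p j (pd i F x)"
  by (rule gpoly_eqI)
     (simp add: gcoeff_gchart_pd[OF fam_d_p[OF W(1)] x i] gcoeff_gchart_pd[OF _ x i] gcoeff_d_p
       chart_pd_cmult[OF c W fam_sm x i])

lemma gchart_pd_d_xi:
  assumes "F \<in> fam W"
  shows "pd i (\<lambda>y. d_xi a (F y)) x = d_xi a (pd i F x)"
proof (rule gpoly_eqI)
  fix S m
  show "gcoeff (pd i (\<lambda>y. d_xi a (F y)) x) (S, m) = gcoeff (d_xi a (pd i F x)) (S, m)"
    using assms by (cases "a \<in> S")
      (simp_all add: gcoeff_gchart_pd[OF fam_d_xi[OF W(1)] x i] gcoeff_gchart_pd[OF _ x i] gcoeff_d_xi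
        chart_pd_cmult[OF c W fam_sm x i] chart_pd_const)
qed

lemma gchart_pd_gpar: "F \<in> fam W \<Longrightarrow> pd i (\<lambda>y. gpar (F y)) x = gpar (pd i F x)"
  by (rule gpoly_eqI)
     (simp add: gcoeff_gchart_pd[OF fam_gpar[OF W(1)] x i] gcoeff_gchart_pd[OF _ x i] gcoeff_gpar
       chart_pd_cmult[OF c W fam_sm x i])

end

lemma gchart_pd_commute:
  assumes F: "F \<in> fam W" and x: "x \<in> W" and ij: "i < n" "j < n"
  shows "pd i (pd j F) x = pd j (pd i F) x"
proof (rule gpoly_eqI)
  fix S m
  have "gcoeff (pd i (pd j F) x) u = cpd i (cpd j (\<lambda>y. gcoeff (F y) u)) x" if ij: "i < n" "j < n" for i j u
    unfolding gcoeff_gchart_pd[OF fam_gchart_pd[OF F ij(2)] x ij(1)]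
    by (rule chart_pd_cong[OF smooth_chartD(1)[OF c] W x ij(1)]) (rule gcoeff_gchart_pd[OF F _ ij(2)])
  then show "gcoeff (pd i (pd j F) x) (S, m) = gcoeff (pd j (pd i F) x) (S, m)"
    using ij chart_pd_commute[OF c W fam_sm[OF F] x ij] by simp
qed

end

end

subsection \<open>The Poisson bracket in a chart\<close>

context courant_algebroid
begin

text \<open>The matrix \<open>g\<close> is a parameter that does not depend on the point. In a
  Darboux chart the coefficients are constant, so brackets can be nested and differentiated without
  derivatives of \<open>g\<close>.\<close>

definition pbr :: "'m chart \<Rightarrow> (nat \<Rightarrow> nat \<Rightarrow> real) \<Rightarrow> ('m \<Rightarrow> gpoly) \<Rightarrow> ('m \<Rightarrow> gpoly) \<Rightarrow> 'm \<Rightarrow> gpoly" where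
  "pbr c g F G x = (\<Sum>i<n. d_p i (F x) * gchart_pd c i G x - gchart_pd c i F x * d_p i (G x)) +
     (\<Sum>a<r. \<Sum>b<r. g a b *\<^sub>R (gpar (d_xi a (F x)) * d_xi b (G x)))"

lemma poisson_eq_pbr:
  assumes "gchart_at C (U, \<phi>, e) x"
  shows "poisson C F G (U, \<phi>, e) x = pbr (U, \<phi>) (inverse_pairing C e x) (F (U, \<phi>, e)) (G (U, \<phi>, e)) x"
  using assms by (simp add: poisson_def pbr_def Let_def d_xi_right_eq)

end

text \<open>The first order operator with coefficients \<open>P\<close>, \<open>D\<close>, \<open>E\<close>; the bracket \<open>{F, \<cdot>}\<close> of an odd \<open>F\<close> has
  this form.\<close>

definition vf :: "nat \<Rightarrow> nat \<Rightarrow> (nat \<Rightarrow> nat \<Rightarrow> real) \<Rightarrow> (nat \<Rightarrow> gpoly) \<Rightarrow> (nat \<Rightarrow> gpoly) \<Rightarrow> (nat \<Rightarrow> gpoly) \<Rightarrow>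
    (nat \<Rightarrow> gpoly) \<Rightarrow> (nat \<Rightarrow> gpoly) \<Rightarrow> (nat \<Rightarrow> gpoly) \<Rightarrow> gpoly" where
  "vf n r g P D E u v w = (\<Sum>i<n. P i * u i - D i * v i) + (\<Sum>a<r. \<Sum>b<r. g a b *\<^sub>R (E a * w b))"

lemma vf_add: "vf n r g P D E (\<lambda>i. u i + u' i) (\<lambda>i. v i + v' i) (\<lambda>i. w i + w' i) =
    vf n r g P D E u v w + vf n r g P D E u' v' w'"
  by (simp add: vf_def distrib_left scaleR_add_right sum.distrib sum_subtractf algebra_simps)

lemma vf_diff: "vf n r g P D E (\<lambda>i. u i - u' i) (\<lambda>i. v i - v' i) (\<lambda>i. w i - w' i) =
    vf n r g P D E u v w - vf n r g P D E u' v' w'"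
  by (simp add: vf_def right_diff_distrib scaleR_diff_right sum.distrib sum_subtractf algebra_simps)

lemma vf_mult_right: "vf n r g P D E (\<lambda>i. u i * k) (\<lambda>i. v i * k) (\<lambda>i. w i * k) = vf n r g P D E u v w * k"
  unfolding vf_def distrib_right sum_distrib_right left_diff_distrib mult_scaleR_left mult.assoc ..

lemma vf_scaleR: "vf n r g P D E (\<lambda>i. k *\<^sub>R u i) (\<lambda>i. k *\<^sub>R v i) (\<lambda>i. k *\<^sub>R w i) = k *\<^sub>R vf n r g P D E u v w"
  by (simp add: vf_def scaleR_add_right scaleR_sum_right scaleR_diff_right mult.commute)

lemma vf_sum: "vf n r g P D E (\<lambda>i. \<Sum>k\<in>I. u k i) (\<lambda>i. \<Sum>k\<in>I. v k i) (\<lambda>i. \<Sum>k\<in>I. w k i) =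
    (\<Sum>k\<in>I. vf n r g P D E (u k) (v k) (w k))"
proof (induction I rule: infinite_finite_induct)
  case (insert k I)
  then show ?case using vf_add[of n r g P D E "u k" "\<lambda>i. \<Sum>k\<in>I. u k i" "v k" "\<lambda>i. \<Sum>k\<in>I. v k i" "w k"] by simp
qed (simp_all add: vf_def)

lemma antisym_sum_zero:
  fixes f :: "nat \<Rightarrow> nat \<Rightarrow> gpoly"
  assumes "\<And>i j. i < m \<Longrightarrow> j < m \<Longrightarrow> f i j = - f j i"
  shows "(\<Sum>i<m. \<Sum>j<m. f i j) = 0"
proof -
  have "(\<Sum>i<m. \<Sum>j<m. f i j) = (\<Sum>j<m. \<Sum>i<m. f i j)" by (rule sum.swap)
  also have "\<dots> = (\<Sum>j<m. \<Sum>i<m. - f j i)"   proof (intro sum.cong refl)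
    fix j i assume "j \<in> {..<m}" "i \<in> {..<m}"
    then show "f i j = - f j i" by (intro assms) auto
  qed
  also have "\<dots> = - (\<Sum>i<m. \<Sum>j<m. f i j)" by (simp add: sum_negf)
  finally have "2 *\<^sub>R (\<Sum>i<m. \<Sum>j<m. f i j) = 0" by (simp add: scaleR_2 eq_neg_iff_add_eq_0)
  then show ?thesis by simp
qed

text \<open>The second order part of the square of an odd first order operator vanishes.\<close>

lemma vf_second_order:
  assumes P: "\<And>i. godd (P i)" and D: "\<And>i. godd (D i)" and E: "\<And>a. geven (E a)"
    and Kxx: "\<And>i j. i < n \<Longrightarrow> j < n \<Longrightarrow> Kxx i j = Kxx j i"
    and Kpp: "\<And>i j. i < n \<Longrightarrow> j < n \<Longrightarrow> Kpp i j = Kpp j i"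
    and Kee: "\<And>a b. a < r \<Longrightarrow> b < r \<Longrightarrow> Kee a b = - Kee b a"
  shows "vf n r g P D E
     (\<lambda>j. vf n r g P D E (\<lambda>i. Kxx i j) (\<lambda>i. Kpx i j) (\<lambda>b. Kex b j))
     (\<lambda>j. vf n r g P D E (\<lambda>i. Kpx j i) (\<lambda>i. Kpp i j) (\<lambda>b. Kep b j))
     (\<lambda>d. - vf n r g P D E (\<lambda>i. Kex d i) (\<lambda>i. Kep d i) (\<lambda>b. Kee b d)) = 0"
proof -
  have PP: "P i * (P j * k) = - (P j * (P i * k))" and DD: "D i * (D j * k) = - (D j * (D i * k))"
    and PD: "P i * (D j * k) = - (D j * (P i * k))" for i j k
    using godd_anticommute[OF P P] godd_anticommute[OF D D] godd_anticommute[OF D P]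
    by (metis mult.assoc mult_minus_left)+
  have EP: "P i * (E a * k) = E a * (P i * k)" and ED: "D i * (E a * k) = E a * (D i * k)"
    and EE: "E a * (E b * k) = E b * (E a * k)" for i a b k
    using geven_mult_commute[OF E] by (metis mult.assoc)+
  \<comment> \<open>In the expansion \<open>s1\<close>, \<open>s2\<close> and \<open>s6\<close>
    vanish by themselves: in the first two anticommuting coefficients meet a symmetric
    \<open>K\<close>, in the last commuting ones meet an antisymmetric \<open>K\<close>. By
    \<open>s3\<close>, \<open>s4\<close> and \<open>s5\<close> the other terms cancel in
    pairs.\<close>
  have s1: "(\<Sum>j<n. P j * (\<Sum>i<n. P i * Kxx i j)) = 0"
    unfolding sum_distrib_left by (rule antisym_sum_zero) (metis PP Kxx)
  have s2: "(\<Sum>j<n. D j * (\<Sum>i<n. D i * Kpp i j)) = 0"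
    unfolding sum_distrib_left by (rule antisym_sum_zero) (metis DD Kpp)
  have s3: "(\<Sum>j<n. P j * (\<Sum>i<n. D i * Kpx i j)) = - (\<Sum>j<n. D j * (\<Sum>i<n. P i * Kpx j i))"
    unfolding sum_distrib_left by (subst sum.swap) (simp add: PD sum_negf)
  let ?S = "\<lambda>f. \<Sum>a<r. \<Sum>b<r. g a b *\<^sub>R f a b"
  have s4: "(\<Sum>j<n. P j * ?S (\<lambda>a b. E a * Kex b j)) = ?S (\<lambda>a b. E a * (\<Sum>i<n. P i * Kex b i))"
  proof -
    have "(\<Sum>j<n. P j * ?S (\<lambda>a b. E a * Kex b j)) = (\<Sum>j<n. ?S (\<lambda>a b. E a * (P j * Kex b j)))"
      by (simp add: sum_distrib_left EP)
    also have "\<dots> = (\<Sum>a<r. \<Sum>j<n. \<Sum>b<r. g a b *\<^sub>R (E a * (P j * Kex b j)))" by (rule sum.swap)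
    also have "\<dots> = (\<Sum>a<r. \<Sum>b<r. \<Sum>j<n. g a b *\<^sub>R (E a * (P j * Kex b j)))"
      by (rule sum.cong[OF refl], rule sum.swap)
    finally show ?thesis by (simp add: sum_distrib_left scaleR_sum_right)
  qed
  have s5: "(\<Sum>j<n. D j * ?S (\<lambda>a b. E a * Kep b j)) = ?S (\<lambda>a b. E a * (\<Sum>i<n. D i * Kep b i))"
  proof -
    have "(\<Sum>j<n. D j * ?S (\<lambda>a b. E a * Kep b j)) = (\<Sum>j<n. ?S (\<lambda>a b. E a * (D j * Kep b j)))"
      by (simp add: sum_distrib_left ED)
    also have "\<dots> = (\<Sum>a<r. \<Sum>j<n. \<Sum>b<r. g a b *\<^sub>R (E a * (D j * Kep b j)))" by (rule sum.swap)
    also have "\<dots> = (\<Sum>a<r. \<Sum>b<r. \<Sum>j<n. g a b *\<^sub>R (E a * (D j * Kep b j)))"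
      by (rule sum.cong[OF refl], rule sum.swap)
    finally show ?thesis by (simp add: sum_distrib_left scaleR_sum_right)
  qed
  have s6: "?S (\<lambda>c d. E c * ?S (\<lambda>a b. E a * Kee b d)) = 0"
  proof -
    let ?T = "\<lambda>c d a b. g c d *\<^sub>R (g a b *\<^sub>R (E c * (E a * Kee b d)))"
    have "?S (\<lambda>c d. E c * ?S (\<lambda>a b. E a * Kee b d)) = (\<Sum>c<r. \<Sum>d<r. \<Sum>a<r. \<Sum>b<r. ?T c d a b)"
      by (simp add: sum_distrib_left scaleR_sum_right)
    also have "\<dots> = (\<Sum>c<r. \<Sum>a<r. \<Sum>d<r. \<Sum>b<r. ?T c d a b)"
      by (rule sum.cong[OF refl], rule sum.swap)
    also have "\<dots> = 0"
    proof (rule antisym_sum_zero)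
      fix c a assume "c < r" "a < r"
      have "(\<Sum>d<r. \<Sum>b<r. ?T c d a b) = (\<Sum>b<r. \<Sum>d<r. ?T c d a b)" by (rule sum.swap)
      also have "\<dots> = (\<Sum>b<r. \<Sum>d<r. - ?T a b c d)"
      proof (intro sum.cong refl)
        fix b d assume "b \<in> {..<r}" "d \<in> {..<r}"
        then have "Kee b d = - Kee d b" by (intro Kee) auto
        then show "?T c d a b = - ?T a b c d" using EE[of c a "Kee d b"] by (simp add: mult.commute)
      qed
      finally show "(\<Sum>d<r. \<Sum>b<r. ?T c d a b) = - (\<Sum>d<r. \<Sum>b<r. ?T a d c b)" by (simp add: sum_negf)
    qed
    finally show ?thesis .
  qed
  have split: "vf n r g P D E u v (\<lambda>d. - w d) =
      (\<Sum>j<n. P j * u j) - (\<Sum>j<n. D j * v j) - ?S (\<lambda>a b. E a * w b)" for u v w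
    by (simp add: vf_def sum_subtractf sum_negf)
  have split': "k * vf n r g P D E u v w =
      k * (\<Sum>j<n. P j * u j) - k * (\<Sum>j<n. D j * v j) + k * ?S (\<lambda>a b. E a * w b)" for k u v w
    by (simp add: vf_def sum_subtractf algebra_simps)
  have sc: "?S (\<lambda>a b. A a b - B a b + G a b) = ?S A - ?S B + ?S G" for A B G :: "nat \<Rightarrow> nat \<Rightarrow> gpoly"
    by (simp add: scaleR_add_right scaleR_diff_right sum.distrib sum_subtractf)
  show ?thesis
    unfolding split split' sc sum.distrib sum_subtractf s1 s2 s3 s4 s5 s6 by simp
qed

context courant_algebroid
begin

lemma pbr_odd:
  assumes "godd (F x)"
  shows "pbr c g F K x = vf n r g (\<lambda>i. d_p i (F x)) (\<lambda>i. gchart_pd c i F x) (\<lambda>a. d_xi a (F x))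
     (\<lambda>i. gchart_pd c i K x) (\<lambda>i. d_p i (K x)) (\<lambda>b. d_xi b (K x))"
  using geven_derivs(2)[OF assms] by (simp add: pbr_def vf_def geven_def)

context
  fixes U \<phi> W and g :: "nat \<Rightarrow> nat \<Rightarrow> real"
  assumes c: "smooth_chart n (atlas C) (U, \<phi>)" and W: "open W" "W \<subseteq> U"
    and g_sym: "\<And>a b. a < r \<Longrightarrow> b < r \<Longrightarrow> g a b = g b a"
begin

private abbreviation "pdc \<equiv> gchart_pd (U, \<phi>)"
private abbreviation "br \<equiv> pbr (U, \<phi>) g"

lemmas fam_rules = W(1) fam_add[OF W(1)] fam_diff[OF W(1)] fam_mult[OF W(1)] fam_scaleR[OF W(1) sm_const[OF W(1)]]
  fam_sum[OF W(1)] fam_d_p[OF W(1)] fam_d_xi[OF W(1)] fam_gpar[OF W(1)]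

lemma fam_pbr:
  assumes "F \<in> fam W" "G \<in> fam W"
  shows "br F G \<in> fam W"
proof -
  have "(\<lambda>x. br F G x) \<in> fam W"
    unfolding pbr_def using assms fam_gchart_pd[OF c W]
    by (intro fam_rules) auto
  then show ?thesis by simp
qed

context
  fixes x assumes x: "x \<in> W"
begin

lemma pbr_add_left:
  assumes "F \<in> fam W" "F' \<in> fam W"
  shows "br (\<lambda>y. F y + F' y) K x = br F K x + br F' K x"
  using gchart_pd_add[OF c W x _ assms]
  by (simp add: pbr_def algebra_simps sum.distrib sum_subtractf scaleR_add_right)

lemma pbr_add_right:
  assumes "K \<in> fam W" "K' \<in> fam W"
  shows "br F (\<lambda>y. K y + K' y) x = br F K x + br F K' x"
  using gchart_pd_add[OF c W x _ assms]
  by (simp add: pbr_def algebra_simps sum.distrib sum_subtractf scaleR_add_right)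

lemma pbr_scale_right:
  assumes "K \<in> fam W"
  shows "br F (\<lambda>y. k *\<^sub>R K y) x = k *\<^sub>R br F K x"
  using gchart_pd_cscaleR[OF c W x _ assms]
  by (simp add: pbr_def scaleR_add_right scaleR_diff_right scaleR_sum_right mult.commute)

lemma pbr_scale_left:
  assumes "F \<in> fam W"
  shows "br (\<lambda>y. k *\<^sub>R F y) K x = k *\<^sub>R br F K x"
  using gchart_pd_cscaleR[OF c W x _ assms]
  by (simp add: pbr_def scaleR_add_right scaleR_diff_right scaleR_sum_right mult.commute)

lemma pbr_cong:
  assumes "\<And>y. y \<in> W \<Longrightarrow> F y = F' y" "\<And>y. y \<in> W \<Longrightarrow> K y = K' y"
  shows "br F K x = br F' K' x"
  unfolding pbr_def
  using gchart_pd_cong[OF c W x _ assms(1)] gchart_pd_cong[OF c W x _ assms(2)] assms x by simp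

lemma godd_gchart_pd:
  assumes F: "F \<in> fam W" "\<And>y. y \<in> W \<Longrightarrow> godd (F y)" and i: "i < n"
  shows "godd (pdc i F x)"
proof -
  have "gpar (pdc i F x) = pdc i (\<lambda>y. gpar (F y)) x" by (rule gchart_pd_gpar[OF c W x i F(1), symmetric])
  also have "\<dots> = pdc i (\<lambda>y. (-1) *\<^sub>R F y) x"
    by (rule gchart_pd_cong[OF c W x i]) (use F(2) in \<open>simp add: godd_def\<close>)
  also have "\<dots> = - pdc i F x" using gchart_pd_cscaleR[OF c W x i F(1), of "-1"] by simp
  finally show ?thesis by (simp add: godd_def)
qed

lemma geven_gchart_pd:
  assumes F: "F \<in> fam W" "\<And>y. y \<in> W \<Longrightarrow> geven (F y)" and i: "i < n"
  shows "geven (pdc i F x)"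
proof -
  have "gpar (pdc i F x) = pdc i (\<lambda>y. gpar (F y)) x" by (rule gchart_pd_gpar[OF c W x i F(1), symmetric])
  also have "\<dots> = pdc i F x"
    by (rule gchart_pd_cong[OF c W x i]) (use F(2) in \<open>simp add: geven_def\<close>)
  finally show ?thesis by (simp add: geven_def)
qed

text \<open>The coefficients \<open>?P\<close> and \<open>?D\<close> of \<open>{F, \<cdot>}\<close>
  are odd and \<open>?E\<close> is even, but \<open>?E\<close> goes with the odd derivation
  \<open>d_xi\<close>; so all three kinds of terms produce the same
  \<open>gpar (K x)\<close>.\<close>

lemma pbr_leibniz:
  assumes F: "F \<in> fam W" "\<And>y. y \<in> W \<Longrightarrow> godd (F y)" and K: "K \<in> fam W" "L \<in> fam W"
  shows "br F (\<lambda>y. K y * L y) x = br F K x * L x + gpar (K x) * br F L x"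
proof -
  let ?P = "\<lambda>i. d_p i (F x)" and ?D = "\<lambda>i. pdc i F x" and ?E = "\<lambda>a. d_xi a (F x)"
  have P: "?P i * (K x * k) = gpar (K x) * (?P i * k)" for i k
    using godd_mult_commute[OF godd_derivs(1)[OF F(2)[OF x]], of "gpar (K x)" i] by (simp flip: mult.assoc)
  have D: "?D i * (K x * k) = gpar (K x) * (?D i * k)" if "i < n" for i k
    using godd_mult_commute[OF godd_gchart_pd[OF F that], of "gpar (K x)"] by (simp flip: mult.assoc)
  have E: "?E a * (gpar (K x) * k) = gpar (K x) * (?E a * k)" for a k
    using geven_mult_commute[OF geven_derivs(2)[OF F(2)[OF x]], of "gpar (K x)" a] by (simp flip: mult.assoc)
  have s1: "(\<Sum>i<n. ?P i * pdc i (\<lambda>y. K y * L y) x - ?D i * d_p i (K x * L x)) =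
      (\<Sum>i<n. ?P i * pdc i K x - ?D i * d_p i (K x)) * L x +
      gpar (K x) * (\<Sum>i<n. ?P i * pdc i L x - ?D i * d_p i (L x))"
    unfolding sum_distrib_left sum_distrib_right sum.distrib[symmetric]
    by (rule sum.cong[OF refl])
       (simp add: gchart_pd_mult[OF c W x _ K] d_p_mult distrib_left P D algebra_simps)
  have s2: "(\<Sum>a<r. \<Sum>b<r. g a b *\<^sub>R (?E a * d_xi b (K x * L x))) =
      (\<Sum>a<r. \<Sum>b<r. g a b *\<^sub>R (?E a * d_xi b (K x))) * L x +
      gpar (K x) * (\<Sum>a<r. \<Sum>b<r. g a b *\<^sub>R (?E a * d_xi b (L x)))"
    by (simp add: sum_distrib_left sum_distrib_right sum.distrib d_xi_mult distrib_left E scaleR_add_right mult.assoc)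
  show ?thesis
    unfolding pbr_odd[of F x, OF F(2)[OF x]] vf_def s1 s2 by (simp add: algebra_simps)
qed

text \<open>A bracket of even degree is symmetric on odd elements; in the terms with
  \<open>d_xi\<close> this uses the symmetry of \<open>g\<close>.\<close>

lemma pbr_sym_odd:
  assumes F: "F \<in> fam W" "\<And>y. y \<in> W \<Longrightarrow> godd (F y)" and G: "G \<in> fam W" "\<And>y. y \<in> W \<Longrightarrow> godd (G y)"
  shows "br G F x = br F G x"
proof -
  note Fx = F(2)[OF x] and Gx = G(2)[OF x]
  have "(\<Sum>i<n. d_p i (G x) * pdc i F x - pdc i G x * d_p i (F x)) =
      (\<Sum>i<n. d_p i (F x) * pdc i G x - pdc i F x * d_p i (G x))"
  proof (rule sum.cong[OF refl])
    fix i assume "i \<in> {..<n}"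
    then have i: "i < n" by simp
    show "d_p i (G x) * pdc i F x - pdc i G x * d_p i (F x) = d_p i (F x) * pdc i G x - pdc i F x * d_p i (G x)"
      using godd_anticommute[OF godd_gchart_pd[OF F i] godd_derivs(1)[OF Gx, of i]]
        godd_anticommute[OF godd_derivs(1)[OF Fx, of i] godd_gchart_pd[OF G i]] by simp
  qed
  moreover have "(\<Sum>a<r. \<Sum>b<r. g a b *\<^sub>R (d_xi a (G x) * d_xi b (F x))) =
      (\<Sum>a<r. \<Sum>b<r. g a b *\<^sub>R (d_xi a (F x) * d_xi b (G x)))"
  proof (subst sum.swap, intro sum.cong refl)
    fix a b assume "a \<in> {..<r}" "b \<in> {..<r}"
    then show "g b a *\<^sub>R (d_xi b (G x) * d_xi a (F x)) = g a b *\<^sub>R (d_xi a (F x) * d_xi b (G x))"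
      using geven_mult_commute[OF geven_derivs(2)[OF Fx, of a], of "d_xi b (G x)"] g_sym by simp
  qed
  ultimately show ?thesis unfolding pbr_odd[of F x, OF Fx] pbr_odd[of G x, OF Gx] vf_def by simp
qed

lemma pbr_sym_even:
  assumes F: "F \<in> fam W" "\<And>y. y \<in> W \<Longrightarrow> godd (F y)" and G: "G \<in> fam W" "\<And>y. y \<in> W \<Longrightarrow> geven (G y)"
  shows "br G F x = - br F G x"
proof -
  note Fx = F(2)[OF x] and Gx = G(2)[OF x]
  have "(\<Sum>i<n. d_p i (G x) * pdc i F x - pdc i G x * d_p i (F x)) =
      - (\<Sum>i<n. d_p i (F x) * pdc i G x - pdc i F x * d_p i (G x))"
    unfolding sum_negf[symmetric]
  proof (rule sum.cong[OF refl])
    fix i assume "i \<in> {..<n}"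
    then have i: "i < n" by simp
    show "d_p i (G x) * pdc i F x - pdc i G x * d_p i (F x) = - (d_p i (F x) * pdc i G x - pdc i F x * d_p i (G x))"
      using geven_mult_commute[OF geven_gchart_pd[OF G i], of "d_p i (F x)"]
        geven_mult_commute[OF geven_derivs(1)[OF Gx, of i], of "pdc i F x"] by simp
  qed
  moreover have "(\<Sum>a<r. \<Sum>b<r. g a b *\<^sub>R (gpar (d_xi a (G x)) * d_xi b (F x))) =
      - (\<Sum>a<r. \<Sum>b<r. g a b *\<^sub>R (d_xi a (F x) * d_xi b (G x)))"
    unfolding sum_negf[symmetric]
  proof (subst sum.swap, intro sum.cong refl)
    fix a b assume "a \<in> {..<r}" "b \<in> {..<r}"
    then show "g b a *\<^sub>R (gpar (d_xi b (G x)) * d_xi a (F x)) = - (g a b *\<^sub>R (d_xi a (F x) * d_xi b (G x)))"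
      using geven_mult_commute[OF geven_derivs(2)[OF Fx, of a], of "d_xi b (G x)"] g_sym
        godd_derivs(2)[OF Gx, of b] by (simp add: godd_def)
  qed
  ultimately show ?thesis
    unfolding pbr_odd[of F x, OF Fx] vf_def unfolding pbr_def by simp
qed

text \<open>Base derivatives commute with all the other derivatives and \<open>g\<close> is
  constant, so they act on a bracket by the plain product rule.\<close>

lemma gchart_pd_pbr:
  assumes F: "F \<in> fam W" and K: "K \<in> fam W" and j: "j < n"
  shows "pdc j (br F K) x = br (pdc j F) K x + br F (pdc j K) x"
proof -
  note pdF = fam_gchart_pd[OF c W F] and pdK = fam_gchart_pd[OF c W K]
  have A: "(\<lambda>y. \<Sum>i<n. d_p i (F y) * pdc i K y - pdc i F y * d_p i (K y)) \<in> fam W"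
    by (intro fam_rules pdF pdK F K) auto
  have B: "(\<lambda>y. \<Sum>a<r. \<Sum>b<r. g a b *\<^sub>R (gpar (d_xi a (F y)) * d_xi b (K y))) \<in> fam W"
    by (intro fam_rules F K)
  have 1: "pdc j (\<lambda>y. d_p i (F y) * pdc i K y - pdc i F y * d_p i (K y)) x =
      d_p i (pdc j F x) * pdc i K x - pdc i (pdc j F) x * d_p i (K x) +
      (d_p i (F x) * pdc i (pdc j K) x - pdc i F x * d_p i (pdc j K x))" if i: "i < n" for i
  proof -
    have a: "(\<lambda>y. d_p i (F y) * pdc i K y) \<in> fam W" "(\<lambda>y. pdc i F y * d_p i (K y)) \<in> fam W"
      by (intro fam_rules pdF[OF i] pdK[OF i] F K)+
    show ?thesis
      unfolding gchart_pd_diff[OF c W x j a] gchart_pd_mult[OF c W x j fam_d_p[OF W(1) F] pdK[OF i]]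
        gchart_pd_mult[OF c W x j pdF[OF i] fam_d_p[OF W(1) K]]
        gchart_pd_d_p[OF c W x j F] gchart_pd_d_p[OF c W x j K]
        gchart_pd_commute[OF c W F x j i] gchart_pd_commute[OF c W K x j i]
      by (simp add: algebra_simps)
  qed
  have 2: "pdc j (\<lambda>y. g a b *\<^sub>R (gpar (d_xi a (F y)) * d_xi b (K y))) x =
      g a b *\<^sub>R (gpar (d_xi a (pdc j F x)) * d_xi b (K x)) + g a b *\<^sub>R (gpar (d_xi a (F x)) * d_xi b (pdc j K x))" for a b
  proof -
    have a: "(\<lambda>y. gpar (d_xi a (F y))) \<in> fam W" "(\<lambda>y. d_xi b (K y)) \<in> fam W"
      by (intro fam_rules F K)+
    show ?thesis
      unfolding gchart_pd_cscaleR[OF c W x j fam_mult[OF W(1) a]] gchart_pd_mult[OF c W x j a]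
        gchart_pd_gpar[OF c W x j fam_d_xi[OF W(1) F]] gchart_pd_d_xi[OF c W x j F] gchart_pd_d_xi[OF c W x j K]
      by (simp add: scaleR_add_right)
  qed
  have eq: "br F K = (\<lambda>y. (\<Sum>i<n. d_p i (F y) * pdc i K y - pdc i F y * d_p i (K y)) +
      (\<Sum>a<r. \<Sum>b<r. g a b *\<^sub>R (gpar (d_xi a (F y)) * d_xi b (K y))))"
    by (rule ext) (simp only: pbr_def)
  have "pdc j (br F K) x = (\<Sum>i<n. pdc j (\<lambda>y. d_p i (F y) * pdc i K y - pdc i F y * d_p i (K y)) x) +
      (\<Sum>a<r. \<Sum>b<r. pdc j (\<lambda>y. g a b *\<^sub>R (gpar (d_xi a (F y)) * d_xi b (K y))) x)"
    unfolding eq gchart_pd_add[OF c W x j A B]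
    by (subst gchart_pd_sum[OF c W x j], (intro fam_rules pdF pdK F K; simp),
        subst gchart_pd_sum[OF c W x j], (intro fam_rules F K),
        subst gchart_pd_sum[OF c W x j], (intro fam_rules F K), rule refl)
  also have "\<dots> = br (pdc j F) K x + br F (pdc j K) x"
    by (simp add: 1 2 pbr_def sum.distrib)
  finally show ?thesis .
qed

lemma d_p_pbr:
  assumes F: "F \<in> fam W" and K: "K \<in> fam W"
  shows "d_p j (br F K x) = br (\<lambda>y. d_p j (F y)) K x + br F (\<lambda>y. d_p j (K y)) x"
proof -
  have 1: "pdc i (\<lambda>y. d_p j (F y)) x = d_p j (pdc i F x)" "pdc i (\<lambda>y. d_p j (K y)) x = d_p j (pdc i K x)" if "i < n" for i
    using gchart_pd_d_p[OF c W x that] F K by auto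
  have 2: "d_p j (d_p i f) = d_p i (d_p j f)" "d_p j (d_xi a f) = d_xi a (d_p j f)"
    "d_p j (gpar f) = gpar (d_p j f)" for i a f
    by (rule d_p_commute d_p_d_xi gpar_d_p[symmetric])+
  show ?thesis
    unfolding pbr_def
    by (simp add: d_p_sum d_p_mult 1 2 sum.distrib sum_subtractf scaleR_add_right algebra_simps)
qed

text \<open>The sign in front of the second bracket arises because the odd \<open>d_xi a\<close> has
  to pass the odd \<open>F\<close>.\<close>

lemma d_xi_pbr:
  assumes F: "F \<in> fam W" "\<And>y. y \<in> W \<Longrightarrow> godd (F y)" and K: "K \<in> fam W"
  shows "d_xi a (br F K x) = br (\<lambda>y. d_xi a (F y)) K x - br F (\<lambda>y. d_xi a (K y)) x"
proof -
  note Fx = F(2)[OF x]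
  have 1: "pdc i (\<lambda>y. d_xi a (F y)) x = d_xi a (pdc i F x)" "pdc i (\<lambda>y. d_xi a (K y)) x = d_xi a (pdc i K x)" if "i < n" for i
    using gchart_pd_d_xi[OF c W x that] F(1) K by auto
  have p: "gpar (d_p i (F x)) = - d_p i (F x)" "gpar (d_xi b (F x)) = d_xi b (F x)" for i b
    using godd_derivs(1)[OF Fx] geven_derivs(2)[OF Fx] by (auto simp: godd_def geven_def)
  have q: "gpar (pdc i F x) = - pdc i F x" if "i < n" for i
    using godd_gchart_pd[OF F that] by (simp add: godd_def)
  have d: "gpar (d_xi b (d_xi a (F x))) = d_xi a (d_xi b (F x))" for b
    using d_xi_anticommute[of b a "F x"] p by (simp add: gpar_d_xi godd_def Fx[unfolded godd_def])
  have dp: "d_xi a (d_p i f) = d_p i (d_xi a f)" for i f by (rule d_p_d_xi[symmetric])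
  have s1: "d_xi a (\<Sum>i<n. d_p i (F x) * pdc i K x - pdc i F x * d_p i (K x)) =
      (\<Sum>i<n. d_p i (d_xi a (F x)) * pdc i K x - d_xi a (pdc i F x) * d_p i (K x)) -
      (\<Sum>i<n. d_p i (F x) * d_xi a (pdc i K x) - pdc i F x * d_p i (d_xi a (K x)))"
    unfolding d_xi_sum sum_subtractf[symmetric]
    by (rule sum.cong[OF refl]) (simp add: d_xi_mult p q dp)
  have s2: "d_xi a (\<Sum>c<r. \<Sum>b<r. g c b *\<^sub>R (d_xi c (F x) * d_xi b (K x))) =
      (\<Sum>c<r. \<Sum>b<r. g c b *\<^sub>R (d_xi a (d_xi c (F x)) * d_xi b (K x))) -
      (\<Sum>c<r. \<Sum>b<r. g c b *\<^sub>R (d_xi c (F x) * d_xi b (d_xi a (K x))))"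
    unfolding d_xi_sum sum_subtractf[symmetric]
    by (intro sum.cong refl) (simp add: d_xi_mult p d_xi_anticommute[of a _ "K x"] scaleR_diff_right)
  show ?thesis
    unfolding pbr_def p d using 1 by (simp add: s1 s2)
qed

text \<open>For odd \<open>F\<close> the operator \<open>{F, \<cdot>}\<close> has the form
  \<open>vf\<close>. Applied to \<open>{F, K}\<close> it produces second derivatives of
  \<open>K\<close>, which cancel by \<open>vf_second_order\<close>, and terms in which it acts on
  its own coefficients, the derivatives of \<open>F\<close>. By the symmetry of the bracket these
  are half of the derivatives of \<open>{F, F}\<close>.\<close>

lemma pbr_pbr_odd:
  assumes F: "F \<in> fam W" "\<And>y. y \<in> W \<Longrightarrow> godd (F y)" and K: "K \<in> fam W"
  shows "2 *\<^sub>R br F (br F K) x = br (br F F) K x"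
proof -
  note Fx = F(2)[OF x]
  \<comment> \<open>\<open>P\<close> and \<open>D\<close> are set to 0 from \<open>n\<close> on,
    because \<open>vf_second_order\<close> asks for the parity of the coefficients at every index,
    while base derivatives are controlled below \<open>n\<close>.\<close>
  define P where "P i = (if i < n then d_p i (F x) else 0)" for i
  define D where "D i = (if i < n then pdc i F x else 0)" for i
  define E where "E a = d_xi a (F x)" for a
  let ?V = "vf n r g P D E"
  have Vcong: "?V u v w = ?V u' v' w'"
    if "\<And>i. i < n \<Longrightarrow> u i = u' i" "\<And>i. i < n \<Longrightarrow> v i = v' i" "\<And>b. b < r \<Longrightarrow> w b = w' b" for u v w u' v' w'
    unfolding vf_def using that by simp
  have V: "br F L x = ?V (\<lambda>i. pdc i L x) (\<lambda>i. d_p i (L x)) (\<lambda>b. d_xi b (L x))" for L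
    unfolding pbr_odd[of F x, OF Fx] vf_def by (simp add: P_def D_def E_def)
  have PDE: "godd (P i)" "godd (D i)" "geven (E a)" for i a
    using godd_derivs(1)[OF Fx] godd_gchart_pd[OF F] geven_derivs(2)[OF Fx]
    by (auto simp: P_def D_def E_def)
  have pF: "(\<lambda>y. d_p i (F y)) \<in> fam W" "(\<lambda>y. d_xi a (F y)) \<in> fam W"
    "(\<lambda>y. d_p i (K y)) \<in> fam W" "(\<lambda>y. d_xi a (K y)) \<in> fam W" for i a
    by (intro fam_rules F K)+
  note pdF = fam_gchart_pd[OF c W F(1)] and pdK = fam_gchart_pd[OF c W K]
  have cF: "pdc j (\<lambda>y. d_p i (F y)) x = d_p i (pdc j F x)" "pdc j (\<lambda>y. d_xi a (F y)) x = d_xi a (pdc j F x)"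
    "pdc j (\<lambda>y. d_p i (K y)) x = d_p i (pdc j K x)" "pdc j (\<lambda>y. d_xi a (K y)) x = d_xi a (pdc j K x)"
    if "j < n" for i j a
    using gchart_pd_d_p[OF c W x that] gchart_pd_d_xi[OF c W x that] F K by auto
  have brE: "br L K x = (\<Sum>i<n. d_p i (L x) * pdc i K x) - (\<Sum>i<n. pdc i L x * d_p i (K x)) +
      (\<Sum>a<r. \<Sum>b<r. g a b *\<^sub>R (gpar (d_xi a (L x)) * d_xi b (K x)))" for L
    by (simp add: pbr_def sum_subtractf)
  have second: "?V (\<lambda>j. br F (pdc j K) x) (\<lambda>j. br F (\<lambda>y. d_p j (K y)) x)
      (\<lambda>d. - br F (\<lambda>y. d_xi d (K y)) x) = 0"
  proof -
    have "?V (\<lambda>j. br F (pdc j K) x) (\<lambda>j. br F (\<lambda>y. d_p j (K y)) x) (\<lambda>d. - br F (\<lambda>y. d_xi d (K y)) x) =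
      ?V (\<lambda>j. ?V (\<lambda>i. pdc i (pdc j K) x) (\<lambda>i. d_p i (pdc j K x)) (\<lambda>b. d_xi b (pdc j K x)))
         (\<lambda>j. ?V (\<lambda>i. d_p j (pdc i K x)) (\<lambda>i. d_p i (d_p j (K x))) (\<lambda>b. d_xi b (d_p j (K x))))
         (\<lambda>d. - ?V (\<lambda>i. d_xi d (pdc i K x)) (\<lambda>i. d_xi d (d_p i (K x))) (\<lambda>b. d_xi b (d_xi d (K x))))"
      unfolding V
    proof (rule Vcong, goal_cases)
      case (2 j)
      show ?case by (rule Vcong) (simp_all add: cF)
    next
      case (3 d)
      show ?case by (rule arg_cong[where f = uminus], rule Vcong) (simp_all add: cF d_p_d_xi)
    qed simp
    also have "\<dots> = 0"
      by (rule vf_second_order[OF PDE])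
         (auto simp: gchart_pd_commute[OF c W K x] d_p_commute intro: d_xi_anticommute)
    finally show ?thesis .
  qed
  \<comment> \<open>In \<open>q1\<close>, \<open>q2\<close> and \<open>q3\<close> the inner
    derivatives are commuted into place, so that \<open>{F, \<cdot>}\<close> appears applied to a
    single derivative of \<open>F\<close>.\<close>
  have q1: "?V (\<lambda>j. d_p i (pdc j F x)) (\<lambda>j. d_p i (d_p j (F x))) (\<lambda>d. d_p i (d_xi d (F x))) =
      br F (\<lambda>y. d_p i (F y)) x" for i
    unfolding V by (rule Vcong) (simp_all add: cF d_p_commute[of i] d_p_d_xi)
  have q2: "?V (\<lambda>j. pdc i (pdc j F) x) (\<lambda>j. pdc i (\<lambda>y. d_p j (F y)) x) (\<lambda>d. pdc i (\<lambda>y. d_xi d (F y)) x) =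
      br F (pdc i F) x" if "i < n" for i
    unfolding V by (rule Vcong) (simp_all add: cF that gchart_pd_commute[OF c W F(1) x that])
  have q3: "?V (\<lambda>j. gpar (d_xi a (pdc j F x))) (\<lambda>j. gpar (d_xi a (d_p j (F x)))) (\<lambda>d. gpar (d_xi a (d_xi d (F x)))) =
      br F (\<lambda>y. d_xi a (F y)) x" for a
    unfolding V
  proof (rule Vcong)
    show "gpar (d_xi a (pdc i F x)) = pdc i (\<lambda>y. d_xi a (F y)) x" if "i < n" for i
      using geven_derivs(2)[OF godd_gchart_pd[OF F that]] by (simp add: cF that geven_def)
    show "gpar (d_xi a (d_p i (F x))) = d_p i (d_xi a (F x))" for i
      using geven_derivs(2)[OF godd_derivs(1)[OF Fx]] by (simp add: geven_def d_p_d_xi)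
    show "gpar (d_xi a (d_xi b (F x))) = d_xi b (d_xi a (F x))" for b
      using godd_derivs(2)[OF geven_derivs(2)[OF Fx, of b], of a] d_xi_anticommute[of a b "F x"]
      by (simp add: godd_def)
  qed
  have first: "?V (\<lambda>j. br (pdc j F) K x) (\<lambda>j. br (\<lambda>y. d_p j (F y)) K x) (\<lambda>d. br (\<lambda>y. d_xi d (F y)) K x) =
      (\<Sum>i<n. br F (\<lambda>y. d_p i (F y)) x * pdc i K x) - (\<Sum>i<n. br F (pdc i F) x * d_p i (K x)) +
      (\<Sum>a<r. \<Sum>b<r. g a b *\<^sub>R (br F (\<lambda>y. d_xi a (F y)) x * d_xi b (K x)))"
    unfolding brE vf_add vf_diff vf_sum vf_scaleR vf_mult_right q1 q3
    using q2 by simp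
  have "br F (br F K) x = ?V (\<lambda>j. br (pdc j F) K x + br F (pdc j K) x)
      (\<lambda>j. br (\<lambda>y. d_p j (F y)) K x + br F (\<lambda>y. d_p j (K y)) x)
      (\<lambda>d. br (\<lambda>y. d_xi d (F y)) K x + (- br F (\<lambda>y. d_xi d (K y)) x))"
    unfolding V[of "br F K"]
    by (rule Vcong) (simp_all add: gchart_pd_pbr[OF F(1) K] d_p_pbr[OF F(1) K] d_xi_pbr[OF F K])
  also have "\<dots> = (\<Sum>i<n. br F (\<lambda>y. d_p i (F y)) x * pdc i K x) - (\<Sum>i<n. br F (pdc i F) x * d_p i (K x)) +
      (\<Sum>a<r. \<Sum>b<r. g a b *\<^sub>R (br F (\<lambda>y. d_xi a (F y)) x * d_xi b (K x)))"
    unfolding vf_add second first by simp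
  finally have L: "br F (br F K) x = (\<Sum>i<n. br F (\<lambda>y. d_p i (F y)) x * pdc i K x) -
      (\<Sum>i<n. br F (pdc i F) x * d_p i (K x)) +
      (\<Sum>a<r. \<Sum>b<r. g a b *\<^sub>R (br F (\<lambda>y. d_xi a (F y)) x * d_xi b (K x)))" .
  \<comment> \<open>A derivative of \<open>{F, F}\<close> falls on either entry, and by the symmetry
    rules for the bracket the two results add up; whence the factor 2 in \<open>r1\<close>,
    \<open>r2\<close> and \<open>r3\<close>.\<close>
  have r1: "d_p i (br F F x) = 2 *\<^sub>R br F (\<lambda>y. d_p i (F y)) x" for i
    using pbr_sym_odd[OF F pF(1)[of i]] godd_derivs(1)[OF F(2)] by (simp add: d_p_pbr[OF F(1,1)] scaleR_2)
  have r2: "pdc i (br F F) x = 2 *\<^sub>R br F (pdc i F) x" if "i < n" for i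
  proof -
    have "godd (pdc i F y)" if "y \<in> W" for y
    proof -
      have "gpar (pdc i F y) = pdc i (\<lambda>y. gpar (F y)) y"
        by (rule gchart_pd_gpar[OF c W \<open>y \<in> W\<close> \<open>i < n\<close> F(1), symmetric])
      also have "\<dots> = pdc i (\<lambda>y. (-1) *\<^sub>R F y) y"
        by (rule gchart_pd_cong[OF c W \<open>y \<in> W\<close> \<open>i < n\<close>]) (use F(2) in \<open>simp add: godd_def\<close>)
      also have "\<dots> = - pdc i F y" using gchart_pd_cscaleR[OF c W \<open>y \<in> W\<close> \<open>i < n\<close> F(1), of "-1"] by simp
      finally show ?thesis by (simp add: godd_def)
    qed
    then show ?thesis
      using pbr_sym_odd[OF F pdF[OF that]] by (simp add: gchart_pd_pbr[OF F(1,1) that] scaleR_2)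
  qed
  have r3: "gpar (d_xi a (br F F x)) = 2 *\<^sub>R br F (\<lambda>y. d_xi a (F y)) x" for a
  proof -
    have "geven (d_xi a (F y))" if "y \<in> W" for y using geven_derivs(2)[OF F(2)[OF that]] .
    then have "d_xi a (br F F x) = - (2 *\<^sub>R br F (\<lambda>y. d_xi a (F y)) x)"
      using pbr_sym_even[OF F pF(2)[of a]] by (simp add: d_xi_pbr[OF F F(1)] scaleR_2)
    moreover have "br F F x = ?V D P E"
      unfolding V by (rule Vcong) (simp_all add: P_def D_def E_def)
    then have "geven (br F F x)"
      unfolding vf_def using PDE by (simp add: geven_def godd_def gpar_sum)
    then have "gpar (d_xi a (br F F x)) = - d_xi a (br F F x)"
      using godd_derivs(2) by (auto simp: godd_def)
    ultimately show ?thesis by simp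
  qed
  show ?thesis
    unfolding L brE[of "br F F"] r1 r3 using r2
    by (simp add: scaleR_add_right scaleR_diff_right scaleR_sum_right mult.commute)
qed

end

text \<open>Polarisation: the identity for one odd element is applied to \<open>F + G\<close>, and
  those for \<open>F\<close> and for \<open>G\<close> are subtracted.\<close>

lemma pbr_jacobi_odd:
  assumes F: "F \<in> fam W" "\<And>y. y \<in> W \<Longrightarrow> godd (F y)" and G: "G \<in> fam W" "\<And>y. y \<in> W \<Longrightarrow> godd (G y)"
    and K: "K \<in> fam W" and x: "x \<in> W"
  shows "br F (br G K) x + br G (br F K) x = br (br F G) K x"
proof -
  let ?H = "\<lambda>y. F y + G y"
  have H: "?H \<in> fam W" "\<And>y. y \<in> W \<Longrightarrow> godd (?H y)" using fam_add[OF W(1) F(1) G(1)] F G by auto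
  note fams = fam_pbr[OF F(1) K] fam_pbr[OF G(1) K] fam_pbr[OF F(1) F(1)] fam_pbr[OF F(1) G(1)]
    fam_pbr[OF G(1) G(1)]
  have e1: "br ?H (br ?H K) x = br F (br F K) x + br F (br G K) x + (br G (br F K) x + br G (br G K) x)"
  proof -
    have "br ?H (br ?H K) x = br ?H (\<lambda>y. br F K y + br G K y) x"
      by (rule pbr_cong[OF x refl]) (rule pbr_add_left[OF _ F(1) G(1)])
    then show ?thesis
      unfolding pbr_add_left[OF x F(1) G(1)] pbr_add_right[OF x fams(1,2)] by simp
  qed
  have "br ?H ?H y = br F F y + (2 *\<^sub>R br F G y + br G G y)" if y: "y \<in> W" for y
    using pbr_sym_odd[OF y F G]
    by (simp add: pbr_add_left[OF y F(1) G(1)] pbr_add_right[OF y F(1) G(1)] scaleR_2)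
  then have "br (br ?H ?H) K x = br (\<lambda>y. br F F y + (2 *\<^sub>R br F G y + br G G y)) K x"
    by (rule pbr_cong[OF x _ refl])
  also have "\<dots> = br (br F F) K x + (br (\<lambda>y. 2 *\<^sub>R br F G y) K x + br (br G G) K x)"
  proof -
    have f2: "(\<lambda>y. 2 *\<^sub>R br F G y) \<in> fam W" using fams(4) by (intro fam_rules) simp
    show ?thesis
      unfolding pbr_add_left[OF x fams(3) fam_add[OF W(1) f2 fams(5)]] pbr_add_left[OF x f2 fams(5)] by simp
  qed
  also have "br (\<lambda>y. 2 *\<^sub>R br F G y) K x = 2 *\<^sub>R br (br F G) K x"
    by (rule pbr_scale_left[OF x fams(4)])
  finally have e2: "2 *\<^sub>R br ?H (br ?H K) x =
      br (br F F) K x + (2 *\<^sub>R br (br F G) K x + br (br G G) K x)"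
    using pbr_pbr_odd[OF x H K] by simp
  have "2 *\<^sub>R (br F (br G K) x + br G (br F K) x) =
      2 *\<^sub>R br ?H (br ?H K) x - br (br F F) K x - br (br G G) K x"
    unfolding e1 using pbr_pbr_odd[OF x F K] pbr_pbr_odd[OF x G K]
    by (simp add: scaleR_add_right)
  also have "\<dots> = 2 *\<^sub>R br (br F G) K x" unfolding e2 by simp
  finally show ?thesis by simp
qed

end

end

section \<open>Invariance under coordinate changes\<close>

text \<open>A derivation along a homomorphism \<Phi> is determined by its values on the generators,
  which gives the chain rule for \<Phi>. The flag \<open>odd'\<close> selects the sign rule:
  \<open>d_xi\<close> is odd, the derivatives along base and momenta are even. Linearity is asked
  for on the variables of a chart only, where base derivatives are well behaved.\<close>

lemma derivation_along_hom:
  fixes \<Phi> D :: "gpoly \<Rightarrow> gpoly" and odd' :: bool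
  assumes \<Phi>: "\<And>f g. \<Phi> (f + g) = \<Phi> f + \<Phi> g" "\<And>c f. \<Phi> (c *\<^sub>R f) = c *\<^sub>R \<Phi> f" "\<And>f g. \<Phi> (f * g) = \<Phi> f * \<Phi> g"
      "\<And>f. \<Phi> (gpar f) = gpar (\<Phi> f)"
    and D: "\<And>f g. gvars {..<r} {..<n} f \<Longrightarrow> gvars {..<r} {..<n} g \<Longrightarrow> D (f + g) = D f + D g"
      "\<And>c f. gvars {..<r} {..<n} f \<Longrightarrow> D (c *\<^sub>R f) = c *\<^sub>R D f" "D 1 = 0"
      "\<And>a f. a < r \<Longrightarrow> gvars {..<r} {..<n} f \<Longrightarrow> D (g_xi a * f) = D (g_xi a) * \<Phi> f +
        (if odd' then - \<Phi> (g_xi a) else \<Phi> (g_xi a)) * D f"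
      "\<And>i f. i < n \<Longrightarrow> gvars {..<r} {..<n} f \<Longrightarrow> D (g_p i * f) = D (g_p i) * \<Phi> f + \<Phi> (g_p i) * D f"
    and par: "\<And>a. a < r \<Longrightarrow> gpar (D (g_xi a)) = (if odd' then D (g_xi a) else - D (g_xi a))"
      "\<And>i. i < n \<Longrightarrow> gpar (D (g_p i)) = (if odd' then - D (g_p i) else D (g_p i))"
    and f: "gvars {..<r} {..<n} f"
  shows "D f = (\<Sum>a<r. D (g_xi a) * \<Phi> (d_xi a f)) + (\<Sum>i<n. D (g_p i) * \<Phi> (d_p i f))"
proof -
  have \<Phi>0: "\<Phi> 0 = 0" using \<Phi>(2)[of 0 0] by simp
  have \<Phi>d: "\<Phi> (f - g) = \<Phi> f - \<Phi> g" for f g using \<Phi>(1)[of f "(-1) *\<^sub>R g"] \<Phi>(2)[of "-1" g] by simp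
  have \<Phi>if: "\<Phi> (if b then f else 0) = (if b then \<Phi> f else 0)" for b f by (simp add: \<Phi>0)
  have "gvars {..<r} {..<n} f \<and>
      D f = (\<Sum>a<r. D (g_xi a) * \<Phi> (d_xi a f)) + (\<Sum>i<n. D (g_p i) * \<Phi> (d_p i f))"
    using f
  proof (induction f rule: gpoly_induct)
    case one
    then show ?case using D(3) by (auto simp: \<Phi>0)
  next
    case (add f g)
    then show ?case using D(1) by (auto simp: \<Phi> distrib_left sum.distrib)
  next
    case (scale c f)
    then show ?case using D(2) by (auto simp: \<Phi> scaleR_add_right scaleR_sum_right)
  next
    case (xi b f)
    then have b: "b < r" and f: "gvars {..<r} {..<n} f" by auto
    let ?s = "if odd' then -1 else 1 :: real"
    have o: "godd (\<Phi> (g_xi b))" using \<Phi>(4)[of "g_xi b"] \<Phi>(2)[of "-1" "g_xi b"] by (simp add: godd_def)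
    have 1: "(?s *\<^sub>R \<Phi> (g_xi b)) * (D (g_xi a) * k) = - (D (g_xi a) * (\<Phi> (g_xi b) * k))" if "a < r" for a k
      using godd_mult_commute[OF o, of "D (g_xi a)"] par(1)[OF that] by (auto simp flip: mult.assoc)
    have 2: "(?s *\<^sub>R \<Phi> (g_xi b)) * (D (g_p i) * k) = D (g_p i) * (\<Phi> (g_xi b) * k)" if "i < n" for i k
      using godd_mult_commute[OF o, of "D (g_p i)"] par(2)[OF that] by (auto simp flip: mult.assoc)
    have "D (g_xi b * f) = D (g_xi b) * \<Phi> f + (?s *\<^sub>R \<Phi> (g_xi b)) * D f" using D(4)[OF b f] by auto
    also have "D f = (\<Sum>a<r. D (g_xi a) * \<Phi> (d_xi a f)) + (\<Sum>i<n. D (g_p i) * \<Phi> (d_p i f))"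
      using xi by blast
    also have "(?s *\<^sub>R \<Phi> (g_xi b)) * \<dots> = (\<Sum>a<r. - (D (g_xi a) * (\<Phi> (g_xi b) * \<Phi> (d_xi a f)))) +
        (\<Sum>i<n. D (g_p i) * (\<Phi> (g_xi b) * \<Phi> (d_p i f)))"
      unfolding distrib_left sum_distrib_left using 1 2 by simp
    finally have "D (g_xi b * f) = D (g_xi b) * \<Phi> f + ((\<Sum>a<r. - (D (g_xi a) * (\<Phi> (g_xi b) * \<Phi> (d_xi a f)))) +
        (\<Sum>i<n. D (g_p i) * (\<Phi> (g_xi b) * \<Phi> (d_p i f))))" .
    moreover have "(\<Sum>a<r. D (g_xi a) * \<Phi> (d_xi a (g_xi b * f))) =
        D (g_xi b) * \<Phi> f + (\<Sum>a<r. - (D (g_xi a) * (\<Phi> (g_xi b) * \<Phi> (d_xi a f))))"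
    proof -
      have "(\<Sum>a<r. D (g_xi a) * \<Phi> (d_xi a (g_xi b * f))) =
          (\<Sum>a<r. (if a = b then D (g_xi a) * \<Phi> f else 0) + - (D (g_xi a) * (\<Phi> (g_xi b) * \<Phi> (d_xi a f))))"
        by (rule sum.cong) (auto simp: d_xi_xi_mult \<Phi>d \<Phi>(3) \<Phi>0 right_diff_distrib)
      then show ?thesis using b by (simp add: sum.distrib sum_negf sum_subtractf)
    qed
    ultimately show ?case using f b by (auto simp: d_p_xi_mult \<Phi>(3))
  next
    case (p j f)
    then have j: "j < n" and f: "gvars {..<r} {..<n} f" by auto
    have ev: "geven (\<Phi> (g_p j))" using \<Phi>(4)[of "g_p j"] by (simp add: geven_def)
    have 1: "\<Phi> (g_p j) * (h * k) = h * (\<Phi> (g_p j) * k)" for h k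
      using geven_mult_commute[OF ev, of h] by (simp flip: mult.assoc)
    have "D (g_p j * f) = D (g_p j) * \<Phi> f + \<Phi> (g_p j) * D f" by (rule D(5)[OF j f])
    also have "D f = (\<Sum>a<r. D (g_xi a) * \<Phi> (d_xi a f)) + (\<Sum>i<n. D (g_p i) * \<Phi> (d_p i f))"
      using p by blast
    also have "\<Phi> (g_p j) * \<dots> = (\<Sum>a<r. D (g_xi a) * (\<Phi> (g_p j) * \<Phi> (d_xi a f))) +
        (\<Sum>i<n. D (g_p i) * (\<Phi> (g_p j) * \<Phi> (d_p i f)))"
      unfolding distrib_left sum_distrib_left 1 ..
    finally have "D (g_p j * f) = D (g_p j) * \<Phi> f + ((\<Sum>a<r. D (g_xi a) * (\<Phi> (g_p j) * \<Phi> (d_xi a f))) +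
        (\<Sum>i<n. D (g_p i) * (\<Phi> (g_p j) * \<Phi> (d_p i f))))" .
    moreover have "(\<Sum>i<n. D (g_p i) * \<Phi> (d_p i (g_p j * f))) =
        D (g_p j) * \<Phi> f + (\<Sum>i<n. D (g_p i) * (\<Phi> (g_p j) * \<Phi> (d_p i f)))"
    proof -
      have "(\<Sum>i<n. D (g_p i) * \<Phi> (d_p i (g_p j * f))) =
          (\<Sum>i<n. (if i = j then D (g_p i) * \<Phi> f else 0) + D (g_p i) * (\<Phi> (g_p j) * \<Phi> (d_p i f)))"
        by (rule sum.cong) (auto simp: d_p_p_mult \<Phi>(1,3) \<Phi>0 distrib_left)
      then show ?thesis using j by (simp add: sum.distrib)
    qed
    ultimately show ?case using f j by (auto simp: d_xi_p_mult \<Phi>(3))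
  qed
  then show ?thesis ..
qed

lemma sum_swap4:
  assumes "finite A" "finite B" "finite I" "finite J"
  shows "(\<Sum>c\<in>I. \<Sum>d\<in>J. \<Sum>a\<in>A. \<Sum>b\<in>B. f c d a b) = (\<Sum>a\<in>A. \<Sum>b\<in>B. \<Sum>c\<in>I. \<Sum>d\<in>J. f c d a b)"
proof -
  have "(\<Sum>c\<in>I. \<Sum>d\<in>J. \<Sum>a\<in>A. \<Sum>b\<in>B. f c d a b) = (\<Sum>c\<in>I. \<Sum>a\<in>A. \<Sum>d\<in>J. \<Sum>b\<in>B. f c d a b)"
    by (rule sum.cong[OF refl]) (rule sum.swap)
  also have "\<dots> = (\<Sum>a\<in>A. \<Sum>c\<in>I. \<Sum>b\<in>B. \<Sum>d\<in>J. f c d a b)"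
    by (subst sum.swap) (intro sum.cong[OF refl] sum.swap)
  also have "\<dots> = (\<Sum>a\<in>A. \<Sum>b\<in>B. \<Sum>c\<in>I. \<Sum>d\<in>J. f c d a b)"
    by (rule sum.cong[OF refl]) (rule sum.swap)
  finally show ?thesis .
qed

lemma sum_bilinear:
  fixes u v :: "nat \<Rightarrow> nat \<Rightarrow> gpoly"
  assumes "finite A" "finite B"
  shows "(\<Sum>c<r. \<Sum>d<r. h c d *\<^sub>R ((\<Sum>a\<in>A. u c a) * (\<Sum>b\<in>B. v d b))) =
    (\<Sum>a\<in>A. \<Sum>b\<in>B. \<Sum>c<(r::nat). \<Sum>d<(r::nat). h c d *\<^sub>R (u c a * v d b))"
  unfolding sum_product scaleR_sum_right by (rule sum_swap4) (use assms in auto)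

context courant_algebroid
begin

lemma frame_coord_sum:
  assumes fr: "frame_at r (fibre C) e x" and v: "\<And>b. b \<in> I \<Longrightarrow> v b \<in> fibre C x"
  shows "frame_coord r e x (\<Sum>b\<in>I. k b *\<^sub>R v b) a = (\<Sum>b\<in>I. k b * frame_coord r e x (v b) a)"
  using v
proof (induction I rule: infinite_finite_induct)
  case (insert b I)
  have "(\<Sum>b\<in>I. k b *\<^sub>R v b) \<in> fibre C x"
    using insert.prems by (intro subspace_sum[OF fibre_subspace] subspace_scale[OF fibre_subspace]) auto
  then show ?case
    using insert frame_coord_linear[OF fr, of "v b" "\<Sum>b\<in>I. k b *\<^sub>R v b" "k b" 1 a] by simp
qed (use frame_coord_linear[OF fr, of 0 0 0 0 a] subspace_0[OF fibre_subspace] in auto)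

text \<open>Smoothness of the pseudo-metric is assumed in the frames of \<open>trivs\<close>;
  arbitrary sections are expanded locally in such a frame.\<close>

lemma sm_pairing:
  assumes W: "open W" and s: "smooth_section n (atlas C) r (fibre C) (trivs C) W s"
    "smooth_section n (atlas C) r (fibre C) (trivs C) W t"
  shows "sm W (\<lambda>x. pairing C x (s x) (t x))"
proof (rule sm_local[OF W])
  fix x assume x: "x \<in> W"
  have "x \<in> (\<Union>(U, e)\<in>trivs C. U)" using vector_bundle by (simp add: smooth_vector_bundle_def)
  then obtain U0 e0 where U0: "(U0, e0) \<in> trivs C" "x \<in> U0" by blast
  have "\<forall>(U, e)\<in>trivs C. open U \<and> (\<forall>x\<in>U. frame_at r (fibre C) e x)"
    using vector_bundle unfolding smooth_vector_bundle_def by blast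
  then have op: "open U0" and fr: "\<And>y. y \<in> U0 \<Longrightarrow> frame_at r (fibre C) e0 y" using U0 by blast+
  have O: "open (U0 \<inter> W)" using op W by blast
  have cs: "sm (U0 \<inter> W) (\<lambda>y. frame_coord r e0 y (s y) a)" "sm (U0 \<inter> W) (\<lambda>y. frame_coord r e0 y (t y) a)"
    if "a < r" for a
    using s U0(1) that unfolding smooth_section_def by blast+
  have sE: "s y \<in> fibre C y" "t y \<in> fibre C y" if "y \<in> W" for y
    using s that unfolding smooth_section_def by blast+
  have "sm (U0 \<inter> W) (\<lambda>y. \<Sum>a<r. \<Sum>b<r. frame_coord r e0 y (s y) a *
      (frame_coord r e0 y (t y) b * pairing C y (e0 a y) (e0 b y)))"
    using sm_subset[OF pairing_smooth[OF U0(1)], of _ _ "U0 \<inter> W"]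
    by (intro sm_sum sm_mult O cs) auto
  then have "sm (U0 \<inter> W) (\<lambda>y. pairing C y (s y) (t y))"
  proof (rule sm_cong[OF O])
    fix y assume y: "y \<in> U0 \<inter> W"
    have f: "frame_at r (fibre C) e0 y" by (rule fr) (use y in simp)
    note m = frame_mem[OF f]
    have "pairing C y (s y) (t y) = (\<Sum>a<r. frame_coord r e0 y (s y) a * pairing C y (e0 a y) (t y))"
    proof -
      have "pairing C y (s y) (t y) = pairing C y (\<Sum>a<r. frame_coord r e0 y (s y) a *\<^sub>R e0 a y) (t y)"
        using arg_cong[OF frame_expansion[OF f sE(1)], of "\<lambda>v. pairing C y v (t y)"] y by blast
      also have "\<dots> = (\<Sum>a<r. frame_coord r e0 y (s y) a * pairing C y (e0 a y) (t y))"
        by (rule pairing_sum_left) (use m sE y in auto)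
      finally show ?thesis .
    qed
    also have "\<dots> = (\<Sum>a<r. frame_coord r e0 y (s y) a *
        (\<Sum>b<r. frame_coord r e0 y (t y) b * pairing C y (e0 a y) (e0 b y)))"
    proof (rule sum.cong[OF refl])
      fix a assume "a \<in> {..<r}"
      then have a: "a < r" by simp
      have "pairing C y (e0 a y) (t y) = pairing C y (e0 a y) (\<Sum>b<r. frame_coord r e0 y (t y) b *\<^sub>R e0 b y)"
        using arg_cong[OF frame_expansion[OF f sE(2)], of "pairing C y (e0 a y)"] y by blast
      also have "\<dots> = (\<Sum>b<r. frame_coord r e0 y (t y) b * pairing C y (e0 a y) (e0 b y))"
        by (rule pairing_sum_right) (use m a in auto)
      finally show "frame_coord r e0 y (s y) a * pairing C y (e0 a y) (t y) = frame_coord r e0 y (s y) a *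
        (\<Sum>b<r. frame_coord r e0 y (t y) b * pairing C y (e0 a y) (e0 b y))" by simp
    qed
    finally show "pairing C y (s y) (t y) = (\<Sum>a<r. \<Sum>b<r. frame_coord r e0 y (s y) a *
      (frame_coord r e0 y (t y) b * pairing C y (e0 a y) (e0 b y)))"
      by (simp add: sum_distrib_left)
  qed
  then show "\<exists>W'. open W' \<and> x \<in> W' \<and> sm W' (\<lambda>x. pairing C x (s x) (t x))"
    using O x U0(2) by blast
qed

lemma smooth_section_subset:
  assumes s: "smooth_section n (atlas C) r (fibre C) (trivs C) V s" and WV: "W \<subseteq> V"
  shows "smooth_section n (atlas C) r (fibre C) (trivs C) W s"
  unfolding smooth_section_def
proof (intro conjI ballI, goal_cases)
  case (1 y)
  then show ?case using s WV unfolding smooth_section_def by blast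
next
  case (2 u)
  obtain U0 e0 where u: "u = (U0, e0)" by force
  have "sm (U0 \<inter> V) (\<lambda>x. frame_coord r e0 x (s x) a)" if "a < r" for a
    using s 2 that unfolding u smooth_section_def by blast
  then have "sm (U0 \<inter> W) (\<lambda>x. frame_coord r e0 x (s x) a)" if "a < r" for a
    by (rule sm_subset) (use that WV in auto)
  then show ?case unfolding u by simp
qed

text \<open>Coordinates in a Darboux frame are pairings with the frame vectors, combined by the
  inverse matrix. That matrix is constant, so it may be evaluated at a fixed \<open>x0\<close>, and
  smoothness of pairings suffices.\<close>

lemma sm_frame_coord:
  assumes d: "darboux_chart C (U, \<phi>, e)" and W: "open W" "W \<subseteq> U"
    and s: "smooth_section n (atlas C) r (fibre C) (trivs C) W s" and a: "a < r"
  shows "sm W (\<lambda>x. frame_coord r e x (s x) a)"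
proof (cases "W = {}")
  case True
  then show ?thesis by (intro smI) (simp add: smooth_Rn_def)
next
  case False
  then obtain x0 where x0: "x0 \<in> W" by blast
  have es: "smooth_section n (atlas C) r (fibre C) (trivs C) W (e b)" if "b < r" for b
    by (rule smooth_section_subset[OF darbouxD(5)[OF d that] W(2)])
  have "sm W (\<lambda>x. \<Sum>b<r. inverse_pairing C e x0 a b * pairing C x (e b x) (s x))"
    by (intro sm_sum sm_mult sm_const W sm_pairing es s) auto
  then show ?thesis
  proof (rule sm_cong[OF W(1)])
    fix x assume x: "x \<in> W"
    have "s x \<in> fibre C x" using s x unfolding smooth_section_def by blast
    then have "frame_coord r e x (s x) a = (\<Sum>b<r. inverse_pairing C e x a b * pairing C x (e b x) (s x))"
      using x W(2) by (intro frame_coord_eq_pairing[OF darbouxD(3)[OF d] a]) auto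
    then show "frame_coord r e x (s x) a = (\<Sum>b<r. inverse_pairing C e x0 a b * pairing C x (e b x) (s x))"
      using inverse_pairing_const[OF d _ _ a, of x x0] x x0 W(2) by (simp add: subset_iff)
  qed
qed

end

section \<open>The transition between two Darboux charts around a common point\<close>

locale chart_pair = courant_algebroid C for C :: "('m::{t2_space,second_countable_topology}, 'v::real_vector) courant_data" +
  fixes U \<phi> e U' \<phi>' e' x
  assumes d: "darboux_chart C (U, \<phi>, e)" and d': "darboux_chart C (U', \<phi>', e')"
    and x: "x \<in> U \<inter> U'"
begin

text \<open>The coordinate change \<open>\<Phi>\<close> substitutes \<open>\<Xi> b\<close> for \<open>\<xi>\<^sup>b\<close> and \<open>P i\<close> for \<open>p\<^sub>i\<close>; \<open>\<theta> a\<close> is the restriction of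
  \<open>\<theta>'\<^sub>a\<close> to the realization.\<close>

definition "W = U \<inter> U'"
definition "S b d' y = frame_coord r e y (e' d' y) b"
definition "T a b y = frame_coord r e' y (e b y) a"
definition "J i j y = chart_pd (U, \<phi>) i (\<lambda>y. \<phi>' y j) y"
definition "g' a b = pairing C x (e' a x) (e' b x)"
definition "h' a b = inverse_pairing C e' x a b"
definition "h a b = inverse_pairing C e x a b"
definition "\<Xi> b y = (\<Sum>d<r. S b d y *\<^sub>R g_xi d)"
definition "\<theta> a = (\<Sum>b<r. (g' a b / 2) *\<^sub>R g_xi b)"
definition "P i y = (\<Sum>j<n. J i j y *\<^sub>R g_p j) +
  (\<Sum>a<r. \<Sum>b<r. chart_pd (U, \<phi>) i (T a b) y *\<^sub>R (\<Xi> b y * \<theta> a))"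
definition "\<Phi> y f = realization_pullback C (U', \<phi>', e') y (cotangent_change C (U, \<phi>, e) (U', \<phi>', e') y f)"

lemma c: "smooth_chart n (atlas C) (U, \<phi>)" and c': "smooth_chart n (atlas C) (U', \<phi>')"
  using darbouxD(1) d d' by blast+

lemma W: "open W" "W \<subseteq> U" "W \<subseteq> U'" and xW: "x \<in> W"
  unfolding W_def using darbouxD(2)[OF d] darbouxD(2)[OF d'] x by (simp_all add: open_Int)

lemma fr: "y \<in> W \<Longrightarrow> frame_at r (fibre C) e y" and fr': "y \<in> W \<Longrightarrow> frame_at r (fibre C) e' y"
  using darbouxD(3)[OF d] darbouxD(3)[OF d'] W by blast+

lemma em: "y \<in> W \<Longrightarrow> a < r \<Longrightarrow> e a y \<in> fibre C y" and em': "y \<in> W \<Longrightarrow> a < r \<Longrightarrow> e' a y \<in> fibre C y"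
  by (rule frame_mem[OF fr] frame_mem[OF fr'], assumption+)+

lemma sect: "b < r \<Longrightarrow> smooth_section n (atlas C) r (fibre C) (trivs C) W (e b)"
  and sect': "b < r \<Longrightarrow> smooth_section n (atlas C) r (fibre C) (trivs C) W (e' b)"
  using smooth_section_subset[OF darbouxD(5)[OF d] W(2)] smooth_section_subset[OF darbouxD(5)[OF d'] W(3)] by simp_all

lemma smS: "b < r \<Longrightarrow> k < r \<Longrightarrow> sm W (S b k)"
  using sm_frame_coord[OF d W(1,2) sect', of k b] by (simp add: S_def[abs_def])

lemma smT: "a < r \<Longrightarrow> k < r \<Longrightarrow> sm W (T a k)"
  using sm_frame_coord[OF d' W(1,3) sect, of k a] by (simp add: T_def[abs_def])

lemma sm_phi': "sm W (\<lambda>y. \<phi>' y j)"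
  by (rule sm_subset[OF sm_coord[OF c'] W(3)])

lemma smJ: "i < n \<Longrightarrow> sm W (J i j)"
  using sm_chart_pd[OF c W(1,2) sm_phi'] by (simp add: J_def[abs_def])

lemma sm_dT: "i < n \<Longrightarrow> a < r \<Longrightarrow> b < r \<Longrightarrow> sm W (chart_pd (U, \<phi>) i (T a b))"
  by (rule sm_chart_pd[OF c W(1,2) smT])

lemma g'_const: "y \<in> W \<Longrightarrow> a < r \<Longrightarrow> b < r \<Longrightarrow> pairing C y (e' a y) (e' b y) = g' a b"
  unfolding g'_def using darbouxD(4)[OF d', of y x a b] W xW by blast

lemma g'_sym: "a < r \<Longrightarrow> b < r \<Longrightarrow> g' a b = g' b a"
  unfolding g'_def using pairing_sym em'[OF xW] by blast

lemma h'_sym: "a < r \<Longrightarrow> b < r \<Longrightarrow> h' a b = h' b a"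
  unfolding h'_def by (rule inverse_pairing_sym[OF fr'[OF xW]])

lemma h_sym: "a < r \<Longrightarrow> b < r \<Longrightarrow> h a b = h b a"
  unfolding h_def by (rule inverse_pairing_sym[OF fr[OF xW]])

lemma h'_g': "a < r \<Longrightarrow> b < r \<Longrightarrow> (\<Sum>k<r. h' a k * g' k b) = (if a = b then 1 else 0)"
  unfolding h'_def g'_def by (rule inverse_pairing[OF fr'[OF xW]])

lemma T_S: "y \<in> W \<Longrightarrow> a < r \<Longrightarrow> k < r \<Longrightarrow> (\<Sum>b<r. T a b y * S b k y) = (if a = k then 1 else 0)"
proof -
  assume y: "y \<in> W" and ak: "a < r" "k < r"
  have "frame_coord r e' y (e' k y) a = frame_coord r e' y (\<Sum>b<r. S b k y *\<^sub>R e b y) a"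
    unfolding S_def using frame_expansion[OF fr[OF y] em'[OF y ak(2)]] by simp
  also have "\<dots> = (\<Sum>b<r. S b k y * T a b y)"
    unfolding T_def by (rule frame_coord_sum[OF fr'[OF y]]) (use em[OF y] in auto)
  finally show ?thesis using frame_coord_basis[OF fr'[OF y] ak] by (simp add: mult.commute)
qed

lemma S_T: "y \<in> W \<Longrightarrow> a < r \<Longrightarrow> k < r \<Longrightarrow> (\<Sum>b<r. S a b y * T b k y) = (if a = k then 1 else 0)"
proof -
  assume y: "y \<in> W" and ak: "a < r" "k < r"
  have "frame_coord r e y (e k y) a = frame_coord r e y (\<Sum>b<r. T b k y *\<^sub>R e' b y) a"
    unfolding T_def using frame_expansion[OF fr'[OF y] em[OF y ak(2)]] by simp
  also have "\<dots> = (\<Sum>b<r. T b k y * S a b y)"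
    unfolding S_def by (rule frame_coord_sum[OF fr[OF y]]) (use em'[OF y] in auto)
  finally show ?thesis using frame_coord_basis[OF fr[OF y] ak] by (simp add: mult.commute)
qed

text \<open>The pairing matrices of both frames are constant, so the right hand side does not depend
  on \<open>y\<close>; differentiating this relation gives \<open>B_antisym\<close>.\<close>

lemma T_g'_T:
  assumes y: "y \<in> W" and bk: "b < r" "k < r"
  shows "(\<Sum>a<r. \<Sum>l<r. T a b y * (g' a l * T l k y)) = pairing C x (e b x) (e k x)"
proof -
  have ex: "e k y = (\<Sum>l<r. T l k y *\<^sub>R e' l y)" if "k < r" for k
    unfolding T_def by (rule frame_expansion[OF fr'[OF y] em[OF y that]])
  have "pairing C y (e b y) (e k y) = (\<Sum>a<r. T a b y * pairing C y (e' a y) (e k y))"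
    by (subst ex[OF bk(1)], subst pairing_sum_left) (use em'[OF y] em[OF y] bk in auto)
  also have "\<dots> = (\<Sum>a<r. T a b y * (\<Sum>l<r. T l k y * g' a l))"
  proof (rule sum.cong[OF refl])
    fix a assume "a \<in> {..<r}"
    then have a: "a < r" by simp
    have "pairing C y (e' a y) (e k y) = (\<Sum>l<r. T l k y * pairing C y (e' a y) (e' l y))"
      by (subst ex[OF bk(2)], subst pairing_sum_right) (use em'[OF y] a in auto)
    then show "T a b y * pairing C y (e' a y) (e k y) = T a b y * (\<Sum>l<r. T l k y * g' a l)"
      using g'_const[OF y a] by simp
  qed
  finally show ?thesis
    using darbouxD(4)[OF d, of y x b k] y xW W(2) bk by (simp add: sum_distrib_left mult.commute subset_iff)
qed

text \<open>The inverse pseudo-metric is a tensor: its coefficients are the pairings of dual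
  vectors, here expanded in the primed frame.\<close>

lemma h'_S_S:
  assumes ab: "a < r" "b < r"
  shows "(\<Sum>k<r. \<Sum>l<r. h' k l * (S a k x * S b l x)) = h a b"
proof -
  note f = fr[OF xW] and f' = fr'[OF xW]
  let ?v = "dual_vec e x"
  note va = dual_vec(1)[OF f ab(1)] and vb = dual_vec(1)[OF f ab(2)]
  have S: "S a k x = pairing C x (?v a) (e' k x)" if "a < r" "k < r" for a k
    unfolding S_def using dual_vec(2)[OF f that(1) em'[OF xW that(2)]] by simp
  have "h a b = pairing C x (?v b) (?v a)"
    unfolding h_def inverse_pairing_eq using dual_vec(2)[OF f ab(2) va] by simp
  also have "\<dots> = pairing C x (?v b) (\<Sum>k<r. frame_coord r e' x (?v a) k *\<^sub>R e' k x)"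
    using frame_expansion[OF f' va] by simp
  also have "\<dots> = (\<Sum>k<r. frame_coord r e' x (?v a) k * pairing C x (?v b) (e' k x))"
    by (rule pairing_sum_right) (use em'[OF xW] vb in auto)
  also have "\<dots> = (\<Sum>k<r. (\<Sum>l<r. h' k l * S a l x) * S b k x)"
  proof (rule sum.cong[OF refl])
    fix k assume "k \<in> {..<r}"
    then have k: "k < r" by simp
    have "frame_coord r e' x (?v a) k = (\<Sum>l<r. h' k l * pairing C x (e' l x) (?v a))"
      unfolding h'_def by (rule frame_coord_eq_pairing[OF f' k va])
    also have "\<dots> = (\<Sum>l<r. h' k l * S a l x)"
      by (rule sum.cong) (use S[OF ab(1)] pairing_sym[OF _ va] em'[OF xW] in auto)
    finally show "frame_coord r e' x (?v a) k * pairing C x (?v b) (e' k x) = (\<Sum>l<r. h' k l * S a l x) * S b k x"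
      using S[OF ab(2) k] by simp
  qed
  also have "\<dots> = (\<Sum>k<r. \<Sum>l<r. h' k l * (S a l x * S b k x))"
    by (simp add: sum_distrib_right mult.assoc)
  also have "\<dots> = (\<Sum>l<r. \<Sum>k<r. h' k l * (S a l x * S b k x))" by (rule sum.swap)
  also have "\<dots> = (\<Sum>l<r. \<Sum>k<r. h' l k * (S a l x * S b k x))"
    using h'_sym by (intro sum.cong) auto
  finally show ?thesis by simp
qed

subsection \<open>Derivatives of the transition functions\<close>

abbreviation "dT i a b \<equiv> chart_pd (U, \<phi>) i (T a b) x"
abbreviation "dS i a b \<equiv> chart_pd (U, \<phi>) i (S a b) x"

text \<open>\<open>B i\<close> is the logarithmic derivative
  \<open>(\<partial>\<^sub>i T) T\<^sup>-\<^sup>1\<close> of the transition matrix at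
  \<open>x\<close>, since \<open>S\<close> is inverse to \<open>T\<close>; \<open>\<eta> i\<close>
  applies it to the primed odd coordinates, see \<open>eta_eq\<close>.\<close>

definition "B i a k = (\<Sum>f<r. dT i a f * S f k x)"
definition "\<eta> i a = (\<Sum>f<r. dT i a f *\<^sub>R \<Xi> f x)"

lemma eta_eq: "\<eta> i a = (\<Sum>k<r. B i a k *\<^sub>R g_xi k)"
  unfolding \<eta>_def \<Xi>_def B_def scaleR_sum_right scaleR_sum_left
  by (subst sum.swap) simp

text \<open>The derivative of an inverse matrix, \<open>\<partial>S = - S (\<partial>T) S\<close>,
  obtained by differentiating \<open>S T = 1\<close> and multiplying by \<open>S\<close> from the
  right.\<close>

lemma dS_eq:
  assumes i: "i < n" and bk: "b < r" "k < r"
  shows "dS i b k = - (\<Sum>a<r. S b a x * B i a k)"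
proof -
  have z: "(\<Sum>a<r. dS i b a * T a f x) = - (\<Sum>a<r. S b a x * dT i a f)" if f: "f < r" for f
  proof -
    have "chart_pd (U, \<phi>) i (\<lambda>y. \<Sum>a<r. S b a y * T a f y) x = 0"
    proof -
      have "chart_pd (U, \<phi>) i (\<lambda>y. \<Sum>a<r. S b a y * T a f y) x =
          chart_pd (U, \<phi>) i (\<lambda>y. if b = f then 1 else 0) x"
        by (rule chart_pd_cong[OF smooth_chartD(1)[OF c] W(1,2) xW i]) (rule S_T[OF _ bk(1) f])
      then show ?thesis by (simp add: chart_pd_const)
    qed
    moreover have "chart_pd (U, \<phi>) i (\<lambda>y. \<Sum>a<r. S b a y * T a f y) x =
        (\<Sum>a<r. dS i b a * T a f x + S b a x * dT i a f)"
    proof -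
      have "sm W (\<lambda>y. S b a y * T a f y)" if "a \<in> {..<r}" for a
        using that bk f by (intro sm_mult W smS smT) auto
      then have "chart_pd (U, \<phi>) i (\<lambda>y. \<Sum>a<r. S b a y * T a f y) x =
          (\<Sum>a<r. chart_pd (U, \<phi>) i (\<lambda>y. S b a y * T a f y) x)"
        by (rule chart_pd_sum[OF c W(1,2) _ xW i])
      also have "\<dots> = (\<Sum>a<r. dS i b a * T a f x + S b a x * dT i a f)"
        using bk f by (intro sum.cong refl chart_pd_mult[OF c W(1,2) smS smT xW i]) auto
      finally show ?thesis .
    qed
    ultimately show ?thesis by (simp add: sum.distrib)
  qed
  have "dS i b k = (\<Sum>a<r. dS i b a * (\<Sum>f<r. T a f x * S f k x))"
  proof -
    have "(\<Sum>a<r. dS i b a * (\<Sum>f<r. T a f x * S f k x)) = (\<Sum>a<r. dS i b a * (if a = k then 1 else 0))"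
      by (intro sum.cong refl) (simp add: T_S[OF xW _ bk(2)])
    then show ?thesis using bk by simp
  qed
  also have "\<dots> = (\<Sum>f<r. (\<Sum>a<r. dS i b a * T a f x) * S f k x)"
    unfolding sum_distrib_left sum_distrib_right by (subst sum.swap) (simp add: mult.assoc)
  also have "\<dots> = - (\<Sum>f<r. (\<Sum>a<r. S b a x * dT i a f) * S f k x)"
    unfolding sum_negf[symmetric] by (intro sum.cong refl) (simp add: z)
  also have "\<dots> = - (\<Sum>a<r. S b a x * B i a k)"
    unfolding B_def sum_distrib_left sum_distrib_right by (subst sum.swap) (simp add: mult.assoc)
  finally show ?thesis .
qed

text \<open>\<open>B i\<close> lies in the orthogonal Lie algebra of \<open>g'\<close>: this is the
  derivative of \<open>T_g'_T\<close>, multiplied by \<open>S\<close> on both sides.\<close>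

lemma B_antisym:
  assumes i: "i < n" and kl: "k < r" "l < r"
  shows "(\<Sum>a<r. g' k a * B i a l) = - (\<Sum>a<r. g' l a * B i a k)"
proof -
  have z: "(\<Sum>a<r. \<Sum>m<r. dT i a b * (g' a m * T m f x) + T a b x * (g' a m * dT i m f)) = 0"
    if bf: "b < r" "f < r" for b f
  proof -
    let ?u = "\<lambda>a m y. T a b y * (g' a m * T m f y)"
    have s: "sm W (\<lambda>y. g' a m * T m f y)" "sm W (?u a m)" if "a < r" "m < r" for a m
      using that bf by (auto intro!: sm_mult sm_const W smT)
    have "chart_pd (U, \<phi>) i (\<lambda>y. \<Sum>a<r. \<Sum>m<r. ?u a m y) x = chart_pd (U, \<phi>) i (\<lambda>y. pairing C x (e b x) (e f x)) x"
      by (rule chart_pd_cong[OF smooth_chartD(1)[OF c] W(1,2) xW i]) (rule T_g'_T[OF _ bf])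
    then have "0 = chart_pd (U, \<phi>) i (\<lambda>y. \<Sum>a<r. \<Sum>m<r. ?u a m y) x" by (simp add: chart_pd_const)
    also have "\<dots> = (\<Sum>a<r. chart_pd (U, \<phi>) i (\<lambda>y. \<Sum>m<r. ?u a m y) x)"
      by (rule chart_pd_sum[OF c W(1,2) _ xW i]) (intro sm_sum W s; simp)
    also have "\<dots> = (\<Sum>a<r. \<Sum>m<r. chart_pd (U, \<phi>) i (?u a m) x)"
      by (rule sum.cong[OF refl], rule chart_pd_sum[OF c W(1,2) _ xW i], rule s) auto
    also have "\<dots> = (\<Sum>a<r. \<Sum>m<r. dT i a b * (g' a m * T m f x) + T a b x * (g' a m * dT i m f))"
    proof (intro sum.cong refl)
      fix a m assume "a \<in> {..<r}" "m \<in> {..<r}"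
      then have am: "a < r" "m < r" by auto
      show "chart_pd (U, \<phi>) i (?u a m) x = dT i a b * (g' a m * T m f x) + T a b x * (g' a m * dT i m f)"
        unfolding chart_pd_mult[OF c W(1,2) smT[OF am(1) bf(1)] s(1)[OF am] xW i]
          chart_pd_cmult[OF c W(1,2) smT[OF am(2) bf(2)] xW i] ..
    qed
    finally show ?thesis ..
  qed
  have TS: "(\<Sum>f<r. T m f x * S f k x) = (if m = k then 1 else 0)" if "m < r" "k < r" for m k
    by (rule T_S[OF xW that])
  have "0 = (\<Sum>b<r. \<Sum>f<r. (\<Sum>a<r. \<Sum>m<r. dT i a b * (g' a m * T m f x) + T a b x * (g' a m * dT i m f)) *
      (S b l x * S f k x))" by (simp add: z)
  also have "\<dots> = (\<Sum>b<r. \<Sum>f<r. \<Sum>a<r. \<Sum>m<r. g' a m * ((dT i a b * S b l x) * (T m f x * S f k x)) +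
      g' a m * ((T a b x * S b l x) * (dT i m f * S f k x)))"
    unfolding sum_distrib_right by (intro sum.cong refl) (simp add: algebra_simps)
  also have "\<dots> = (\<Sum>a<r. \<Sum>m<r. \<Sum>b<r. \<Sum>f<r. g' a m * ((dT i a b * S b l x) * (T m f x * S f k x)) +
      g' a m * ((T a b x * S b l x) * (dT i m f * S f k x)))"
    by (rule sum_swap4) auto
  also have "\<dots> = (\<Sum>a<r. \<Sum>m<r. g' a m * (B i a l * (\<Sum>f<r. T m f x * S f k x)) +
      g' a m * ((\<Sum>b<r. T a b x * S b l x) * B i m k))"
  proof (intro sum.cong refl)
    fix a m
    have *: "(\<Sum>b<r. \<Sum>f<r. q * (u b * v f)) = q * ((\<Sum>b<r. u b) * (\<Sum>f<r. v f))" for q :: real and u v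
      by (simp only: sum_product) (simp only: sum_distrib_left)
    show "(\<Sum>b<r. \<Sum>f<r. g' a m * ((dT i a b * S b l x) * (T m f x * S f k x)) +
        g' a m * ((T a b x * S b l x) * (dT i m f * S f k x))) =
        g' a m * (B i a l * (\<Sum>f<r. T m f x * S f k x)) + g' a m * ((\<Sum>b<r. T a b x * S b l x) * B i m k)"
      unfolding sum.distrib * B_def ..
  qed
  also have "\<dots> = (\<Sum>a<r. \<Sum>m<r. (g' a m * B i a l) * (if m = k then 1 else 0) +
      (if a = l then 1 else 0) * (g' a m * B i m k))"
    by (intro sum.cong refl) (simp add: TS kl)
  also have "\<dots> = (\<Sum>a<r. g' a k * B i a l) + (\<Sum>m<r. g' l m * B i m k)"
  proof -
    have "(\<Sum>a<r. \<Sum>m<r. (if a = l then 1 else 0) * (g' a m * B i m k)) = (\<Sum>a<r. (if a = l then 1 else 0) * (\<Sum>m<r. g' a m * B i m k))"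
      by (simp only: sum_distrib_left)
    then show ?thesis using kl by (simp only: sum.distrib sum_delta_real) simp
  qed
  also have "(\<Sum>a<r. g' a k * B i a l) = (\<Sum>a<r. g' k a * B i a l)"
    using g'_sym kl by (intro sum.cong) auto
  finally show ?thesis by simp
qed

end

text \<open>The hypotheses \<open>LL\<close>, \<open>SL\<close> and \<open>SS\<close> are the
  relations \<open>{P\<^sub>i, P\<^sub>k} = 0\<close>, \<open>{P\<^sub>i, \<Xi>\<^sub>b} = 0\<close>
  and \<open>{\<Xi>\<^sub>a, \<Xi>\<^sub>b} = h\<^sub>a\<^sub>b\<close> in the primed coordinates,
  where \<open>L\<close>, \<open>X'\<close> and \<open>Q\<close> stand for the derivatives of the
  transformed coordinates. From these the bracket of two functions, expanded by the chain rule,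
  regains its old form.\<close>

lemma change_algebra:
  fixes fp gp fe ge pF pG :: "nat \<Rightarrow> gpoly" and L X' Q :: "nat \<Rightarrow> nat \<Rightarrow> gpoly" and S h h' :: "nat \<Rightarrow> nat \<Rightarrow> real"
  assumes L: "\<And>i a. i < n \<Longrightarrow> a < r \<Longrightarrow> godd (L i a)"
    and X': "\<And>i a. i < n \<Longrightarrow> a < r \<Longrightarrow> godd (X' i a)"
    and Q: "\<And>i k. i < n \<Longrightarrow> k < n \<Longrightarrow> geven (Q i k)"
    and LL: "\<And>i k. i < n \<Longrightarrow> k < n \<Longrightarrow> (\<Sum>a<r. \<Sum>b<r. h' a b *\<^sub>R (L i a * L k b)) = Q i k - Q k i"
    and SL: "\<And>i b. i < n \<Longrightarrow> b < r \<Longrightarrow> (\<Sum>a<r. \<Sum>d<r. (h' a d * S b d) *\<^sub>R L i a) = X' i b"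
    and sym: "\<And>a b. a < r \<Longrightarrow> b < r \<Longrightarrow> h' a b = h' b a"
    and SS: "\<And>a b. a < r \<Longrightarrow> b < r \<Longrightarrow> (\<Sum>k<r. \<Sum>l<r. h' k l * (S a k * S b l)) = h a b"
  shows "(\<Sum>i<n. fp i * (pG i + (\<Sum>a<r. X' i a * ge a) + (\<Sum>k<n. Q i k * gp k)) -
      (pF i + (\<Sum>a<r. X' i a * fe a) + (\<Sum>k<n. Q i k * fp k)) * gp i) +
    (\<Sum>a<r. \<Sum>b<r. h' a b *\<^sub>R (gpar ((\<Sum>k<r. S k a *\<^sub>R fe k) + (\<Sum>i<n. L i a * fp i)) *
      ((\<Sum>k<r. S k b *\<^sub>R ge k) + (\<Sum>i<n. L i b * gp i)))) =
    (\<Sum>i<n. fp i * pG i - pF i * gp i) + (\<Sum>a<r. \<Sum>b<r. h a b *\<^sub>R (gpar (fe a) * ge b))"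
proof -
  let ?fe = "\<lambda>a. gpar (fe a)"
  have "(\<Sum>i<n. L i a * gpar (fp i)) = (\<Sum>i<n. fp i * L i a)" if "a < r" for a
    by (rule sum.cong[OF refl]) (use godd_mult_commute[OF L] that in simp)
  then have g: "gpar ((\<Sum>k<r. S k a *\<^sub>R fe k) + (\<Sum>i<n. L i a * fp i)) =
      (\<Sum>k<r. S k a *\<^sub>R ?fe k) - (\<Sum>i<n. fp i * L i a)" if "a < r" for a
    using that L[of _ a] by (simp add: gpar_sum godd_def sum_negf)
  \<comment> \<open>\<open>?AA\<close> is the odd part of the bracket in the old coordinates.
    \<open>?AB\<close> and \<open>?BA\<close> cancel the terms with \<open>X'\<close>, and
    \<open>?BB\<close> cancels those with \<open>Q\<close>.\<close>
  let ?AA = "\<Sum>k<r. \<Sum>l<r. h k l *\<^sub>R (?fe k * ge l)" and ?AB = "\<Sum>k<r. \<Sum>i<n. ?fe k * X' i k * gp i"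
    and ?BA = "\<Sum>i<n. \<Sum>k<r. fp i * X' i k * ge k" and ?BB = "\<Sum>i<n. \<Sum>k<n. fp i * (Q i k - Q k i) * gp k"
  have AA: "(\<Sum>a<r. \<Sum>b<r. h' a b *\<^sub>R ((\<Sum>k<r. S k a *\<^sub>R ?fe k) * (\<Sum>k<r. S k b *\<^sub>R ge k))) = ?AA"
    (is "?l = _")
  proof -
    have "?l = (\<Sum>k<r. \<Sum>l<r. \<Sum>a<r. \<Sum>b<r. h' a b *\<^sub>R ((S k a *\<^sub>R ?fe k) * (S l b *\<^sub>R ge l)))"
      by (rule sum_bilinear) auto
    also have "\<dots> = (\<Sum>k<r. \<Sum>l<r. (\<Sum>a<r. \<Sum>b<r. h' a b * (S k a * S l b)) *\<^sub>R (?fe k * ge l))"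
      unfolding scaleR_sum_left by (intro sum.cong refl) simp
    also have "\<dots> = ?AA" by (intro sum.cong refl) (simp add: SS)
    finally show ?thesis .
  qed
  have AB: "(\<Sum>a<r. \<Sum>b<r. h' a b *\<^sub>R ((\<Sum>k<r. S k a *\<^sub>R ?fe k) * (\<Sum>i<n. L i b * gp i))) = ?AB"
    (is "?l = _")
  proof -
    have "?l = (\<Sum>k<r. \<Sum>i<n. \<Sum>a<r. \<Sum>b<r. h' a b *\<^sub>R ((S k a *\<^sub>R ?fe k) * (L i b * gp i)))"
      by (rule sum_bilinear) auto
    also have "\<dots> = (\<Sum>k<r. \<Sum>i<n. \<Sum>a<r. \<Sum>b<r. ?fe k * ((h' b a * S k a) *\<^sub>R L i b) * gp i)"
      by (intro sum.cong refl) (simp add: sym mult.assoc)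
    also have "\<dots> = (\<Sum>k<r. \<Sum>i<n. \<Sum>b<r. \<Sum>a<r. ?fe k * ((h' b a * S k a) *\<^sub>R L i b) * gp i)"
      by (intro sum.cong refl sum.swap)
    also have "\<dots> = (\<Sum>k<r. \<Sum>i<n. ?fe k * (\<Sum>b<r. \<Sum>a<r. (h' b a * S k a) *\<^sub>R L i b) * gp i)"
      by (simp only: sum_distrib_left sum_distrib_right)
    also have "\<dots> = ?AB" by (intro sum.cong refl) (simp add: SL)
    finally show ?thesis .
  qed
  have BA: "(\<Sum>a<r. \<Sum>b<r. h' a b *\<^sub>R ((\<Sum>i<n. fp i * L i a) * (\<Sum>k<r. S k b *\<^sub>R ge k))) = ?BA"
    (is "?l = _")
  proof -
    have "?l = (\<Sum>i<n. \<Sum>k<r. \<Sum>a<r. \<Sum>b<r. h' a b *\<^sub>R ((fp i * L i a) * (S k b *\<^sub>R ge k)))"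
      by (rule sum_bilinear) auto
    also have "\<dots> = (\<Sum>i<n. \<Sum>k<r. \<Sum>a<r. \<Sum>b<r. fp i * ((h' a b * S k b) *\<^sub>R L i a) * ge k)"
      by (intro sum.cong refl) (simp add: mult.assoc)
    also have "\<dots> = (\<Sum>i<n. \<Sum>k<r. fp i * (\<Sum>a<r. \<Sum>b<r. (h' a b * S k b) *\<^sub>R L i a) * ge k)"
      by (simp only: sum_distrib_left sum_distrib_right)
    also have "\<dots> = ?BA" by (intro sum.cong refl) (simp add: SL)
    finally show ?thesis .
  qed
  have BB: "(\<Sum>a<r. \<Sum>b<r. h' a b *\<^sub>R ((\<Sum>i<n. fp i * L i a) * (\<Sum>i<n. L i b * gp i))) = ?BB"
    (is "?l = _")
  proof -
    have "?l = (\<Sum>i<n. \<Sum>k<n. \<Sum>a<r. \<Sum>b<r. h' a b *\<^sub>R ((fp i * L i a) * (L k b * gp k)))"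
      by (rule sum_bilinear) auto
    also have "\<dots> = (\<Sum>i<n. \<Sum>k<n. \<Sum>a<r. \<Sum>b<r. fp i * (h' a b *\<^sub>R (L i a * L k b)) * gp k)"
      by (intro sum.cong refl) (simp add: mult.assoc)
    also have "\<dots> = (\<Sum>i<n. \<Sum>k<n. fp i * (\<Sum>a<r. \<Sum>b<r. h' a b *\<^sub>R (L i a * L k b)) * gp k)"
      by (simp only: sum_distrib_left sum_distrib_right)
    also have "\<dots> = ?BB" by (intro sum.cong refl) (simp add: LL)
    finally show ?thesis .
  qed
  have e: "h' a b *\<^sub>R (gpar ((\<Sum>k<r. S k a *\<^sub>R fe k) + (\<Sum>i<n. L i a * fp i)) *
      ((\<Sum>k<r. S k b *\<^sub>R ge k) + (\<Sum>i<n. L i b * gp i))) =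
      h' a b *\<^sub>R ((\<Sum>k<r. S k a *\<^sub>R ?fe k) * (\<Sum>k<r. S k b *\<^sub>R ge k)) +
      h' a b *\<^sub>R ((\<Sum>k<r. S k a *\<^sub>R ?fe k) * (\<Sum>i<n. L i b * gp i)) -
      h' a b *\<^sub>R ((\<Sum>i<n. fp i * L i a) * (\<Sum>k<r. S k b *\<^sub>R ge k)) -
      h' a b *\<^sub>R ((\<Sum>i<n. fp i * L i a) * (\<Sum>i<n. L i b * gp i))" if "a < r" for a b
    unfolding g[OF that] by (simp only: left_diff_distrib distrib_left scaleR_diff_right scaleR_add_right)
       (simp only: diff_conv_add_uminus minus_add_distrib add_ac)
  have "(\<Sum>a<r. \<Sum>b<r. h' a b *\<^sub>R (gpar ((\<Sum>k<r. S k a *\<^sub>R fe k) + (\<Sum>i<n. L i a * fp i)) *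
      ((\<Sum>k<r. S k b *\<^sub>R ge k) + (\<Sum>i<n. L i b * gp i)))) =
      (\<Sum>a<r. \<Sum>b<r. h' a b *\<^sub>R ((\<Sum>k<r. S k a *\<^sub>R ?fe k) * (\<Sum>k<r. S k b *\<^sub>R ge k)) +
      h' a b *\<^sub>R ((\<Sum>k<r. S k a *\<^sub>R ?fe k) * (\<Sum>i<n. L i b * gp i)) -
      h' a b *\<^sub>R ((\<Sum>i<n. fp i * L i a) * (\<Sum>k<r. S k b *\<^sub>R ge k)) -
      h' a b *\<^sub>R ((\<Sum>i<n. fp i * L i a) * (\<Sum>i<n. L i b * gp i)))"
    by (intro sum.cong refl e) simp
  also have "\<dots> = ?AA + ?AB - ?BA - ?BB"
    unfolding sum.distrib sum_subtractf AA AB BA BB ..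
  finally have 1: "(\<Sum>a<r. \<Sum>b<r. h' a b *\<^sub>R (gpar ((\<Sum>k<r. S k a *\<^sub>R fe k) + (\<Sum>i<n. L i a * fp i)) *
      ((\<Sum>k<r. S k b *\<^sub>R ge k) + (\<Sum>i<n. L i b * gp i)))) = ?AA + ?AB - ?BA - ?BB" .
  have "(\<Sum>i<n. fp i * (pG i + (\<Sum>a<r. X' i a * ge a) + (\<Sum>k<n. Q i k * gp k)) -
      (pF i + (\<Sum>a<r. X' i a * fe a) + (\<Sum>k<n. Q i k * fp k)) * gp i) =
      (\<Sum>i<n. fp i * pG i - pF i * gp i) + ?BA - (\<Sum>i<n. \<Sum>a<r. X' i a * fe a * gp i) +
      ((\<Sum>i<n. \<Sum>k<n. fp i * (Q i k * gp k)) - (\<Sum>i<n. \<Sum>k<n. Q i k * fp k * gp i))"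
    unfolding distrib_left distrib_right sum.distrib sum_subtractf sum_distrib_left sum_distrib_right
    by (simp add: algebra_simps)
  moreover have "(\<Sum>i<n. \<Sum>a<r. X' i a * fe a * gp i) = ?AB"
    by (subst sum.swap, intro sum.cong refl) (use godd_mult_commute[OF X', of _ _ "gpar (fe _)"] in simp)
  moreover have "(\<Sum>i<n. \<Sum>k<n. Q i k * fp k * gp i) = (\<Sum>i<n. \<Sum>k<n. fp i * (Q k i * gp k))"
    by (subst sum.swap, intro sum.cong refl) (use geven_mult_commute[OF Q] in \<open>simp add: mult.assoc[symmetric]\<close>)
  moreover have "?BB = (\<Sum>i<n. \<Sum>k<n. fp i * (Q i k * gp k)) - (\<Sum>i<n. \<Sum>k<n. fp i * (Q k i * gp k))"
    by (simp add: algebra_simps sum_subtractf)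
  ultimately show ?thesis unfolding 1 by simp
qed

section \<open>Smooth families as combinations of constant monomials\<close>

context courant_algebroid
begin

definition gmono :: "nat set \<times> nat multiset \<Rightarrow> gpoly" where
  "gmono u = gpoly_of (\<lambda>v. if v = u then 1 else 0)"

lemma gcoeff_gmono: "finite (fst u) \<Longrightarrow> gcoeff (gmono u) v = (if v = u then 1 else 0)"
proof -
  assume u: "finite (fst u)"
  have "finite {v. (if v = u then 1 else 0 :: real) \<noteq> 0}" by (rule finite_subset[of _ "{u}"]) auto
  moreover have "finite S" if "(if (S, m) = u then 1 else 0 :: real) \<noteq> 0" for S m
  proof -
    have "(S, m) = u" using that by (simp split: if_splits)
    then have "S = fst u" by force
    then show ?thesis using u by simp
  qed
  ultimately show ?thesis unfolding gmono_def by (subst gcoeff_gpoly_of) simp_all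
qed

lemma gvars_gmono: "finite (fst u) \<Longrightarrow> fst u \<subseteq> A \<Longrightarrow> set_mset (snd u) \<subseteq> B \<Longrightarrow> gvars A B (gmono u)"
  by (auto simp: gvars_def gcoeff_gmono)

text \<open>Separates the dependence on the point, which sits in smooth scalar functions, from
  finitely many constant monomials. Properties of substitutions need then be known for constant
  polynomials only.\<close>

lemma fam_expansion:
  assumes F: "F \<in> fam W"
  obtains M where "finite M" "\<And>u. u \<in> M \<Longrightarrow> gvars {..<r} {..<n} (gmono u)"
    "\<And>y. y \<in> W \<Longrightarrow> F y = (\<Sum>u\<in>M. gcoeff (F y) u *\<^sub>R gmono u)"
proof -
  obtain N where N: "finite N" "\<And>x u. x \<in> W \<Longrightarrow> gcoeff (F x) u \<noteq> 0 \<Longrightarrow> u \<in> N"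
    using famD[OF F] by metis
  let ?M = "{u \<in> N. finite (fst u) \<and> fst u \<subseteq> {..<r} \<and> set_mset (snd u) \<subseteq> {..<n}}"
  have fin: "finite ?M" using N(1) by simp
  have "F y = (\<Sum>u\<in>?M. gcoeff (F y) u *\<^sub>R gmono u)" if y: "y \<in> W" for y
  proof (rule gpoly_eqI)
    fix S m
    have "gcoeff (\<Sum>u\<in>?M. gcoeff (F y) u *\<^sub>R gmono u) (S, m) =
        (\<Sum>u\<in>?M. if (S, m) = u then gcoeff (F y) u else 0)"
      unfolding gcoeff_sum by (rule sum.cong[OF refl]) (simp add: gcoeff_scaleR gcoeff_gmono)
    also have "\<dots> = (if (S, m) \<in> ?M then gcoeff (F y) (S, m) else 0)"
      by (rule sum.delta'[OF fin])
    also have "\<dots> = gcoeff (F y) (S, m)"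
    proof (cases "gcoeff (F y) (S, m) = 0")
      case False
      then have "(S, m) \<in> ?M"
        using N(2)[OF y False] finite_coeff_fst[OF False] fam_gvars[OF F y] unfolding gvars_def by auto
      then show ?thesis by simp
    qed simp
    finally show "gcoeff (F y) (S, m) = gcoeff (\<Sum>u\<in>?M. gcoeff (F y) u *\<^sub>R gmono u) (S, m)" by simp
  qed
  moreover have "gvars {..<r} {..<n} (gmono u)" if "u \<in> ?M" for u
    by (rule gvars_gmono) (use that in auto)
  ultimately show ?thesis using that[of ?M] fin by blast
qed

end

section \<open>The coordinate change as a homomorphism of graded algebras\<close>

context chart_pair
begin

definition "\<sigma>1 y k = (if k < r then \<Xi> k y else (\<Sum>a<r. T a (k - r) y *\<^sub>R g_xi (r + a)))"
definition "\<tau>1 y i = (\<Sum>j<n. J i j y *\<^sub>R g_p j) +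
  (\<Sum>a<r. \<Sum>b<r. chart_pd (U, \<phi>) i (T a b) y *\<^sub>R (\<Xi> b y * g_xi (r + a)))"
definition "\<sigma>2 y k = (if k < r then g_xi k
  else (\<Sum>b<r. (pairing C y (e' (k - r) y) (e' b y) / 2) *\<^sub>R g_xi b))"

lemma Phi_eq: "\<Phi> y f = g_subst (\<sigma>2 y) g_p (g_subst (\<sigma>1 y) (\<tau>1 y) f)"
  unfolding \<Phi>_def realization_pullback_def cotangent_change_def \<sigma>1_def[abs_def] \<tau>1_def[abs_def]
    \<sigma>2_def[abs_def] \<Xi>_def S_def T_def[abs_def] J_def prod.case Let_def ..

lemma godd_Xi: "godd (\<Xi> b y)" unfolding \<Xi>_def by (intro godd_sum godd_intros)

lemma godd_theta: "godd (\<theta> b)" unfolding \<theta>_def by (intro godd_sum godd_intros)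

lemma subst_parity: "godd (\<sigma>1 y k)" "geven (\<tau>1 y i)" "godd (\<sigma>2 y k)" "geven (g_p i)"
proof -
  show "godd (\<sigma>1 y k)" unfolding \<sigma>1_def by (cases "k < r") (simp_all add: godd_Xi godd_sum godd_intros)
  show "geven (\<tau>1 y i)" unfolding \<tau>1_def by (intro geven_sum geven_intros godd_intros godd_Xi)
  show "godd (\<sigma>2 y k)" unfolding \<sigma>2_def by (cases "k < r") (simp_all add: godd_sum godd_intros)
qed (rule geven_intros)

lemma Phi_linear [simp]: "\<Phi> y (f + g) = \<Phi> y f + \<Phi> y g" "\<Phi> y (k *\<^sub>R f) = k *\<^sub>R \<Phi> y f" "\<Phi> y 0 = 0"
  by (simp_all add: Phi_eq)

lemma Phi_minus [simp]: "\<Phi> y (- f) = - \<Phi> y f" "\<Phi> y (f - g) = \<Phi> y f - \<Phi> y g"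
  using Phi_linear(2)[of y "-1" f] Phi_linear(1)[of y f "- g"] Phi_linear(2)[of y "-1" g] by simp_all

lemma Phi_1 [simp]: "\<Phi> y 1 = 1" by (simp add: Phi_eq)

lemma Phi_mult [simp]: "\<Phi> y (f * g) = \<Phi> y f * \<Phi> y g"
  unfolding Phi_eq g_subst_mult[OF subst_parity(1,2)] g_subst_mult[OF subst_parity(3,4)] ..

lemma Phi_sum: "\<Phi> y (\<Sum>i\<in>I. f i) = (\<Sum>i\<in>I. \<Phi> y (f i))"
  by (simp add: Phi_eq g_subst_sum)

lemma Phi_gpar: "\<Phi> y (gpar f) = gpar (\<Phi> y f)"
  unfolding Phi_eq gpar_g_subst[OF subst_parity(1,2)] gpar_g_subst[OF subst_parity(3,4)] ..

lemma subst_Xi: "g_subst (\<sigma>2 y) g_p (\<Xi> b y) = \<Xi> b y"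
  unfolding \<Xi>_def g_subst_sum g_subst_linear g_subst_xi[OF subst_parity(3)]
  by (rule sum.cong[OF refl]) (simp add: \<sigma>2_def)

lemma Phi_xi: "b < r \<Longrightarrow> \<Phi> y (g_xi b) = \<Xi> b y"
  unfolding Phi_eq g_subst_xi[OF subst_parity(1)] by (simp add: \<sigma>1_def subst_Xi)

lemma Phi_p:
  assumes y: "y \<in> W"
  shows "\<Phi> y (g_p i) = P i y"
proof -
  have \<sigma>2: "\<sigma>2 y (r + a) = \<theta> a" if "a < r" for a
    unfolding \<sigma>2_def \<theta>_def by (simp, intro sum.cong refl) (simp add: g'_const[OF y that])
  show ?thesis
    unfolding Phi_eq g_subst_p[OF subst_parity(2)] \<tau>1_def P_def
    by (simp add: g_subst_sum g_subst_p[OF subst_parity(4)] g_subst_mult[OF subst_parity(3,4)] subst_Xi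
      g_subst_xi[OF subst_parity(3)]) (intro sum.cong refl, simp add: \<sigma>2)
qed

lemma geven_P: "geven (P i y)"
  unfolding P_def by (intro geven_intros geven_sum godd_Xi godd_theta)

lemma fam_Xi: "b < r \<Longrightarrow> \<Xi> b \<in> fam W"
  unfolding \<Xi>_def[abs_def] by (intro fam_sum fam_scaleR smS fam_const gvars_intros W(1)) auto

lemma fam_P: "i < n \<Longrightarrow> P i \<in> fam W"
proof -
  assume i: "i < n"
  have "gvars {..<r} {..<n} (\<theta> a)" for a unfolding \<theta>_def by (intro gvars_sum gvars_intros)
  then show ?thesis
    unfolding P_def[abs_def] using i
    by (intro fam_add fam_sum fam_scaleR fam_mult fam_Xi smJ sm_dT fam_const gvars_intros W(1)) auto
qed

lemma fam_Phi_const: "gvars {..<r} {..<n} f \<Longrightarrow> (\<lambda>y. \<Phi> y f) \<in> fam W"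
proof (induction f rule: gpoly_induct)
  case one
  then show ?case by (simp add: fam_const[OF W(1)] gvars_intros)
next
  case (add f g)
  then show ?case by (simp add: fam_add[OF W(1)])
next
  case (scale c f)
  then show ?case by (simp add: fam_scaleR[OF W(1)] sm_const[OF W(1)])
next
  case (xi a f)
  then show ?case by (simp add: fam_mult[OF W(1)] Phi_xi fam_Xi)
next
  case (p i f)
  then have "(\<lambda>y. P i y * \<Phi> y f) \<in> fam W" by (intro fam_mult W(1) fam_P) auto
  then show ?case by (rule fam_cong[OF W(1)]) (simp add: Phi_p)
qed

lemma fam_Phi:
  assumes F: "F \<in> fam W"
  shows "(\<lambda>y. \<Phi> y (F y)) \<in> fam W"
proof -
  obtain M where M: "finite M" "\<And>u. u \<in> M \<Longrightarrow> gvars {..<r} {..<n} (gmono u)"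
    "\<And>y. y \<in> W \<Longrightarrow> F y = (\<Sum>u\<in>M. gcoeff (F y) u *\<^sub>R gmono u)" using fam_expansion[OF F] by metis
  have "(\<lambda>y. \<Sum>u\<in>M. gcoeff (F y) u *\<^sub>R \<Phi> y (gmono u)) \<in> fam W"
    by (intro fam_sum fam_scaleR W(1) fam_sm[OF F] fam_Phi_const M(2))
  then show ?thesis
  proof (rule fam_cong[OF W(1)])
    fix y assume "y \<in> W"
    from arg_cong[OF M(3)[OF this], of "\<Phi> y"]
    show "\<Phi> y (F y) = (\<Sum>u\<in>M. gcoeff (F y) u *\<^sub>R \<Phi> y (gmono u))" by (simp add: Phi_sum)
  qed
qed

section \<open>Chain rules for the coordinate change\<close>

abbreviation "pdx i \<equiv> gchart_pd (U, \<phi>) i"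

lemmas pd_rules = gchart_pd_sum[OF c W(1,2) xW] gchart_pd_scaleR[OF c W(1,2) xW] gchart_pd_mult[OF c W(1,2) xW]
  gchart_pd_add[OF c W(1,2) xW]

text \<open>The point enters \<open>\<Phi> y (F y)\<close> twice. The product rule on the expansion
  in monomials separates the derivative of the coefficients of \<open>F\<close> from that of the
  substitution.\<close>

lemma pdx_Phi_split:
  assumes F: "F \<in> fam W" and i: "i < n"
  shows "pdx i (\<lambda>y. \<Phi> y (F y)) x = \<Phi> x (pdx i F x) + pdx i (\<lambda>y. \<Phi> y (F x)) x"
proof -
  obtain M where M: "finite M" "\<And>u. u \<in> M \<Longrightarrow> gvars {..<r} {..<n} (gmono u)"
    "\<And>y. y \<in> W \<Longrightarrow> F y = (\<Sum>u\<in>M. gcoeff (F y) u *\<^sub>R gmono u)" using fam_expansion[OF F] by metis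
  note fm = fam_Phi_const[OF M(2)] and fm' = fam_const[OF W(1) M(2)]
  let ?d = "\<lambda>u. chart_pd (U, \<phi>) i (\<lambda>y. gcoeff (F y) u) x"
  have 1: "pdx i F x = (\<Sum>u\<in>M. ?d u *\<^sub>R gmono u)"
  proof -
    have "pdx i F x = pdx i (\<lambda>y. \<Sum>u\<in>M. gcoeff (F y) u *\<^sub>R gmono u) x"
      by (rule gchart_pd_cong[OF c W(1,2) xW i M(3)])
    also have "\<dots> = (\<Sum>u\<in>M. pdx i (\<lambda>y. gcoeff (F y) u *\<^sub>R gmono u) x)"
      by (rule pd_rules(1)[OF i]) (intro fam_scaleR W(1) fam_sm[OF F] fm')
    also have "\<dots> = (\<Sum>u\<in>M. ?d u *\<^sub>R gmono u)"
      by (rule sum.cong[OF refl], subst pd_rules(2)[OF i fam_sm[OF F] fm']) (auto simp: gchart_pd_const[OF c W(1,2)])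
    finally show ?thesis .
  qed
  have 2: "pdx i (\<lambda>y. \<Phi> y (F x)) x = (\<Sum>u\<in>M. gcoeff (F x) u *\<^sub>R pdx i (\<lambda>y. \<Phi> y (gmono u)) x)"
  proof -
    have "\<Phi> y (F x) = (\<Sum>u\<in>M. gcoeff (F x) u *\<^sub>R \<Phi> y (gmono u))" for y
      using arg_cong[OF M(3)[OF xW], of "\<Phi> y"] by (simp add: Phi_sum)
    then have "pdx i (\<lambda>y. \<Phi> y (F x)) x = pdx i (\<lambda>y. \<Sum>u\<in>M. gcoeff (F x) u *\<^sub>R \<Phi> y (gmono u)) x" by simp
    also have "\<dots> = (\<Sum>u\<in>M. pdx i (\<lambda>y. gcoeff (F x) u *\<^sub>R \<Phi> y (gmono u)) x)"
      by (rule pd_rules(1)[OF i]) (intro fam_scaleR W(1) sm_const[OF W(1)] fm)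
    also have "\<dots> = (\<Sum>u\<in>M. gcoeff (F x) u *\<^sub>R pdx i (\<lambda>y. \<Phi> y (gmono u)) x)"
      by (rule sum.cong[OF refl], rule gchart_pd_cscaleR[OF c W(1,2) xW i fm])
    finally show ?thesis .
  qed
  have "pdx i (\<lambda>y. \<Phi> y (F y)) x = pdx i (\<lambda>y. \<Sum>u\<in>M. gcoeff (F y) u *\<^sub>R \<Phi> y (gmono u)) x"
  proof (rule gchart_pd_cong[OF c W(1,2) xW i])
    fix y assume "y \<in> W"
    from arg_cong[OF M(3)[OF this], of "\<Phi> y"]
    show "\<Phi> y (F y) = (\<Sum>u\<in>M. gcoeff (F y) u *\<^sub>R \<Phi> y (gmono u))" by (simp add: Phi_sum)
  qed
  also have "\<dots> = (\<Sum>u\<in>M. pdx i (\<lambda>y. gcoeff (F y) u *\<^sub>R \<Phi> y (gmono u)) x)"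
    by (rule pd_rules(1)[OF i]) (intro fam_scaleR W(1) fam_sm[OF F] fm)
  also have "\<dots> = (\<Sum>u\<in>M. ?d u *\<^sub>R \<Phi> x (gmono u) + gcoeff (F x) u *\<^sub>R pdx i (\<lambda>y. \<Phi> y (gmono u)) x)"
    by (rule sum.cong[OF refl], rule pd_rules(2)[OF i fam_sm[OF F] fm])
  finally show ?thesis unfolding 1 2 by (simp add: Phi_sum sum.distrib)
qed

abbreviation "Xd i a \<equiv> pdx i (\<Xi> a) x"
abbreviation "Pd i k \<equiv> pdx i (P k) x"
abbreviation "L i k \<equiv> d_xi k (P i x)"

lemma godd_Xd: "i < n \<Longrightarrow> a < r \<Longrightarrow> godd (Xd i a)"
  by (rule godd_gchart_pd[OF c W(1,2) h_sym xW fam_Xi godd_Xi])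

lemma geven_Pd: "i < n \<Longrightarrow> k < n \<Longrightarrow> geven (Pd i k)"
  by (rule geven_gchart_pd[OF c W(1,2) h_sym xW fam_P geven_P])

text \<open>The second term of \<open>pdx_Phi_split\<close> is an even derivation along \<Phi>,
  hence given by its values \<open>Xd\<close> and \<open>Pd\<close> on the generators.\<close>

lemma pdx_Phi:
  assumes F: "F \<in> fam W" and i: "i < n"
  shows "pdx i (\<lambda>y. \<Phi> y (F y)) x = \<Phi> x (pdx i F x) + (\<Sum>a<r. Xd i a * \<Phi> x (d_xi a (F x))) +
    (\<Sum>k<n. Pd i k * \<Phi> x (d_p k (F x)))"
proof -
  let ?D = "\<lambda>f. pdx i (\<lambda>y. \<Phi> y f) x"
  have xi: "?D (g_xi a) = Xd i a" if "a < r" for a using that by (simp add: Phi_xi)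
  have p: "?D (g_p k) = Pd i k" for k
    by (rule gchart_pd_cong[OF c W(1,2) xW i]) (simp add: Phi_p)
  have gx: "gvars {..<r} {..<n} (g_xi a)" if "a < r" for a using that by (simp add: gvars_intros)
  have gp: "gvars {..<r} {..<n} (g_p a)" if "a < n" for a using that by (simp add: gvars_intros)
  have "?D (F x) = (\<Sum>a<r. ?D (g_xi a) * \<Phi> x (d_xi a (F x))) + (\<Sum>k<n. ?D (g_p k) * \<Phi> x (d_p k (F x)))"
  proof (rule derivation_along_hom[where odd' = False])
    show "?D (f + g) = ?D f + ?D g" if "gvars {..<r} {..<n} f" "gvars {..<r} {..<n} g" for f g
      unfolding Phi_linear by (rule pd_rules(4)[OF i]) (rule fam_Phi_const that)+
    show "?D (k *\<^sub>R f) = k *\<^sub>R ?D f" if "gvars {..<r} {..<n} f" for k f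
      unfolding Phi_linear by (rule gchart_pd_cscaleR[OF c W(1,2) xW i]) (rule fam_Phi_const that)+
    show "?D 1 = 0" by (simp add: gchart_pd_const[OF c W(1,2)])
    show "?D (g_xi a * f) = ?D (g_xi a) * \<Phi> x f + (if False then - \<Phi> x (g_xi a) else \<Phi> x (g_xi a)) * ?D f"
      if "a < r" "gvars {..<r} {..<n} f" for a f
      unfolding Phi_mult if_False by (rule pd_rules(3)[OF i]) (rule fam_Phi_const gx that)+
    show "?D (g_p k * f) = ?D (g_p k) * \<Phi> x f + \<Phi> x (g_p k) * ?D f"
      if "k < n" "gvars {..<r} {..<n} f" for k f
      unfolding Phi_mult by (rule pd_rules(3)[OF i]) (rule fam_Phi_const gp that)+
    show "gpar (?D (g_xi a)) = (if False then ?D (g_xi a) else - ?D (g_xi a))" if "a < r" for a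
      unfolding xi[OF that] using godd_Xd[OF i that] by (simp add: godd_def)
    show "gpar (?D (g_p k)) = (if False then - ?D (g_p k) else ?D (g_p k))" if "k < n" for k
      unfolding p using geven_Pd[OF i that] by (simp add: geven_def)
    show "gvars {..<r} {..<n} (F x)" by (rule fam_gvars[OF F xW])
  qed (simp_all add: Phi_gpar)
  then show ?thesis unfolding pdx_Phi_split[OF F i] by (simp add: xi p)
qed

text \<open>The new momenta enter through the linear term of \<open>P\<close> only; the transformed
  odd coordinates are free of them.\<close>

lemma d_p_Phi:
  assumes f: "gvars {..<r} {..<n} f" and l: "l < n"
  shows "d_p l (\<Phi> x f) = (\<Sum>i<n. J i l x *\<^sub>R \<Phi> x (d_p i f))"
proof -
  have Xi0: "d_p l (\<Xi> b x) = 0" for b by (simp add: \<Xi>_def d_p_sum)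
  have xi: "d_p l (\<Phi> x (g_xi a)) = 0" if "a < r" for a using that by (simp add: Phi_xi Xi0)
  have p: "d_p l (\<Phi> x (g_p i)) = J i l x *\<^sub>R 1" for i
  proof -
    have "d_p l (\<theta> a) = 0" for a by (simp add: \<theta>_def d_p_sum)
    then have "d_p l (P i x) = (\<Sum>j<n. J i j x *\<^sub>R (if l = j then 1 else 0))"
      by (simp add: P_def d_p_sum d_p_mult Xi0 d_p_p)
    also have "\<dots> = (\<Sum>j<n. if l = j then J i j x *\<^sub>R 1 else 0)" by (rule sum.cong) auto
    finally show ?thesis using l by (simp add: Phi_p[OF xW])
  qed
  have "d_p l (\<Phi> x f) = (\<Sum>a<r. d_p l (\<Phi> x (g_xi a)) * \<Phi> x (d_xi a f)) + (\<Sum>k<n. d_p l (\<Phi> x (g_p k)) * \<Phi> x (d_p k f))"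
    by (rule derivation_along_hom[where odd' = False and D = "\<lambda>f. d_p l (\<Phi> x f)"])
       (simp_all add: Phi_gpar d_p_mult f xi p)
  then show ?thesis by (simp add: xi p)
qed

text \<open>The new odd coordinates enter through \<Xi> and also through the quadratic term of
  \<open>P\<close>, which is the origin of the terms with \<open>L\<close>.\<close>

lemma d_xi_Phi:
  assumes f: "gvars {..<r} {..<n} f" and k: "k < r"
  shows "d_xi k (\<Phi> x f) = (\<Sum>a<r. S a k x *\<^sub>R \<Phi> x (d_xi a f)) + (\<Sum>i<n. L i k * \<Phi> x (d_p i f))"
proof -
  have xi: "d_xi k (\<Phi> x (g_xi a)) = S a k x *\<^sub>R 1" if "a < r" for a
  proof -
    have "d_xi k (\<Xi> a x) = (\<Sum>d<r. S a d x *\<^sub>R (if k = d then 1 else 0))"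
      by (simp add: \<Xi>_def d_xi_sum d_xi_xi)
    also have "\<dots> = (\<Sum>d<r. if k = d then S a d x *\<^sub>R 1 else 0)" by (rule sum.cong) auto
    finally show ?thesis using k that by (simp add: Phi_xi)
  qed
  have "d_xi k (\<Phi> x f) = (\<Sum>a<r. d_xi k (\<Phi> x (g_xi a)) * \<Phi> x (d_xi a f)) + (\<Sum>i<n. d_xi k (\<Phi> x (g_p i)) * \<Phi> x (d_p i f))"
  proof (rule derivation_along_hom[where odd' = True and D = "\<lambda>f. d_xi k (\<Phi> x f)"])
    show "d_xi k (\<Phi> x (g_xi a * f)) = d_xi k (\<Phi> x (g_xi a)) * \<Phi> x f +
        (if True then - \<Phi> x (g_xi a) else \<Phi> x (g_xi a)) * d_xi k (\<Phi> x f)" if "a < r" for a f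
      using godd_Xi[of a x] that by (simp add: d_xi_mult Phi_xi godd_def)
    show "d_xi k (\<Phi> x (g_p i * f)) = d_xi k (\<Phi> x (g_p i)) * \<Phi> x f + \<Phi> x (g_p i) * d_xi k (\<Phi> x f)" for i f
      using geven_P[of i x] by (simp add: d_xi_mult Phi_p[OF xW] geven_def)
    show "gpar (d_xi k (\<Phi> x (g_xi a))) = (if True then d_xi k (\<Phi> x (g_xi a)) else - d_xi k (\<Phi> x (g_xi a)))"
      if "a < r" for a by (simp add: xi[OF that])
    show "gpar (d_xi k (\<Phi> x (g_p i))) = (if True then - d_xi k (\<Phi> x (g_p i)) else d_xi k (\<Phi> x (g_p i)))" for i
      using godd_derivs(2)[OF geven_P[of i x], of k] by (simp add: Phi_p[OF xW] godd_def)
  qed (simp_all add: Phi_gpar f)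
  then show ?thesis by (simp add: xi Phi_p[OF xW])
qed

section \<open>Canonical bracket relations of the transformed coordinates\<close>

lemma godd_eta: "godd (\<eta> i a)"
  unfolding \<eta>_def by (intro godd_sum godd_intros godd_Xi)

lemma Xd_eq:
  assumes i: "i < n" and b: "b < r"
  shows "Xd i b = - (\<Sum>a<r. S b a x *\<^sub>R \<eta> i a)"
proof -
  have "Xd i b = (\<Sum>k<r. pdx i (\<lambda>y. S b k y *\<^sub>R g_xi k) x)"
    unfolding \<Xi>_def[abs_def]
    by (rule pd_rules(1)[OF i]) (use b in \<open>intro fam_scaleR W(1) smS fam_const gvars_intros; simp\<close>)
  also have "\<dots> = (\<Sum>k<r. dS i b k *\<^sub>R g_xi k)"
  proof (rule sum.cong[OF refl])
    fix k assume "k \<in> {..<r}"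
    then have "(\<lambda>y. g_xi k) \<in> fam W" "sm W (S b k)"
      using b by (auto intro!: fam_const W(1) gvars_intros smS)
    then show "pdx i (\<lambda>y. S b k y *\<^sub>R g_xi k) x = dS i b k *\<^sub>R g_xi k"
      using pd_rules(2)[OF i, of "S b k" "\<lambda>y. g_xi k"] by (simp add: gchart_pd_const[OF c W(1,2)])
  qed
  also have "\<dots> = (\<Sum>k<r. - (\<Sum>a<r. (S b a x * B i a k) *\<^sub>R g_xi k))"
    by (rule sum.cong[OF refl]) (simp add: dS_eq[OF i b] scaleR_sum_left)
  also have "\<dots> = - (\<Sum>a<r. S b a x *\<^sub>R \<eta> i a)"
    unfolding sum_negf by (subst sum.swap) (simp add: eta_eq scaleR_sum_right)
  finally show ?thesis .
qed

lemma P_eq: "P i x = (\<Sum>j<n. J i j x *\<^sub>R g_p j) + (\<Sum>a<r. \<eta> i a * \<theta> a)"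
  by (simp add: P_def \<eta>_def sum_distrib_right)

text \<open>Skewness of \<open>g' B\<close> moves the matrix \<open>g'\<close> from \<theta> to
  \<eta>, at the cost of a sign; the 1/2 is that in the definition of \<theta>.\<close>

lemma B_theta:
  assumes i: "i < n" and k: "k < r"
  shows "(\<Sum>a<r. B i a k *\<^sub>R \<theta> a) = - (1/2) *\<^sub>R (\<Sum>a<r. g' k a *\<^sub>R \<eta> i a)"
proof -
  have "(\<Sum>a<r. B i a k *\<^sub>R \<theta> a) = (\<Sum>b<r. ((1/2) * (\<Sum>a<r. g' b a * B i a k)) *\<^sub>R g_xi b)"
  proof -
    have "(\<Sum>a<r. B i a k *\<^sub>R \<theta> a) = (\<Sum>a<r. \<Sum>b<r. ((1/2) * (g' b a * B i a k)) *\<^sub>R g_xi b)"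
      unfolding \<theta>_def scaleR_sum_right by (intro sum.cong refl) (simp add: g'_sym mult.commute)
    then show ?thesis unfolding sum_distrib_left scaleR_sum_left by (subst sum.swap)
  qed
  also have "\<dots> = (\<Sum>b<r. ((1/2) * (- (\<Sum>a<r. g' k a * B i a b))) *\<^sub>R g_xi b)"
    by (rule sum.cong[OF refl]) (use B_antisym[OF i _ k] in simp)
  also have "\<dots> = (\<Sum>b<r. \<Sum>a<r. - (1/2) *\<^sub>R ((g' k a * B i a b) *\<^sub>R g_xi b))"
    by (simp add: sum_distrib_left scaleR_sum_left sum_negf scaleR_sum_right)
  also have "\<dots> = - (1/2) *\<^sub>R (\<Sum>a<r. g' k a *\<^sub>R \<eta> i a)"
    unfolding eta_eq scaleR_sum_right by (subst sum.swap) simp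
  finally show ?thesis .
qed

text \<open>The derivative of \<open>\<eta> i a * \<theta> a\<close> falls on either factor. By
  \<open>B_theta\<close> the two contributions agree after summation, and the two halves add
  up.\<close>

lemma L_eq:
  assumes i: "i < n" and k: "k < r"
  shows "L i k = - (\<Sum>a<r. g' k a *\<^sub>R \<eta> i a)"
proof -
  have dd: "(\<Sum>d<r. u d *\<^sub>R (if k = d then 1 else 0)) = u k *\<^sub>R (1::gpoly)" for u
  proof -
    have "(\<Sum>d<r. u d *\<^sub>R (if k = d then 1 else 0)) = (\<Sum>d<r. if k = d then u d *\<^sub>R (1::gpoly) else 0)"
      by (rule sum.cong) auto
    then show ?thesis using k by simp
  qed
  have 1: "d_xi k (\<eta> i a) = B i a k *\<^sub>R 1" for a
    unfolding eta_eq by (simp only: d_xi_sum d_xi_linear d_xi_xi dd)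
  have 2: "d_xi k (\<theta> a) = (g' a k / 2) *\<^sub>R 1" for a
    unfolding \<theta>_def by (simp only: d_xi_sum d_xi_linear d_xi_xi dd)
  have "L i k = (\<Sum>a<r. d_xi k (\<eta> i a * \<theta> a))"
    by (simp add: P_eq d_xi_sum)
  also have "\<dots> = (\<Sum>a<r. B i a k *\<^sub>R \<theta> a + - (1/2) *\<^sub>R (g' k a *\<^sub>R \<eta> i a))"
  proof (rule sum.cong[OF refl])
    fix a assume a: "a \<in> {..<r}"
    then show "d_xi k (\<eta> i a * \<theta> a) = B i a k *\<^sub>R \<theta> a + - (1/2) *\<^sub>R (g' k a *\<^sub>R \<eta> i a)"
      using godd_eta[of i a] g'_sym[of a k] k by (simp add: d_xi_mult 1 2 godd_def)
  qed
  also have "\<dots> = - (1/2) *\<^sub>R (\<Sum>a<r. g' k a *\<^sub>R \<eta> i a) + - (1/2) *\<^sub>R (\<Sum>a<r. g' k a *\<^sub>R \<eta> i a)"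
    unfolding sum.distrib B_theta[OF i k] scaleR_sum_right ..
  also have "\<dots> = - (\<Sum>a<r. g' k a *\<^sub>R \<eta> i a)"
    using scaleR_left_distrib[of "-1/2" "-1/2" "\<Sum>a<r. g' k a *\<^sub>R \<eta> i a"] by simp
  finally show ?thesis .
qed

text \<open>The first two sums contain second derivatives of \<open>\<phi>'\<close> and
  \<open>T\<close> and are symmetric in \<open>i\<close> and \<open>k\<close>. The last one comes
  from differentiating \<Xi>; it is antisymmetric, since the \<eta> anticommute, and it alone
  survives in the commutator.\<close>

lemma Pd_eq:
  assumes i: "i < n" and k: "k < n"
  shows "Pd i k = (\<Sum>j<n. chart_pd (U, \<phi>) i (J k j) x *\<^sub>R g_p j) +
    (\<Sum>a<r. \<Sum>b<r. chart_pd (U, \<phi>) i (chart_pd (U, \<phi>) k (T a b)) x *\<^sub>R (\<Xi> b x * \<theta> a)) +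
    (1/2) *\<^sub>R (\<Sum>a<r. \<Sum>b<r. g' a b *\<^sub>R (\<eta> i a * \<eta> k b))"
proof -
  have gt: "(\<lambda>y. \<theta> a) \<in> fam W" for a
    unfolding \<theta>_def by (intro fam_const W(1) gvars_sum gvars_intros) auto
  have gp: "(\<lambda>y. g_p j) \<in> fam W" if "j < n" for j
    using that by (intro fam_const W(1) gvars_intros) auto
  have f1: "(\<lambda>y. J k j y *\<^sub>R g_p j) \<in> fam W" if "j \<in> {..<n}" for j
    using that k by (intro fam_scaleR W(1) smJ gp) auto
  let ?t = "\<lambda>a b y. chart_pd (U, \<phi>) k (T a b) y *\<^sub>R (\<Xi> b y * \<theta> a)"
  have f2: "?t a b \<in> fam W" if "a \<in> {..<r}" "b \<in> {..<r}" for a b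
    using that k by (intro fam_scaleR fam_mult W(1) sm_dT fam_Xi gt) auto
  have p2: "pdx i (?t a b) x = chart_pd (U, \<phi>) i (chart_pd (U, \<phi>) k (T a b)) x *\<^sub>R (\<Xi> b x * \<theta> a) +
      dT k a b *\<^sub>R (Xd i b * \<theta> a)" if "a \<in> {..<r}" "b \<in> {..<r}" for a b
  proof -
    have ab: "a < r" "b < r" using that by auto
    show ?thesis
      using pd_rules(2)[OF i sm_dT[OF k ab] fam_mult[OF W(1) fam_Xi[OF ab(2)] gt[of a]]]
        pd_rules(3)[OF i fam_Xi[OF ab(2)] gt[of a]] by (simp add: gchart_pd_const[OF c W(1,2)])
  qed
  have last: "(\<Sum>a<r. \<Sum>b<r. dT k a b *\<^sub>R (Xd i b * \<theta> a)) = (1/2) *\<^sub>R (\<Sum>a<r. \<Sum>b<r. g' a b *\<^sub>R (\<eta> i a * \<eta> k b))"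
  proof -
    have "(\<Sum>a<r. \<Sum>b<r. dT k a b *\<^sub>R (Xd i b * \<theta> a)) =
        (\<Sum>a<r. \<Sum>b<r. \<Sum>f<r. - ((dT k a b * S b f x) *\<^sub>R (\<eta> i f * \<theta> a)))"
      by (intro sum.cong refl) (simp add: Xd_eq[OF i] sum_distrib_right scaleR_sum_right sum_negf)
    also have "\<dots> = (\<Sum>a<r. \<Sum>f<r. \<Sum>b<r. - ((dT k a b * S b f x) *\<^sub>R (\<eta> i f * \<theta> a)))"
      by (intro sum.cong refl sum.swap)
    also have "\<dots> = (\<Sum>a<r. \<Sum>f<r. - (\<eta> i f * (B k a f *\<^sub>R \<theta> a)))"
      by (intro sum.cong refl) (simp add: B_def scaleR_sum_left sum_negf sum_distrib_left)
    also have "\<dots> = - (\<Sum>f<r. \<eta> i f * (\<Sum>a<r. B k a f *\<^sub>R \<theta> a))"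
      by (subst sum.swap) (simp add: sum_distrib_left sum_negf)
    also have "\<dots> = - (\<Sum>f<r. \<eta> i f * (- (1/2) *\<^sub>R (\<Sum>a<r. g' f a *\<^sub>R \<eta> k a)))"
      by (intro arg_cong[where f = uminus] sum.cong refl) (simp only: B_theta[OF k] lessThan_iff)
    also have "\<dots> = (1/2) *\<^sub>R (\<Sum>a<r. \<Sum>b<r. g' a b *\<^sub>R (\<eta> i a * \<eta> k b))"
      by (simp add: sum_distrib_left scaleR_sum_right sum_negf)
    finally show ?thesis .
  qed
  have "Pd i k = pdx i (\<lambda>y. \<Sum>j<n. J k j y *\<^sub>R g_p j) x + pdx i (\<lambda>y. \<Sum>a<r. \<Sum>b<r. ?t a b y) x"
    unfolding P_def[abs_def] by (rule pd_rules(4)[OF i]) (intro fam_sum W(1) f1 f2; assumption)+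
  also have "pdx i (\<lambda>y. \<Sum>j<n. J k j y *\<^sub>R g_p j) x = (\<Sum>j<n. pdx i (\<lambda>y. J k j y *\<^sub>R g_p j) x)"
    by (rule pd_rules(1)[OF i f1])
  also have "\<dots> = (\<Sum>j<n. chart_pd (U, \<phi>) i (J k j) x *\<^sub>R g_p j)"
    using pd_rules(2)[OF i smJ[OF k] gp] by (intro sum.cong refl) (simp add: gchart_pd_const[OF c W(1,2)])
  also have "pdx i (\<lambda>y. \<Sum>a<r. \<Sum>b<r. ?t a b y) x = (\<Sum>a<r. pdx i (\<lambda>y. \<Sum>b<r. ?t a b y) x)"
    by (rule pd_rules(1)[OF i]) (intro fam_sum W(1) f2; assumption)
  also have "\<dots> = (\<Sum>a<r. \<Sum>b<r. pdx i (?t a b) x)"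
    by (rule sum.cong[OF refl], rule pd_rules(1)[OF i], rule f2)
  also have "\<dots> = (\<Sum>a<r. \<Sum>b<r. chart_pd (U, \<phi>) i (chart_pd (U, \<phi>) k (T a b)) x *\<^sub>R (\<Xi> b x * \<theta> a) +
      dT k a b *\<^sub>R (Xd i b * \<theta> a))"
    by (intro sum.cong refl p2)
  also have "\<dots> = (\<Sum>a<r. \<Sum>b<r. chart_pd (U, \<phi>) i (chart_pd (U, \<phi>) k (T a b)) x *\<^sub>R (\<Xi> b x * \<theta> a)) +
      (1/2) *\<^sub>R (\<Sum>a<r. \<Sum>b<r. g' a b *\<^sub>R (\<eta> i a * \<eta> k b))"
    unfolding sum.distrib last ..
  finally show ?thesis by (simp only: add.assoc)
qed

lemma Pd_commutator:
  assumes i: "i < n" and k: "k < n"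
  shows "Pd i k - Pd k i = (\<Sum>a<r. \<Sum>b<r. g' a b *\<^sub>R (\<eta> i a * \<eta> k b))"
proof -
  have 1: "chart_pd (U, \<phi>) k (J i j) x = chart_pd (U, \<phi>) i (J k j) x" for j
    unfolding J_def[abs_def] using chart_pd_commute[OF c W(1,2) sm_phi' xW k i] by simp
  have 2: "chart_pd (U, \<phi>) k (chart_pd (U, \<phi>) i (T a b)) x = chart_pd (U, \<phi>) i (chart_pd (U, \<phi>) k (T a b)) x"
    if "a < r" "b < r" for a b
    by (rule chart_pd_commute[OF c W(1,2) smT[OF that] xW k i])
  have 3: "(\<Sum>a<r. \<Sum>b<r. g' a b *\<^sub>R (\<eta> k a * \<eta> i b)) = - (\<Sum>a<r. \<Sum>b<r. g' a b *\<^sub>R (\<eta> i a * \<eta> k b))"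
  proof -
    have "(\<Sum>a<r. \<Sum>b<r. g' a b *\<^sub>R (\<eta> k a * \<eta> i b)) = (\<Sum>b<r. \<Sum>a<r. g' a b *\<^sub>R (\<eta> k a * \<eta> i b))"
      by (rule sum.swap)
    also have "\<dots> = (\<Sum>b<r. \<Sum>a<r. - (g' b a *\<^sub>R (\<eta> i b * \<eta> k a)))"
      by (intro sum.cong refl) (simp add: g'_sym godd_anticommute[OF godd_eta godd_eta, of _ _ k])
    finally show ?thesis by (simp add: sum_negf)
  qed
  have 4: "(\<Sum>a<r. \<Sum>b<r. chart_pd (U, \<phi>) k (chart_pd (U, \<phi>) i (T a b)) x *\<^sub>R (\<Xi> b x * \<theta> a)) =
    (\<Sum>a<r. \<Sum>b<r. chart_pd (U, \<phi>) i (chart_pd (U, \<phi>) k (T a b)) x *\<^sub>R (\<Xi> b x * \<theta> a))"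
    by (intro sum.cong refl) (simp add: 2)
  show ?thesis
    unfolding Pd_eq[OF i k] Pd_eq[OF k i] 1 3 4
    by (simp add: algebra_simps scaleR_left_distrib[symmetric])
qed

text \<open>The relation \<open>{P\<^sub>i, P\<^sub>k} = 0\<close>: the inverse matrix
  \<open>h'\<close> contracts the two factors \<open>g'\<close> that occur in \<open>L\<close> to
  one, which leaves the commutator of \<open>Pd\<close>.\<close>

lemma h'_L_L:
  assumes i: "i < n" and k: "k < n"
  shows "(\<Sum>a<r. \<Sum>b<r. h' a b *\<^sub>R (L i a * L k b)) = Pd i k - Pd k i"
proof -
  have "(\<Sum>a<r. \<Sum>b<r. h' a b *\<^sub>R (L i a * L k b)) =
      (\<Sum>a<r. \<Sum>b<r. h' a b *\<^sub>R ((\<Sum>l<r. g' a l *\<^sub>R \<eta> i l) * (\<Sum>m<r. g' b m *\<^sub>R \<eta> k m)))"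
    by (intro sum.cong refl) (simp add: L_eq i k)
  also have "\<dots> = (\<Sum>l<r. \<Sum>m<r. \<Sum>a<r. \<Sum>b<r. h' a b *\<^sub>R ((g' a l *\<^sub>R \<eta> i l) * (g' b m *\<^sub>R \<eta> k m)))"
    by (rule sum_bilinear) auto
  also have "\<dots> = (\<Sum>l<r. \<Sum>m<r. (\<Sum>a<r. g' a l * (\<Sum>b<r. h' a b * g' b m)) *\<^sub>R (\<eta> i l * \<eta> k m))"
    by (intro sum.cong refl) (simp add: scaleR_sum_left sum_distrib_left mult_ac)
  also have "\<dots> = (\<Sum>l<r. \<Sum>m<r. g' l m *\<^sub>R (\<eta> i l * \<eta> k m))"
  proof (intro sum.cong refl)
    fix l m assume lm: "l \<in> {..<r}" "m \<in> {..<r}"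
    have "(\<Sum>a<r. g' a l * (\<Sum>b<r. h' a b * g' b m)) = (\<Sum>a<r. g' a l * (if a = m then 1 else 0))"
      by (intro sum.cong refl) (use lm in \<open>simp add: h'_g'\<close>)
    also have "\<dots> = g' l m" using lm g'_sym[of l m] by (simp only: sum_delta_real) simp
    finally show "(\<Sum>a<r. g' a l * (\<Sum>b<r. h' a b * g' b m)) *\<^sub>R (\<eta> i l * \<eta> k m) = g' l m *\<^sub>R (\<eta> i l * \<eta> k m)"
      by simp
  qed
  finally show ?thesis using Pd_commutator[OF i k] by simp
qed

text \<open>The relation \<open>{P\<^sub>i, \<Xi>\<^sub>b} = 0\<close>: here \<open>h'\<close>
  cancels the \<open>g'\<close> in \<open>L\<close>, and what remains is the formula for
  \<open>Xd\<close>.\<close>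

lemma h'_S_L:
  assumes i: "i < n" and b: "b < r"
  shows "(\<Sum>a<r. \<Sum>k<r. (h' a k * S b k x) *\<^sub>R L i a) = Xd i b"
proof -
  have "(\<Sum>a<r. \<Sum>k<r. (h' a k * S b k x) *\<^sub>R L i a) =
      (\<Sum>a<r. \<Sum>k<r. \<Sum>l<r. - ((S b k x * (h' k a * g' a l)) *\<^sub>R \<eta> i l))"
    by (intro sum.cong refl) (simp add: L_eq i scaleR_sum_right sum_negf h'_sym mult_ac)
  also have "\<dots> = (\<Sum>k<r. \<Sum>l<r. \<Sum>a<r. - ((S b k x * (h' k a * g' a l)) *\<^sub>R \<eta> i l))"
    by (subst sum.swap) (intro sum.cong refl sum.swap)
  also have "\<dots> = (\<Sum>k<r. \<Sum>l<r. - ((S b k x * (\<Sum>a<r. h' k a * g' a l)) *\<^sub>R \<eta> i l))"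
    by (simp only: sum_negf scaleR_sum_left sum_distrib_left)
  also have "\<dots> = (\<Sum>k<r. \<Sum>l<r. if k = l then - (S b k x *\<^sub>R \<eta> i l) else 0)"
    by (intro sum.cong refl) (simp add: h'_g')
  also have "\<dots> = (\<Sum>k<r. - (S b k x *\<^sub>R \<eta> i k))"
    by (intro sum.cong refl) simp
  also have "\<dots> = Xd i b" by (simp add: Xd_eq[OF i b] sum_negf)
  finally show ?thesis .
qed

lemma pdx_chain:
  assumes G: "G \<in> fam W" and i: "i < n"
  shows "pdx i G x = (\<Sum>l<n. J i l x *\<^sub>R gchart_pd (U', \<phi>') l G x)"
proof (rule gpoly_eqI)
  fix S' m
  show "gcoeff (pdx i G x) (S', m) = gcoeff (\<Sum>l<n. J i l x *\<^sub>R gchart_pd (U', \<phi>') l G x) (S', m)"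
    unfolding gcoeff_sum gcoeff_scaleR gcoeff_gchart_pd[OF c W(1,2) G xW i] J_def
      chart_pd_chain[OF c c' W xW fam_sm[OF G] i]
    by (intro sum.cong refl) (simp add: gcoeff_gchart_pd[OF c' W(1,3) G xW])
qed

text \<open>The base derivatives of the primed chart are collected by \<open>pdx_chain\<close> into
  those of the other chart; after the three chain rules the claim is an instance of
  \<open>change_algebra\<close>.\<close>

theorem pbr_Phi:
  assumes F: "F \<in> fam W" and G: "G \<in> fam W"
  shows "pbr (U', \<phi>') h' (\<lambda>y. \<Phi> y (F y)) (\<lambda>y. \<Phi> y (G y)) x = \<Phi> x (pbr (U, \<phi>) h F G x)"
proof -
  note fF = fam_Phi[OF F] and fG = fam_Phi[OF G] and vF = fam_gvars[OF F xW] and vG = fam_gvars[OF G xW]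
  let ?fp = "\<lambda>i. \<Phi> x (d_p i (F x))" and ?gp = "\<lambda>i. \<Phi> x (d_p i (G x))"
  let ?F = "\<lambda>y. \<Phi> y (F y)" and ?G = "\<lambda>y. \<Phi> y (G y)"
  have "(\<Sum>l<n. d_p l (?F x) * gchart_pd (U', \<phi>') l ?G x - gchart_pd (U', \<phi>') l ?F x * d_p l (?G x)) =
      (\<Sum>l<n. \<Sum>i<n. ?fp i * (J i l x *\<^sub>R gchart_pd (U', \<phi>') l ?G x) - (J i l x *\<^sub>R gchart_pd (U', \<phi>') l ?F x) * ?gp i)"
    by (intro sum.cong refl) (simp add: d_p_Phi[OF vF] d_p_Phi[OF vG] sum_distrib_left sum_distrib_right sum_subtractf)
  also have "\<dots> = (\<Sum>i<n. ?fp i * pdx i ?G x - pdx i ?F x * ?gp i)"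
    by (subst sum.swap, rule sum.cong[OF refl])
       (simp add: pdx_chain[OF fF] pdx_chain[OF fG] sum_distrib_left sum_distrib_right sum_subtractf)
  finally have 1: "(\<Sum>l<n. d_p l (?F x) * gchart_pd (U', \<phi>') l ?G x - gchart_pd (U', \<phi>') l ?F x * d_p l (?G x)) = \<dots>" .
  have "(\<Sum>a<r. \<Sum>b<r. h' a b *\<^sub>R (gpar (d_xi a (?F x)) * d_xi b (?G x))) = (\<Sum>a<r. \<Sum>b<r. h' a b *\<^sub>R
      (gpar ((\<Sum>k<r. S k a x *\<^sub>R \<Phi> x (d_xi k (F x))) + (\<Sum>i<n. L i a * ?fp i)) *
      ((\<Sum>k<r. S k b x *\<^sub>R \<Phi> x (d_xi k (G x))) + (\<Sum>i<n. L i b * ?gp i))))"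
    by (intro sum.cong refl) (simp only: d_xi_Phi[OF vF] d_xi_Phi[OF vG] lessThan_iff)
  moreover have "(\<Sum>i<n. ?fp i * pdx i ?G x - pdx i ?F x * ?gp i) = (\<Sum>i<n. ?fp i *
      (\<Phi> x (pdx i G x) + (\<Sum>a<r. Xd i a * \<Phi> x (d_xi a (G x))) + (\<Sum>k<n. Pd i k * ?gp k)) -
      (\<Phi> x (pdx i F x) + (\<Sum>a<r. Xd i a * \<Phi> x (d_xi a (F x))) + (\<Sum>k<n. Pd i k * ?fp k)) * ?gp i)"
    by (intro sum.cong refl) (simp only: pdx_Phi[OF F] pdx_Phi[OF G] lessThan_iff)
  ultimately have "pbr (U', \<phi>') h' ?F ?G x = (\<Sum>i<n. ?fp i * \<Phi> x (pdx i G x) - \<Phi> x (pdx i F x) * ?gp i) +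
      (\<Sum>a<r. \<Sum>b<r. h a b *\<^sub>R (gpar (\<Phi> x (d_xi a (F x))) * \<Phi> x (d_xi b (G x))))"
    unfolding pbr_def 1
    using change_algebra[of n r L "Xd" "Pd" h' "\<lambda>a k. S a k x" h ?fp "\<lambda>i. \<Phi> x (pdx i G x)"
      "\<lambda>a. \<Phi> x (d_xi a (G x))" ?gp "\<lambda>i. \<Phi> x (pdx i F x)" "\<lambda>a. \<Phi> x (d_xi a (F x))",
      OF godd_derivs(2)[OF geven_P] godd_Xd geven_Pd h'_L_L h'_S_L h'_sym h'_S_S] by simp
  also have "\<dots> = \<Phi> x (pbr (U, \<phi>) h F G x)"
    by (simp add: pbr_def Phi_sum Phi_gpar)
  finally show ?thesis .
qed

end

section \<open>The algebra of functions\<close>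

text \<open>A bound, not homogeneity: functions are finite sums of homogeneous ones, with a bound on
  the degree that is uniform over all charts and points.\<close>

definition gle :: "nat \<Rightarrow> gpoly \<Rightarrow> bool" where
  "gle N f \<longleftrightarrow> (\<forall>S m. gcoeff f (S, m) \<noteq> 0 \<longrightarrow> card S + 2 * size m \<le> N)"

lemma gle_0 [simp]: "gle N 0"
  by (simp add: gle_def gcoeff_simps)

lemma gle_mono: "gle N f \<Longrightarrow> N \<le> N' \<Longrightarrow> gle N' f"
  unfolding gle_def by (meson order_trans)

lemma gle_add: "gle N f \<Longrightarrow> gle N g \<Longrightarrow> gle N (f + g)"
  unfolding gle_def gcoeff_simps by (metis add.right_neutral)

lemma gle_scaleR: "gle N f \<Longrightarrow> gle N (k *\<^sub>R f)"
  unfolding gle_def gcoeff_simps by auto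

lemma gle_diff: "gle N f \<Longrightarrow> gle N g \<Longrightarrow> gle N (f - g)"
  unfolding gle_def gcoeff_simps by (metis diff_zero)

lemma gle_sum: "(\<And>i. i \<in> I \<Longrightarrow> gle N (f i)) \<Longrightarrow> gle N (\<Sum>i\<in>I. f i)"
  by (induction I rule: infinite_finite_induct) (simp_all add: gle_add)

lemma gle_mult:
  assumes "gle N f" "gle N' g"
  shows "gle (N + N') (f * g)"
  unfolding gle_def
proof (intro allI impI)
  fix S m assume "gcoeff (f * g) (S, m) \<noteq> 0"
  then obtain T k where *: "gcoeff f (T, k) \<noteq> 0" "gcoeff g (S - T, m - k) \<noteq> 0"
    "card S = card T + card (S - T)" "size m = size k + size (m - k)"
    by (rule gcoeff_times_nonzero)
  then have "card T + 2 * size k \<le> N" "card (S - T) + 2 * size (m - k) \<le> N'"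
    using assms unfolding gle_def by blast+
  then show "card S + 2 * size m \<le> N + N'" using *(3,4) by linarith
qed

lemma gle_gpar: "gle N f \<Longrightarrow> gle N (gpar f)"
  unfolding gle_def gcoeff_gpar by auto

lemma gle_d_p: "gle N f \<Longrightarrow> gle N (d_p i f)"
  unfolding gle_def
proof (intro allI impI)
  fix S m assume f: "\<forall>S m. gcoeff f (S, m) \<noteq> 0 \<longrightarrow> card S + 2 * size m \<le> N" and "gcoeff (d_p i f) (S, m) \<noteq> 0"
  then have "gcoeff f (S, add_mset i m) \<noteq> 0" by (simp add: gcoeff_d_p)
  then have "card S + 2 * size (add_mset i m) \<le> N" using f by blast
  then show "card S + 2 * size m \<le> N" by simp
qed

lemma gle_d_xi: "gle N f \<Longrightarrow> gle N (d_xi a f)"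
  unfolding gle_def
proof (intro allI impI)
  fix S m assume f: "\<forall>S m. gcoeff f (S, m) \<noteq> 0 \<longrightarrow> card S + 2 * size m \<le> N" and nz: "gcoeff (d_xi a f) (S, m) \<noteq> 0"
  have c: "a \<notin> S" "gcoeff f (insert a S, m) \<noteq> 0" using nz by (simp_all add: gcoeff_d_xi split: if_splits)
  then have "card (insert a S) + 2 * size m \<le> N" using f by blast
  moreover have "card S \<le> card (insert a S)"
    using finite_coeff_fst[OF c(2)] by (intro card_mono) auto
  ultimately show "card S + 2 * size m \<le> N" by simp
qed

lemma gdeg_small: "gdeg k f \<Longrightarrow> k < 2 \<Longrightarrow> d_p i f = 0" "gdeg 0 f \<Longrightarrow> d_xi a f = 0"
proof -
  show "d_p i f = 0" if "gdeg k f" "k < 2"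
  proof (rule gpoly_eqI, rule ccontr)
    fix S m assume "gcoeff (d_p i f) (S, m) \<noteq> gcoeff 0 (S, m)"
    then have "gcoeff f (S, add_mset i m) \<noteq> 0" by (simp add: gcoeff_d_p gcoeff_simps)
    then have "card S + 2 * size (add_mset i m) = k" using that unfolding gdeg_def by blast
    then show False using that by simp
  qed
  show "d_xi a f = 0" if "gdeg 0 f"
  proof (rule gpoly_eqI, rule ccontr)
    fix S m assume "gcoeff (d_xi a f) (S, m) \<noteq> gcoeff 0 (S, m)"
    then have nz: "gcoeff f (insert a S, m) \<noteq> 0" by (auto simp: gcoeff_d_xi gcoeff_simps split: if_splits)
    then have "card (insert a S) = 0" using that unfolding gdeg_def by fastforce
    then show False using finite_coeff_fst[OF nz] by (metis card_eq_0_iff insert_not_empty)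
  qed
qed

lemma gpar_gdeg_0: "gdeg 0 f \<Longrightarrow> gpar f = f" and godd_gdeg: "gdeg k f \<Longrightarrow> odd k \<Longrightarrow> godd f"
  and geven_gdeg: "gdeg k f \<Longrightarrow> even k \<Longrightarrow> geven f"
  using gdeg_parity by (fastforce simp: godd_def geven_def)+

text \<open>The factor \<open>count m i + 1\<close> in \<open>d_p\<close> is nonzero, so a momentum
  in some monomial is detected by a derivative. The form with derivatives is the one that is
  compatible with brackets.\<close>

lemma pfree_iff:
  assumes f: "gvars A {..<n} f"
  shows "(\<forall>i<n. d_p i f = 0) \<longleftrightarrow> (\<forall>S m. gcoeff f (S, m) \<noteq> 0 \<longrightarrow> m = {#})"
proof
  assume z: "\<forall>i<n. d_p i f = 0"
  show "\<forall>S m. gcoeff f (S, m) \<noteq> 0 \<longrightarrow> m = {#}"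
  proof (intro allI impI, rule ccontr)
    fix S m assume nz: "gcoeff f (S, m) \<noteq> 0" and "m \<noteq> {#}"
    then obtain i m' where m: "m = add_mset i m'" using multiset_cases by blast
    then have "i < n" using f nz unfolding gvars_def by fastforce
    then have "gcoeff (d_p i f) (S, m') = 0" using z by (simp add: gcoeff_simps)
    then show False using nz m by (simp add: gcoeff_d_p)
  qed
next
  assume z: "\<forall>S m. gcoeff f (S, m) \<noteq> 0 \<longrightarrow> m = {#}"
  have "gcoeff (d_p i f) (S, m) = gcoeff 0 (S, m)" for i S m
    using z[rule_format, of S "add_mset i m"] by (auto simp: gcoeff_d_p gcoeff_simps)
  then show "\<forall>i<n. d_p i f = 0" by (auto intro: gpoly_eqI)
qed

text \<open>Turns the degree bound of \<open>graded_functions\<close> into the common finite set of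
  monomials required by \<open>fam\<close>.\<close>

lemma finite_monomials: "finite {(S, m :: nat multiset). S \<subseteq> {..<r::nat} \<and> set_mset m \<subseteq> {..<n} \<and> card S + 2 * size m \<le> N}"
  (is "finite ?M")
proof (rule finite_subset)
  let ?L = "{xs. set xs \<subseteq> {..<n} \<and> length xs \<le> N}"
  have "finite ?L" by (rule finite_lists_length_le) simp
  then show "finite (Pow {..<r} \<times> mset ` ?L)" by simp
  show "?M \<subseteq> Pow {..<r} \<times> mset ` ?L"
  proof safe
    fix S m assume *: "set_mset m \<subseteq> {..<n}" "card S + 2 * size m \<le> N"
    obtain xs where "mset xs = m" using ex_mset by blast
    with * have "m = mset xs" "xs \<in> ?L" by auto
    then show "m \<in> mset ` ?L" by blast
  qed
qed

definition tr :: "('m, 'v::real_vector) courant_data \<Rightarrow> ('m, 'v) gchart \<Rightarrow> ('m, 'v) gchart \<Rightarrow> 'm \<Rightarrow> gpoly \<Rightarrow> gpoly" where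
  "tr C c c' x f = realization_pullback C c' x (cotangent_change C c c' x f)"

lemma (in chart_pair) tr_eq: "tr C (U, \<phi>, e) (U', \<phi>', e') y f = \<Phi> y f"
  by (simp add: tr_def \<Phi>_def)

section \<open>Closure of the functions under algebra operations and bracket\<close>

context courant_algebroid
begin

abbreviation "gf \<equiv> graded_functions C"

lemma chart_pairI: "gchart_at C (U, \<phi>, e) x \<Longrightarrow> gchart_at C (U', \<phi>', e') x \<Longrightarrow> chart_pair C U \<phi> e U' \<phi>' e' x"
  by (intro chart_pair.intro courant_algebroid_axioms chart_pair_axioms.intro) (auto simp: gchart_at_def)

lemma gfD:
  assumes F: "F \<in> gf"
  shows gf_off: "\<not> gchart_at C c x \<Longrightarrow> F c x = 0"
    and gf_bound: "\<exists>N. \<forall>c x. gle N (F c x)"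
    and gf_fam: "darboux_chart C (U, \<phi>, e) \<Longrightarrow> F (U, \<phi>, e) \<in> fam U"
    and gf_tr: "chart_pair C U \<phi> e U' \<phi>' e' x \<Longrightarrow> F (U', \<phi>', e') x = tr C (U, \<phi>, e) (U', \<phi>', e') x (F (U, \<phi>, e) x)"
proof -
  note F' = F[unfolded graded_functions_def mem_Collect_eq]
  obtain N where N: "\<And>c x S m. gcoeff (F c x) (S, m) \<noteq> 0 \<Longrightarrow>
      S \<subseteq> {..<r} \<and> set_mset m \<subseteq> {..<n} \<and> card S + 2 * size m \<le> N"
    using F'[THEN conjunct2, THEN conjunct1] by blast
  show "\<not> gchart_at C c x \<Longrightarrow> F c x = 0" using F'[THEN conjunct1] by blast
  show "\<exists>N. \<forall>c x. gle N (F c x)" unfolding gle_def using N by blast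
  show "F (U, \<phi>, e) \<in> fam U" if d: "darboux_chart C (U, \<phi>, e)"
  proof (rule famI[OF finite_monomials[of r n N]])
    from F'[THEN conjunct2, THEN conjunct2, THEN conjunct1, rule_format, OF d] show "sm U (\<lambda>x. gcoeff (F (U, \<phi>, e) x) (S, m))" for S m by simp
    show "gvars {..<r} {..<n} (F (U, \<phi>, e) x)" for x unfolding gvars_def using N by blast
    show "u \<in> {(S, m). S \<subseteq> {..<r} \<and> set_mset m \<subseteq> {..<n} \<and> card S + 2 * size m \<le> N}"
      if "gcoeff (F (U, \<phi>, e) x) u \<noteq> 0" for x u
      using that N[of "(U, \<phi>, e)" x "fst u" "snd u"] by (cases u) simp
  qed
  show "F (U', \<phi>', e') x = tr C (U, \<phi>, e) (U', \<phi>', e') x (F (U, \<phi>, e) x)"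
    if p: "chart_pair C U \<phi> e U' \<phi>' e' x"
  proof -
    have g: "gchart_at C (U, \<phi>, e) x" "gchart_at C (U', \<phi>', e') x"
      using chart_pair.d[OF p] chart_pair.d'[OF p] chart_pair.x[OF p] by (auto simp: gchart_at_def)
    from F'[THEN conjunct2, THEN conjunct2, THEN conjunct2, rule_format, OF g] show ?thesis unfolding tr_def .
  qed
qed

lemma gfI:
  assumes off: "\<And>c x. \<not> gchart_at C c x \<Longrightarrow> F c x = 0" and N: "\<And>c x. gle N (F c x)"
    and fam: "\<And>U \<phi> e. darboux_chart C (U, \<phi>, e) \<Longrightarrow> F (U, \<phi>, e) \<in> fam U"
    and tr: "\<And>U \<phi> e U' \<phi>' e' x. chart_pair C U \<phi> e U' \<phi>' e' x \<Longrightarrow>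
      F (U', \<phi>', e') x = tr C (U, \<phi>, e) (U', \<phi>', e') x (F (U, \<phi>, e) x)"
  shows "F \<in> gf"
  unfolding graded_functions_def
proof (intro CollectI conjI allI impI)
  show "\<exists>N. \<forall>c x S m. gcoeff (F c x) (S, m) \<noteq> 0 \<longrightarrow>
      S \<subseteq> {..<r} \<and> set_mset m \<subseteq> {..<n} \<and> card S + 2 * size m \<le> N"
  proof (intro exI[of _ N] allI impI)
    fix c :: "('m, 'v) gchart" and x S m assume nz: "gcoeff (F c x) (S, m) \<noteq> 0"
    obtain U \<phi> e where c: "c = (U, \<phi>, e)" using prod_cases3 by blast
    have "gchart_at C c x" using nz off[of c x] by (cases "gchart_at C c x") (simp_all add: gcoeff_simps)
    then have "darboux_chart C (U, \<phi>, e)" "x \<in> U" unfolding c gchart_at_def by auto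
    then have "gvars {..<r} {..<n} (F c x)" unfolding c using fam_gvars[OF fam] by blast
    then show "S \<subseteq> {..<r} \<and> set_mset m \<subseteq> {..<n} \<and> card S + 2 * size m \<le> N"
      using nz N[of c x] unfolding gvars_def gle_def by blast
  qed
  show "sm (fst c) (\<lambda>x. gcoeff (F c x) u)" if "darboux_chart C c" for c u
    using fam_sm[OF fam] that by (cases c) simp
  show "F c' x = realization_pullback C c' x (cotangent_change C c c' x (F c x))"
    if g: "gchart_at C c x" "gchart_at C c' x" for c c' x
  proof -
    obtain U \<phi> e U' \<phi>' e' where c: "c = (U, \<phi>, e)" "c' = (U', \<phi>', e')" using prod_cases3 by metis
    show ?thesis using tr[OF chart_pairI[OF g[unfolded c]]] unfolding tr_def c .
  qed
qed (rule off)

definition gpar_fun :: "('m, 'v) gfun \<Rightarrow> ('m, 'v) gfun" where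
  "gpar_fun F = (\<lambda>c x. gpar (F c x))"

lemma gf_add:
  assumes "F \<in> gf" "G \<in> gf"
  shows "F + G \<in> gf"
proof -
  obtain M N where "\<And>c x. gle M (F c x)" "\<And>c x. gle N (G c x)"
    using gf_bound[OF assms(1)] gf_bound[OF assms(2)] by blast
  then have "gle (max M N) ((F + G) c x)" for c x
    by (simp add: gle_add gle_mono[of M _ "max M N"] gle_mono[of N _ "max M N"])
  moreover have "(F + G) (U, \<phi>, e) \<in> fam U" if "darboux_chart C (U, \<phi>, e)" for U \<phi> e
    using fam_add[OF darbouxD(2)[OF that] gf_fam[OF assms(1) that] gf_fam[OF assms(2) that]]
    by (simp add: plus_fun_def)
  moreover have "(F + G) (U', \<phi>', e') x = tr C (U, \<phi>, e) (U', \<phi>', e') x ((F + G) (U, \<phi>, e) x)"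
    if "chart_pair C U \<phi> e U' \<phi>' e' x" for U \<phi> e U' \<phi>' e' x
    using gf_tr[OF assms(1) that] gf_tr[OF assms(2) that] chart_pair.tr_eq[OF that]
      chart_pair.Phi_linear(1)[OF that] by simp
  ultimately show ?thesis using gf_off[OF assms(1)] gf_off[OF assms(2)] by (intro gfI) simp_all
qed

lemma gf_scale:
  assumes "F \<in> gf"
  shows "k *\<^sub>R F \<in> gf"
proof -
  obtain N where "\<And>c x. gle N (F c x)" using gf_bound[OF assms(1)] by blast
  then have "gle N ((k *\<^sub>R F) c x)" for c x by (simp add: gle_scaleR)
  moreover have "(k *\<^sub>R F) (U, \<phi>, e) \<in> fam U" if "darboux_chart C (U, \<phi>, e)" for U \<phi> e
    using fam_scaleR[OF darbouxD(2)[OF that] sm_const[OF darbouxD(2)[OF that]] gf_fam[OF assms that]]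
    by (simp add: scaleR_fun_def)
  moreover have "(k *\<^sub>R F) (U', \<phi>', e') x = tr C (U, \<phi>, e) (U', \<phi>', e') x ((k *\<^sub>R F) (U, \<phi>, e) x)"
    if "chart_pair C U \<phi> e U' \<phi>' e' x" for U \<phi> e U' \<phi>' e' x
    using gf_tr[OF assms that] chart_pair.tr_eq[OF that] chart_pair.Phi_linear(2)[OF that] by simp
  ultimately show ?thesis using gf_off[OF assms] by (intro gfI) simp_all
qed

lemma gf_gpar:
  assumes "F \<in> gf"
  shows "gpar_fun F \<in> gf"
proof -
  obtain N where "\<And>c x. gle N (F c x)" using gf_bound[OF assms(1)] by blast
  then have "gle N (gpar_fun F c x)" for c x by (simp add: gle_gpar gpar_fun_def)
  moreover have "gpar_fun F (U, \<phi>, e) \<in> fam U" if "darboux_chart C (U, \<phi>, e)" for U \<phi> e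
    using fam_gpar[OF darbouxD(2)[OF that] gf_fam[OF assms that]] by (simp add: gpar_fun_def)
  moreover have "gpar_fun F (U', \<phi>', e') x = tr C (U, \<phi>, e) (U', \<phi>', e') x (gpar_fun F (U, \<phi>, e) x)"
    if "chart_pair C U \<phi> e U' \<phi>' e' x" for U \<phi> e U' \<phi>' e' x
    using gf_tr[OF assms that] chart_pair.tr_eq[OF that] chart_pair.Phi_gpar[OF that]
    by (simp add: gpar_fun_def)
  ultimately show ?thesis using gf_off[OF assms] by (intro gfI) (simp_all add: gpar_fun_def)
qed

lemma gf_mult:
  assumes "F \<in> gf" "G \<in> gf"
  shows "F * G \<in> gf"
proof -
  obtain M N where "\<And>c x. gle M (F c x)" "\<And>c x. gle N (G c x)"
    using gf_bound[OF assms(1)] gf_bound[OF assms(2)] by blast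
  then have "gle (M + N) ((F * G) c x)" for c x by (simp add: gle_mult)
  moreover have "(F * G) (U, \<phi>, e) \<in> fam U" if "darboux_chart C (U, \<phi>, e)" for U \<phi> e
    using fam_mult[OF darbouxD(2)[OF that] gf_fam[OF assms(1) that] gf_fam[OF assms(2) that]]
    by (simp add: times_fun_def)
  moreover have "(F * G) (U', \<phi>', e') x = tr C (U, \<phi>, e) (U', \<phi>', e') x ((F * G) (U, \<phi>, e) x)"
    if "chart_pair C U \<phi> e U' \<phi>' e' x" for U \<phi> e U' \<phi>' e' x
    using gf_tr[OF assms(1) that] gf_tr[OF assms(2) that] chart_pair.tr_eq[OF that]
      chart_pair.Phi_mult[OF that] by simp
  ultimately show ?thesis using gf_off[OF assms(1)] gf_off[OF assms(2)] by (intro gfI) simp_all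
qed

lemma gf_0: "0 \<in> gf"
proof (rule gfI)
  show "(0 :: ('m, 'v) gfun) (U, \<phi>, e) \<in> fam U" if "darboux_chart C (U, \<phi>, e)" for U \<phi> e
    using fam_0[OF darbouxD(2)[OF that]] by (simp add: zero_fun_def)
  show "(0 :: ('m, 'v) gfun) (U', \<phi>', e') x = tr C (U, \<phi>, e) (U', \<phi>', e') x ((0 :: ('m, 'v) gfun) (U, \<phi>, e) x)"
    if p: "chart_pair C U \<phi> e U' \<phi>' e' x" for U \<phi> e U' \<phi>' e' x
    using chart_pair.tr_eq[OF p] chart_pair.Phi_linear(3)[OF p] by simp
  show "gle 0 ((0 :: ('m, 'v) gfun) c x)" for c x by simp
qed simp

lemma gf_base_fun:
  assumes "f \<in> smooth_functions C"
  shows "base_fun C f \<in> gf"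
proof (rule gfI)
  show "gle 0 (base_fun C f c x)" for c x
    by (auto simp: base_fun_def of_real_def gle_def gcoeff_simps)
  show "base_fun C f (U, \<phi>, e) \<in> fam U" if d: "darboux_chart C (U, \<phi>, e)" for U \<phi> e
  proof (rule fam_cong[OF darbouxD(2)[OF d]])
    have "sm U f" using assms sm_subset[of UNIV f U] by simp
    then show "(\<lambda>x. f x *\<^sub>R 1) \<in> fam U"
      by (intro fam_scaleR fam_const gvars_intros darbouxD(2)[OF d])
    show "x \<in> U \<Longrightarrow> base_fun C f (U, \<phi>, e) x = f x *\<^sub>R 1" for x
      using d by (simp add: base_fun_def gchart_at_def of_real_def)
  qed
  show "base_fun C f (U', \<phi>', e') x = tr C (U, \<phi>, e) (U', \<phi>', e') x (base_fun C f (U, \<phi>, e) x)"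
    if p: "chart_pair C U \<phi> e U' \<phi>' e' x" for U \<phi> e U' \<phi>' e' x
    using chart_pair.d[OF p] chart_pair.d'[OF p] chart_pair.x[OF p] chart_pair.tr_eq[OF p]
      chart_pair.Phi_linear(2)[OF p] chart_pair.Phi_1[OF p]
    by (simp add: base_fun_def gchart_at_def of_real_def)
qed (simp add: base_fun_def)

text \<open>A base derivative creates no monomials, so degree bounds and homogeneity survive
  it.\<close>

lemma gchart_pd_support:
  assumes c: "smooth_chart n (atlas C) (U, \<phi>)" and W: "open W" "W \<subseteq> U" and F: "F \<in> fam W" and x: "x \<in> W" and i: "i < n"
    and nz: "gcoeff (gchart_pd (U, \<phi>) i F x) (S, m) \<noteq> 0"
  obtains y where "y \<in> W" "gcoeff (F y) (S, m) \<noteq> 0"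
proof (rule ccontr)
  assume "\<not> thesis"
  then have z: "gcoeff (F y) (S, m) = 0" if "y \<in> W" for y using that \<open>\<And>y. y \<in> W \<Longrightarrow> gcoeff (F y) (S, m) \<noteq> 0 \<Longrightarrow> thesis\<close> by blast
  have "chart_pd (U, \<phi>) i (\<lambda>y. gcoeff (F y) (S, m)) x = 0"
    by (rule chart_pd_zero[OF c W x i]) (rule z)
  then show False using nz gcoeff_gchart_pd[OF c W F x i] by simp
qed

text \<open>The degree bound follows from those for derivatives and products, smoothness from the
  constant coefficients in a Darboux chart, and the transformation rule from
  \<open>pbr_Phi\<close>.\<close>

lemma gf_poisson:
  assumes F: "F \<in> gf" and G: "G \<in> gf"
  shows "poisson C F G \<in> gf"
proof -
  obtain M N where M: "\<And>c x. gle M (F c x)" and N: "\<And>c x. gle N (G c x)"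
    using gf_bound[OF F] gf_bound[OF G] by blast
  have off: "\<not> gchart_at C c x \<Longrightarrow> poisson C F G c x = 0" for c x
    by (cases c) (simp add: poisson_def)
  have 1: "gle (M + N) (poisson C F G c x)" for c x
  proof (cases "gchart_at C c x")
    case True
    obtain U \<phi> e where c: "c = (U, \<phi>, e)" using prod_cases3 by blast
    have d: "darboux_chart C (U, \<phi>, e)" and x: "x \<in> U" using True unfolding c gchart_at_def by auto
    have le: "gle K (gchart_pd (U, \<phi>) i (A (U, \<phi>, e)) x)" if A: "A \<in> gf" "\<And>c x. gle K (A c x)" "i < n" for A K i
      unfolding gle_def
    proof (intro allI impI)
      fix S m assume "gcoeff (gchart_pd (U, \<phi>) i (A (U, \<phi>, e)) x) (S, m) \<noteq> 0"
      then obtain y where "gcoeff (A (U, \<phi>, e) y) (S, m) \<noteq> 0"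
        by (rule gchart_pd_support[OF darbouxD(1,2)[OF d] subset_refl gf_fam[OF A(1) d] x A(3)])
      then show "card S + 2 * size m \<le> K" using A(2) unfolding gle_def by blast
    qed
    have "gle (M + N) (pbr (U, \<phi>) (inverse_pairing C e x) (F (U, \<phi>, e)) (G (U, \<phi>, e)) x)"
      unfolding pbr_def
      by (intro gle_add gle_sum gle_diff gle_scaleR gle_mult gle_gpar gle_d_p gle_d_xi le F G M N) auto
    then show ?thesis using poisson_eq_pbr True unfolding c by simp
  qed (simp add: off)
  have 2: "poisson C F G (U, \<phi>, e) \<in> fam U" if d: "darboux_chart C (U, \<phi>, e)" for U \<phi> e
  proof (cases "U = {}")
    case True
    then show ?thesis using darbouxD(2)[OF d] by (intro fam_cong[OF _ fam_0]) auto
  next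
    case False
    then obtain x0 where x0: "x0 \<in> U" by blast
    note c = darbouxD(1)[OF d] and op = darbouxD(2)[OF d]
    show ?thesis
    proof (rule fam_cong[OF op])
      show "pbr (U, \<phi>) (inverse_pairing C e x0) (F (U, \<phi>, e)) (G (U, \<phi>, e)) \<in> fam U"
        by (rule fam_pbr[OF c op subset_refl inverse_pairing_sym[OF darbouxD(3)[OF d x0]] gf_fam[OF F d] gf_fam[OF G d]])
      show "poisson C F G (U, \<phi>, e) y = pbr (U, \<phi>) (inverse_pairing C e x0) (F (U, \<phi>, e)) (G (U, \<phi>, e)) y"
        if y: "y \<in> U" for y
        using poisson_eq_pbr[of U \<phi> e y] d y inverse_pairing_const[OF d y x0] by (simp add: gchart_at_def pbr_def)
    qed
  qed
  have 3: "poisson C F G (U', \<phi>', e') x = tr C (U, \<phi>, e) (U', \<phi>', e') x (poisson C F G (U, \<phi>, e) x)"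
    if p: "chart_pair C U \<phi> e U' \<phi>' e' x" for U \<phi> e U' \<phi>' e' x
  proof -
    interpret p: chart_pair C U \<phi> e U' \<phi>' e' x by (rule p)
    have g: "gchart_at C (U, \<phi>, e) x" "gchart_at C (U', \<phi>', e') x"
      using p.d p.d' p.x by (auto simp: gchart_at_def)
    have h: "inverse_pairing C e' x = p.h'" "inverse_pairing C e x = p.h"
      by (simp_all add: p.h'_def p.h_def fun_eq_iff)
    \<comment> \<open>The transformation rule is needed on the whole overlap and not only at
      \<open>x\<close>, because the bracket differentiates along the base.\<close>
    have t: "A (U', \<phi>', e') y = p.\<Phi> y (A (U, \<phi>, e) y)" if "A \<in> gf" "y \<in> p.W" for A y
    proof -
      have "chart_pair C U \<phi> e U' \<phi>' e' y"
        using p.d p.d' that(2) by (intro chart_pairI) (auto simp: gchart_at_def p.W_def)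
      from gf_tr[OF that(1) this] show ?thesis by (simp add: p.tr_eq)
    qed
    have f: "A (U, \<phi>, e) \<in> fam p.W" if "A \<in> gf" for A
      by (rule fam_subset[OF gf_fam[OF that p.d] p.W(2)])
    have "poisson C F G (U', \<phi>', e') x = pbr (U', \<phi>') p.h' (F (U', \<phi>', e')) (G (U', \<phi>', e')) x"
      using poisson_eq_pbr[OF g(2)] by (simp add: h)
    also have "\<dots> = pbr (U', \<phi>') p.h' (\<lambda>y. p.\<Phi> y (F (U, \<phi>, e) y)) (\<lambda>y. p.\<Phi> y (G (U, \<phi>, e) y)) x"
      by (rule pbr_cong[OF p.c' p.W(1,3) p.h'_sym p.xW t[OF F] t[OF G]])
    also have "\<dots> = p.\<Phi> x (poisson C F G (U, \<phi>, e) x)"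
      unfolding p.pbr_Phi[OF f[OF F] f[OF G]] poisson_eq_pbr[OF g(1)] h ..
    finally show ?thesis by (simp add: p.tr_eq)
  qed
  show ?thesis by (rule gfI[OF off 1 2 3])
qed

section \<open>Homogeneous pieces\<close>

lemma graded_piece_int: "F \<in> graded_piece C (int k) \<longleftrightarrow> F \<in> gf \<and> (\<forall>c x. gdeg k (F c x))"
  unfolding graded_piece_def gdeg_def by (simp only: of_nat_eq_iff mem_Collect_eq)

lemma graded_piece_neg: "k < 0 \<Longrightarrow> graded_piece C k = {0}"
proof -
  assume k: "k < 0"
  have "F = 0" if "F \<in> graded_piece C k" for F
  proof (intro ext)
    fix c x
    have "gcoeff (F c x) (S, m) = 0" for S m
    proof (rule ccontr)
      assume nz: "gcoeff (F c x) (S, m) \<noteq> 0"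
      have "\<forall>c x S m. gcoeff (F c x) (S, m) \<noteq> 0 \<longrightarrow> int (card S + 2 * size m) = k"
        using that unfolding graded_piece_def by blast
      from this[rule_format, OF nz] k show False by simp
    qed
    then show "F c x = 0 c x" by (intro gpoly_eqI) (simp add: gcoeff_simps)
  qed
  moreover have "0 \<in> graded_piece C k" using gf_0 by (simp add: graded_piece_def gcoeff_simps)
  ultimately show ?thesis by blast
qed

lemma graded_piece_cases:
  assumes "F \<in> graded_piece C k"
  shows "k < 0 \<and> F = 0 \<or> (\<exists>l. k = int l \<and> F \<in> gf \<and> (\<forall>c x. gdeg l (F c x)))"
proof (cases "k < 0")
  case True
  then show ?thesis using assms graded_piece_neg by blast
next
  case False
  then obtain l where k: "k = int l" using nonneg_int_cases[of k] by auto
  then show ?thesis using assms graded_piece_int[of F l] by blast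
qed

lemma subspace_graded_piece: "subspace (graded_piece C k)"
proof (rule subspaceI)
  show "0 \<in> graded_piece C k" using gf_0 by (simp add: graded_piece_def gcoeff_simps)
  show "F + G \<in> graded_piece C k" if "F \<in> graded_piece C k" "G \<in> graded_piece C k" for F G
    using that gf_add unfolding graded_piece_def by (auto simp: gcoeff_simps) (metis add.right_neutral)
  show "t *\<^sub>R F \<in> graded_piece C k" if "F \<in> graded_piece C k" for t F
    using that gf_scale unfolding graded_piece_def by (auto simp: gcoeff_simps)
qed

lemma graded_piece_mult:
  assumes F: "F \<in> graded_piece C k" and G: "G \<in> graded_piece C l"
  shows "F * G \<in> graded_piece C (k + l)"
proof (cases "F = 0 \<or> G = 0")
  case True
  then show ?thesis using subspace_0[OF subspace_graded_piece] by auto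
next
  case False
  obtain k' where k: "k = int k'" "F \<in> gf" "\<And>c x. gdeg k' (F c x)"
    using graded_piece_cases[OF F] False by blast
  obtain l' where l: "l = int l'" "G \<in> gf" "\<And>c x. gdeg l' (G c x)"
    using graded_piece_cases[OF G] False by blast
  have "F * G \<in> graded_piece C (int (k' + l'))"
    unfolding graded_piece_int using gf_mult[OF k(2) l(2)] gdeg_mult[OF k(3) l(3)] by simp
  then show ?thesis using k l by simp
qed

lemma gf_piece: "F \<in> graded_piece C k \<Longrightarrow> F \<in> gf"
  by (simp add: graded_piece_def)

lemma gpar_piece:
  assumes F: "F \<in> graded_piece C k"
  shows "gpar_fun F = (if even k then 1 else - 1) *\<^sub>R F"
proof (cases "F = 0")
  case True
  then show ?thesis by (simp add: gpar_fun_def fun_eq_iff)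
next
  case False
  then obtain l where l: "k = int l" "\<And>c x. gdeg l (F c x)" using graded_piece_cases[OF F] by blast
  have "gpar (F c x) = (if even k then 1 else - 1) *\<^sub>R F c x" for c x
    using gdeg_parity[OF l(2)[of c x]] l(1) by simp
  then show ?thesis by (intro ext) (simp add: gpar_fun_def)
qed

lemma poisson_off: "\<not> gchart_at C c x \<Longrightarrow> poisson C F G c x = 0"
  by (cases c) (simp add: poisson_def)

end

section \<open>Global identities for the bracket from its form in a chart\<close>

locale darboux_at = courant_algebroid C for C :: "('m::{t2_space,second_countable_topology}, 'v::real_vector) courant_data" +
  fixes U \<phi> e x
  assumes d: "darboux_chart C (U, \<phi>, e)" and x: "x \<in> U"
begin

text \<open>The inverse matrix frozen at \<open>x\<close>. It is the inverse matrix on all of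
  \<open>U\<close>, so nested brackets can be computed with it.\<close>

definition "g a b = inverse_pairing C e x a b"

lemmas c = darbouxD(1)[OF d] and opU = darbouxD(2)[OF d] and frx = darbouxD(3)[OF d x]

lemma at: "gchart_at C (U, \<phi>, e) x" using d x by (simp add: gchart_at_def)

lemma g_sym: "a < r \<Longrightarrow> b < r \<Longrightarrow> g a b = g b a"
  unfolding g_def by (rule inverse_pairing_sym[OF frx])

abbreviation "brk \<equiv> pbr (U, \<phi>) g"

lemma poisson_eq: "y \<in> U \<Longrightarrow> poisson C F G (U, \<phi>, e) y = brk (F (U, \<phi>, e)) (G (U, \<phi>, e)) y"
  using poisson_eq_pbr[of U \<phi> e y] d inverse_pairing_const[OF d _ x, of y]
  by (simp add: gchart_at_def pbr_def g_def)

lemma br_cong: "(\<And>y. y \<in> U \<Longrightarrow> F y = F' y) \<Longrightarrow> (\<And>y. y \<in> U \<Longrightarrow> K y = K' y) \<Longrightarrow> brk F K x = brk F' K' x"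
  by (rule pbr_cong[OF c opU subset_refl g_sym x])

lemma poisson_poisson: "poisson C F (poisson C G K) (U, \<phi>, e) x = brk (F (U, \<phi>, e)) (brk (G (U, \<phi>, e)) (K (U, \<phi>, e))) x"
  unfolding poisson_eq[OF x] by (rule br_cong[OF refl poisson_eq])

lemma poisson_poisson': "poisson C (poisson C G K) F (U, \<phi>, e) x = brk (brk (G (U, \<phi>, e)) (K (U, \<phi>, e))) (F (U, \<phi>, e)) x"
  unfolding poisson_eq[OF x] by (rule br_cong[OF poisson_eq refl])

end

context courant_algebroid
begin

lemma gfun_eqI:
  assumes "\<And>U \<phi> e x. darboux_at C U \<phi> e x \<Longrightarrow> F (U, \<phi>, e) x = G (U, \<phi>, e) x"
    and "\<And>c x. \<not> gchart_at C c x \<Longrightarrow> F c x = G c x"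
  shows "F = G"
proof (intro ext)
  fix c :: "('m, 'v) gchart" and x
  obtain U \<phi> e where c: "c = (U, \<phi>, e)" using prod_cases3 by blast
  show "F c x = G c x"
  proof (cases "gchart_at C c x")
    case True
    then have "darboux_at C U \<phi> e x"
      unfolding c by (intro darboux_at.intro courant_algebroid_axioms darboux_at_axioms.intro) (auto simp: gchart_at_def)
    then show ?thesis using assms(1) c by blast
  qed (rule assms(2))
qed

lemma poisson_add:
  assumes "F \<in> gf" "G \<in> gf" "K \<in> gf"
  shows "poisson C K (F + G) = poisson C K F + poisson C K G"
proof (rule gfun_eqI)
  fix U \<phi> e x assume "darboux_at C U \<phi> e x"
  then interpret p: darboux_at C U \<phi> e x .
  show "poisson C K (F + G) (U, \<phi>, e) x = (poisson C K F + poisson C K G) (U, \<phi>, e) x"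
    using pbr_add_right[OF p.c p.opU subset_refl p.g_sym p.x gf_fam[OF assms(1) p.d] gf_fam[OF assms(2) p.d]]
    by (simp add: p.poisson_eq[OF p.x] plus_fun_def)
qed (simp add: poisson_off)

lemma poisson_scale:
  assumes "F \<in> gf" "K \<in> gf"
  shows "poisson C K (t *\<^sub>R F) = t *\<^sub>R poisson C K F"
proof (rule gfun_eqI)
  fix U \<phi> e x assume "darboux_at C U \<phi> e x"
  then interpret p: darboux_at C U \<phi> e x .
  show "poisson C K (t *\<^sub>R F) (U, \<phi>, e) x = (t *\<^sub>R poisson C K F) (U, \<phi>, e) x"
    using pbr_scale_right[OF p.c p.opU subset_refl p.g_sym p.x gf_fam[OF assms(1) p.d]]
    by (simp add: p.poisson_eq[OF p.x] scaleR_fun_def)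
qed (simp add: poisson_off)

lemma poisson_leibniz:
  assumes "F \<in> gf" "G \<in> gf" "K \<in> gf" and odd: "\<And>c x. godd (K c x)"
  shows "poisson C K (F * G) = poisson C K F * G + gpar_fun F * poisson C K G"
proof (rule gfun_eqI)
  fix U \<phi> e x assume "darboux_at C U \<phi> e x"
  then interpret p: darboux_at C U \<phi> e x .
  show "poisson C K (F * G) (U, \<phi>, e) x = (poisson C K F * G + gpar_fun F * poisson C K G) (U, \<phi>, e) x"
    using pbr_leibniz[OF p.c p.opU subset_refl p.g_sym p.x gf_fam[OF assms(3) p.d] odd
        gf_fam[OF assms(1) p.d] gf_fam[OF assms(2) p.d]]
    by (simp add: p.poisson_eq[OF p.x] times_fun_def gpar_fun_def)
qed (simp add: poisson_off)

lemma poisson_jacobi_odd: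
  assumes "F \<in> gf" "G \<in> gf" "K \<in> gf" and odd: "\<And>c x. godd (F c x)" "\<And>c x. godd (G c x)"
  shows "poisson C F (poisson C G K) + poisson C G (poisson C F K) = poisson C (poisson C F G) K"
proof (rule gfun_eqI)
  fix U \<phi> e x assume "darboux_at C U \<phi> e x"
  then interpret p: darboux_at C U \<phi> e x .
  show "(poisson C F (poisson C G K) + poisson C G (poisson C F K)) (U, \<phi>, e) x = poisson C (poisson C F G) K (U, \<phi>, e) x"
    using pbr_jacobi_odd[OF p.c p.opU subset_refl p.g_sym gf_fam[OF assms(1) p.d] odd(1)
        gf_fam[OF assms(2) p.d] odd(2) gf_fam[OF assms(3) p.d] p.x]
    by (simp add: p.poisson_poisson p.poisson_poisson')
qed (simp add: poisson_off)

lemma poisson_0_left: "poisson C 0 K = 0"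
proof (rule gfun_eqI)
  fix U \<phi> e x assume "darboux_at C U \<phi> e x"
  then interpret p: darboux_at C U \<phi> e x .
  have "gchart_pd (U, \<phi>) i (0 (U, \<phi>, e)) x = 0" for i
    using gchart_pd_const[OF p.c p.opU subset_refl, of i 0 x] by (simp add: zero_fun_def)
  then show "poisson C 0 K (U, \<phi>, e) x = 0 (U, \<phi>, e) x"
    by (simp add: p.poisson_eq[OF p.x] pbr_def)
qed (simp add: poisson_off)

lemma poisson_1: "poisson C K (base_fun C (\<lambda>_. 1)) = 0"
proof (rule gfun_eqI)
  fix U \<phi> e x assume "darboux_at C U \<phi> e x"
  then interpret p: darboux_at C U \<phi> e x .
  have "p.brk (K (U, \<phi>, e)) (base_fun C (\<lambda>_. 1) (U, \<phi>, e)) x = p.brk (K (U, \<phi>, e)) (\<lambda>_. 1) x"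
    by (rule p.br_cong) (use p.d in \<open>simp_all add: base_fun_def gchart_at_def\<close>)
  then show "poisson C K (base_fun C (\<lambda>_. 1)) (U, \<phi>, e) x = 0 (U, \<phi>, e) x"
    using gchart_pd_const[OF p.c p.opU subset_refl, of _ 1 x] by (simp add: p.poisson_eq[OF p.x] pbr_def)
qed (simp add: poisson_off)

text \<open>Base derivatives keep the degree. Each term of the bracket removes one momentum of
  degree 2 or two odd coordinates of degree 1, so the degree is \<open>3 + k - 2\<close>.\<close>

lemma poisson_degree:
  assumes H: "H \<in> graded_piece C 3" and F: "F \<in> graded_piece C k"
  shows "poisson C H F \<in> graded_piece C (k + 1)"
proof (cases "F = 0")
  case True
  then have "poisson C H F = 0 *\<^sub>R poisson C H 0"
    using poisson_scale[OF gf_0 gf_piece[OF H], of 0] by simp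
  then show ?thesis using subspace_0[OF subspace_graded_piece] by simp
next
  case False
  then obtain l where nonneg: "k = int l" "F \<in> gf" "\<And>c x. gdeg l (F c x)"
    using graded_piece_cases[OF F] by blast
  have "H \<in> graded_piece C (int 3)" using H by simp
  then have H': "H \<in> gf" "\<And>c x. gdeg 3 (H c x)" unfolding graded_piece_int by blast+
  have e1: "1 + 2 = (3 :: nat)" by simp
  have "gdeg (l + 1) (poisson C H F c x)" for c x
  proof (cases "gchart_at C c x")
    case True
    obtain U \<phi> e where c: "c = (U, \<phi>, e)" using prod_cases3 by blast
    have d: "darboux_chart C (U, \<phi>, e)" and x: "x \<in> U" using True unfolding c gchart_at_def by auto
    have le: "gdeg K (gchart_pd (U, \<phi>) i (A (U, \<phi>, e)) x)" if A: "A \<in> gf" "\<And>c x. gdeg K (A c x)" "i < n" for A K i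
      unfolding gdeg_def
    proof (intro allI impI)
      fix S m assume "gcoeff (gchart_pd (U, \<phi>) i (A (U, \<phi>, e)) x) (S, m) \<noteq> 0"
      then obtain y where "gcoeff (A (U, \<phi>, e) y) (S, m) \<noteq> 0"
        by (rule gchart_pd_support[OF darbouxD(1,2)[OF d] subset_refl gf_fam[OF A(1) d] x A(3)])
      then show "card S + 2 * size m = K" using A(2) unfolding gdeg_def by blast
    qed
    let ?f = "F (U, \<phi>, e)" and ?h = "H (U, \<phi>, e)"
    have Hd: "gdeg 3 (?h x)" and Fd: "gdeg l (?f x)" using H' nonneg by auto
    have 1: "gdeg (l + 1) (d_p i (?h x) * gchart_pd (U, \<phi>) i ?f x)" if "i < n" for i
    proof -
      have "gdeg 1 (d_p i (?h x))" by (rule gdeg_d_p[of 1, unfolded e1, OF Hd])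
      from gdeg_mult[OF this le[OF nonneg(2,3) that]] show ?thesis by simp
    qed
    have 2: "gdeg (l + 1) (gchart_pd (U, \<phi>) i ?h x * d_p i (?f x))" if "i < n" for i
    \<comment> \<open>Degrees are natural numbers here. Where \<open>l - 2\<close> would be
      truncated the derivative of \<open>F\<close> is 0, which has every degree.\<close>
    proof (cases "l < 2")
      case True
      then show ?thesis using gdeg_small(1)[OF Fd] by simp
    next
      case False
      then have e2: "l - 2 + 2 = l" "3 + (l - 2) = l + 1" by simp_all
      have "gdeg (l - 2) (d_p i (?f x))" by (rule gdeg_d_p[of "l - 2", unfolded e2, OF Fd])
      from gdeg_mult[OF le[OF H' that] this] show ?thesis unfolding e2 .
    qed
    have 3: "gdeg (l + 1) (gpar (d_xi a (?h x)) * d_xi b (?f x))" for a b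
    proof (cases "l = 0")
      case True
      then show ?thesis using gdeg_small(2) Fd by simp
    next
      case False
      then have 1: "gdeg (l - 1) (d_xi b (?f x))" by (intro gdeg_d_xi) (use Fd in simp)
      have 2: "gdeg 2 (d_xi a (?h x))" by (rule gdeg_d_xi) (use Hd in simp)
      then have "gdeg 2 (gpar (d_xi a (?h x)))" using gdeg_parity[OF 2] by simp
      from gdeg_mult[OF this 1] show ?thesis using False by simp
    qed
    have diff: "gdeg k (u - v)" if "gdeg k u" "gdeg k v" for k u v
      using gdeg_add[OF that(1) gdeg_scaleR[OF that(2), of "-1"]] by simp
    have "gdeg (l + 1) (pbr (U, \<phi>) (inverse_pairing C e x) ?h ?f x)"
      unfolding pbr_def by (intro gdeg_add gdeg_sum diff gdeg_scaleR 1 2 3) auto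
    then show ?thesis using poisson_eq_pbr True unfolding c by simp
  qed (simp add: poisson_off)
  then have "poisson C H F \<in> graded_piece C (int (l + 1))"
    unfolding graded_piece_int using gf_poisson[OF H'(1) nonneg(2)] by blast
  then show ?thesis using nonneg(1) by (simp add: add.commute)
qed

end

section \<open>The naive ideal\<close>

text \<open>The anchor condition on the Hamiltonian speaks of global sections. The vector at
  \<open>x\<close> is extended with constant coefficients in the frame and cut off by a bump
  function.\<close>

lemma (in darboux_at) dual_section:
  assumes a: "a < r"
  obtains \<psi> where "\<psi> \<in> sections C" "\<psi> x = dual_vec e x a"
proof -
  obtain b K where b: "sm UNIV b" "b x = 1" "closed K" "K \<subseteq> U" "\<And>y. y \<notin> K \<Longrightarrow> b y = 0"
    using bump_function[OF c x] by metis
  define \<psi> where "\<psi> y = (if y \<in> U then \<Sum>k<r. (b y * g a k) *\<^sub>R e k y else 0)" for y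
  have \<psi>E: "\<psi> y \<in> fibre C y" for y
    using frame_mem[OF darbouxD(3)[OF d]]
    by (auto simp: \<psi>_def intro!: subspace_sum[OF fibre_subspace] subspace_scale[OF fibre_subspace] subspace_0[OF fibre_subspace])
  have "smooth_section n (atlas C) r (fibre C) (trivs C) UNIV \<psi>"
    unfolding smooth_section_def
  proof (intro conjI ballI \<psi>E)
    fix t assume t: "t \<in> trivs C"
    obtain U0 e0 where t0: "t = (U0, e0)" by force
    have vb: "open U0" "\<And>y. y \<in> U0 \<Longrightarrow> frame_at r (fibre C) e0 y"
      using vector_bundle t t0 unfolding smooth_vector_bundle_def by blast+
    have "sm U0 (\<lambda>y. frame_coord r e0 y (\<psi> y) k)" if k: "k < r" for k
    proof (rule sm_local[OF vb(1)])
      fix y assume y: "y \<in> U0"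
      show "\<exists>W'. open W' \<and> y \<in> W' \<and> sm W' (\<lambda>y. frame_coord r e0 y (\<psi> y) k)"
      proof (cases "y \<in> U")
        case True
        have op: "open (U0 \<inter> U)" using vb(1) opU by (rule open_Int)
        have ek: "sm (U0 \<inter> U) (\<lambda>y. frame_coord r e0 y (e l y) k)" if "l < r" for l
          using darbouxD(5)[OF d that] t t0 k unfolding smooth_section_def by blast
        have "sm (U0 \<inter> U) b" using b(1) by (rule sm_subset) simp
        then have "sm (U0 \<inter> U) (\<lambda>y. \<Sum>l<r. (b y * g a l) * frame_coord r e0 y (e l y) k)"
          by (intro sm_sum sm_mult op sm_const[OF op] ek) auto
        then have "sm (U0 \<inter> U) (\<lambda>y. frame_coord r e0 y (\<psi> y) k)"
        proof (rule sm_cong[OF op])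
          fix z assume z: "z \<in> U0 \<inter> U"
          then have "frame_coord r e0 z (\<Sum>l<r. (b z * g a l) *\<^sub>R e l z) k = (\<Sum>l<r. (b z * g a l) * frame_coord r e0 z (e l z) k)"
            by (intro frame_coord_sum vb(2) frame_mem[OF darbouxD(3)[OF d]]) auto
          then show "frame_coord r e0 z (\<psi> z) k = (\<Sum>l<r. (b z * g a l) * frame_coord r e0 z (e l z) k)"
            using z by (simp add: \<psi>_def)
        qed
        then show ?thesis using op y True by blast
      next
        case False
        \<comment> \<open>Around a point outside \<open>U\<close> the complement of the closed set
          \<open>K\<close> serves as neighbourhood; there \<psi> vanishes.\<close>
        have op: "open (U0 \<inter> - K)" using vb(1) b(3) by (simp add: open_Int open_Compl)
        have "sm (U0 \<inter> - K) (\<lambda>y. frame_coord r e0 y (\<psi> y) k)"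
        proof (rule sm_cong[OF op sm_const[OF op, of 0]])
          fix z assume z: "z \<in> U0 \<inter> - K"
          then have "\<psi> z = 0" using b(5)[of z] by (simp add: \<psi>_def)
          then show "frame_coord r e0 z (\<psi> z) k = 0"
            using frame_coord_linear[OF vb(2), of z 0 0 0 0 k] z subspace_0[OF fibre_subspace] by simp
        qed
        then show ?thesis using op y False b(4) by blast
      qed
    qed
    then show "case t of (U0, e0) \<Rightarrow> \<forall>k<r. sm (U0 \<inter> UNIV) (\<lambda>y. frame_coord r e0 y (\<psi> y) k)"
      by (simp add: t0)
  qed
  then have "\<psi> \<in> sections C" by (simp add: sections_def)
  moreover have "\<psi> x = dual_vec e x a"
  proof -
    have "dual_vec e x a = (\<Sum>k<r. frame_coord r e x (dual_vec e x a) k *\<^sub>R e k x)"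
      by (rule frame_expansion[OF frx dual_vec(1)[OF frx a]])
    also have "\<dots> = (\<Sum>k<r. g a k *\<^sub>R e k x)"
      by (rule sum.cong[OF refl]) (simp only: g_def inverse_pairing_eq)
    finally show ?thesis using x b(2) by (simp add: \<psi>_def)
  qed
  ultimately show ?thesis using that by blast
qed

locale courant_with_hamiltonian = courant_algebroid C
  for C :: "('m::{t2_space,second_countable_topology}, 'v::real_vector) courant_data" +
  fixes H :: "('m, 'v) gfun"
  assumes hamiltonian: "courant_hamiltonian C H"
begin

abbreviation "Q \<equiv> poisson C H"

lemma H3: "H \<in> graded_piece C 3" and H_H: "poisson C H H = 0"
  and H_anchor: "\<psi> \<in> sections C \<Longrightarrow> f \<in> smooth_functions C \<Longrightarrow>
    base_fun C (anchor_act C \<psi> f) = poisson C (poisson C (section_fun C \<psi>) H) (base_fun C f)"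
  using hamiltonian unfolding courant_hamiltonian_def zero_fun_def by blast+

lemma H_gf: "H \<in> gf" by (rule gf_piece[OF H3])

lemma H_deg: "gdeg 3 (H c x)"
proof -
  have "H \<in> graded_piece C (int 3)" using H3 by simp
  then show ?thesis unfolding graded_piece_int by blast
qed

lemma H_odd: "godd (H c x)"
  by (rule godd_gdeg[OF H_deg]) simp

lemma Q_gf: "F \<in> gf \<Longrightarrow> Q F \<in> gf"
  by (rule gf_poisson[OF H_gf])

lemma Q_degree: "F \<in> graded_piece C k \<Longrightarrow> Q F \<in> graded_piece C (k + 1)"
  by (rule poisson_degree[OF H3])

text \<open>The Jacobi identity with both odd entries equal to \<open>H\<close> reads
  \<open>2 Q (Q F) = {{H, H}, F}\<close>.\<close>

lemma Q_Q: "F \<in> gf \<Longrightarrow> Q (Q F) = 0"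
  using poisson_jacobi_odd[OF H_gf H_gf _ H_odd H_odd, of F]
  by (simp add: H_H poisson_0_left flip: scaleR_2)

lemma base_fun_piece: "f \<in> smooth_functions C \<Longrightarrow> base_fun C f \<in> graded_piece C 0"
proof -
  assume "f \<in> smooth_functions C"
  moreover have "gdeg 0 (base_fun C f c x)" for c x
    by (auto simp: base_fun_def of_real_def intro!: gdeg_scaleR)
  ultimately have "base_fun C f \<in> graded_piece C (int 0)"
    unfolding graded_piece_int using gf_base_fun by blast
  then show ?thesis by simp
qed

lemma Qf_deg: "f \<in> smooth_functions C \<Longrightarrow> gdeg 1 (Q (base_fun C f) c x)"
proof -
  assume "f \<in> smooth_functions C"
  from Q_degree[OF base_fun_piece[OF this]] have "Q (base_fun C f) \<in> graded_piece C (int 1)" by simp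
  then show ?thesis unfolding graded_piece_int by blast
qed

lemma Qf_odd: "f \<in> smooth_functions C \<Longrightarrow> godd (Q (base_fun C f) c x)"
  by (rule godd_gdeg[OF Qf_deg]) simp_all

end

locale darboux_ham = darboux_at C U \<phi> e x + courant_with_hamiltonian C H
  for C :: "('m::{t2_space,second_countable_topology}, 'v::real_vector) courant_data" and U \<phi> e x H
begin

abbreviation "c0 \<equiv> (U, \<phi>, e)"

lemma famH: "H c0 \<in> fam U" by (rule gf_fam[OF H_gf d])

lemmas at_rules = c opU subset_refl

text \<open>Without momenta the terms with base derivatives disappear, so the bracket at
  \<open>x\<close> depends on the values of \<open>A\<close> and \<open>F\<close> at
  \<open>x\<close> alone.\<close>

lemma brk_pfree:
  assumes A: "\<And>i. i < n \<Longrightarrow> d_p i (A x) = 0" "\<And>a. gpar (d_xi a (A x)) = d_xi a (A x)"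
    and F: "\<And>i. i < n \<Longrightarrow> d_p i (F x) = 0"
  shows "brk A F x = (\<Sum>a<r. \<Sum>b<r. g a b *\<^sub>R (d_xi a (A x) * d_xi b (F x)))"
  using A F by (simp add: pbr_def)

lemma deg1_rules:
  assumes "gdeg 1 A"
  shows "d_p i A = 0" "gpar (d_xi a A) = d_xi a A"
proof -
  show "d_p i A = 0" by (rule gdeg_small(1)[OF assms]) simp
  have "gdeg 0 (d_xi a A)" by (rule gdeg_d_xi) (use assms in simp)
  then show "gpar (d_xi a A) = d_xi a A" by (rule gpar_gdeg_0)
qed

text \<open>\<open>{\<psi>, f}\<close> vanishes by degree, so the Jacobi identity rewrites
  \<open>{{\<psi>, H}, f}\<close> as \<open>{\<psi>, {H, f}}\<close>. If \<psi> is at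
  \<open>x\<close> the dual vector with index \<open>a\<close>, then on functions of degree 1 the
  bracket with \<psi> is \<open>\<Sum>\<^sub>b g\<^sup>a\<^sup>b
  \<partial>/\<partial>\<xi>\<^sup>b\<close> there.\<close>

lemma anchor_eq:
  assumes f: "f \<in> smooth_functions C" and a: "a < r"
  shows "anchor C x (dual_vec e x a) f *\<^sub>R 1 = (\<Sum>b<r. g a b *\<^sub>R d_xi b (Q (base_fun C f) c0 x))"
proof -
  obtain \<psi> where \<psi>: "\<psi> \<in> sections C" "\<psi> x = dual_vec e x a" using dual_section[OF a] .
  let ?f = "base_fun C f c0" and ?s = "section_fun C \<psi> c0"
  have s: "?s y = (\<Sum>k<r. pairing C y (\<psi> y) (e k y) *\<^sub>R g_xi k)" if "y \<in> U" for y
    using d that by (simp add: section_fun_def gchart_at_def)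
  have ss: "smooth_section n (atlas C) r (fibre C) (trivs C) U \<psi>"
    by (rule smooth_section_subset[of UNIV]) (use \<psi>(1) in \<open>simp_all add: sections_def\<close>)
  have fs: "?s \<in> fam U"
  proof (rule fam_cong[OF opU _ s])
    show "(\<lambda>y. \<Sum>k<r. pairing C y (\<psi> y) (e k y) *\<^sub>R g_xi k) \<in> fam U"
      by (intro fam_sum fam_scaleR fam_const gvars_intros opU sm_pairing ss darbouxD(5)[OF d]) auto
  qed
  have os: "godd (?s y)" if "y \<in> U" for y
    unfolding s[OF that] by (intro godd_sum godd_intros)
  have ff: "?f \<in> fam U" by (rule gf_fam[OF gf_base_fun[OF f] d])
  have sd: "gdeg 1 (?s y)" if "y \<in> U" for y
    unfolding s[OF that] by (intro gdeg_sum gdeg_scaleR gdeg_simps(3))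
  have fd: "gdeg 0 (?f y)" for y
    by (auto simp: base_fun_def of_real_def intro!: gdeg_scaleR)
  have sf: "brk ?s ?f y = 0" if "y \<in> U" for y
    using deg1_rules(1)[OF sd[OF that]] gdeg_small(1)[OF fd] gdeg_small(2)[OF fd] by (simp add: pbr_def)
  have Hsf: "brk (H c0) (brk ?s ?f) x = 0"
  proof -
    have "brk (H c0) (brk ?s ?f) x = brk (H c0) (\<lambda>y. 0) x" by (rule br_cong[OF refl sf])
    then show ?thesis using gchart_pd_const[OF at_rules, of _ 0 x] by (simp add: pbr_def)
  qed
  have "anchor C x (dual_vec e x a) f *\<^sub>R 1 = base_fun C (anchor_act C \<psi> f) c0 x"
    using at \<psi>(2) by (simp add: base_fun_def anchor_act_def of_real_def)
  also have "\<dots> = brk (brk ?s (H c0)) ?f x"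
    unfolding H_anchor[OF \<psi>(1) f] by (rule poisson_poisson')
  also have "\<dots> = brk ?s (brk (H c0) ?f) x"
    using pbr_jacobi_odd[where g = g, OF at_rules g_sym fs os famH H_odd ff x] Hsf by simp
  also have "\<dots> = brk ?s (Q (base_fun C f) c0) x"
    by (rule br_cong[OF refl]) (simp add: poisson_eq)
  also have "\<dots> = (\<Sum>k<r. \<Sum>b<r. g k b *\<^sub>R (d_xi k (?s x) * d_xi b (Q (base_fun C f) c0 x)))"
    by (rule brk_pfree) (use deg1_rules[OF sd[OF x]] deg1_rules[OF Qf_deg[OF f]] in auto)
  also have "\<dots> = (\<Sum>k<r. if a = k then (\<Sum>b<r. g a b *\<^sub>R d_xi b (Q (base_fun C f) c0 x)) else 0)"
  proof (rule sum.cong[OF refl])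
    fix k assume "k \<in> {..<r}"
    then have k: "k < r" by simp
    have "d_xi k (?s x) = (\<Sum>l<r. if k = l then pairing C x (\<psi> x) (e l x) *\<^sub>R 1 else 0)"
      unfolding s[OF x] d_xi_sum by (rule sum.cong) (auto simp: d_xi_xi)
    also have "\<dots> = frame_coord r e x (e k x) a *\<^sub>R 1"
      using k dual_vec(2)[OF frx a frame_mem[OF frx k]] \<psi>(2) by simp
    finally have "d_xi k (?s x) = (if a = k then 1 else 0)"
      using frame_coord_basis[OF frx a k] by auto
    then show "(\<Sum>b<r. g k b *\<^sub>R (d_xi k (?s x) * d_xi b (Q (base_fun C f) c0 x))) =
        (if a = k then (\<Sum>b<r. g a b *\<^sub>R d_xi b (Q (base_fun C f) c0 x)) else 0)" by auto
  qed
  finally show ?thesis using a by simp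
qed

lemma anchor_derivation_eq:
  assumes f: "f \<in> smooth_functions C" and F: "\<And>i. i < n \<Longrightarrow> d_p i (F c0 x) = 0"
  shows "anchor_derivation C c0 x f (F c0 x) = poisson C (Q (base_fun C f)) F c0 x"
proof -
  let ?q = "Q (base_fun C f) c0"
  have "anchor_derivation C c0 x f (F c0 x) = (\<Sum>a<r. (anchor C x (dual_vec e x a) f *\<^sub>R 1) * d_xi a (F c0 x))"
    by (simp add: anchor_derivation_def dual_vec_def)
  also have "\<dots> = (\<Sum>a<r. \<Sum>b<r. g a b *\<^sub>R (d_xi b (?q x) * d_xi a (F c0 x)))"
    by (rule sum.cong[OF refl]) (simp add: anchor_eq[OF f] sum_distrib_right)
  also have "\<dots> = (\<Sum>b<r. \<Sum>a<r. g a b *\<^sub>R (d_xi b (?q x) * d_xi a (F c0 x)))" by (rule sum.swap)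
  also have "\<dots> = (\<Sum>b<r. \<Sum>a<r. g b a *\<^sub>R (d_xi b (?q x) * d_xi a (F c0 x)))"
    by (intro sum.cong refl) (simp add: g_sym)
  also have "\<dots> = brk ?q (F c0) x"
    by (rule brk_pfree[symmetric]) (use deg1_rules[OF Qf_deg[OF f]] F in auto)
  finally show ?thesis by (simp add: poisson_eq[OF x])
qed

text \<open>The function \<open>f\<close> below has differential \<open>dx\<^sup>j\<close> at \<open>x\<close>, so that \<open>{H, f}\<close> is
  \<open>\<partial>H/\<partial>p\<^sub>j\<close> there.\<close>

lemma d_p_H:
  assumes j: "j < n"
  obtains f where "f \<in> smooth_functions C" "Q (base_fun C f) c0 x = d_p j (H c0 x)"
proof -
  obtain b K where b: "sm UNIV b" "b x = 1" "closed K" "K \<subseteq> U" "\<And>y. y \<notin> K \<Longrightarrow> b y = 0"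
    using bump_function[OF c x] by metis
  \<comment> \<open>Because the second factor vanishes at \<open>x\<close>, the product rule leaves
    \<open>b x = 1\<close> times the derivative of the coordinate.\<close>
  define f where "f y = b y * (\<phi> y j - \<phi> x j)" for y
  have bU: "sm U b" using b(1) by (rule sm_subset) simp
  have s1: "sm U (\<lambda>y. \<phi> y j - \<phi> x j)"
    by (intro sm_diff opU sm_coord[OF c] sm_const[OF opU])
  have "sm UNIV f"
  proof (rule sm_local[OF open_UNIV])
    fix y
    show "\<exists>W'. open W' \<and> y \<in> W' \<and> sm W' f"
    proof (cases "y \<in> U")
      case True
      have "sm U f" unfolding f_def[abs_def] by (intro sm_mult opU bU s1)
      then show ?thesis using True opU by blast
    next
      case False
      have op: "open (- K)" using b(3) by (simp add: open_Compl)
      have "sm (- K) f"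
        by (rule sm_cong[OF op sm_const[OF op, of 0]]) (simp add: f_def b(5))
      then show ?thesis using False op b(4) by blast
    qed
  qed
  then have f: "f \<in> smooth_functions C" by simp
  have pd: "chart_pd (U, \<phi>) i f x = (if i = j then 1 else 0)" if i: "i < n" for i
  proof -
    have "chart_pd (U, \<phi>) i (\<lambda>y. \<phi> y j - \<phi> x j) x = chart_pd (U, \<phi>) i (\<lambda>y. \<phi> y j + - \<phi> x j) x" by simp
    also have "\<dots> = (if i = j then 1 else 0)"
      by (subst chart_pd_add[OF at_rules sm_coord[OF c] sm_const[OF opU] x i])
         (simp add: chart_pd_coord[OF c x i] chart_pd_const)
    finally show ?thesis
      unfolding f_def[abs_def] using chart_pd_mult[OF at_rules bU s1 x i] b(2) by simp
  qed
  have 0: "d_p i (base_fun C f c0 y) = 0" "d_xi a (base_fun C f c0 y) = 0" for i a y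
    by (auto simp: base_fun_def of_real_def)
  have 1: "gchart_pd (U, \<phi>) i (base_fun C f c0) x = (if i = j then 1 else 0)" if i: "i < n" for i
  proof -
    have "gchart_pd (U, \<phi>) i (base_fun C f c0) x = gchart_pd (U, \<phi>) i (\<lambda>y. f y *\<^sub>R 1) x"
      by (rule gchart_pd_cong[OF at_rules x i]) (use d in \<open>simp add: base_fun_def gchart_at_def of_real_def\<close>)
    also have "\<dots> = chart_pd (U, \<phi>) i f x *\<^sub>R 1 + f x *\<^sub>R gchart_pd (U, \<phi>) i (\<lambda>y. 1) x"
      by (rule gchart_pd_scaleR[OF at_rules x i]) (use \<open>sm UNIV f\<close> in \<open>auto intro: sm_subset fam_const opU gvars_intros\<close>)
    finally show ?thesis using pd[OF i] gchart_pd_const[OF at_rules, of i 1 x] by simp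
  qed
  have "Q (base_fun C f) c0 x = (\<Sum>i<n. d_p i (H c0 x) * (if i = j then 1 else 0))"
    unfolding poisson_eq[OF x] pbr_def 0 by (simp add: 1)
  also have "\<dots> = (\<Sum>i<n. if i = j then d_p i (H c0 x) else 0)"
    by (rule sum.cong) auto
  finally show ?thesis using that[OF f] j by simp
qed

end

section \<open>The differential preserves the kernel sections\<close>

context courant_with_hamiltonian
begin

lemma darboux_hamI: "gchart_at C (U, \<phi>, e) x \<Longrightarrow> darboux_ham C U \<phi> e x H"
  by (intro darboux_ham.intro courant_with_hamiltonian_axioms darboux_at.intro
      courant_algebroid_axioms darboux_at_axioms.intro) (auto simp: gchart_at_def)

text \<open>The two pointwise conditions, absence of momenta and annihilation by the anchor, become
  equations for derivatives and brackets, to which the Jacobi identity can be applied.\<close>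

lemma kernel_sections_iff:
  "F \<in> kernel_sections C k \<longleftrightarrow> F \<in> graded_piece C (int k) \<and>
    (\<forall>c x. gchart_at C c x \<longrightarrow> (\<forall>i<n. d_p i (F c x) = 0)) \<and>
    (\<forall>f\<in>smooth_functions C. poisson C (Q (base_fun C f)) F = 0)"
  (is "_ \<longleftrightarrow> _ \<and> ?p \<and> ?k")
proof (cases "F \<in> graded_piece C (int k)")
  case True
  then have gF: "F \<in> gf" by (rule gf_piece)
  have p: "?p \<longleftrightarrow> (\<forall>c x S m. gcoeff (F c x) (S, m) \<noteq> 0 \<longrightarrow> m = {#})"
  proof -
    have "(\<forall>i<n. d_p i (F c x) = 0) \<longleftrightarrow> (\<forall>S m. gcoeff (F c x) (S, m) \<noteq> 0 \<longrightarrow> m = {#})"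
      if "gchart_at C c x" for c x
    proof -
      obtain U \<phi> e where c: "c = (U, \<phi>, e)" using prod_cases3 by blast
      have "gvars {..<r} {..<n} (F c x)"
        using fam_gvars[OF gf_fam[OF gF]] that unfolding c gchart_at_def by simp
      then show ?thesis by (rule pfree_iff)
    qed
    moreover have "\<forall>S m. gcoeff (F c x) (S, m) \<noteq> 0 \<longrightarrow> m = {#}" if "\<not> gchart_at C c x" for c x
      using gf_off[OF gF that] by (simp add: gcoeff_simps)
    ultimately show ?thesis
      by (intro iffI allI impI) (metis, metis)
  qed
  have k: "?k \<longleftrightarrow> (\<forall>c x. gchart_at C c x \<longrightarrow> (\<forall>f\<in>smooth_functions C. anchor_derivation C c x f (F c x) = 0))"
    if ?p
  proof -
    have *: "anchor_derivation C c x f (F c x) = poisson C (Q (base_fun C f)) F c x"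
      if at: "gchart_at C c x" and f: "f \<in> smooth_functions C" for c x f
    proof -
      obtain U \<phi> e where c_eq: "c = (U, \<phi>, e)" using prod_cases3 by blast
      interpret darboux_ham C U \<phi> e x H by (rule darboux_hamI) (use at c_eq in simp)
      have "d_p i (F (U, \<phi>, e) x) = 0" if "i < n" for i
        using \<open>?p\<close>[rule_format, OF at that] unfolding c_eq .
      then show ?thesis unfolding c_eq by (rule anchor_derivation_eq[OF f])
    qed
    show ?thesis
    proof
      assume ?k
      then show "\<forall>c x. gchart_at C c x \<longrightarrow> (\<forall>f\<in>smooth_functions C. anchor_derivation C c x f (F c x) = 0)"
        using * by (metis zero_fun_apply)
    next
      assume r: "\<forall>c x. gchart_at C c x \<longrightarrow> (\<forall>f\<in>smooth_functions C. anchor_derivation C c x f (F c x) = 0)"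
      show ?k
      proof (intro ballI ext)
        fix f c x assume f: "f \<in> smooth_functions C"
        show "poisson C (Q (base_fun C f)) F c x = 0 c x"
          using r[rule_format, of c x f] *[of c x f] f poisson_off[of c x] by (cases "gchart_at C c x") simp_all
      qed
    qed
  qed
  show ?thesis
    unfolding kernel_sections_def exterior_sections_def mem_Collect_eq p[symmetric] using True k by blast
next
  case False
  then show ?thesis by (simp add: kernel_sections_def exterior_sections_def)
qed

lemma Q_kernel:
  assumes F: "F \<in> kernel_sections C k"
  shows "Q F \<in> kernel_sections C (Suc k)"
proof -
  have Fk: "F \<in> graded_piece C (int k)"
    and p: "\<And>c x i. gchart_at C c x \<Longrightarrow> i < n \<Longrightarrow> d_p i (F c x) = 0"
    and z: "\<And>f. f \<in> smooth_functions C \<Longrightarrow> poisson C (Q (base_fun C f)) F = 0"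
    using F unfolding kernel_sections_iff by blast+
  have gF: "F \<in> gf" by (rule gf_piece[OF Fk])
  have "Q F \<in> graded_piece C (int (Suc k))" using Q_degree[OF Fk] by (simp add: add.commute)
  moreover have "d_p j (Q F c x) = 0" if at: "gchart_at C c x" and j: "j < n" for c x j
  proof -
    obtain U \<phi> e where c: "c = (U, \<phi>, e)" using prod_cases3 by blast
    interpret q: darboux_ham C U \<phi> e x H by (rule darboux_hamI) (use at c in simp)
    have pU: "d_p i (F (U, \<phi>, e) y) = 0" if "y \<in> U" "i < n" for i y
      by (rule p) (use q.d that in \<open>simp_all add: gchart_at_def\<close>)
    obtain f where f: "f \<in> smooth_functions C" "Q (base_fun C f) (U, \<phi>, e) x = d_p j (H (U, \<phi>, e) x)"
      using q.d_p_H[OF j] .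
    let ?D = "\<lambda>y. d_p j (H (U, \<phi>, e) y)"
    have D1: "gdeg 1 (?D y)" for y
    proof -
      have "1 + 2 = (3 :: nat)" by simp
      then show ?thesis by (metis gdeg_d_p H_deg)
    qed
    have "d_p j (Q F c x) = q.brk ?D (F (U, \<phi>, e)) x + q.brk (H (U, \<phi>, e)) (\<lambda>y. d_p j (F (U, \<phi>, e) y)) x"
      unfolding c q.poisson_eq[OF q.x] by (rule d_p_pbr[OF q.at_rules q.g_sym q.x q.famH gf_fam[OF gF q.d]])
    also have "q.brk (H (U, \<phi>, e)) (\<lambda>y. d_p j (F (U, \<phi>, e) y)) x = q.brk (H (U, \<phi>, e)) (\<lambda>y. 0) x"
      by (rule q.br_cong[OF refl]) (rule pU[OF _ j])
    also have "\<dots> = 0" using gchart_pd_const[OF q.at_rules, of _ 0 x] by (simp add: pbr_def)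
    \<comment> \<open>\<open>?D\<close> and \<open>Q (base_fun C f)\<close> agree at the point
      \<open>x\<close> only. This suffices, because by \<open>brk_pfree\<close> the bracket with
      \<open>F\<close> sees only the values there.\<close>
    also have "q.brk ?D (F (U, \<phi>, e)) x = q.brk (Q (base_fun C f) (U, \<phi>, e)) (F (U, \<phi>, e)) x"
    proof -
      have "q.brk ?D (F (U, \<phi>, e)) x = (\<Sum>a<r. \<Sum>b<r. q.g a b *\<^sub>R (d_xi a (?D x) * d_xi b (F (U, \<phi>, e) x)))"
        by (rule q.brk_pfree) (use q.deg1_rules[OF D1] pU[OF q.x] in auto)
      also have "\<dots> = q.brk (Q (base_fun C f) (U, \<phi>, e)) (F (U, \<phi>, e)) x"
        unfolding f(2)[symmetric]
        by (rule q.brk_pfree[symmetric]) (use q.deg1_rules[OF Qf_deg[OF f(1)]] pU[OF q.x] in auto)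
      finally show ?thesis .
    qed
    also have "\<dots> = 0" unfolding q.poisson_eq[OF q.x, symmetric] z[OF f(1)] by simp
    finally show ?thesis by simp
  qed
  moreover have "poisson C (Q (base_fun C f)) (Q F) = 0" if f: "f \<in> smooth_functions C" for f
  proof -
    let ?G = "Q (base_fun C f)"
    have G: "?G \<in> gf" by (rule Q_gf[OF gf_base_fun[OF f]])
    have "Q (poisson C ?G F) + poisson C ?G (Q F) = poisson C (Q ?G) F"
      by (rule poisson_jacobi_odd[OF H_gf G gF H_odd Qf_odd[OF f]])
    moreover have "Q 0 = 0" using poisson_scale[OF gf_0 H_gf, of 0] by simp
    ultimately show ?thesis by (simp add: z[OF f] Q_Q[OF gf_base_fun[OF f]] poisson_0_left)
  qed
  ultimately show ?thesis unfolding kernel_sections_iff by blast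
qed

lemma kernel_0: "0 \<in> kernel_sections C k"
  unfolding kernel_sections_iff
  using subspace_0[OF subspace_graded_piece[of "int k"]] poisson_scale[OF gf_0 Q_gf[OF gf_base_fun], of _ 0] by simp

lemma kernel_gf: "K \<in> kernel_sections C k \<Longrightarrow> K \<in> gf" "K \<in> kernel_sections C k \<Longrightarrow> gdeg k (K c x)"
  unfolding kernel_sections_iff graded_piece_int by blast+

text \<open>Kernel sections are homogeneous, hence even or odd. Moving them to the front is what
  makes the naive ideal stable under multiplication from the left.\<close>

lemma kernel_commute:
  assumes K: "K \<in> kernel_sections C k"
  shows "A * K = K * (if even k then A else gpar_fun A)"
proof (intro ext)
  fix c x
  show "(A * K) c x = (K * (if even k then A else gpar_fun A)) c x"
    using geven_mult_commute[OF geven_gdeg[OF kernel_gf(2)[OF K]], of "A c x" c x]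
      godd_mult_commute[OF godd_gdeg[OF kernel_gf(2)[OF K]], of "A c x" c x]
    by (simp add: gpar_fun_def)
qed

lemma kernel_gpar: "K \<in> kernel_sections C k \<Longrightarrow> gpar_fun K = (-1) ^ k *\<^sub>R K"
  using gdeg_parity[OF kernel_gf(2)] by (simp add: gpar_fun_def fun_eq_iff)

section \<open>Differential ideals and the powers of the naive ideal\<close>

abbreviation "A \<equiv> function_algebra C"
abbreviation "I \<equiv> naive_ideal C"
abbreviation "Ip \<equiv> naive_ideal_power C"

lemma mult_A: "F \<otimes>\<^bsub>A\<^esub> G = F * G" and add_A: "F \<oplus>\<^bsub>A\<^esub> G = F + G"
  by (simp_all add: function_algebra_def fun_eq_iff)

lemma ideal_prod_cases [consumes 1, case_names prod sum]:
  assumes "x \<in> ideal_prod A S T" "\<And>i j. i \<in> S \<Longrightarrow> j \<in> T \<Longrightarrow> P (i * j)"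
    "\<And>s t. s \<in> ideal_prod A S T \<Longrightarrow> t \<in> ideal_prod A S T \<Longrightarrow> P s \<Longrightarrow> P t \<Longrightarrow> P (s + t)"
  shows "P x"
  using assms(1)
proof (induction rule: ideal_prod.induct)
  case (prod i j)
  then show ?case unfolding mult_A by (rule assms(2))
next
  case (sum s t)
  then show ?case unfolding add_A by (intro assms(3))
qed

lemma ideal_prodI: "i \<in> S \<Longrightarrow> j \<in> T \<Longrightarrow> i * j \<in> ideal_prod A S T"
  and ideal_prod_add: "s \<in> ideal_prod A S T \<Longrightarrow> t \<in> ideal_prod A S T \<Longrightarrow> s + t \<in> ideal_prod A S T"
  using ideal_prod.prod[of i S j T A] ideal_prod.sum[of s A S T t] by (simp_all add: mult_A add_A)

text \<open>Stability under \<open>gpar_fun\<close> is included because the Leibniz rule for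
  \<open>Q\<close> involves it, and multiplication from both sides because the algebra is only
  graded commutative.\<close>

definition dg_ideal :: "('m, 'v) gfun set \<Rightarrow> bool" where
  "dg_ideal J \<longleftrightarrow> J \<subseteq> gf \<and> subspace J \<and> (\<forall>F\<in>J. Q F \<in> J \<and> gpar_fun F \<in> J) \<and>
     (\<forall>F\<in>J. \<forall>G\<in>gf. F * G \<in> J \<and> G * F \<in> J)"

lemma Q_mult: "F \<in> gf \<Longrightarrow> G \<in> gf \<Longrightarrow> Q (F * G) = Q F * G + gpar_fun F * Q G"
  by (rule poisson_leibniz[OF _ _ H_gf H_odd])

lemma Q_add: "F \<in> gf \<Longrightarrow> G \<in> gf \<Longrightarrow> Q (F + G) = Q F + Q G"
  by (rule poisson_add[OF _ _ H_gf])

lemma gpar_fun_mult: "gpar_fun (F * G) = gpar_fun F * gpar_fun G"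
  and gpar_fun_add: "gpar_fun (F + G) = gpar_fun F + gpar_fun G"
  by (simp_all add: gpar_fun_def fun_eq_iff)

lemma dg_ideal_gf: "dg_ideal gf"
  unfolding dg_ideal_def using Q_gf gf_gpar gf_mult gf_add gf_scale gf_0
  by (auto intro: subspaceI)

lemma dg_ideal_prod:
  assumes J: "dg_ideal J" and K: "dg_ideal K"
  shows "dg_ideal (ideal_prod A J K)"
proof -
  let ?P = "ideal_prod A J K"
  note jk = J[unfolded dg_ideal_def] K[unfolded dg_ideal_def]
  have J0: "0 \<in> J" and K0: "0 \<in> K" using jk subspace_0 by blast+
  have "0 * 0 \<in> ?P" by (rule ideal_prodI[OF J0 K0])
  then have P0: "0 \<in> ?P" by simp
  \<comment> \<open>All closure properties go through one induction over sums of products. Scalar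
    multiples are among them, since \<open>ideal_prod\<close> is closed under sums by construction
    but not under scalars.\<close>
  have *: "x \<in> gf \<and> Q x \<in> ?P \<and> gpar_fun x \<in> ?P \<and> (\<forall>t. t *\<^sub>R x \<in> ?P) \<and> (\<forall>G\<in>gf. x * G \<in> ?P \<and> G * x \<in> ?P)"
    if "x \<in> ?P" for x
    using that
  proof (induction rule: ideal_prod_cases)
    case (prod i j)
    have i: "i \<in> gf" "Q i \<in> J" "gpar_fun i \<in> J" "\<And>t. t *\<^sub>R i \<in> J" "\<And>G. G \<in> gf \<Longrightarrow> G * i \<in> J"
      using prod(1) jk(1) subspace_scale by blast+
    have j: "j \<in> gf" "Q j \<in> K" "gpar_fun j \<in> K" "\<And>G. G \<in> gf \<Longrightarrow> j * G \<in> K"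
      using prod(2) jk(2) by blast+
    have "Q (i * j) \<in> ?P"
      unfolding Q_mult[OF i(1) j(1)] by (intro ideal_prod_add ideal_prodI i j prod)
    moreover have "gpar_fun (i * j) \<in> ?P"
      unfolding gpar_fun_mult by (intro ideal_prodI i j)
    moreover have "t *\<^sub>R (i * j) \<in> ?P" for t
      unfolding mult_scaleR_left[symmetric] by (intro ideal_prodI i prod)
    moreover have "(i * j) * G \<in> ?P" "G * (i * j) \<in> ?P" if "G \<in> gf" for G
      unfolding mult.assoc[of i j G] mult.assoc[of G i j, symmetric] by (intro ideal_prodI i j prod that)+
    ultimately show ?case using gf_mult[OF i(1) j(1)] by blast
  next
    case (sum s t)
    then have st: "s \<in> gf" "t \<in> gf" by blast+
    show ?case
      unfolding Q_add[OF st] gpar_fun_add scaleR_add_right distrib_left distrib_right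
      using sum gf_add[OF st] ideal_prod_add by blast
  qed
  have "subspace ?P" using P0 * ideal_prod_add by (intro subspaceI) blast+
  then show ?thesis unfolding dg_ideal_def using * by blast
qed

text \<open>The union of the kernel sections of all degrees need not be a subspace, so this is not a
  case of \<open>dg_ideal_prod\<close>. The union is stable under \<open>Q\<close> by
  \<open>Q_kernel\<close>, and factors on the left are moved past a kernel section by
  \<open>kernel_commute\<close>.\<close>

lemma dg_ideal_I: "dg_ideal I"
proof -
  let ?K = "\<Union>k\<in>{1..}. kernel_sections C k"
  have I: "I = ideal_prod A ?K gf" by (simp add: naive_ideal_def)
  have "0 * 0 \<in> I" unfolding I by (rule ideal_prodI) (use kernel_0[of 1] gf_0 in auto)
  then have I0: "0 \<in> I" by simp
  have *: "x \<in> gf \<and> Q x \<in> I \<and> gpar_fun x \<in> I \<and> (\<forall>t. t *\<^sub>R x \<in> I) \<and> (\<forall>G\<in>gf. x * G \<in> I \<and> G * x \<in> I)"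
    if "x \<in> I" for x
    using that unfolding I
  proof (induction rule: ideal_prod_cases)
    case (prod i j)
    then obtain k where k: "k \<ge> 1" "i \<in> kernel_sections C k" by auto
    have i: "i \<in> gf" "Q i \<in> ?K" "i \<in> ?K"
      using kernel_gf(1)[OF k(2)] Q_kernel[OF k(2)] k by auto
    note j = prod(2)
    have t: "t *\<^sub>R (i * j) \<in> ideal_prod A ?K gf" if "j \<in> gf" for t j
      unfolding mult_scaleR_right[symmetric] by (intro ideal_prodI i gf_scale that)
    have g: "gpar_fun i * j \<in> ideal_prod A ?K gf" if "j \<in> gf" for j
      unfolding kernel_gpar[OF k(2)] mult_scaleR_left by (rule t[OF that])
    have "Q (i * j) \<in> ideal_prod A ?K gf"
      unfolding Q_mult[OF i(1) j] by (intro ideal_prod_add ideal_prodI i j g Q_gf)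
    moreover have "gpar_fun (i * j) \<in> ideal_prod A ?K gf"
      unfolding gpar_fun_mult by (intro g gf_gpar j)
    moreover have "(i * j) * G \<in> ideal_prod A ?K gf" if "G \<in> gf" for G
      unfolding mult.assoc by (intro ideal_prodI i gf_mult j that)
    moreover have "G * (i * j) \<in> ideal_prod A ?K gf" if "G \<in> gf" for G
    proof -
      let ?G = "if even k then G else gpar_fun G"
      have "?G \<in> gf" using that gf_gpar by simp
      then have "i * (?G * j) \<in> ideal_prod A ?K gf" by (intro ideal_prodI i gf_mult j)
      also have "i * (?G * j) = G * (i * j)"
        unfolding mult.assoc[symmetric] by (rule arg_cong[OF kernel_commute[OF k(2), symmetric]])
      finally show ?thesis .
    qed
    ultimately show ?case using gf_mult[OF i(1) j] t[OF j] by blast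
  next
    case (sum s t)
    then have st: "s \<in> gf" "t \<in> gf" by blast+
    show ?case
      unfolding Q_add[OF st] gpar_fun_add scaleR_add_right distrib_left distrib_right
      using sum gf_add[OF st] ideal_prod_add by blast
  qed
  have "subspace I"
  proof (rule subspaceI[OF I0])
    show "x + y \<in> I" if "x \<in> I" "y \<in> I" for x y
      using that unfolding I by (rule ideal_prod_add)
    show "t *\<^sub>R x \<in> I" if "x \<in> I" for t x using *[OF that] by blast
  qed
  then show ?thesis unfolding dg_ideal_def using * by blast
qed

lemma dg_ideal_power: "dg_ideal (Ip p)"
  by (induction p) (simp_all add: dg_ideal_gf dg_ideal_prod dg_ideal_I)

lemma power_Suc: "Ip (Suc p) \<subseteq> Ip p"
proof
  fix x assume "x \<in> Ip (Suc p)"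
  then have "x \<in> ideal_prod A (Ip p) I" by simp
  then show "x \<in> Ip p"
  proof (induction rule: ideal_prod_cases)
    case (prod i j)
    then show ?case using dg_ideal_power[of p] dg_ideal_I unfolding dg_ideal_def by blast
  next
    case (sum s t)
    then show ?case using dg_ideal_power[of p] subspace_add unfolding dg_ideal_def by blast
  qed
qed

lemma power_antimono: "p \<le> q \<Longrightarrow> Ip q \<subseteq> Ip p"
  by (rule lift_Suc_antimono_le[of Ip]) (rule power_Suc)

lemma power_mult:
  assumes "F \<in> Ip p" "G \<in> Ip q"
  shows "F * G \<in> Ip (p + q)"
  using assms(2)
proof (induction q arbitrary: G)
  case 0
  then show ?case using assms(1) dg_ideal_power[of p] unfolding dg_ideal_def naive_ideal_power.simps add_0_right by blast
next
  case (Suc q)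
  from Suc.prems have "G \<in> ideal_prod A (Ip q) I" by simp
  then have "F * G \<in> ideal_prod A (Ip (p + q)) I"
  proof (induction rule: ideal_prod_cases)
    case (prod i j)
    then show ?case unfolding mult.assoc[symmetric] by (intro ideal_prodI Suc.IH)
  next
    case (sum s t)
    then show ?case unfolding distrib_left by (intro ideal_prod_add)
  qed
  then show ?case unfolding add_Suc_right naive_ideal_power.simps .
qed

lemma gge_mult:
  assumes f: "\<forall>S m. gcoeff f (S, m) \<noteq> 0 \<longrightarrow> p \<le> card S + 2 * size m"
    and g: "\<forall>S m. gcoeff g (S, m) \<noteq> 0 \<longrightarrow> q \<le> card S + 2 * size m"
    and nz: "gcoeff (f * g) (S, m) \<noteq> 0"
  shows "p + q \<le> card S + 2 * size m"
proof -
  obtain T k where *: "gcoeff f (T, k) \<noteq> 0" "gcoeff g (S - T, m - k) \<noteq> 0"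
    "card S = card T + card (S - T)" "size m = size k + size (m - k)"
    by (rule gcoeff_times_nonzero[OF nz])
  then have "p \<le> card T + 2 * size k" "q \<le> card (S - T) + 2 * size (m - k)" using f g by blast+
  then show ?thesis using *(3,4) by linarith
qed

lemma ideal_degree: "F \<in> I \<Longrightarrow> gcoeff (F c x) (S, m) \<noteq> 0 \<Longrightarrow> 1 \<le> card S + 2 * size m"
proof -
  assume "F \<in> I"
  then have "F \<in> ideal_prod A (\<Union>k\<in>{1..}. kernel_sections C k) gf" by (simp add: naive_ideal_def)
  then have "\<forall>S m. gcoeff (F c x) (S, m) \<noteq> 0 \<longrightarrow> 1 \<le> card S + 2 * size m"
  proof (induction rule: ideal_prod_cases)
    case (prod i j)
    then obtain k where k: "k \<ge> 1" "i \<in> kernel_sections C k" by auto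
    have "\<forall>S m. gcoeff (i c x) (S, m) \<noteq> 0 \<longrightarrow> 1 \<le> card S + 2 * size m"
      using kernel_gf(2)[OF k(2), of c x] k(1) unfolding gdeg_def by fastforce
    from gge_mult[OF this, of "j c x" 0] show ?case by simp
  next
    case (sum s t)
    then show ?case by (simp add: gcoeff_simps) (metis add.right_neutral)
  qed
  then show "gcoeff (F c x) (S, m) \<noteq> 0 \<Longrightarrow> 1 \<le> card S + 2 * size m" by blast
qed

text \<open>All coordinates have nonnegative degree and elements of \<open>I\<close> start in degree
  1, so in a product of \<open>p\<close> of them the degrees add up to at least
  \<open>p\<close>.\<close>

lemma power_degree:
  assumes "F \<in> Ip p"
  shows "\<forall>S m. gcoeff (F c x) (S, m) \<noteq> 0 \<longrightarrow> p \<le> card S + 2 * size m"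
  using assms
proof (induction p arbitrary: F)
  case (Suc p)
  then have "F \<in> ideal_prod A (Ip p) I" by simp
  then show ?case
  proof (induction rule: ideal_prod_cases)
    case (prod i j)
    have "\<forall>S m. gcoeff (j c x) (S, m) \<noteq> 0 \<longrightarrow> 1 \<le> card S + 2 * size m"
      using ideal_degree[OF prod(2)] by blast
    from gge_mult[OF Suc.IH[OF prod(1)] this] show ?case by simp
  next
    case (sum s t)
    then show ?case by (simp add: gcoeff_simps) (metis add.right_neutral)
  qed
qed simp

section \<open>The spectral sequence of the naive filtration\<close>

lemma filtration_subspace: "subspace (naive_filtration C p k)"
  unfolding naive_filtration_def
  using dg_ideal_power subspace_graded_piece by (intro subspace_inter) (simp_all add: dg_ideal_def)

lemma filtration_large:
  assumes "p > max 0 k"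
  shows "naive_filtration C p k = {0}"
proof -
  have "F = 0" if F: "F \<in> naive_filtration C p k" for F
  proof (intro ext)
    fix c x
    have "gcoeff (F c x) (S, m) = 0" for S m
    proof (rule ccontr)
      assume nz: "gcoeff (F c x) (S, m) \<noteq> 0"
      have Fp: "F \<in> Ip (nat p)" using F by (simp add: naive_filtration_def)
      have "\<forall>c x S m. gcoeff (F c x) (S, m) \<noteq> 0 \<longrightarrow> int (card S + 2 * size m) = k"
        using F unfolding naive_filtration_def graded_piece_def by blast
      from this[rule_format, OF nz] power_degree[OF Fp, rule_format, OF nz] assms show False by linarith
    qed
    then show "F c x = 0 c x" by (intro gpoly_eqI) (simp add: gcoeff_simps)
  qed
  then show ?thesis using subspace_0[OF filtration_subspace] by blast
qed

lemma filtration_0: "F \<in> naive_filtration C p k \<Longrightarrow> F \<in> gf" "F \<in> naive_filtration C p k \<Longrightarrow> F \<in> graded_piece C k"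
  using gf_piece by (auto simp: naive_filtration_def)

sublocale filtered_dga "function_algebra C" "naive_filtration C" Q "base_fun C (\<lambda>_. 1)"
proof
  show "add A = (+)" "ring.zero A = 0" "smult A = (*\<^sub>R)"
    by (simp_all add: function_algebra_def fun_eq_iff)
  fix p k :: int
  show "subspace (naive_filtration C p k)" by (rule filtration_subspace)
  have "Ip (nat (p + 1)) \<subseteq> Ip (nat p)" by (rule power_antimono) simp
  then show "naive_filtration C (p + 1) k \<subseteq> naive_filtration C p k"
    unfolding naive_filtration_def by blast
  show "p \<le> 0 \<Longrightarrow> naive_filtration C p k = naive_filtration C 0 k"
    by (simp add: naive_filtration_def)
  show "max 0 k < p \<Longrightarrow> naive_filtration C p k = {0}" by (rule filtration_large)
  show "x \<in> naive_filtration C p k \<Longrightarrow> Q x \<in> naive_filtration C p (k + 1)" for x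
    using dg_ideal_power[of "nat p"] Q_degree unfolding naive_filtration_def dg_ideal_def by blast
  show "Q (x + y) = Q x + Q y" if "x \<in> naive_filtration C 0 k" "y \<in> naive_filtration C 0 k" for x y
    by (rule Q_add) (rule filtration_0 that)+
  show "Q (t *\<^sub>R x) = t *\<^sub>R Q x" "Q (Q x) = 0" if "x \<in> naive_filtration C 0 k" for t x
    using poisson_scale[OF _ H_gf] Q_Q filtration_0(1)[OF that] by blast+
  show "Q (x * y) = Q x * y + (if even k then 1 else - 1) *\<^sub>R (x * Q y)"
    if "x \<in> naive_filtration C 0 k" "y \<in> naive_filtration C 0 m" for x y m
    unfolding Q_mult[OF filtration_0(1)[OF that(1)] filtration_0(1)[OF that(2)]]
      gpar_piece[OF filtration_0(2)[OF that(1)]] by simp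
  show "x * y \<in> naive_filtration C (p + p') (k + k')"
    if x: "x \<in> naive_filtration C p k" and y: "y \<in> naive_filtration C p' k'" for x y p' k'
  proof -
    have "x * y \<in> Ip (nat p + nat p')"
      by (rule power_mult) (use x y in \<open>simp_all add: naive_filtration_def\<close>)
    \<comment> \<open>For indices of different sign \<open>nat p + nat p'\<close> may exceed
      \<open>nat (p + p')\<close>; the powers decrease, so the product lies in the required
      one.\<close>
    moreover have "Ip (nat p + nat p') \<subseteq> Ip (nat (p + p'))" by (rule power_antimono) simp
    ultimately show ?thesis
      using graded_piece_mult[OF filtration_0(2)[OF x] filtration_0(2)[OF y]]
      unfolding naive_filtration_def by blast
  qed
  have 1: "(\<lambda>_. 1) \<in> smooth_functions C" using sm_const[OF open_UNIV] by simp
  show "base_fun C (\<lambda>_. 1) \<in> naive_filtration C 0 0"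
    using base_fun_piece[OF 1] gf_base_fun[OF 1] by (simp add: naive_filtration_def)
  show "Q (base_fun C (\<lambda>_. 1)) = 0" by (rule poisson_1)
  \<comment> \<open>Outside the chart domains the unit function is 0, but so is
    \<open>x\<close>.\<close>
  show "base_fun C (\<lambda>_. 1) * x = x" "x * base_fun C (\<lambda>_. 1) = x" if "x \<in> naive_filtration C 0 k" for x
    using gf_off[OF filtration_0(1)[OF that]] by (auto simp: fun_eq_iff base_fun_def)
qed

text \<open>In filtration 0 the pieces are the full graded pieces of the algebra, so the cohomology
  of the filtered algebra is the standard one.\<close>

lemma coh_eq: "coh = H_std C H" "coh_mul = H_std_mul C H" "coh_fil = H_std_filtration C H"
proof -
  have F0: "naive_filtration C 0 k = graded_piece C k" for k
    using gf_piece by (auto simp: naive_filtration_def)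
  have z: "cocyc k = standard_cocycles C H k" "cob k = standard_coboundaries C H k" for k
    by (simp_all add: cocyc_def cob_def standard_cocycles_def standard_coboundaries_def F0
      standard_differential_def[abs_def] zero_M)
  show "coh = H_std C H" by (intro ext) (simp add: coh_def H_std_def z)
  show "coh_mul = H_std_mul C H"
    by (intro ext) (simp add: coh_mul_def H_std_mul_def z quot_lift2_def coset_M mult_A)
  show "coh_fil = H_std_filtration C H"
    by (intro ext) (simp add: coh_fil_def H_std_filtration_def z coset_M)
qed

lemma graded_class_eq: "graded_class C p k F = trans_set (N 0 p k) F"
  by (simp add: graded_class_def N_0 coset_M)

end

theorem proposition4p2:
  fixes C :: "('m::{t2_space,second_countable_topology}, 'v::real_vector) courant_data"
    and H :: "('m, 'v) gfun"
  assumes "courant_algebroid C"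
    and "courant_hamiltonian C H"
  shows "\<exists>(E :: nat \<Rightarrow> int \<Rightarrow> int \<Rightarrow> (real, ('m, 'v) gfun set) module) d mul h.
    algebra_spectral_sequence E d mul h \<and>
    (\<forall>p q. E 0 p q = associated_graded C p (p + q)) \<and>
    (\<forall>p q. \<forall>F\<in>naive_filtration C p (p + q).
       d 0 p q (graded_class C p (p + q) F) =
         graded_class C p (p + q + 1) (standard_differential C H F)) \<and>
    (\<forall>p q p' q'. \<forall>F\<in>naive_filtration C p (p + q). \<forall>G\<in>naive_filtration C p' (p' + q').
       mul 0 p q p' q' (graded_class C p (p + q) F) (graded_class C p' (p' + q') G) =
         graded_class C (p + p') (p + q + p' + q') (F \<otimes>\<^bsub>function_algebra C\<^esub> G)) \<and>
    converges_to E d mul h (H_std C H) (H_std_mul C H) (H_std_filtration C H)"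
proof -
  interpret courant_with_hamiltonian C H
    using assms by (intro courant_with_hamiltonian.intro courant_with_hamiltonian_axioms.intro)
  show ?thesis
  proof (intro exI conjI allI ballI)
    show "algebra_spectral_sequence page page_d page_mul page_next"
      by (rule algebra_spectral_sequence_page)
    show "page 0 p q = associated_graded C p (p + q)" for p q
      by (simp add: page_def associated_graded_def Z_0 N_0)
    show "page_d 0 p q (graded_class C p (p + q) F) =
        graded_class C p (p + q + 1) (standard_differential C H F)"
      if "F \<in> naive_filtration C p (p + q)" for p q F
      using page_d_eq[of F 0 p q] that by (simp add: graded_class_eq Z_0 standard_differential_def)
    show "page_mul 0 p q p' q' (graded_class C p (p + q) F) (graded_class C p' (p' + q') G) =
        graded_class C (p + p') (p + q + p' + q') (F \<otimes>\<^bsub>function_algebra C\<^esub> G)"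
      if "F \<in> naive_filtration C p (p + q)" "G \<in> naive_filtration C p' (p' + q')" for p q p' q' F G
      using page_mul_eq[of F 0 p q G p' q'] that by (simp add: graded_class_eq Z_0 mult_A)
    show "converges_to page page_d page_mul page_next (H_std C H) (H_std_mul C H) (H_std_filtration C H)"
      using converges_to_coh unfolding coh_eq .
  qed
qed

end
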